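(* Let $a\in(0,1)$, and let $u_0:\mathbb{R}^n\to\mathbb{R}^n$ be a smooth radial vector field of the form $u_0(x)=-v_0(|x|)\,\frac{x}{|x|}$, where $v_0$ is a scalar function. Assume that one of the following conditions is satisfied: (i) $n\in\{2,3\}$ and, for some $C>0$, $$-C\le v_0(|x|)\le C(1+|x|)^{-(n-1)/3}\quad\text{for all }x;$$ (ii) $n=4$ and, for some $C>0$, $$-C\le v_0(|x|)\le \frac{\frac43\log(1+|x|)+C}{1+|x|}\quad\text{for all }x;$$ (iii) $n\ge 5$ and, for some $\gamma<1$ and $C>0$, $$-C\le v_0(|x|)\le \gamma\,\frac{n-2}{n-4}\,\frac{2}{|x|}\quad\text{for all }x\neq 0.$$ Then the equation $$\frac{\partial u}{\partial t}+a\,(u\cdot\nabla)u+\frac12(1-a)\nabla|u|^2+\frac12(\operatorname{div}u)\,u=\Delta u$$ has a global bounded solution $u:\mathbb{R}^n\times[0,\infty)\to\mathbb{R}^n$ with the initial condition $u(x,0)=u_0(x)$.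
   Context: Here $n$ is the space dimension, $u(x,t)=(u_1(x,t),\dots,u_n(x,t))$ is a time-dependent vector field, $\Delta$ acts componentwise, and $(u\cdot\nabla)u$ is the vector field with $i$-th component $\sum_j u_j\partial_j u_i$. "Global" means defined for all times $t\ge 0$, and "bounded" means $\sup_{x,t}|u(x,t)|<\infty$. *)

theory Defs
  imports "HOL-Analysis.Analysis"
begin

definition partial :: "'n \<Rightarrow> (real ^ 'n \<Rightarrow> 'b::real_normed_vector) \<Rightarrow> real ^ 'n \<Rightarrow> 'b"
  where "partial j f x = frechet_derivative f (at x) (axis j 1)"

primrec C_k :: "nat \<Rightarrow> (real ^ 'n \<Rightarrow> 'b::real_normed_vector) \<Rightarrow> bool"
  where
    "C_k 0 f \<longleftrightarrow> continuous_on UNIV f"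
  | "C_k (Suc k) f \<longleftrightarrow> (\<forall>x. f differentiable at x) \<and> (\<forall>j. C_k k (partial j f))"

definition smooth :: "(real ^ 'n \<Rightarrow> 'b::real_normed_vector) \<Rightarrow> bool"
  where "smooth f \<longleftrightarrow> (\<forall>k. C_k k f)"

definition gradient :: "(real ^ 'n \<Rightarrow> real) \<Rightarrow> real ^ 'n \<Rightarrow> real ^ 'n"
  where "gradient f x = (\<chi> i. partial i f x)"

definition divergence :: "(real ^ 'n \<Rightarrow> real ^ 'n) \<Rightarrow> real ^ 'n \<Rightarrow> real"
  where "divergence w x = (\<Sum>j\<in>UNIV. partial j (\<lambda>y. w y $ j) x)"

definition laplacian :: "(real ^ 'n \<Rightarrow> real) \<Rightarrow> real ^ 'n \<Rightarrow> real"
  where "laplacian f x = (\<Sum>j\<in>UNIV. partial j (partial j f) x)"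

definition vector_laplacian :: "(real ^ 'n \<Rightarrow> real ^ 'n) \<Rightarrow> real ^ 'n \<Rightarrow> real ^ 'n"
  where "vector_laplacian w x = (\<chi> i. laplacian (\<lambda>y. w y $ i) x)"

definition advection :: "(real ^ 'n \<Rightarrow> real ^ 'n) \<Rightarrow> (real ^ 'n \<Rightarrow> real ^ 'n) \<Rightarrow> real ^ 'n \<Rightarrow> real ^ 'n"
  where "advection w z x = (\<chi> i. \<Sum>j\<in>UNIV. w x $ j * partial j (\<lambda>y. z y $ i) x)"

definition time_derivative :: "(real ^ 'n \<Rightarrow> real \<Rightarrow> real ^ 'n) \<Rightarrow> real ^ 'n \<Rightarrow> real \<Rightarrow> real ^ 'n"
  where "time_derivative u x t = vector_derivative (\<lambda>s. u x s) (at t)"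

text \<open>
  Classical regularity of a field that attains its initial value: jointly continuous for
  \<open>t \<ge> 0\<close>, once continuously differentiable in time and twice in space for \<open>t > 0\<close>.
  The differentiability conditions make the derivative operators above, which are total
  functions, denote actual derivatives. Values of \<open>u\<close> at \<open>t < 0\<close> are irrelevant.
\<close>

definition classical_regularity :: "(real ^ 'n \<Rightarrow> real \<Rightarrow> real ^ 'n) \<Rightarrow> bool"
  where "classical_regularity u \<longleftrightarrow>
    continuous_on (UNIV \<times> {0..}) (\<lambda>(x, t). u x t) \<and>
    (\<forall>x. \<forall>t>0. (\<lambda>s. u x s) differentiable at t) \<and>
    (\<forall>t>0. C_k 2 (\<lambda>x. u x t)) \<and>
    continuous_on (UNIV \<times> {0<..}) (\<lambda>(x, t). time_derivative u x t) \<and>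
    (\<forall>j. continuous_on (UNIV \<times> {0<..}) (\<lambda>(x, t). partial j (\<lambda>y. u y t) x)) \<and>
    (\<forall>j k. continuous_on (UNIV \<times> {0<..}) (\<lambda>(x, t). partial j (partial k (\<lambda>y. u y t)) x))"

definition solves_equation :: "real \<Rightarrow> (real ^ 'n \<Rightarrow> real \<Rightarrow> real ^ 'n) \<Rightarrow> bool"
  where "solves_equation a u \<longleftrightarrow>
    (\<forall>x. \<forall>t>0.
      time_derivative u x t
      + a *\<^sub>R advection (\<lambda>y. u y t) (\<lambda>y. u y t) x
      + (1/2 * (1 - a)) *\<^sub>R gradient (\<lambda>y. (norm (u y t))\<^sup>2) x
      + (1/2 * divergence (\<lambda>y. u y t) x) *\<^sub>R u x t
      = vector_laplacian (\<lambda>y. u y t) x)"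

definition global_bounded_solution ::
    "real \<Rightarrow> (real ^ 'n \<Rightarrow> real ^ 'n) \<Rightarrow> (real ^ 'n \<Rightarrow> real \<Rightarrow> real ^ 'n) \<Rightarrow> bool"
  where "global_bounded_solution a u0 u \<longleftrightarrow>
    classical_regularity u \<and>
    solves_equation a u \<and>
    bounded ((\<lambda>(x, t). u x t) ` (UNIV \<times> {0..})) \<and>
    (\<forall>x. u x 0 = u0 x)"

end

theory Submission imports Defs "HOL-Probability.Distributions" begin

text \<open>
  Bounded continuous data have a mild solution, the limit of Picard iterates
  \<open>u = e\<^bsup>t\<Delta>\<^esup> u\<^sub>0 + \<integral> e\<^bsup>(t-s)\<Delta>\<^esup> N(u) ds\<close>, for a time that depends only on the bound of
  \<open>u\<^sub>0\<close>. The iteration commutes with rotations, so radial data stay radial: \<open>u\<close> is parallel to \<open>x\<close> and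
  is determined by the scalar \<open>m = u \<bullet> x\<close>. This scalar satisfies a parabolic equation from which the
  parameter \<open>a\<close> has disappeared and for which comparison holds. The lower bound
  \<open>- C \<le> v\<^sub>0\<close> gives the upper barrier \<open>C |x|\<close> for \<open>m\<close>; the upper bound on \<open>v\<^sub>0\<close> puts \<open>- m\<close> below a dilate
  \<open>h (k |x|\<^sup>2)\<close> of an explicit stationary supersolution. Hence \<open>|u|\<close> stays bounded, the existence time
  does not shrink, and the local solutions, which agree where they overlap, can be glued.
\<close>

section \<open>Operators with Gaussian kernels\<close>

text \<open>The Jacobian of a radial field is symmetric, so \<open>(u . grad) u\<close> is half the
  gradient of \<open>|u|^2\<close> and the terms weighted with \<open>a\<close> and
  \<open>1 - a\<close> merge. In terms of \<open>m\<close> and its radial derivative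
  \<open>G\<close> the quadratic part becomes \<open>- (3/2 m G + (n - 4)/2 m^2) / |x|^2\<close>.
  Its second coefficient changes sign at \<open>n = 4\<close>, which is the source of the three
  growth conditions. For outward motion the quadratic part helps and a plain bound suffices; for
  inward motion it works against diffusion, and the supersolutions constructed here have restricted
  growth.

  Keeping \<open>m\<close> on the whole space, instead of a profile in \<open>r\<close>, avoids a
  boundary at \<open>r = 0\<close>. The price is that comparison runs for a quotient by
  \<open>|x|\<close>, which has to be controlled near the origin separately.

  The data enter the iteration only through their supremum, so gradients may blow up like
  \<open>1 / sqrt t\<close>. Uniqueness is therefore proved against a solution that has already run
  for a positive time, and consecutive local solutions overlap by half of their lifespan.\<close>

lemma integrable_exp_minus_square:
  assumes "0 < c" shows "integrable lborel (\<lambda>x::real. exp (- c * x\<^sup>2))"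
proof -
  define s where "s = 1 / sqrt (2 * c)"
  have s: "s\<^sup>2 = 1 / (2 * c)" "0 < s" using assms by (auto simp: s_def power_divide)
  have "integrable lborel (\<lambda>x. sqrt (2 * pi * s\<^sup>2) * normal_density 0 s x)"
    by (intro integrable_mult_right integrable_normal_density) (use s in auto)
  also have "(\<lambda>x. sqrt (2 * pi * s\<^sup>2) * normal_density 0 s x) = (\<lambda>x::real. exp (- c * x\<^sup>2))"
    using assms s by (auto simp: normal_density_def fun_eq_iff field_simps)
  finally show ?thesis .
qed

lemma integrable_gaussian:
  assumes "0 < c" shows "integrable lborel (\<lambda>z::'a::euclidean_space. exp (- c * (norm z)\<^sup>2))"
proof -
  interpret product_sigma_finite "\<lambda>_::'a. lborel :: real measure" ..
  have eq: "exp (- c * (norm (\<Sum>b\<in>Basis. f b *\<^sub>R b :: 'a))\<^sup>2) = (\<Prod>b\<in>(Basis::'a set). exp (- c * (f b)\<^sup>2))" for f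
  proof -
    have "(norm (\<Sum>b\<in>Basis. f b *\<^sub>R b :: 'a))\<^sup>2 = (\<Sum>b\<in>(Basis::'a set). (f b)\<^sup>2)"
      unfolding power2_norm_eq_inner by (subst euclidean_inner) (simp add: inner_sum_left inner_Basis if_distrib sum.delta power2_eq_square cong: if_cong)
    then show ?thesis by (simp add: sum_distrib_left exp_sum flip: sum_negf)
  qed
  show ?thesis
    apply (subst lborel_eq)
    apply (subst integrable_distr_eq)
      apply measurable
    apply (subst eq)
    apply (rule product_integrable_prod)
     apply simp
    by (rule integrable_exp_minus_square[OF assms])
qed

section \<open>Lebesgue integrals depending on a parameter\<close>

lemma norm_integral_le_bound:
  fixes f :: "'z \<Rightarrow> 'b::{banach, second_countable_topology}"
  assumes "integrable M f" "integrable M g" "\<And>z. z \<in> space M \<Longrightarrow> norm (f z) \<le> g z"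
  shows "norm (\<integral>z. f z \<partial>M) \<le> (\<integral>z. g z \<partial>M)"
  by (rule order_trans[OF integral_norm_bound], rule integral_mono) (use assms in auto)

text \<open>The mean value inequality turns the bound on \<open>F'\<close> into the Lipschitz bound
  \<open>lips\<close>. Hence the normalised remainders \<open>R\<close> are dominated by
  \<open>2 * g z\<close>, and dominated convergence along sequences applies.\<close>

lemma has_derivative_lebesgue_integral:
  fixes F :: "'x::euclidean_space \<Rightarrow> 'z \<Rightarrow> 'b::{banach, second_countable_topology}"
  assumes e: "0 < e"
    and int: "\<And>y. y \<in> ball x e \<Longrightarrow> integrable M (F y)"
    and meas: "\<And>h. (\<lambda>z. F' x z h) \<in> borel_measurable M"
    and der: "\<And>y z. y \<in> ball x e \<Longrightarrow> z \<in> space M \<Longrightarrow> ((\<lambda>y. F y z) has_derivative F' y z) (at y)"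
    and bd: "\<And>y z h. y \<in> ball x e \<Longrightarrow> z \<in> space M \<Longrightarrow> norm (F' y z h) \<le> g z * norm h"
    and g: "integrable M g"
  shows "((\<lambda>y. \<integral>z. F y z \<partial>M) has_derivative (\<lambda>h. \<integral>z. F' x z h \<partial>M)) (at x)"
proof -
  have x: "x \<in> ball x e" using e by simp
  have lin: "linear (F' x z)" if "z \<in> space M" for z
    using der[OF x that] has_derivative_linear by blast
  have intF': "integrable M (\<lambda>z. F' x z h)" for h
    by (rule Bochner_Integration.integrable_bound[of M "\<lambda>z. g z * norm h"])
       (use g meas bd[OF x] in \<open>auto intro!: AE_I2 intro: order_trans[OF _ abs_ge_self]\<close>)
  have bl: "bounded_linear (\<lambda>h. \<integral>z. F' x z h \<partial>M)"
  proof (rule bounded_linear_intro[where K="\<integral>z. g z \<partial>M"])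
    fix h k
    have "(\<integral>z. F' x z (h + k) \<partial>M) = (\<integral>z. F' x z h + F' x z k \<partial>M)"
      by (rule Bochner_Integration.integral_cong) (auto simp: linear_add[OF lin])
    then show "(\<integral>z. F' x z (h + k) \<partial>M) = (\<integral>z. F' x z h \<partial>M) + (\<integral>z. F' x z k \<partial>M)"
      by (simp add: intF')
  next
    fix r h
    have "(\<integral>z. F' x z (r *\<^sub>R h) \<partial>M) = (\<integral>z. r *\<^sub>R F' x z h \<partial>M)"
      by (rule Bochner_Integration.integral_cong) (auto simp: linear_cmul[OF lin])
    then show "(\<integral>z. F' x z (r *\<^sub>R h) \<partial>M) = r *\<^sub>R (\<integral>z. F' x z h \<partial>M)"
      by simp
  next
    fix h
    have "norm (\<integral>z. F' x z h \<partial>M) \<le> (\<integral>z. g z * norm h \<partial>M)"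
      by (rule norm_integral_le_bound) (use intF' g bd[OF x] in auto)
    then show "norm (\<integral>z. F' x z h \<partial>M) \<le> norm h * (\<integral>z. g z \<partial>M)"
      by (simp add: mult.commute)
  qed
  have lips: "norm (F y z - F x z) \<le> g z * norm (y - x)" if "y \<in> ball x e" "z \<in> space M" for y z
  proof (rule differentiable_bound[of "ball x e" "\<lambda>y. F y z" "\<lambda>y. F' y z"])
    show "\<And>w. w \<in> ball x e \<Longrightarrow> ((\<lambda>y. F y z) has_derivative F' w z) (at w within ball x e)"
      using der that(2) by (meson has_derivative_at_withinI)
    show "\<And>w. w \<in> ball x e \<Longrightarrow> onorm (F' w z) \<le> g z"
      using bd that(2) by (metis mult.commute onorm_le)
  qed (use that e in auto)
  define R where "R y z = (F y z - F x z - F' x z (y - x)) /\<^sub>R norm (y - x)" for y z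
  have "((\<lambda>y. norm ((\<integral>z. F y z \<partial>M) - (\<integral>z. F x z \<partial>M) - (\<integral>z. F' x z (y - x) \<partial>M)) / norm (y - x)) \<longlongrightarrow> 0) (at x)"
    unfolding tendsto_at_iff_sequentially comp_def
  proof (intro allI impI)
    fix X :: "nat \<Rightarrow> 'x" assume "\<forall>i. X i \<in> UNIV - {x}" and X: "X \<longlonglongrightarrow> x"
    then have Xn: "X i \<noteq> x" for i by auto
    from X e obtain N where N: "\<And>i. i \<ge> N \<Longrightarrow> X i \<in> ball x e"
      by (metis dist_commute lim_sequentially mem_ball)
    \<comment> \<open>Domination is available only inside the ball, so the finitely many terms
      outside it are dropped and restored at the end by \<open>LIMSEQ_offset\<close>.\<close>
    define Y where "Y i = X (i + N)" for i
    have Y: "Y \<longlonglongrightarrow> x" "\<And>i. Y i \<in> ball x e" "\<And>i. Y i \<noteq> x"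
      using N Xn LIMSEQ_ignore_initial_segment[OF X] by (auto simp: Y_def[abs_def])
    have "(\<lambda>i. \<integral>z. R (Y i) z \<partial>M) \<longlonglongrightarrow> (\<integral>z. 0 \<partial>M)"
    proof (rule integral_dominated_convergence[where w="\<lambda>z. 2 * g z"])
      show "(\<lambda>z. R (Y i) z) \<in> borel_measurable M" for i
        unfolding R_def using int[OF Y(2)] int[OF x] meas by measurable
      show "integrable M (\<lambda>z. 2 * g z)" using g by simp
      show "AE z in M. (\<lambda>i. R (Y i) z) \<longlonglongrightarrow> 0"
      proof (rule AE_I2)
        fix z assume z: "z \<in> space M"
        have "((\<lambda>y. norm (F y z - F x z - F' x z (y - x)) / norm (y - x)) \<longlongrightarrow> 0) (at x)"
          using der[OF x z] unfolding has_derivative_iff_norm by auto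
        then have "(\<lambda>i. norm (F (Y i) z - F x z - F' x z (Y i - x)) / norm (Y i - x)) \<longlonglongrightarrow> 0"
          unfolding tendsto_at_iff_sequentially comp_def by (rule mp[OF mp[OF spec[of _ Y]]]) (use Y in auto)
        then have "(\<lambda>i. norm (R (Y i) z)) \<longlonglongrightarrow> 0"
          by (simp add: R_def divide_inverse mult.commute)
        then show "(\<lambda>i. R (Y i) z) \<longlonglongrightarrow> 0" by (rule tendsto_norm_zero_cancel)
      qed
      fix i
      show "AE z in M. norm (R (Y i) z) \<le> 2 * g z"
      proof (rule AE_I2)
        fix z assume z: "z \<in> space M"
        have "norm (F (Y i) z - F x z - F' x z (Y i - x)) \<le> g z * norm (Y i - x) + g z * norm (Y i - x)"
          using lips[OF Y(2) z] bd[OF x z] by (meson norm_triangle_le_diff add_mono)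
        moreover have "norm (R (Y i) z) = norm (F (Y i) z - F x z - F' x z (Y i - x)) / norm (Y i - x)"
          by (simp add: R_def divide_inverse mult.commute)
        ultimately show "norm (R (Y i) z) \<le> 2 * g z"
          using Y(3)[of i] by (simp add: pos_divide_le_eq)
      qed
    qed simp
    then have "(\<lambda>i. norm (\<integral>z. R (Y i) z \<partial>M)) \<longlonglongrightarrow> 0"
      using tendsto_norm_zero by fastforce
    moreover have "norm (\<integral>z. R (Y i) z \<partial>M) = norm ((\<integral>z. F (Y i) z \<partial>M) - (\<integral>z. F x z \<partial>M) - (\<integral>z. F' x z (Y i - x) \<partial>M)) / norm (Y i - x)" for i
      unfolding R_def using int[OF Y(2)] int[OF x] intF' by (simp add: divide_inverse mult.commute)
    ultimately have "(\<lambda>i. norm ((\<integral>z. F (Y i) z \<partial>M) - (\<integral>z. F x z \<partial>M) - (\<integral>z. F' x z (Y i - x) \<partial>M)) / norm (Y i - x)) \<longlonglongrightarrow> 0"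
      by simp
    then show "(\<lambda>i. norm ((\<integral>z. F (X i) z \<partial>M) - (\<integral>z. F x z \<partial>M) - (\<integral>z. F' x z (X i - x) \<partial>M)) / norm (X i - x)) \<longlonglongrightarrow> 0"
      unfolding Y_def by (rule LIMSEQ_offset)
  qed
  then show ?thesis using bl by (simp add: has_derivative_iff_norm)
qed

lemma continuous_on_lebesgue_integral:
  fixes K :: "'p::metric_space \<Rightarrow> 'z \<Rightarrow> 'b::{banach, second_countable_topology}"
  assumes meas: "\<And>p. p \<in> S \<Longrightarrow> K p \<in> borel_measurable M"
    and w: "integrable M w"
    and bd: "\<And>p z. p \<in> S \<Longrightarrow> z \<in> space M \<Longrightarrow> norm (K p z) \<le> w z"
    and cont: "\<And>z. z \<in> space M \<Longrightarrow> continuous_on S (\<lambda>p. K p z)"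
  shows "continuous_on S (\<lambda>p. \<integral>z. K p z \<partial>M)"
  unfolding continuous_on_sequentially comp_def
proof (intro allI ballI impI)
  fix X p assume p: "p \<in> S" and X: "(\<forall>n. X n \<in> S) \<and> X \<longlonglongrightarrow> p"
  show "(\<lambda>n. \<integral>z. K (X n) z \<partial>M) \<longlonglongrightarrow> (\<integral>z. K p z \<partial>M)"
  proof (rule integral_dominated_convergence[where w=w])
    show "AE z in M. (\<lambda>n. K (X n) z) \<longlonglongrightarrow> K p z"
      using cont p X unfolding continuous_on_sequentially comp_def by (auto intro!: AE_I2)
  qed (use meas p X w bd in auto)
qed

text \<open>Up to a reflection, convolution with the kernel dilated by \<open>\<sigma>\<close>, with
  the dilation placed in the argument of \<open>f\<close>. In this form \<open>\<sigma> = 0\<close>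
  is allowed and gives \<open>f\<close> times the mass of \<open>k\<close>, so continuity down to
  the initial time is plain dominated convergence.\<close>

definition Tk :: "('a::euclidean_space \<Rightarrow> real) \<Rightarrow> real \<Rightarrow> ('a \<Rightarrow> 'b::euclidean_space) \<Rightarrow> 'a \<Rightarrow> 'b"
  where "Tk k \<sigma> f x = (\<integral>z. k z *\<^sub>R f (x + \<sigma> *\<^sub>R z) \<partial>lborel)"

text \<open>The rate \<open>1/8\<close> is half the rate \<open>1/4\<close> of \<open>gauss\<close>;
  the other half absorbs the quadratic polynomials that appear in first and second
  derivatives.\<close>

definition kern :: "('a::euclidean_space \<Rightarrow> real) \<Rightarrow> bool"
  where "kern k \<longleftrightarrow> continuous_on UNIV k \<and> (\<exists>C. \<forall>z. \<bar>k z\<bar> \<le> C * exp (- (norm z)\<^sup>2 / 8))"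

definition kern_grad :: "('a::euclidean_space \<Rightarrow> real) \<Rightarrow> ('a \<Rightarrow> 'a) \<Rightarrow> bool"
  where "kern_grad k k' \<longleftrightarrow> kern k \<and> continuous_on UNIV k' \<and>
    (\<exists>C. \<forall>z. norm (k' z) \<le> C * exp (- (norm z)\<^sup>2 / 8)) \<and>
    (\<forall>z. (k has_derivative (\<lambda>h. k' z \<bullet> h)) (at z))"

lemma kern_integrable: assumes "kern k" shows "integrable lborel k"
proof -
  from assms obtain C where C: "\<And>z. \<bar>k z\<bar> \<le> C * exp (- (norm z)\<^sup>2 / 8)" by (auto simp: kern_def)
  show ?thesis
  proof (rule Bochner_Integration.integrable_bound)
    show "integrable lborel (\<lambda>z::'a. C * exp (- (1/8) * (norm z)\<^sup>2))"
      by (intro integrable_mult_right integrable_gaussian) simp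
    show "k \<in> borel_measurable lborel"
      using assms by (simp add: kern_def borel_measurable_continuous_onI)
    show "AE z in lborel. norm (k z) \<le> norm (C * exp (- (1/8) * (norm z)\<^sup>2))"
      using C by (auto intro!: AE_I2 intro: order_trans[OF _ abs_ge_self])
  qed
qed

lemma kern_grad_component:
  assumes "kern_grad k k'" shows "kern (\<lambda>z. k' z \<bullet> h)"
proof -
  from assms obtain C where C: "\<And>z. norm (k' z) \<le> C * exp (- (norm z)\<^sup>2 / 8)" and c: "continuous_on UNIV k'"
    by (auto simp: kern_grad_def)
  have "\<bar>k' z \<bullet> h\<bar> \<le> (C * norm h) * exp (- (norm z)\<^sup>2 / 8)" for z
  proof -
    have "\<bar>k' z \<bullet> h\<bar> \<le> norm (k' z) * norm h" by (rule Cauchy_Schwarz_ineq2)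
    also have "\<dots> \<le> (C * exp (- (norm z)\<^sup>2 / 8)) * norm h" by (intro mult_right_mono C) auto
    finally show ?thesis by (simp add: mult_ac)
  qed
  then show ?thesis unfolding kern_def using c by (auto intro!: continuous_intros)
qed

definition knorm :: "('a::euclidean_space \<Rightarrow> real) \<Rightarrow> real"
  where "knorm k = (\<integral>z. \<bar>k z\<bar> \<partial>lborel)"

lemma knorm_nonneg: "0 \<le> knorm k" by (simp add: knorm_def)

lemma Tk_integrable:
  fixes f :: "'a::euclidean_space \<Rightarrow> 'b::euclidean_space"
  assumes k: "kern k" and f: "continuous_on UNIV f" "\<And>y. norm (f y) \<le> B"
  shows "integrable lborel (\<lambda>z. k z *\<^sub>R f (x + \<sigma> *\<^sub>R z))"
proof (rule Bochner_Integration.integrable_bound[where f="\<lambda>z. B * k z"])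
  show "integrable lborel (\<lambda>z. B * k z)" using kern_integrable[OF k] by simp
  have "continuous_on UNIV (\<lambda>z. k z *\<^sub>R f (x + \<sigma> *\<^sub>R z))"
    using k by (intro continuous_intros continuous_on_compose2[OF f(1)]) (auto simp: kern_def)
  then show "(\<lambda>z. k z *\<^sub>R f (x + \<sigma> *\<^sub>R z)) \<in> borel_measurable lborel"
    by (simp add: borel_measurable_continuous_onI)
  have "norm (k z *\<^sub>R f y) \<le> norm (B * k z)" for y z
  proof -
    have "\<bar>k z\<bar> * norm (f y) \<le> \<bar>k z\<bar> * \<bar>B\<bar>" using f(2)[of y] by (intro mult_left_mono) auto
    then show ?thesis by (simp add: abs_mult mult.commute)
  qed
  then show "AE z in lborel. norm (k z *\<^sub>R f (x + \<sigma> *\<^sub>R z)) \<le> norm (B * k z)" by simp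
qed

lemma Tk_norm:
  fixes f :: "'a::euclidean_space \<Rightarrow> 'b::euclidean_space"
  assumes k: "kern k" and f: "continuous_on UNIV f" "\<And>y. norm (f y) \<le> B"
  shows "norm (Tk k \<sigma> f x) \<le> knorm k * B"
proof -
  have "norm (Tk k \<sigma> f x) \<le> (\<integral>z. \<bar>k z\<bar> * B \<partial>lborel)"
    unfolding Tk_def
    by (rule norm_integral_le_bound[OF Tk_integrable[OF k f]])
       (use kern_integrable[OF k] f(2) in \<open>auto intro!: mult_left_mono\<close>)
  then show ?thesis by (simp add: knorm_def)
qed

lemma Tk_diff:
  fixes f :: "'a::euclidean_space \<Rightarrow> 'b::euclidean_space"
  assumes k: "kern k" and f: "continuous_on UNIV f" "\<And>y. norm (f y) \<le> B"
    and g: "continuous_on UNIV g" "\<And>y. norm (g y) \<le> B'"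
  shows "Tk k \<sigma> (\<lambda>y. f y - g y) x = Tk k \<sigma> f x - Tk k \<sigma> g x"
  unfolding Tk_def scaleR_right_diff_distrib
  by (rule Bochner_Integration.integral_diff[OF Tk_integrable[OF k f] Tk_integrable[OF k g]])

lemma lborel_integral_translate:
  fixes f :: "'a::euclidean_space \<Rightarrow> 'b::{banach,second_countable_topology}"
  assumes "f \<in> borel_measurable borel"
  shows "(\<integral>z. f (c + z) \<partial>lborel) = (\<integral>z. f z \<partial>lborel)"
proof -
  have "(\<integral>z. f z \<partial>lborel) = (\<integral>z. f z \<partial>distr lborel borel ((+) c))" by (simp add: lborel_distr_plus)
  also have "\<dots> = (\<integral>z. f (c + z) \<partial>lborel)" by (rule integral_distr) (use assms in auto)
  finally show ?thesis by simp
qed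

text \<open>A translation of the integration variable moves the dependence on \<open>y\<close> from
  \<open>f\<close> to the kernel, so \<open>f\<close> need only be continuous and bounded. The chain
  rule then costs the factor \<open>1 / \<sigma>\<close>.\<close>

lemma Tk_has_derivative:
  fixes f :: "'a::euclidean_space \<Rightarrow> 'b::euclidean_space"
  assumes k: "kern_grad k k'" and f: "continuous_on UNIV f" "\<And>y. norm (f y) \<le> B" and s: "0 < \<sigma>"
  shows "(Tk k \<sigma> f has_derivative (\<lambda>h. (- (1 / \<sigma>)) *\<^sub>R Tk (\<lambda>z. k' z \<bullet> h) \<sigma> f x)) (at x)"
proof -
  have kk: "kern k" and ck: "continuous_on UNIV k" and ck': "continuous_on UNIV k'"
    and der: "\<And>z. (k has_derivative (\<lambda>h. k' z \<bullet> h)) (at z)"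
    using k by (auto simp: kern_grad_def kern_def)
  from k obtain C where C: "\<And>z. norm (k' z) \<le> C * exp (- (norm z)\<^sup>2 / 8)" by (auto simp: kern_grad_def)
  have C0: "0 \<le> C" using C[of 0] norm_ge_zero[of "k' 0"] by (simp del: norm_ge_zero)
  define F where "F y z = k (z - (1/\<sigma>) *\<^sub>R (y - x)) *\<^sub>R f (x + \<sigma> *\<^sub>R z)" for y z
  define F' where "F' y z h = (- (1/\<sigma>) * (k' (z - (1/\<sigma>) *\<^sub>R (y - x)) \<bullet> h)) *\<^sub>R f (x + \<sigma> *\<^sub>R z)" for y z h
  have cF: "continuous_on UNIV (F y)" for y
    unfolding F_def by (intro continuous_intros continuous_on_compose2[OF ck] continuous_on_compose2[OF f(1)]) auto
  have eq: "Tk k \<sigma> f y = (\<integral>z. F y z \<partial>lborel)" for y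
  proof -
    have "(\<integral>z. F y ((1/\<sigma>) *\<^sub>R (y - x) + z) \<partial>lborel) = (\<integral>z. F y z \<partial>lborel)"
      by (rule lborel_integral_translate) (simp add: cF borel_measurable_continuous_onI)
    moreover have "F y ((1/\<sigma>) *\<^sub>R (y - x) + z) = k z *\<^sub>R f (y + \<sigma> *\<^sub>R z)" for z
      using s by (simp add: F_def algebra_simps)
    ultimately show ?thesis by (simp add: Tk_def)
  qed
  have intF: "integrable lborel (F y)" for y
  proof -
    have "integrable (distr lborel borel ((+) ((1/\<sigma>) *\<^sub>R (y - x)))) (F y)"
    proof (subst integrable_distr_eq)
      show "F y \<in> borel_measurable borel" by (simp add: cF borel_measurable_continuous_onI)
      have "F y ((1/\<sigma>) *\<^sub>R (y - x) + z) = k z *\<^sub>R f (y + \<sigma> *\<^sub>R z)" for z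
        using s by (simp add: F_def algebra_simps)
      then show "integrable lborel (\<lambda>z. F y ((1/\<sigma>) *\<^sub>R (y - x) + z))"
        using Tk_integrable[OF kk f] by simp
    qed auto
    then show ?thesis by (simp add: lborel_distr_plus)
  qed
  \<comment> \<open>Halving the Gaussian rate absorbs the shift by \<open>w\<close>; this gives one
    integrable majorant for all \<open>y\<close> within \<open>\<sigma>\<close> of
    \<open>x\<close>.\<close>
  have sq: "(norm z)\<^sup>2 / 16 \<le> (norm (z - w))\<^sup>2 / 8 + 1/8" if "norm w < 1" for z w :: 'a
  proof -
    have "norm z \<le> norm (z - w) + norm w" by (metis norm_triangle_sub add.commute norm_minus_commute)
    then have "(norm z)\<^sup>2 \<le> (norm (z - w) + 1)\<^sup>2" using that by (intro power_mono) auto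
    also have "\<dots> \<le> 2 * (norm (z - w))\<^sup>2 + 2"
      using sum_squares_bound[of "norm (z - w)" 1] by (simp add: power2_sum)
    finally show ?thesis by simp
  qed
  define g where "g z = (1/\<sigma> * (C * exp (1/8)) * B) * exp (- (1/16) * (norm z)\<^sup>2)" for z :: 'a
  have "((\<lambda>y. \<integral>z. F y z \<partial>lborel) has_derivative (\<lambda>h. \<integral>z. F' x z h \<partial>lborel)) (at x)"
  proof (rule has_derivative_lebesgue_integral[where e=\<sigma> and g=g])
    have "continuous_on UNIV (\<lambda>z. F' x z h)" for h
      unfolding F'_def
      by (intro continuous_intros continuous_on_compose2[OF ck'] continuous_on_compose2[OF f(1)]) auto
    then show "(\<lambda>z. F' x z h) \<in> borel_measurable lborel" for h
      by (simp add: borel_measurable_continuous_onI)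
    show "((\<lambda>y. F y z) has_derivative F' y z) (at y)" for y z
      unfolding F_def F'_def
      apply (rule has_derivative_eq_rhs)
      apply (rule has_derivative_scaleR[OF has_derivative_compose[OF _ der] has_derivative_const])
      apply (rule derivative_intros)+
      using s by (simp add: fun_eq_iff)
    show "integrable lborel g" unfolding g_def by (intro integrable_mult_right integrable_gaussian) simp
    fix y z h assume y: "y \<in> ball x \<sigma>"
    define w where "w = (1/\<sigma>) *\<^sub>R (y - x)"
    have w: "norm w < 1" using y s by (simp add: w_def dist_norm norm_minus_commute)
    have "norm (k' (z - w)) \<le> C * exp (- (norm (z - w))\<^sup>2 / 8)" by (rule C)
    also have "\<dots> \<le> C * (exp (1/8) * exp (- (1/16) * (norm z)\<^sup>2))"
      unfolding exp_add[symmetric] using sq[OF w, of z] by (intro mult_left_mono C0) simp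
    finally have n: "norm (k' (z - w)) \<le> C * exp (1/8) * exp (- (1/16) * (norm z)\<^sup>2)" by simp
    have "norm (F' y z h) = (1/\<sigma>) * \<bar>k' (z - w) \<bullet> h\<bar> * norm (f (x + \<sigma> *\<^sub>R z))"
      using s by (simp add: F'_def w_def abs_mult)
    also have "\<dots> \<le> (1/\<sigma>) * ((C * exp (1/8) * exp (- (1/16) * (norm z)\<^sup>2)) * norm h) * B"
      by (intro mult_mono f(2) order_refl order_trans[OF Cauchy_Schwarz_ineq2] n mult_nonneg_nonneg) (use s C0 in auto)
    finally show "norm (F' y z h) \<le> g z * norm h" by (simp add: g_def mult_ac)
  qed (use s intF in auto)
  moreover have "(\<integral>z. F' x z h \<partial>lborel) = (- (1 / \<sigma>)) *\<^sub>R Tk (\<lambda>z. k' z \<bullet> h) \<sigma> f x" for h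
  proof -
    have "(\<integral>z. F' x z h \<partial>lborel) = (\<integral>z. (- (1/\<sigma>)) *\<^sub>R ((k' z \<bullet> h) *\<^sub>R f (x + \<sigma> *\<^sub>R z)) \<partial>lborel)"
      by (rule Bochner_Integration.integral_cong) (simp_all add: F'_def)
    then show ?thesis by (simp only: Tk_def integral_scaleR_right)
  qed
  moreover have "Tk k \<sigma> f = (\<lambda>y. \<integral>z. F y z \<partial>lborel)" using eq by auto
  ultimately show ?thesis by simp
qed

text \<open>The companion of \<open>Tk_has_derivative\<close> for differentiable \<open>f\<close>.
  Since a derivative is unique, comparing the two formulas amounts to an integration by parts
  without boundary terms.\<close>

lemma Tk_has_derivative_src:
  fixes f :: "'a::euclidean_space \<Rightarrow> 'b::euclidean_space"
  assumes k: "kern k" and f: "continuous_on UNIV f" "\<And>y. norm (f y) \<le> B"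
    and der: "\<And>y. (f has_derivative f' y) (at y)"
    and f': "\<And>h. continuous_on UNIV (\<lambda>y. f' y h)" "\<And>y h. norm (f' y h) \<le> B' * norm h"
  shows "(Tk k \<sigma> f has_derivative (\<lambda>h. Tk k \<sigma> (\<lambda>y. f' y h) x)) (at x)"
proof -
  have ck: "continuous_on UNIV k" using k by (auto simp: kern_def)
  have "((\<lambda>y. \<integral>z. k z *\<^sub>R f (y + \<sigma> *\<^sub>R z) \<partial>lborel) has_derivative (\<lambda>h. \<integral>z. k z *\<^sub>R f' (x + \<sigma> *\<^sub>R z) h \<partial>lborel)) (at x)"
  proof (rule has_derivative_lebesgue_integral[where e=1 and g="\<lambda>z. \<bar>k z\<bar> * B'" and F="\<lambda>y z. k z *\<^sub>R f (y + \<sigma> *\<^sub>R z)" and F'="\<lambda>y z h. k z *\<^sub>R f' (y + \<sigma> *\<^sub>R z) h"])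
    show "integrable lborel (\<lambda>z. k z *\<^sub>R f (y + \<sigma> *\<^sub>R z))" for y by (rule Tk_integrable[OF k f])
    show "(\<lambda>z. k z *\<^sub>R f' (x + \<sigma> *\<^sub>R z) h) \<in> borel_measurable lborel" for h
      by (simp, intro borel_measurable_continuous_onI continuous_intros continuous_on_compose2[OF ck] continuous_on_compose2[OF f'(1)]) auto
    show "((\<lambda>y. k z *\<^sub>R f (y + \<sigma> *\<^sub>R z)) has_derivative (\<lambda>h. k z *\<^sub>R f' (y + \<sigma> *\<^sub>R z) h)) (at y)" for y z
      by (rule has_derivative_eq_rhs, rule has_derivative_scaleR_right,
          rule has_derivative_compose[OF _ der], (rule derivative_intros)+) simp
    show "norm (k z *\<^sub>R f' (y + \<sigma> *\<^sub>R z) h) \<le> \<bar>k z\<bar> * B' * norm h" for y z h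
      using f'(2)[of _ h] by (simp add: mult.assoc mult_left_mono)
    show "integrable lborel (\<lambda>z. \<bar>k z\<bar> * B')" using kern_integrable[OF k] by simp
  qed auto
  then show ?thesis by (simp add: Tk_def[abs_def])
qed

lemma Tk_continuous:
  fixes f :: "'a::euclidean_space \<Rightarrow> 'c::metric_space \<Rightarrow> 'b::euclidean_space"
  assumes k: "kern k" and f: "continuous_on (UNIV \<times> S) (\<lambda>(y, s). f y s)" "\<And>y s. s \<in> S \<Longrightarrow> norm (f y s) \<le> B"
  shows "continuous_on (UNIV \<times> UNIV \<times> S) (\<lambda>(x, \<sigma>, s). Tk k \<sigma> (\<lambda>y. f y s) x)"
proof -
  have ck: "continuous_on UNIV k" using k by (auto simp: kern_def)
  have cf: "continuous_on UNIV (\<lambda>y. f y s)" if "s \<in> S" for s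
    using continuous_on_compose2[OF f(1), of UNIV "\<lambda>y. (y, s)"] that by (simp add: image_subset_iff continuous_on_Pair)
  have "continuous_on (UNIV \<times> UNIV \<times> S) (\<lambda>p. \<integral>z. k z *\<^sub>R (case (fst p + fst (snd p) *\<^sub>R z, snd (snd p)) of (y, s) \<Rightarrow> f y s) \<partial>lborel)"
  proof (rule continuous_on_lebesgue_integral[where w="\<lambda>z. \<bar>k z\<bar> * B"])
    show "integrable lborel (\<lambda>z. \<bar>k z\<bar> * B)" using kern_integrable[OF k] by simp
    fix p :: "'a \<times> real \<times> 'c" assume p: "p \<in> UNIV \<times> UNIV \<times> S"
    then show "(\<lambda>z. k z *\<^sub>R (case (fst p + fst (snd p) *\<^sub>R z, snd (snd p)) of (y, s) \<Rightarrow> f y s)) \<in> borel_measurable lborel"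
      by (simp, intro borel_measurable_continuous_onI continuous_intros continuous_on_compose2[OF ck] continuous_on_compose2[OF cf[of "snd (snd p)"]]) auto
    show "norm (k z *\<^sub>R (case (fst p + fst (snd p) *\<^sub>R z, snd (snd p)) of (y, s) \<Rightarrow> f y s)) \<le> \<bar>k z\<bar> * B" for z
      using f(2) p by (auto intro!: mult_left_mono)
  next
    fix z :: 'a
    show "continuous_on (UNIV \<times> UNIV \<times> S) (\<lambda>p. k z *\<^sub>R (case (fst p + fst (snd p) *\<^sub>R z, snd (snd p)) of (y, s) \<Rightarrow> f y s))"
      by (intro continuous_intros continuous_on_compose2[OF f(1)]) auto
  qed
  then show ?thesis by (simp add: Tk_def case_prod_unfold)
qed

text \<open>
  The heat semigroup at time \<open>t\<close> is \<open>Tk gauss (sqrt t)\<close>. The kernels \<open>dgauss\<close>, \<open>ddgauss h\<close> and \<open>lgauss\<close>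
  are the gradient of \<open>gauss\<close>, the gradient of its derivative along \<open>h\<close>, and its Laplacian; each space
  derivative moved onto the kernel costs a factor \<open>1 / \<sigma>\<close>.
\<close>

definition gauss_const :: "'a::euclidean_space itself \<Rightarrow> real"
  where "gauss_const _ = 1 / (\<integral>z. exp (- (norm (z::'a))\<^sup>2 / 4) \<partial>lborel)"

definition gauss :: "'a::euclidean_space \<Rightarrow> real"
  where "gauss z = gauss_const TYPE('a) * exp (- (norm z)\<^sup>2 / 4)"

definition dgauss :: "'a::euclidean_space \<Rightarrow> 'a"
  where "dgauss z = (- (gauss z / 2)) *\<^sub>R z"

definition ddgauss :: "'a::euclidean_space \<Rightarrow> 'a \<Rightarrow> 'a"
  where "ddgauss h z = gauss z *\<^sub>R ((z \<bullet> h / 4) *\<^sub>R z - (1/2) *\<^sub>R h)"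

definition lgauss :: "'a::euclidean_space \<Rightarrow> real"
  where "lgauss z = ((norm z)\<^sup>2 / 4 - real DIM('a) / 2) * gauss z"

section \<open>The heat kernel and its derivatives\<close>

lemma gauss_const_pos: "0 < gauss_const TYPE('a::euclidean_space)"
proof -
  let ?f = "\<lambda>z::'a. exp (- (norm z)\<^sup>2 / 4)"
  have i: "integrable lborel ?f" using integrable_gaussian[of "1/4", where 'a='a] by simp
  have "(\<integral>z. ?f z \<partial>lborel) \<noteq> 0"
  proof
    assume "(\<integral>z. ?f z \<partial>lborel) = 0"
    then have "AE z in lborel. ?f z = 0"
      using integral_nonneg_eq_0_iff_AE[OF i] by simp
    then have "AE z::'a in lborel. False" by simp
    then have "emeasure lborel (UNIV::'a set) = 0" by (simp add: AE_iff_measurable[of UNIV])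
    then show False by simp
  qed
  moreover have "0 \<le> (\<integral>z. ?f z \<partial>lborel)" by (rule Bochner_Integration.integral_nonneg) simp
  ultimately have "0 < (\<integral>z. ?f z \<partial>lborel)" by linarith
  then show ?thesis by (simp add: gauss_const_def)
qed

lemma gauss_nonneg: "0 \<le> gauss (z::'a::euclidean_space)"
  unfolding gauss_def using gauss_const_pos[where 'a='a] by (simp add: less_imp_le)

lemma gauss_cont [continuous_intros]: "continuous_on S f \<Longrightarrow> continuous_on S (\<lambda>x. gauss (f x))"
  unfolding gauss_def by (intro continuous_intros) auto

lemma norm_power_gauss_bound:
  fixes z :: "'a::euclidean_space"
  shows "(1 + (norm z)\<^sup>2) * gauss z \<le> 8 * gauss_const TYPE('a) * exp (- (norm z)\<^sup>2 / 8)"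
proof -
  have "1 + (norm z)\<^sup>2 \<le> 8 * exp ((norm z)\<^sup>2 / 8)"
    using exp_ge_add_one_self[of "(norm z)\<^sup>2 / 8"] zero_le_power2[of "norm z"] by linarith
  then have "(1 + (norm z)\<^sup>2) * gauss z \<le> 8 * exp ((norm z)\<^sup>2 / 8) * gauss z"
    by (intro mult_right_mono gauss_nonneg)
  also have "\<dots> = 8 * gauss_const TYPE('a) * (exp ((norm z)\<^sup>2 / 8) * exp (- (norm z)\<^sup>2 / 4))"
    by (simp add: gauss_def)
  also have "exp ((norm z)\<^sup>2 / 8) * exp (- (norm z)\<^sup>2 / 4) = exp (- (norm z)\<^sup>2 / 8)"
    by (simp add: exp_add[symmetric])
  finally show ?thesis .
qed

lemma kern_if_gauss_bound:
  fixes k :: "'a::euclidean_space \<Rightarrow> real"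
  assumes "continuous_on UNIV k" "\<And>z. \<bar>k z\<bar> \<le> C * ((1 + (norm z)\<^sup>2) * gauss z)"
  shows "kern k"
proof -
  have C: "0 \<le> C"
    using order_trans[OF abs_ge_zero assms(2)[of 0]] gauss_const_pos[where 'a='a] by (simp add: gauss_def zero_le_mult_iff)
  have "\<bar>k z\<bar> \<le> C * (8 * gauss_const TYPE('a)) * exp (- (norm z)\<^sup>2 / 8)" for z
    using order_trans[OF assms(2)[of z] mult_left_mono[OF norm_power_gauss_bound C]] by (simp add: mult_ac)
  then show ?thesis using assms(1) by (auto simp: kern_def)
qed

lemma norm_le_one_plus_square: "r \<le> 1 + r\<^sup>2" for r :: real
  using sum_squares_bound[of r 1] zero_le_power2[of r] by (simp; linarith)

lemma kern_grad_if_gauss_bound: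
  fixes k :: "'a::euclidean_space \<Rightarrow> real"
  assumes "kern k" "continuous_on UNIV k'" "\<And>z. norm (k' z) \<le> C * ((1 + (norm z)\<^sup>2) * gauss z)" "0 \<le> C"
    "\<And>z. (k has_derivative (\<lambda>h. k' z \<bullet> h)) (at z)"
  shows "kern_grad k k'"
proof -
  have "norm (k' z) \<le> C * (8 * gauss_const TYPE('a)) * exp (- (norm z)\<^sup>2 / 8)" for z
    using order_trans[OF assms(3)[of z] mult_left_mono[OF norm_power_gauss_bound assms(4)]] by (simp add: mult_ac)
  then show ?thesis using assms by (auto simp: kern_grad_def)
qed

lemma gauss_kern: "kern gauss"
proof (rule kern_if_gauss_bound[where C=1])
  show "\<bar>gauss z\<bar> \<le> 1 * ((1 + (norm z)\<^sup>2) * gauss z)" for z :: 'a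
    using gauss_nonneg[of z] by (simp add: distrib_right)
qed (intro continuous_intros)

lemma gauss_has_derivative: "(gauss has_derivative (\<lambda>h. dgauss z \<bullet> h)) (at z)"
proof -
  have "((\<lambda>z::'a. gauss_const TYPE('a) * exp (- (z \<bullet> z) / 4)) has_derivative (\<lambda>h. dgauss z \<bullet> h)) (at z)"
    by (auto intro!: derivative_eq_intros simp: dgauss_def gauss_def power2_norm_eq_inner fun_eq_iff inner_commute)
  then show ?thesis by (simp add: gauss_def[abs_def] power2_norm_eq_inner)
qed

lemma dgauss_cont [continuous_intros]: "continuous_on S f \<Longrightarrow> continuous_on S (\<lambda>x. dgauss (f x))"
  unfolding dgauss_def by (intro continuous_intros) auto

lemma ddgauss_cont [continuous_intros]: "continuous_on S f \<Longrightarrow> continuous_on S (\<lambda>x. ddgauss h (f x))"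
  unfolding ddgauss_def by (intro continuous_intros) auto

lemma gauss_kern_grad: "kern_grad gauss dgauss"
proof (rule kern_grad_if_gauss_bound[where C=1])
  show "norm (dgauss z) \<le> 1 * ((1 + (norm z)\<^sup>2) * gauss z)" for z :: 'a
  proof -
    have "norm (dgauss z) = (norm z / 2) * gauss z"
      using gauss_nonneg[of z] by (simp add: dgauss_def)
    also have "\<dots> \<le> (1 + (norm z)\<^sup>2) * gauss z"
      using norm_le_one_plus_square[of "norm z"] norm_ge_zero[of z]
      by (intro mult_right_mono gauss_nonneg) linarith
    finally show ?thesis by simp
  qed
  show "continuous_on UNIV (dgauss :: 'a \<Rightarrow> 'a)" by (intro continuous_intros)
qed (simp_all add: gauss_kern gauss_has_derivative)

lemma dgauss_kern_grad: "kern_grad (\<lambda>z. dgauss z \<bullet> h) (ddgauss h)"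
proof (rule kern_grad_if_gauss_bound[where C="norm h"])
  show "kern (\<lambda>z. dgauss z \<bullet> h)" by (rule kern_grad_component[OF gauss_kern_grad])
  show "continuous_on UNIV (ddgauss h)" by (intro continuous_intros)
  show "norm (ddgauss h z) \<le> norm h * ((1 + (norm z)\<^sup>2) * gauss z)" for z :: 'a
  proof -
    have "norm ((z \<bullet> h / 4) *\<^sub>R z - (1/2) *\<^sub>R h) \<le> \<bar>z \<bullet> h\<bar> / 4 * norm z + norm h / 2"
      by (rule norm_triangle_le_diff) simp
    also have "\<dots> \<le> (norm z * norm h) / 4 * norm z + norm h / 2"
      by (intro add_mono mult_right_mono divide_right_mono Cauchy_Schwarz_ineq2) auto
    also have "\<dots> = norm h * (1/2 + (norm z)\<^sup>2 / 4)"
      by (simp add: algebra_simps power2_eq_square)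
    also have "\<dots> \<le> norm h * (1 + (norm z)\<^sup>2)" by (intro mult_left_mono) (simp_all add: add_mono)
    finally have "norm ((z \<bullet> h / 4) *\<^sub>R z - (1/2) *\<^sub>R h) \<le> norm h * (1 + (norm z)\<^sup>2)" .
    then show ?thesis
      unfolding ddgauss_def using gauss_nonneg[of z]
      by (simp only: norm_scaleR abs_of_nonneg mult.assoc[symmetric] mult.commute[of "gauss z"] mult_right_mono)
  qed
  show "((\<lambda>z. dgauss z \<bullet> h) has_derivative (\<lambda>k. ddgauss h z \<bullet> k)) (at z)" for z :: 'a
    unfolding dgauss_def
    by (auto intro!: derivative_eq_intros has_derivative_compose[OF _ gauss_has_derivative]
        simp: fun_eq_iff ddgauss_def dgauss_def algebra_simps inner_simps inner_commute diff_divide_distrib)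
qed simp

lemma lgauss_kern: "kern lgauss"
proof (rule kern_if_gauss_bound[where C="real DIM('a)"])
  show "continuous_on UNIV (lgauss :: 'a \<Rightarrow> real)" unfolding lgauss_def by (intro continuous_intros) auto
  fix z :: 'a
  have D: "1 \<le> real DIM('a)" using DIM_positive[where 'a='a] by linarith
  have "\<bar>(norm z)\<^sup>2 / 4 - real DIM('a) / 2\<bar> \<le> (norm z)\<^sup>2 / 4 + real DIM('a) / 2" by (rule abs_leI) auto
  also have "\<dots> \<le> real DIM('a) * (1 + (norm z)\<^sup>2)"
    unfolding distrib_left using mult_right_mono[OF D, of "(norm z)\<^sup>2"] zero_le_power2[of "norm z"] D by linarith
  finally show "\<bar>lgauss z\<bar> \<le> real DIM('a) * ((1 + (norm z)\<^sup>2) * gauss z)"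
    using gauss_nonneg[of z] by (simp add: lgauss_def abs_mult mult.assoc[symmetric] mult_right_mono)
qed

lemma lgauss_eq_sum: "lgauss z = (\<Sum>b\<in>Basis. ddgauss b z \<bullet> b)"
proof -
  have "(\<Sum>b\<in>Basis. ddgauss b z \<bullet> b) = gauss z * ((\<Sum>b\<in>Basis. (z \<bullet> b)\<^sup>2) / 4 - real DIM('a) / 2)"
    by (simp add: ddgauss_def inner_diff_left sum_subtractf power2_eq_square right_diff_distrib
        sum_distrib_left sum_divide_distrib)
  also have "(\<Sum>b\<in>Basis. (z \<bullet> b)\<^sup>2) = (norm z)\<^sup>2"
    unfolding power2_norm_eq_inner by (subst euclidean_inner) (simp add: power2_eq_square)
  finally show ?thesis by (simp add: lgauss_def mult.commute)
qed

lemma integral_gauss: "(\<integral>z. gauss z \<partial>(lborel::'a::euclidean_space measure)) = 1"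
  using gauss_const_pos[where 'a='a] by (simp add: gauss_def gauss_const_def)

lemma knorm_gauss: "knorm (gauss :: 'a::euclidean_space \<Rightarrow> real) = 1"
  by (simp add: knorm_def integral_gauss abs_of_nonneg[OF gauss_nonneg])

text \<open>Puts the dilation back onto the kernel. The time derivative has to fall on the kernel
  with \<open>f (x + y)\<close> frozen, because \<open>f\<close> is not assumed
  differentiable.\<close>

lemma Tk_scale:
  fixes f :: "'a::euclidean_space \<Rightarrow> 'b::euclidean_space"
  assumes "0 < \<sigma>" "continuous_on UNIV k" "continuous_on UNIV f"
  shows "Tk k \<sigma> f x = (\<integral>y. (k (y /\<^sub>R \<sigma>) / \<sigma> ^ DIM('a)) *\<^sub>R f (x + y) \<partial>lborel)"
    and "integrable lborel (\<lambda>z. k z *\<^sub>R f (x + \<sigma> *\<^sub>R z)) \<Longrightarrow> integrable lborel (\<lambda>y. (k (y /\<^sub>R \<sigma>) / \<sigma> ^ DIM('a)) *\<^sub>R f (x + y))"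
proof -
  let ?g = "\<lambda>y. (k (y /\<^sub>R \<sigma>) / \<sigma> ^ DIM('a)) *\<^sub>R f (x + y)"
  have gm[measurable]: "?g \<in> borel_measurable borel"
    by (intro borel_measurable_continuous_onI continuous_intros continuous_on_compose2[OF assms(2)] continuous_on_compose2[OF assms(3)])
       (use assms(1) in auto)
  have l: "lborel = density (distr lborel borel (\<lambda>x. (0::'a) + \<sigma> *\<^sub>R x)) (\<lambda>_. \<bar>\<sigma>\<bar>^DIM('a))"
    using assms(1) by (intro lborel_affine) simp
  have g: "\<sigma> ^ DIM('a) *\<^sub>R ?g (0 + \<sigma> *\<^sub>R z) = k z *\<^sub>R f (x + \<sigma> *\<^sub>R z)" for z
    using assms(1) by simp
  have "(\<integral>y. ?g y \<partial>lborel) = (\<integral>y. ?g y \<partial>density (distr lborel borel (\<lambda>x. (0::'a) + \<sigma> *\<^sub>R x)) (\<lambda>_. \<bar>\<sigma>\<bar>^DIM('a)))"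
    by (subst l) simp
  also have "\<dots> = (\<integral>z. \<sigma> ^ DIM('a) *\<^sub>R ?g (0 + \<sigma> *\<^sub>R z) \<partial>lborel)"
    using assms(1) by (subst integral_density) (simp_all add: integral_distr del: scaleR_scaleR)
  finally show "Tk k \<sigma> f x = (\<integral>y. ?g y \<partial>lborel)" by (simp only: g Tk_def)
  assume i: "integrable lborel (\<lambda>z. k z *\<^sub>R f (x + \<sigma> *\<^sub>R z))"
  have "integrable (density (distr lborel borel (\<lambda>x. (0::'a) + \<sigma> *\<^sub>R x)) (\<lambda>_. \<bar>\<sigma>\<bar>^DIM('a))) ?g"
    apply (subst integrable_density)
       apply simp
      apply simp
     using assms(1) apply simp
    apply (subst integrable_distr_eq)
      apply simp
     apply (rule borel_measurable_scaleR[OF borel_measurable_const gm])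
    using i assms(1) by (simp only: g abs_of_pos)
  then show "integrable lborel ?g" using l by simp
qed

lemma Tk_gauss_time_derivative:
  fixes f :: "'a::euclidean_space \<Rightarrow> 'b::euclidean_space"
  assumes f: "continuous_on UNIV f" "\<And>y. norm (f y) \<le> B" and t: "0 < t"
  shows "((\<lambda>t. Tk gauss (sqrt t) f x) has_vector_derivative (1 / t) *\<^sub>R Tk lgauss (sqrt t) f x) (at t)"
proof -
  let ?n = "real DIM('a)"
  \<comment> \<open>The heat kernel with the power of \<open>\<tau>\<close> written as an
    exponential, so that a single chain rule gives its time derivative.\<close>
  define H where "H y \<tau> = gauss_const TYPE('a) * exp (- (norm y)\<^sup>2 / (4 * \<tau>) - ?n / 2 * ln \<tau>)" for y :: 'a and \<tau>
  have pw: "sqrt \<tau> ^ DIM('a) = exp (?n / 2 * ln \<tau>)" if "0 < \<tau>" for \<tau>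
  proof -
    have "exp (?n / 2 * ln \<tau>) = exp (?n * ln (sqrt \<tau>))" using that by (simp add: ln_sqrt)
    also have "\<dots> = exp (ln (sqrt \<tau>)) ^ DIM('a)" by (rule exp_of_nat_mult)
    finally show ?thesis using that by simp
  qed
  have nsq: "(norm (y /\<^sub>R sqrt \<tau>))\<^sup>2 = (norm y)\<^sup>2 / \<tau>" if "0 < \<tau>" for y :: 'a and \<tau>
  proof -
    have "norm (y /\<^sub>R sqrt \<tau>) = norm y / sqrt \<tau>" using that by (simp add: divide_inverse mult.commute)
    then show ?thesis using that by (simp add: power_divide)
  qed
  have Heq: "gauss (y /\<^sub>R sqrt \<tau>) / sqrt \<tau> ^ DIM('a) = H y \<tau>" if "0 < \<tau>" for y :: 'a and \<tau>
    using that unfolding gauss_def H_def nsq[OF that] by (simp add: pw exp_diff mult.commute)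
  have leq: "(1 / \<tau>) * (lgauss (y /\<^sub>R sqrt \<tau>) / sqrt \<tau> ^ DIM('a)) = H y \<tau> * ((norm y)\<^sup>2 / (4 * \<tau>\<^sup>2) - ?n / (2 * \<tau>))"
    if "0 < \<tau>" for y :: 'a and \<tau>
  proof -
    have "lgauss (y /\<^sub>R sqrt \<tau>) / sqrt \<tau> ^ DIM('a) = ((norm y)\<^sup>2 / (4 * \<tau>) - ?n / 2) * H y \<tau>"
      unfolding Heq[OF that, symmetric] lgauss_def
      unfolding nsq[OF that] by (simp add: mult.commute)
    then show ?thesis using that by (simp add: field_simps power2_eq_square)
  qed
  define F where "F \<tau> y = H y \<tau> *\<^sub>R f (x + y)" for \<tau> y
  define F' where "F' \<tau> y h = (h * (H y \<tau> * ((norm y)\<^sup>2 / (4 * \<tau>\<^sup>2) - ?n / (2 * \<tau>)))) *\<^sub>R f (x + y)" for \<tau> y and h :: real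
  define K where "K = gauss_const TYPE('a) * exp (- (?n / 2 * ln (t / 2)))"
  have K0: "0 \<le> K" using gauss_const_pos[where 'a='a] by (simp add: K_def)
  \<comment> \<open>On \<open>ball t (t / 2)\<close> one has \<open>\<tau> < 3 * t / 2\<close>, so
    the kernel decays at least like \<open>exp (- |y|^2 / (6 t))\<close>. Half of this exponent
    absorbs the factor \<open>|y|^2 / t^2\<close> produced by the time derivative, which leaves the
    rate \<open>1 / (12 t)\<close>.\<close>
  define g where "g y = (K * ((12 + ?n) / t) * B) * exp (- (1 / (12 * t)) * (norm y)\<^sup>2)" for y :: 'a
  have cH: "continuous_on UNIV (\<lambda>y. H y \<tau>)" if "0 < \<tau>" for \<tau>
    unfolding H_def using that by (intro continuous_intros) auto
  have "((\<lambda>\<tau>. \<integral>y. F \<tau> y \<partial>lborel) has_derivative (\<lambda>h. \<integral>y. F' t y h \<partial>lborel)) (at t)"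
  proof (rule has_derivative_lebesgue_integral[where e="t/2" and g=g])
    show "0 < t / 2" using t by simp
    show "integrable lborel g" unfolding g_def by (intro integrable_mult_right integrable_gaussian) (use t in simp)
    have "continuous_on UNIV (\<lambda>y. F' t y h)" for h
      unfolding F'_def by (intro continuous_intros cH t continuous_on_compose2[OF f(1)]) (use t in auto)
    then show "(\<lambda>y. F' t y h) \<in> borel_measurable lborel" for h
      by (simp add: borel_measurable_continuous_onI)
    fix \<tau> assume "\<tau> \<in> ball t (t / 2)"
    then have b: "t / 2 < \<tau>" "\<tau> < 3 * t / 2" by (auto simp: dist_real_def abs_if split: if_splits)
    have tau: "0 < \<tau>" using b t by linarith
    show "integrable lborel (F \<tau>)"
    proof -
      have "integrable lborel (\<lambda>y. (gauss (y /\<^sub>R sqrt \<tau>) / sqrt \<tau> ^ DIM('a)) *\<^sub>R f (x + y))"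
        using tau by (intro Tk_scale(2) Tk_integrable[OF gauss_kern f] f(1) continuous_intros) auto
      then show ?thesis by (simp add: Heq[OF tau] F_def[abs_def])
    qed
    fix y :: 'a
    have "((\<lambda>\<tau>. H y \<tau>) has_derivative (\<lambda>h. h * (H y \<tau> * ((norm y)\<^sup>2 / (4 * \<tau>\<^sup>2) - ?n / (2 * \<tau>))))) (at \<tau>)"
    proof -
      define w where "w = (norm y)\<^sup>2"
      have "((\<lambda>\<tau>. - w / (4 * \<tau>) - ?n / 2 * ln \<tau>) has_real_derivative (w / (4 * \<tau>\<^sup>2) - ?n / (2 * \<tau>))) (at \<tau>)"
        using tau by (auto intro!: derivative_eq_intros simp: power2_eq_square)
      then have "((\<lambda>\<tau>. gauss_const TYPE('a) * exp (- w / (4 * \<tau>) - ?n / 2 * ln \<tau>)) has_real_derivative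
          gauss_const TYPE('a) * (exp (- w / (4 * \<tau>) - ?n / 2 * ln \<tau>) * (w / (4 * \<tau>\<^sup>2) - ?n / (2 * \<tau>)))) (at \<tau>)"
        by (intro DERIV_cmult DERIV_fun_exp)
      then show ?thesis
        unfolding has_field_derivative_def H_def w_def
        by (rule has_derivative_eq_rhs) (intro ext, simp only: mult_ac)
    qed
    then show "((\<lambda>\<tau>. F \<tau> y) has_derivative F' \<tau> y) (at \<tau>)"
      unfolding F_def F'_def
      by (rule has_derivative_scaleR_left)
    fix h :: real
    let ?w = "(norm y)\<^sup>2"
    have H0: "0 \<le> H y \<tau>" using gauss_const_pos[where 'a='a] by (simp add: H_def)
    have H1: "H y \<tau> \<le> K * exp (- (?w / (6 * t)))"
    proof -
      have "?w / (6 * t) \<le> ?w / (4 * \<tau>)" using b t tau by (intro divide_left_mono) auto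
      moreover have "?n / 2 * ln (t / 2) \<le> ?n / 2 * ln \<tau>" using b t tau by (intro mult_left_mono) auto
      ultimately show ?thesis
        unfolding H_def K_def mult.assoc exp_add[symmetric] minus_divide_left[symmetric] using gauss_const_pos[where 'a='a]
        by (intro mult_left_mono iffD2[OF exp_le_cancel_iff]) linarith+
    qed
    have p: "\<bar>?w / (4 * \<tau>\<^sup>2) - ?n / (2 * \<tau>)\<bar> \<le> ((12 + ?n) / t) * exp (?w / (12 * t))"
    proof -
      have "(t/2)\<^sup>2 \<le> \<tau>\<^sup>2" using b t by (intro power_mono) auto
      then have "?w / (4 * \<tau>\<^sup>2) \<le> ?w / (4 * (t/2)\<^sup>2)" using t tau by (intro divide_left_mono) auto
      then have 1: "?w / (4 * \<tau>\<^sup>2) \<le> ?w / t\<^sup>2" by (simp add: power_divide)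
      have 2: "?n / (2 * \<tau>) \<le> ?n / t" using b t tau by (intro divide_left_mono) auto
      have e: "1 + ?w / (12 * t) \<le> exp (?w / (12 * t))" by (rule exp_ge_add_one_self)
      have e1: "1 \<le> exp (?w / (12 * t))" using t by simp
      have e2: "?w / (12 * t) \<le> exp (?w / (12 * t))" using e by linarith
      have "\<bar>?w / (4 * \<tau>\<^sup>2) - ?n / (2 * \<tau>)\<bar> \<le> ?w / (4 * \<tau>\<^sup>2) + ?n / (2 * \<tau>)"
        using tau by (intro abs_leI) auto
      also have "\<dots> \<le> ?w / t\<^sup>2 + ?n / t" using 1 2 by linarith
      also have "\<dots> = (12 / t) * (?w / (12 * t)) + (?n / t) * 1" using t by (simp add: power2_eq_square)
      also have "\<dots> \<le> (12 / t) * exp (?w / (12 * t)) + (?n / t) * exp (?w / (12 * t))"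
        by (intro add_mono mult_left_mono e1 e2) (use t in auto)
      finally show ?thesis by (simp add: add_divide_distrib distrib_right)
    qed
    have "norm (F' \<tau> y h) = \<bar>h\<bar> * (H y \<tau> * \<bar>?w / (4 * \<tau>\<^sup>2) - ?n / (2 * \<tau>)\<bar>) * norm (f (x + y))"
      using H0 by (simp add: F'_def abs_mult)
    also have "\<dots> \<le> \<bar>h\<bar> * ((K * exp (- (?w / (6 * t)))) * (((12 + ?n) / t) * exp (?w / (12 * t)))) * B"
      by (intro mult_mono f(2) order_refl H1 p mult_nonneg_nonneg) (use K0 H0 t in auto)
    also have "\<dots> = (K * ((12 + ?n) / t) * B) * (exp (- (?w / (6 * t))) * exp (?w / (12 * t))) * \<bar>h\<bar>"
      by (simp only: mult_ac)
    also have "exp (- (?w / (6 * t))) * exp (?w / (12 * t)) = exp (- (1 / (12 * t)) * ?w)"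
      using t by (simp add: exp_add[symmetric] field_simps)
    finally show "norm (F' \<tau> y h) \<le> g y * norm h" by (simp only: g_def real_norm_def)
  qed
  then have d: "((\<lambda>\<tau>. \<integral>y. F \<tau> y \<partial>lborel) has_derivative (\<lambda>h. h *\<^sub>R (\<integral>y. F' t y 1 \<partial>lborel))) (at t)"
  proof (rule has_derivative_eq_rhs, intro ext)
    fix h
    have "F' t y h = h *\<^sub>R F' t y 1" for y by (simp add: F'_def)
    then show "(\<integral>y. F' t y h \<partial>lborel) = h *\<^sub>R (\<integral>y. F' t y 1 \<partial>lborel)"
      by (simp only: integral_scaleR_right)
  qed
  have T1: "Tk gauss (sqrt \<tau>) f x = (\<integral>y. F \<tau> y \<partial>lborel)" if "0 < \<tau>" for \<tau>
    using Tk_scale(1)[of "sqrt \<tau>" gauss f x] that f(1) by (simp add: Heq F_def continuous_intros)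
  have lc: "continuous_on UNIV (lgauss :: 'a \<Rightarrow> real)" using lgauss_kern[where 'a='a] by (simp add: kern_def)
  have "(1 / t) *\<^sub>R Tk lgauss (sqrt t) f x = (1 / t) *\<^sub>R (\<integral>y. (lgauss (y /\<^sub>R sqrt t) / sqrt t ^ DIM('a)) *\<^sub>R f (x + y) \<partial>lborel)"
    using Tk_scale(1)[of "sqrt t" lgauss f x] t f(1) lc by simp
  also have "\<dots> = (\<integral>y. F' t y 1 \<partial>lborel)"
    unfolding integral_scaleR_right[symmetric] scaleR_scaleR leq[OF t] F'_def by simp
  finally have T2: "(\<integral>y. F' t y 1 \<partial>lborel) = (1 / t) *\<^sub>R Tk lgauss (sqrt t) f x" by simp
  show ?thesis
    unfolding has_vector_derivative_def T2[symmetric]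
    by (rule has_derivative_transform_within_open[OF d, of "{0<..}"]) (use t T1 in auto)
qed

section \<open>Partial derivatives and the Frechet derivative\<close>

lemma partial_eqI: "(f has_derivative f') (at x) \<Longrightarrow> partial j f x = f' (axis j 1)"
  unfolding partial_def by (metis frechet_derivative_at)

lemma has_derivative_partial:
  fixes f :: "real ^ 'n \<Rightarrow> 'b::real_normed_vector"
  assumes "f differentiable (at x)"
  shows "(f has_derivative (\<lambda>h. \<Sum>j\<in>UNIV. h $ j *\<^sub>R partial j f x)) (at x)"
proof -
  from assms obtain f' where f': "(f has_derivative f') (at x)" by (auto simp: differentiable_def)
  then have lin: "linear f'" by (rule has_derivative_linear)
  have "f' h = (\<Sum>j\<in>UNIV. h $ j *\<^sub>R partial j f x)" for h
  proof -
    have "f' h = f' (\<Sum>j\<in>UNIV. h $ j *s axis j 1)" by (simp add: basis_expansion)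
    also have "\<dots> = (\<Sum>j\<in>UNIV. h $ j *\<^sub>R f' (axis j 1))"
      by (simp add: linear_sum[OF lin] linear_cmul[OF lin] scalar_mult_eq_scaleR)
    finally show ?thesis by (simp add: partial_eqI[OF f'])
  qed
  then show ?thesis using f' by (metis (no_types, lifting) ext)
qed

lemma sum_axis_scaleR: "(\<Sum>j\<in>UNIV. (axis l 1 :: real ^ 'n) $ j *\<^sub>R p j) = (p l :: 'b::real_vector)"
proof -
  have "(\<Sum>j\<in>UNIV. (axis l 1 :: real ^ 'n) $ j *\<^sub>R p j) = (\<Sum>j\<in>UNIV. if j = l then p l else 0)"
    by (rule sum.cong) (auto simp: axis_def)
  then show ?thesis by simp
qed

lemma partial_eq_sumI:
  fixes f :: "real ^ 'n \<Rightarrow> 'b::real_normed_vector"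
  assumes "(f has_derivative (\<lambda>h. \<Sum>j\<in>UNIV. h $ j *\<^sub>R p j)) (at x)"
  shows "partial l f x = p l"
  using partial_eqI[OF assms, of l] by (simp add: sum_axis_scaleR)

section \<open>Fields with parabolic derivative bounds\<close>

definition pd :: "'n \<Rightarrow> (real ^ 'n \<Rightarrow> real \<Rightarrow> 'b::real_normed_vector) \<Rightarrow> real ^ 'n \<Rightarrow> real \<Rightarrow> 'b"
  where "pd j u x t = partial j (\<lambda>y. u y t) x"

text \<open>Time zero is left out because derivatives of merely bounded data may blow up there;
  \<open>T\<close> is included because only space derivatives occur.\<close>

definition c1 :: "real \<Rightarrow> (real ^ 'n \<Rightarrow> real \<Rightarrow> 'b::real_normed_vector) \<Rightarrow> bool"
  where "c1 T u \<longleftrightarrow> continuous_on (UNIV \<times> {0<..T}) (\<lambda>(x, t). u x t) \<and>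
    (\<forall>j. continuous_on (UNIV \<times> {0<..T}) (\<lambda>(x, t). pd j u x t)) \<and>
    (\<forall>t\<in>{0<..T}. \<forall>x. (\<lambda>y. u y t) differentiable (at x))"

lemma c1_has_derivative:
  assumes "c1 T u" "0 < t" "t \<le> T"
  shows "((\<lambda>y. u y t) has_derivative (\<lambda>h. \<Sum>j\<in>UNIV. h $ j *\<^sub>R pd j u x t)) (at x)"
  unfolding pd_def by (rule has_derivative_partial) (use assms in \<open>auto simp: c1_def\<close>)

lemma pd_eqI:
  assumes "((\<lambda>y. u y t) has_derivative (\<lambda>h. \<Sum>j\<in>UNIV. h $ j *\<^sub>R p j)) (at x)"
  shows "pd l u x t = p l"
  unfolding pd_def by (rule partial_eq_sumI[OF assms])

lemma c1I:
  assumes "continuous_on (UNIV \<times> {0<..T}) (\<lambda>(x, t). u x t)"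
    and p: "\<And>j. continuous_on (UNIV \<times> {0<..T}) (\<lambda>(x, t). p j x t)"
    and der: "\<And>x t. 0 < t \<Longrightarrow> t \<le> T \<Longrightarrow> ((\<lambda>y. u y t) has_derivative (\<lambda>h. \<Sum>j\<in>UNIV. h $ j *\<^sub>R p j x t)) (at x)"
  shows "c1 T u" and "\<And>j x t. 0 < t \<Longrightarrow> t \<le> T \<Longrightarrow> pd j u x t = p j x t"
proof -
  show eq: "\<And>j x t. 0 < t \<Longrightarrow> t \<le> T \<Longrightarrow> pd j u x t = p j x t" by (rule pd_eqI[OF der])
  have "continuous_on (UNIV \<times> {0<..T}) (\<lambda>(x, t). pd j u x t)" for j
    using p[of j] by (rule continuous_on_eq) (auto simp: eq)
  moreover have "(\<lambda>y. u y t) differentiable (at x)" if "0 < t" "t \<le> T" for x t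
    using der[OF that] by (rule differentiableI)
  ultimately show "c1 T u" using assms(1) by (auto simp: c1_def)
qed

lemma c1_slice: assumes "c1 T u" "0 < t" "t \<le> T" shows "continuous_on UNIV (\<lambda>y. u y t)"
  using has_derivative_continuous[OF c1_has_derivative[OF assms]] by (simp add: continuous_at_imp_continuous_on)

lemma c1_pd_slice: assumes "c1 T u" "0 < t" "t \<le> T" shows "continuous_on UNIV (\<lambda>y. pd j u y t)"
proof -
  have "continuous_on (UNIV \<times> {0<..T}) (\<lambda>(x, t). pd j u x t)" using assms(1) by (simp add: c1_def)
  then have "continuous_on UNIV (\<lambda>y. case (y, t) of (x, t) \<Rightarrow> pd j u x t)"
    by (rule continuous_on_compose2) (use assms in \<open>auto intro!: continuous_intros\<close>)
  then show ?thesis by simp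
qed

lemma c1_sum_op:
  assumes u: "c1 T u" and v: "c1 T v"
  shows "c1 T (\<lambda>x t. u x t + v x t)" "\<And>j x t. 0 < t \<Longrightarrow> t \<le> T \<Longrightarrow> pd j (\<lambda>x t. u x t + v x t) x t = pd j u x t + pd j v x t"
    "c1 T (\<lambda>x t. u x t - v x t)" "\<And>j x t. 0 < t \<Longrightarrow> t \<le> T \<Longrightarrow> pd j (\<lambda>x t. u x t - v x t) x t = pd j u x t - pd j v x t"
proof -
  have cu: "continuous_on (UNIV \<times> {0<..T}) (\<lambda>p. u (fst p) (snd p))" "\<And>j. continuous_on (UNIV \<times> {0<..T}) (\<lambda>p. pd j u (fst p) (snd p))"
    and cv: "continuous_on (UNIV \<times> {0<..T}) (\<lambda>p. v (fst p) (snd p))" "\<And>j. continuous_on (UNIV \<times> {0<..T}) (\<lambda>p. pd j v (fst p) (snd p))"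
    using u v by (auto simp: c1_def case_prod_unfold)
  have 1: "((\<lambda>y. u y t + v y t) has_derivative (\<lambda>h. \<Sum>j\<in>UNIV. h $ j *\<^sub>R (pd j u x t + pd j v x t))) (at x)"
    if "0 < t" "t \<le> T" for x t
    using has_derivative_add[OF c1_has_derivative[OF u that] c1_has_derivative[OF v that]]
    by (simp add: scaleR_right_distrib sum.distrib)
  have 2: "((\<lambda>y. u y t - v y t) has_derivative (\<lambda>h. \<Sum>j\<in>UNIV. h $ j *\<^sub>R (pd j u x t - pd j v x t))) (at x)"
    if "0 < t" "t \<le> T" for x t
    using has_derivative_diff[OF c1_has_derivative[OF u that] c1_has_derivative[OF v that]]
    by (simp add: scaleR_right_diff_distrib sum_subtractf)
  show "c1 T (\<lambda>x t. u x t + v x t)" "\<And>j x t. 0 < t \<Longrightarrow> t \<le> T \<Longrightarrow> pd j (\<lambda>x t. u x t + v x t) x t = pd j u x t + pd j v x t"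
    using c1I[where T=T and u="\<lambda>x t. u x t + v x t" and p="\<lambda>j x t. pd j u x t + pd j v x t", OF _ _ 1]
    by (simp_all add: case_prod_unfold cu cv continuous_on_add)
  show "c1 T (\<lambda>x t. u x t - v x t)" "\<And>j x t. 0 < t \<Longrightarrow> t \<le> T \<Longrightarrow> pd j (\<lambda>x t. u x t - v x t) x t = pd j u x t - pd j v x t"
    using c1I[where T=T and u="\<lambda>x t. u x t - v x t" and p="\<lambda>j x t. pd j u x t - pd j v x t", OF _ _ 2]
    by (simp_all add: case_prod_unfold cu cv continuous_on_diff)
qed

text \<open>Fields are given by formulas that hold only for \<open>0 < t \<le> T\<close>; this
  transfers regularity between fields that agree there.\<close>

lemma c1_cong:
  assumes u: "c1 T u" and eq: "\<And>x t. 0 < t \<Longrightarrow> t \<le> T \<Longrightarrow> u x t = v x t"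
  shows "c1 T v" "\<And>j x t. 0 < t \<Longrightarrow> t \<le> T \<Longrightarrow> pd j v x t = pd j u x t"
proof -
  show e: "\<And>j x t. 0 < t \<Longrightarrow> t \<le> T \<Longrightarrow> pd j v x t = pd j u x t"
    unfolding pd_def using eq by presburger
  have e': "(\<lambda>y. v y t) = (\<lambda>y. u y t)" if "0 < t" "t \<le> T" for t using eq[OF that] by auto
  show "c1 T v"
    unfolding c1_def
  proof (intro conjI allI ballI)
    show "continuous_on (UNIV \<times> {0<..T}) (\<lambda>(x, t). v x t)"
      by (rule continuous_on_eq[of _ "\<lambda>(x, t). u x t"]) (use u eq in \<open>auto simp: c1_def\<close>)
    show "continuous_on (UNIV \<times> {0<..T}) (\<lambda>(x, t). pd j v x t)" for j
      by (rule continuous_on_eq[of _ "\<lambda>(x, t). pd j u x t"]) (use u e in \<open>auto simp: c1_def\<close>)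
    show "(\<lambda>y. v y t) differentiable at x" if "t \<in> {0<..T}" for x t
      using u that e'[of t] by (auto simp: c1_def)
  qed
qed

text \<open>
  The rates of \<open>jet\<close> are those of the heat flow of bounded data; \<open>src\<close> has the rates of a product of such
  a field with its gradient.
\<close>

definition jet :: "real \<Rightarrow> real \<Rightarrow> (real ^ 'n \<Rightarrow> real \<Rightarrow> 'b::real_normed_vector) \<Rightarrow> bool"
  where "jet T A u \<longleftrightarrow> c1 T u \<and> (\<forall>j. c1 T (pd j u)) \<and>
    (\<forall>t\<in>{0<..T}. \<forall>x. norm (u x t) \<le> A \<and> (\<forall>j. norm (pd j u x t) \<le> A / sqrt t) \<and>
      (\<forall>j l. norm (pd l (pd j u) x t) \<le> A / t))"

definition src :: "real \<Rightarrow> real \<Rightarrow> (real ^ 'n \<Rightarrow> real \<Rightarrow> 'b::real_normed_vector) \<Rightarrow> bool"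
  where "src T B f \<longleftrightarrow> c1 T f \<and>
    (\<forall>t\<in>{0<..T}. \<forall>x. norm (f x t) \<le> B / sqrt t \<and> (\<forall>j. norm (pd j f x t) \<le> B / t))"

lemma jet_add:
  assumes u: "jet T A u" and v: "jet T B v"
  shows "jet T (A + B) (\<lambda>x t. u x t + v x t)"
proof -
  have u1: "c1 T u" "\<And>j. c1 T (pd j u)" and v1: "c1 T v" "\<And>j. c1 T (pd j v)" using u v by (auto simp: jet_def)
  note s = c1_sum_op(1,2)[OF u1(1) v1(1)]
  note s2 = c1_sum_op(1,2)[OF u1(2) v1(2)]
  have e: "pd j u x t + pd j v x t = pd j (\<lambda>x t. u x t + v x t) x t" if "0 < t" "t \<le> T" for j x t
    using s(2)[OF that] by simp
  note c = c1_cong[OF s2(1) e]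
  show ?thesis
    unfolding jet_def using u v s c s2(2)
    by (auto simp: jet_def add_divide_distrib intro!: norm_triangle_le add_mono)
qed

lemma jet_mono: assumes "jet T A u" "A \<le> B" shows "jet T B u"
proof -
  have "A / sqrt t \<le> B / sqrt t" "A / t \<le> B / t" if "0 < t" for t using that assms(2) by (auto intro: divide_right_mono)
  then show ?thesis using assms unfolding jet_def by (meson greaterThanAtMost_iff order_trans)
qed

lemma src_add:
  assumes u: "src T A u" and v: "src T B v"
  shows "src T (A + B) (\<lambda>x t. u x t + v x t)"
  unfolding src_def using u v c1_sum_op(1,2)[of T u v]
  by (auto simp: src_def add_divide_distrib intro!: norm_triangle_le add_mono)

lemma src_mono: assumes "src T A u" "A \<le> B" shows "src T B u"
proof -
  have "A / sqrt t \<le> B / sqrt t" "A / t \<le> B / t" if "0 < t" for t using that assms(2) by (auto intro: divide_right_mono)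
  then show ?thesis using assms unfolding src_def by (meson greaterThanAtMost_iff order_trans)
qed

text \<open>A general quadratic first-order term. Convergence of the iteration rests only on
  bilinearity of the \<open>\<beta> j\<close> and the bound \<open>2 |a| |b|\<close>, not on the
  particular equation.\<close>

definition nonlin :: "('n \<Rightarrow> 'b \<Rightarrow> 'b \<Rightarrow> 'b) \<Rightarrow> (real ^ 'n \<Rightarrow> real \<Rightarrow> 'b) \<Rightarrow> (real ^ 'n \<Rightarrow> real \<Rightarrow> 'b) \<Rightarrow> real ^ 'n \<Rightarrow> real \<Rightarrow> 'b::real_normed_vector"
  where "nonlin \<beta> u v x t = (\<Sum>j\<in>UNIV. \<beta> j (u x t) (pd j v x t))"

text \<open>By the product rule the gradient pairs \<open>u\<close> with second derivatives of
  \<open>v\<close>, and first derivatives with first derivatives; both have the rate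
  \<open>1 / t\<close>. The factor \<open>4 n\<close> collects these two terms, the constant
  \<open>2\<close> of each \<open>\<beta> j\<close> and the sum over \<open>j\<close>.\<close>

lemma src_nonlin:
  fixes u v :: "real ^ 'n \<Rightarrow> real \<Rightarrow> 'b::real_normed_vector"
  assumes bl: "\<And>j. bounded_bilinear (\<beta> j)" and nb: "\<And>j a b. norm (\<beta> j a b) \<le> 2 * norm a * norm b"
    and u: "jet T A u" and v: "jet T B v" and AB: "0 \<le> A" "0 \<le> B"
  shows "src T (4 * real CARD('n) * A * B) (nonlin \<beta> u v)"
proof -
  let ?n = "real CARD('n)"
  have u1: "c1 T u" "\<And>j. c1 T (pd j u)" and v1: "c1 T v" "\<And>j. c1 T (pd j v)" using u v by (auto simp: jet_def)
  define p where "p l x t = (\<Sum>j\<in>UNIV. \<beta> j (u x t) (pd l (pd j v) x t) + \<beta> j (pd l u x t) (pd j v x t))" for l x t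
  have c: "continuous_on (UNIV \<times> {0<..T}) (\<lambda>p. u (fst p) (snd p))" "\<And>j. continuous_on (UNIV \<times> {0<..T}) (\<lambda>p. pd j u (fst p) (snd p))"
    "\<And>j. continuous_on (UNIV \<times> {0<..T}) (\<lambda>p. pd j v (fst p) (snd p))" "\<And>j l. continuous_on (UNIV \<times> {0<..T}) (\<lambda>p. pd l (pd j v) (fst p) (snd p))"
    using u1 v1 by (auto simp: c1_def case_prod_unfold)
  have der: "((\<lambda>y. nonlin \<beta> u v y t) has_derivative (\<lambda>h. \<Sum>l\<in>UNIV. h $ l *\<^sub>R p l x t)) (at x)" if t: "0 < t" "t \<le> T" for x t
  proof -
    have "((\<lambda>y. \<Sum>j\<in>UNIV. \<beta> j (u y t) (pd j v y t)) has_derivative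
        (\<lambda>h. \<Sum>j\<in>UNIV. \<beta> j (u x t) (\<Sum>l\<in>UNIV. h $ l *\<^sub>R pd l (pd j v) x t) + \<beta> j (\<Sum>l\<in>UNIV. h $ l *\<^sub>R pd l u x t) (pd j v x t))) (at x)"
      by (intro has_derivative_sum bounded_bilinear.FDERIV[OF bl] c1_has_derivative[OF u1(1) t] c1_has_derivative[OF v1(2) t])
    moreover have "(\<Sum>j\<in>UNIV. \<beta> j (u x t) (\<Sum>l\<in>UNIV. h $ l *\<^sub>R pd l (pd j v) x t) + \<beta> j (\<Sum>l\<in>UNIV. h $ l *\<^sub>R pd l u x t) (pd j v x t))
        = (\<Sum>l\<in>UNIV. h $ l *\<^sub>R p l x t)" for h
    proof -
      have "(\<Sum>j\<in>UNIV. \<beta> j (u x t) (\<Sum>l\<in>UNIV. h $ l *\<^sub>R pd l (pd j v) x t) + \<beta> j (\<Sum>l\<in>UNIV. h $ l *\<^sub>R pd l u x t) (pd j v x t))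
        = (\<Sum>j\<in>UNIV. \<Sum>l\<in>UNIV. h $ l *\<^sub>R (\<beta> j (u x t) (pd l (pd j v) x t) + \<beta> j (pd l u x t) (pd j v x t)))"
        by (simp add: bounded_bilinear.sum_left[OF bl] bounded_bilinear.sum_right[OF bl]
          bounded_bilinear.scaleR_left[OF bl] bounded_bilinear.scaleR_right[OF bl] scaleR_right_distrib sum.distrib)
      also have "\<dots> = (\<Sum>l\<in>UNIV. h $ l *\<^sub>R p l x t)"
        unfolding p_def scaleR_sum_right by (rule sum.swap)
      finally show ?thesis .
    qed
    ultimately show ?thesis unfolding nonlin_def by simp
  qed
  have c': "continuous_on (UNIV \<times> {0<..T}) (\<lambda>q. \<beta> j (f q) (g q))"
    if "continuous_on (UNIV \<times> {0<..T}) f" "continuous_on (UNIV \<times> {0<..T}) g" for j and f g :: "(real^'n) \<times> real \<Rightarrow> 'b"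
    using bounded_bilinear.continuous_on[OF bl that] .
  have cn: "continuous_on (UNIV \<times> {0<..T}) (\<lambda>(x, t). nonlin \<beta> u v x t)" "continuous_on (UNIV \<times> {0<..T}) (\<lambda>(x, t). p j x t)" for j
    unfolding case_prod_unfold nonlin_def p_def by (intro continuous_on_sum continuous_on_add c' c)+
  have C1: "c1 T (nonlin \<beta> u v)" and P: "\<And>j x t. 0 < t \<Longrightarrow> t \<le> T \<Longrightarrow> pd j (nonlin \<beta> u v) x t = p j x t"
    using c1I[where T=T and u="nonlin \<beta> u v" and p=p, OF _ _ der] cn by simp_all
  have b: "norm (u x t) \<le> A" "norm (pd j u x t) \<le> A / sqrt t" "norm (pd j v x t) \<le> B / sqrt t" "norm (pd l (pd j v) x t) \<le> B / t"
    if "0 < t" "t \<le> T" for x t j l using u v that by (auto simp: jet_def)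
  have "norm (nonlin \<beta> u v x t) \<le> 4 * ?n * A * B / sqrt t" if t: "0 < t" "t \<le> T" for x t
  proof -
    have "norm (nonlin \<beta> u v x t) \<le> (\<Sum>j\<in>(UNIV::'n set). 2 * A * (B / sqrt t))"
      unfolding nonlin_def
      by (rule sum_norm_le) (rule order_trans[OF nb], intro mult_mono mult_left_mono b t, use AB in auto)
    also have "\<dots> = 2 * ?n * A * B / sqrt t" by simp
    also have "\<dots> \<le> 4 * ?n * A * B / sqrt t" using AB t by (intro divide_right_mono mult_right_mono) auto
    finally show ?thesis .
  qed
  moreover have "norm (p l x t) \<le> 4 * ?n * A * B / t" if t: "0 < t" "t \<le> T" for l x t
  proof -
    have "norm (p l x t) \<le> (\<Sum>j\<in>(UNIV::'n set). 2 * A * (B / t) + 2 * (A / sqrt t) * (B / sqrt t))"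
      unfolding p_def
      by (rule sum_norm_le) (rule norm_triangle_le, intro add_mono; rule order_trans[OF nb], intro mult_mono mult_left_mono b t, use AB t in auto)
    also have "\<dots> = 4 * ?n * A * B / t" using t by (simp add: field_simps)
    finally show ?thesis .
  qed
  ultimately show ?thesis using C1 P by (auto simp: src_def)
qed

lemma nonlin_diff:
  assumes bl: "\<And>j. bounded_bilinear (\<beta> j)"
    and u: "c1 T u" and v: "c1 T v" and t: "0 < t" "t \<le> T"
  shows "nonlin \<beta> u u x t - nonlin \<beta> v v x t =
    nonlin \<beta> (\<lambda>x t. u x t - v x t) u x t + nonlin \<beta> v (\<lambda>x t. u x t - v x t) x t"
  unfolding nonlin_def c1_sum_op(4)[OF u v t] sum_subtractf[symmetric] sum.distrib[symmetric]
  by (rule sum.cong) (simp_all add: bounded_bilinear.diff_left[OF bl] bounded_bilinear.diff_right[OF bl])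

text \<open>Bounds such as \<open>B / sqrt t\<close> are uniform only away from time zero.
  Continuity is local, and a point with \<open>s < \<tau> p\<close> has a neighbourhood on which
  \<open>s < \<tau>\<close>, so it suffices to treat each set
  \<open>s \<le> \<tau> p\<close>.\<close>

lemma continuous_on_positive_time:
  fixes \<tau> :: "'p::metric_space \<Rightarrow> real"
  assumes \<tau>: "continuous_on UNIV \<tau>"
    and F: "\<And>s. 0 < s \<Longrightarrow> continuous_on {p \<in> P. s \<le> \<tau> p} F"
  shows "continuous_on {p \<in> P. 0 < \<tau> p} F"
  unfolding continuous_on_eq_continuous_within
proof
  fix p assume p: "p \<in> {p \<in> P. 0 < \<tau> p}"
  define s where "s = \<tau> p / 2"
  have s: "0 < s" "s < \<tau> p" using p by (auto simp: s_def)
  have "continuous (at p within {p \<in> P. s \<le> \<tau> p}) F"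
    using F[OF s(1)] p s by (auto simp: continuous_on_eq_continuous_within)
  moreover have "at p within {p \<in> P. s \<le> \<tau> p} = at p within {p \<in> P. 0 < \<tau> p}"
  proof (rule at_within_nhd[of p "{q. s < \<tau> q}"])
    show "open {q. s < \<tau> q}" by (rule open_Collect_less[OF continuous_on_const \<tau>])
  qed (use s p in auto)
  ultimately show "continuous (at p within {p \<in> P. 0 < \<tau> p}) F" by simp
qed

section \<open>The Duhamel integral\<close>

text \<open>
  Time integrals over \<open>{0<..<t}\<close> are rescaled to the fixed interval \<open>{0<..<1}\<close> by \<open>s = t * \<theta>\<close>. The weight
  \<open>wt\<close> dominates all integrands that occur.
\<close>

definition I01 :: "real measure" where "I01 = restrict_space lborel {0<..<1}"

definition wt :: "real \<Rightarrow> real" where "wt \<theta> = (\<theta> * (1 - \<theta>)) powr (-3/4)"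

lemma space_I01 [simp]: "space I01 = {0<..<1}" by (simp add: I01_def)

lemma I01_measurable: "continuous_on {0<..<1} g \<Longrightarrow> (g :: real \<Rightarrow> 'b::topological_space) \<in> borel_measurable I01"
  unfolding I01_def
  by (subst measurable_cong_sets[of _ "restrict_space borel {0<..<1}" _ borel])
     (auto intro!: borel_measurable_continuous_on_restrict sets_restrict_space_cong)

lemma integrable_wt: "integrable I01 wt"
proof -
  have "set_integrable lborel {0..1::real} (\<lambda>t. t powr (1/4 - 1) * (1 - t) powr (1/4 - 1))"
    by (rule integrable_Beta) auto
  then have "set_integrable lborel {0<..<1::real} (\<lambda>t. t powr (1/4 - 1) * (1 - t) powr (1/4 - 1))"
    by (rule set_integrable_subset) auto
  then have "set_integrable lborel {0<..<1::real} wt"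
    by (rule iffD1[OF set_integrable_cong, rotated -1]) (auto simp: wt_def powr_mult)
  then show ?thesis
    unfolding I01_def set_integrable_def by (subst integrable_restrict_space) auto
qed

lemma wt_nonneg: "0 \<le> wt \<theta>" by (simp add: wt_def)

text \<open>The value of the Beta function at \<open>(1/4, 1/4)\<close>.\<close>

definition Wc :: real where "Wc = (\<integral>\<theta>. wt \<theta> \<partial>I01)"

lemma Wc_nonneg: "0 \<le> Wc" unfolding Wc_def by (rule Bochner_Integration.integral_nonneg) (simp add: wt_nonneg)

definition tint :: "(real ^ 'n \<Rightarrow> real \<Rightarrow> real \<Rightarrow> 'b::euclidean_space) \<Rightarrow> real ^ 'n \<Rightarrow> real \<Rightarrow> 'b"
  where "tint \<Phi> x t = t *\<^sub>R (\<integral>\<theta>. \<Phi> x t \<theta> \<partial>I01)"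

lemma tint_norm:
  assumes m: "continuous_on {0<..<1} (\<Phi> x t)" and b: "\<And>\<theta>. 0 < \<theta> \<Longrightarrow> \<theta> < 1 \<Longrightarrow> norm (\<Phi> x t \<theta>) \<le> c * wt \<theta>" and t: "0 \<le> t"
  shows "integrable I01 (\<Phi> x t)" "norm (tint \<Phi> x t) \<le> t * (c * Wc)"
proof -
  have i: "integrable I01 (\<lambda>\<theta>. c * wt \<theta>)" using integrable_wt by simp
  show int: "integrable I01 (\<Phi> x t)"
    by (rule Bochner_Integration.integrable_bound[OF i I01_measurable[OF m]])
       (use b in \<open>auto intro!: AE_I2 order_trans[OF _ abs_ge_self]\<close>)
  have "norm (\<integral>\<theta>. \<Phi> x t \<theta> \<partial>I01) \<le> (\<integral>\<theta>. c * wt \<theta> \<partial>I01)"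
    by (rule norm_integral_le_bound[OF int i]) (use b in auto)
  then show "norm (tint \<Phi> x t) \<le> t * (c * Wc)"
    unfolding tint_def Wc_def using t by (simp add: mult_left_mono)
qed

lemma triple_cont:
  assumes "continuous_on (UNIV \<times> {0<..T} \<times> {0<..<1}) (\<lambda>(x, t, \<theta>). \<Phi> x t \<theta>)"
  shows "0 < t \<Longrightarrow> t \<le> T \<Longrightarrow> continuous_on {0<..<1} (\<Phi> x t)"
    "0 < \<theta> \<Longrightarrow> \<theta> < 1 \<Longrightarrow> continuous_on (UNIV \<times> {0<..T}) (\<lambda>(x, t). \<Phi> x t \<theta>)"
proof -
  assume "0 < t" "t \<le> T"
  then have "continuous_on {0<..<1} (\<lambda>\<theta>. case (x, t, \<theta>) of (x, t, \<theta>) \<Rightarrow> \<Phi> x t \<theta>)"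
    by (intro continuous_on_compose2[OF assms] continuous_intros) auto
  then show "continuous_on {0<..<1} (\<Phi> x t)" by simp
next
  assume "0 < \<theta>" "\<theta> < 1"
  then have "continuous_on (UNIV \<times> {0<..T}) (\<lambda>p. case (fst p, snd p, \<theta>) of (x, t, \<theta>) \<Rightarrow> \<Phi> x t \<theta>)"
    by (intro continuous_on_compose2[OF assms] continuous_intros) auto
  then show "continuous_on (UNIV \<times> {0<..T}) (\<lambda>(x, t). \<Phi> x t \<theta>)" by (simp add: case_prod_unfold)
qed

lemma tint_cont:
  fixes \<Phi> :: "real ^ 'n \<Rightarrow> real \<Rightarrow> real \<Rightarrow> 'b::euclidean_space"
  assumes c: "continuous_on (UNIV \<times> {0<..T} \<times> {0<..<1}) (\<lambda>(x, t, \<theta>). \<Phi> x t \<theta>)"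
    and b: "\<And>x t \<theta>. 0 < t \<Longrightarrow> t \<le> T \<Longrightarrow> 0 < \<theta> \<Longrightarrow> \<theta> < 1 \<Longrightarrow> norm (\<Phi> x t \<theta>) \<le> K * t powr (- a) * wt \<theta>"
    and a: "0 \<le> a" and K: "0 \<le> K"
  shows "continuous_on (UNIV \<times> {0<..T}) (\<lambda>(x, t). tint \<Phi> x t)"
proof -
  have "continuous_on {p \<in> UNIV \<times> {..T}. 0 < snd p} (\<lambda>p. \<integral>\<theta>. \<Phi> (fst p) (snd p) \<theta> \<partial>I01)"
  proof (rule continuous_on_positive_time)
    show "continuous_on UNIV (snd :: (real^'n) \<times> real \<Rightarrow> real)" by (intro continuous_intros)
    fix s :: real assume s: "0 < s"
    show "continuous_on {p \<in> UNIV \<times> {..T}. s \<le> snd p} (\<lambda>p. \<integral>\<theta>. \<Phi> (fst p) (snd p) \<theta> \<partial>I01)"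
    proof (rule continuous_on_lebesgue_integral[where w="\<lambda>\<theta>. (K * s powr (- a)) * wt \<theta>"])
      show "integrable I01 (\<lambda>\<theta>. (K * s powr (- a)) * wt \<theta>)" using integrable_wt by simp
      fix p :: "(real^'n) \<times> real" assume p: "p \<in> {p \<in> UNIV \<times> {..T}. s \<le> snd p}"
      then show "\<Phi> (fst p) (snd p) \<in> borel_measurable I01"
        using s by (intro I01_measurable triple_cont(1)[OF c]) auto
      fix \<theta> :: real assume t: "\<theta> \<in> space I01"
      have "norm (\<Phi> (fst p) (snd p) \<theta>) \<le> K * snd p powr (- a) * wt \<theta>" using b[of "snd p" \<theta> "fst p"] p t s by auto
      also have "\<dots> \<le> K * s powr (- a) * wt \<theta>"
        using p s a by (intro mult_right_mono mult_left_mono powr_mono2' wt_nonneg K) auto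
      finally show "norm (\<Phi> (fst p) (snd p) \<theta>) \<le> (K * s powr (- a)) * wt \<theta>" .
    next
      fix \<theta> :: real assume "\<theta> \<in> space I01"
      then have "continuous_on (UNIV \<times> {0<..T}) (\<lambda>(x, t). \<Phi> x t \<theta>)" by (intro triple_cont(2)[OF c]) auto
      then show "continuous_on {p \<in> UNIV \<times> {..T}. s \<le> snd p} (\<lambda>p. \<Phi> (fst p) (snd p) \<theta>)"
        using s by (auto simp: case_prod_unfold elim!: continuous_on_subset)
    qed
  qed
  moreover have "{p \<in> UNIV \<times> {..T}. 0 < snd p} = (UNIV :: (real^'n) set) \<times> {0<..T}" by auto
  ultimately show ?thesis
    unfolding tint_def case_prod_unfold by (intro continuous_intros) auto
qed

lemma tint_c1:
  fixes \<Phi> :: "real ^ 'n \<Rightarrow> real \<Rightarrow> real \<Rightarrow> 'b::euclidean_space"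
  assumes c: "continuous_on (UNIV \<times> {0<..T} \<times> {0<..<1}) (\<lambda>(x, t, \<theta>). \<Phi> x t \<theta>)"
    and b: "\<And>x t \<theta>. 0 < t \<Longrightarrow> t \<le> T \<Longrightarrow> 0 < \<theta> \<Longrightarrow> \<theta> < 1 \<Longrightarrow> norm (\<Phi> x t \<theta>) \<le> K * t powr (- a) * wt \<theta>"
    and c': "\<And>j. continuous_on (UNIV \<times> {0<..T} \<times> {0<..<1}) (\<lambda>(x, t, \<theta>). \<Phi>' j x t \<theta>)"
    and b': "\<And>j x t \<theta>. 0 < t \<Longrightarrow> t \<le> T \<Longrightarrow> 0 < \<theta> \<Longrightarrow> \<theta> < 1 \<Longrightarrow> norm (\<Phi>' j x t \<theta>) \<le> K * t powr (- a') * wt \<theta>"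
    and a: "0 \<le> a" "0 \<le> a'" and K: "0 \<le> K"
    and der: "\<And>x t \<theta>. 0 < t \<Longrightarrow> t \<le> T \<Longrightarrow> 0 < \<theta> \<Longrightarrow> \<theta> < 1 \<Longrightarrow>
      ((\<lambda>x. \<Phi> x t \<theta>) has_derivative (\<lambda>h. \<Sum>j\<in>UNIV. h $ j *\<^sub>R \<Phi>' j x t \<theta>)) (at x)"
  shows "c1 T (tint \<Phi>)" "\<And>j x t. 0 < t \<Longrightarrow> t \<le> T \<Longrightarrow> pd j (tint \<Phi>) x t = tint (\<Phi>' j) x t"
proof -
  note cc = tint_cont[OF c b a(1) K] tint_cont[OF c' b' a(2) K]
  have d: "((\<lambda>y. tint \<Phi> y t) has_derivative (\<lambda>h. \<Sum>j\<in>UNIV. h $ j *\<^sub>R tint (\<Phi>' j) x t)) (at x)"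
    if t: "0 < t" "t \<le> T" for x t
  proof -
    define k where "k = K * t powr (- a')"
    have i: "integrable I01 (\<Phi> x t)" for x
      by (rule tint_norm(1)[where \<Phi>=\<Phi> and c="K * t powr (- a)", OF triple_cont(1)[OF c t] b[OF t]]) (use t in auto)
    have i': "integrable I01 (\<Phi>' j x t)" for x j
      by (rule tint_norm(1)[where \<Phi>="\<Phi>' j" and c="K * t powr (- a')", OF triple_cont(1)[OF c' t] b'[OF t]]) (use t in auto)
    have "((\<lambda>y. \<integral>\<theta>. \<Phi> y t \<theta> \<partial>I01) has_derivative (\<lambda>h. \<integral>\<theta>. (\<Sum>j\<in>UNIV. h $ j *\<^sub>R \<Phi>' j x t \<theta>) \<partial>I01)) (at x)"
    proof (rule has_derivative_lebesgue_integral[where e=1 and g="\<lambda>\<theta>. (real CARD('n) * k) * wt \<theta>" and F'="\<lambda>x \<theta> h. \<Sum>j\<in>UNIV. h $ j *\<^sub>R \<Phi>' j x t \<theta>"])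
      show "integrable I01 (\<lambda>\<theta>. (real CARD('n) * k) * wt \<theta>)" using integrable_wt by simp
      show "(\<lambda>\<theta>. \<Sum>j\<in>UNIV. h $ j *\<^sub>R \<Phi>' j x t \<theta>) \<in> borel_measurable I01" for h
        by (intro I01_measurable continuous_intros triple_cont(1)[OF c' t])
      fix y :: "real^'n" and \<theta> :: real assume th: "\<theta> \<in> space I01"
      then show "((\<lambda>y. \<Phi> y t \<theta>) has_derivative (\<lambda>h. \<Sum>j\<in>UNIV. h $ j *\<^sub>R \<Phi>' j y t \<theta>)) (at y)"
        using der[OF t] by auto
      fix h :: "real^'n"
      have "norm (\<Sum>j\<in>UNIV. h $ j *\<^sub>R \<Phi>' j y t \<theta>) \<le> (\<Sum>j\<in>(UNIV::'n set). norm h * (k * wt \<theta>))"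
        using th b'[OF t, of \<theta> _ y] unfolding k_def
        by (intro sum_norm_le) (auto intro!: mult_mono component_le_norm_cart)
      then show "norm (\<Sum>j\<in>UNIV. h $ j *\<^sub>R \<Phi>' j y t \<theta>) \<le> (real CARD('n) * k) * wt \<theta> * norm h"
        by (simp add: mult_ac)
    qed (auto simp: i)
    then have "((\<lambda>y. t *\<^sub>R (\<integral>\<theta>. \<Phi> y t \<theta> \<partial>I01)) has_derivative (\<lambda>h. t *\<^sub>R (\<integral>\<theta>. (\<Sum>j\<in>UNIV. h $ j *\<^sub>R \<Phi>' j x t \<theta>) \<partial>I01))) (at x)"
      by (rule has_derivative_scaleR_right)
    moreover have "t *\<^sub>R (\<integral>\<theta>. (\<Sum>j\<in>UNIV. h $ j *\<^sub>R \<Phi>' j x t \<theta>) \<partial>I01) = (\<Sum>j\<in>UNIV. h $ j *\<^sub>R tint (\<Phi>' j) x t)" for h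
      using i' by (simp add: tint_def scaleR_sum_right mult.commute)
    ultimately show ?thesis unfolding tint_def by simp
  qed
  show "c1 T (tint \<Phi>)" "\<And>j x t. 0 < t \<Longrightarrow> t \<le> T \<Longrightarrow> pd j (tint \<Phi>) x t = tint (\<Phi>' j) x t"
    using c1I[where T=T and u="tint \<Phi>" and p="\<lambda>j. tint (\<Phi>' j)", OF cc(1) cc(2) d] by auto
qed

section \<open>The Duhamel integrand and its space derivatives\<close>

definition heatint :: "(real ^ 'n \<Rightarrow> real) \<Rightarrow> (real ^ 'n \<Rightarrow> real \<Rightarrow> 'b::euclidean_space) \<Rightarrow> real ^ 'n \<Rightarrow> real \<Rightarrow> real \<Rightarrow> 'b"
  where "heatint k f x t \<theta> = Tk k (sqrt (t * (1 - \<theta>))) (\<lambda>y. f y (t * \<theta>)) x"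

lemma heatint_cont:
  fixes f :: "real ^ 'n \<Rightarrow> real \<Rightarrow> 'b::euclidean_space"
  assumes k: "kern k" and f: "continuous_on (UNIV \<times> {0<..T}) (\<lambda>(y, s). f y s)"
    and b: "\<And>s0. 0 < s0 \<Longrightarrow> \<exists>B. \<forall>s y. s0 \<le> s \<longrightarrow> s \<le> T \<longrightarrow> norm (f y s) \<le> B"
  shows "continuous_on (UNIV \<times> {0<..T} \<times> {0<..<1}) (\<lambda>(x, t, \<theta>). heatint k f x t \<theta>)"
proof -
  let ?P = "(UNIV :: (real^'n) set) \<times> {0<..T} \<times> {0<..<1::real}"
  let ?\<tau> = "\<lambda>p::(real^'n) \<times> real \<times> real. fst (snd p) * snd (snd p)"
  have "continuous_on {p \<in> ?P. 0 < ?\<tau> p} (\<lambda>p. heatint k f (fst p) (fst (snd p)) (snd (snd p)))"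
  proof (rule continuous_on_positive_time)
    show "continuous_on UNIV ?\<tau>" by (intro continuous_intros)
    fix s0 :: real assume s0: "0 < s0"
    obtain B where B: "\<And>s y. s \<in> {s0..T} \<Longrightarrow> norm (f y s) \<le> B" using b[OF s0] by auto
    have fs: "continuous_on (UNIV \<times> {s0..T}) (\<lambda>(y, s). f y s)"
      by (rule continuous_on_subset[OF f]) (use s0 in auto)
    have "continuous_on {p \<in> ?P. s0 \<le> ?\<tau> p}
      (\<lambda>p. case (fst p, sqrt (fst (snd p) * (1 - snd (snd p))), ?\<tau> p) of (x, \<sigma>, s) \<Rightarrow> Tk k \<sigma> (\<lambda>y. f y s) x)"
    proof (rule continuous_on_compose2[OF Tk_continuous[OF k fs B]])
      have "t * \<theta> \<le> T" if "0 < t" "t \<le> T" "0 < \<theta>" "\<theta> < 1" for t \<theta> :: real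
        using mult_mono[of t T \<theta> 1] that by simp
      then show "(\<lambda>p. (fst p, sqrt (fst (snd p) * (1 - snd (snd p))), ?\<tau> p)) ` {p \<in> ?P. s0 \<le> ?\<tau> p} \<subseteq> UNIV \<times> UNIV \<times> {s0..T}"
        by auto
    qed (auto intro!: continuous_intros)
    then show "continuous_on {p \<in> ?P. s0 \<le> ?\<tau> p} (\<lambda>p. heatint k f (fst p) (fst (snd p)) (snd (snd p)))"
      by (simp add: heatint_def)
  qed
  moreover have "{p \<in> ?P. 0 < ?\<tau> p} = ?P" by auto
  ultimately show ?thesis by (simp add: case_prod_unfold)
qed

text \<open>
  Moving both derivatives onto the heat kernel gives the bound \<open>(t - s)\<^sup>-\<^sup>1 s\<^sup>-\<^sup>1\<^sup>/\<^sup>2\<close>, which is not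
  integrable at \<open>s = t\<close>; leaving one on the source gives \<open>(t - s)\<^sup>-\<^sup>1\<^sup>/\<^sup>2 s\<^sup>-\<^sup>1\<close>, which is not integrable at
  \<open>s = 0\<close>. Their geometric mean is integrable.
\<close>

lemma powr_min_bound:
  fixes r K p q :: real
  assumes "0 < p" "0 < q" "0 \<le> K" "0 \<le> r" "r \<le> K * (1 / sqrt p * (1 / q))" "r \<le> K * (1 / p * (1 / sqrt q))"
  shows "r \<le> K * (p * q) powr (-3/4)"
proof -
  have e: "1 / sqrt p = p powr (-1/2)" "1 / sqrt q = q powr (-1/2)" "1 / p = p powr (-1)" "1 / q = q powr (-1)"
    using assms by (auto simp: powr_minus_divide powr_half_sqrt)
  have "r * r \<le> (K * (1 / sqrt p * (1 / q))) * (K * (1 / p * (1 / sqrt q)))"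
    using assms by (intro mult_mono) auto
  also have "\<dots> = K\<^sup>2 * ((p powr (-1/2) * p powr (-1)) * (q powr (-1) * q powr (-1/2)))"
    unfolding e by (simp only: power2_eq_square mult_ac)
  also have "p powr (-1/2) * p powr (-1) = p powr (-3/2)" unfolding powr_add[symmetric] by simp
  also have "q powr (-1) * q powr (-1/2) = q powr (-3/2)" unfolding powr_add[symmetric] by simp
  also have "K\<^sup>2 * (p powr (-3/2) * q powr (-3/2)) = (K * (p * q) powr (-3/4))\<^sup>2"
  proof -
    have "((p * q) powr (-3/4))\<^sup>2 = (p * q) powr (-3/2)"
      unfolding power2_eq_square powr_add[symmetric] by simp
    then show ?thesis using assms by (simp only: power_mult_distrib powr_mult)
  qed
  finally have "r\<^sup>2 \<le> (K * (p * q) powr (-3/4))\<^sup>2" by (simp add: power2_eq_square)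
  then show ?thesis by (rule power2_le_imp_le) (use assms in auto)
qed

text \<open>The powers of \<open>t\<close> are those of parabolic scaling. Multiplied by the length
  \<open>t\<close> of the time interval they become \<open>sqrt t\<close>, \<open>1\<close> and
  \<open>1 / sqrt t\<close>, for the Duhamel integral and its derivatives of first and second
  order.\<close>

lemma wt_bounds:
  assumes t: "0 < t" and th: "0 < \<theta>" "\<theta> < 1"
  shows "1 / sqrt (t * \<theta>) \<le> t powr (-1/2) * wt \<theta>"
    "1 / sqrt (t * (1 - \<theta>)) * (1 / sqrt (t * \<theta>)) \<le> t powr (-1) * wt \<theta>"
    "((t * (1 - \<theta>)) * (t * \<theta>)) powr (-3/4) = t powr (-3/2) * wt \<theta>"
proof -
  have m: "0 < \<theta> * (1 - \<theta>)" "\<theta> * (1 - \<theta>) \<le> 1" "\<theta> * (1 - \<theta>) \<le> \<theta>"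
    using th mult_mono[of \<theta> 1 "1 - \<theta>" 1] by auto
  have w: "(\<theta> * (1 - \<theta>)) powr (-1/2) \<le> wt \<theta>"
    unfolding wt_def using m by (intro powr_mono') auto
  have "\<theta> powr (-1/2) \<le> (\<theta> * (1 - \<theta>)) powr (-1/2)" using m by (intro powr_mono2') auto
  then have "t powr (-1/2) * \<theta> powr (-1/2) \<le> t powr (-1/2) * wt \<theta>"
    using w by (intro mult_left_mono) auto
  moreover have "1 / sqrt (t * \<theta>) = t powr (-1/2) * \<theta> powr (-1/2)"
    using t th by (simp add: powr_minus_divide powr_half_sqrt real_sqrt_mult)
  ultimately show "1 / sqrt (t * \<theta>) \<le> t powr (-1/2) * wt \<theta>" by simp
  have e2: "1 / sqrt (t * (1 - \<theta>)) * (1 / sqrt (t * \<theta>)) = t powr (-1) * (\<theta> * (1 - \<theta>)) powr (-1/2)"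
    using t th by (simp add: powr_minus_divide powr_half_sqrt real_sqrt_mult)
  show "1 / sqrt (t * (1 - \<theta>)) * (1 / sqrt (t * \<theta>)) \<le> t powr (-1) * wt \<theta>"
    unfolding e2 by (intro mult_left_mono w) auto
  have "(t * (1 - \<theta>)) * (t * \<theta>) = (t * t) * (\<theta> * (1 - \<theta>))" by simp
  then show "((t * (1 - \<theta>)) * (t * \<theta>)) powr (-3/4) = t powr (-3/2) * wt \<theta>"
    using t m by (simp add: wt_def powr_mult powr_add[symmetric])
qed

lemma kernel_constant:
  "\<exists>C\<ge>1. \<forall>j l :: 'n::finite. knorm (\<lambda>z. dgauss z \<bullet> (axis j 1 :: real ^ 'n)) \<le> C \<and>
    knorm (\<lambda>z. ddgauss (axis j 1 :: real ^ 'n) z \<bullet> axis l 1) \<le> C"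
proof -
  let ?a = "\<lambda>j::'n. knorm (\<lambda>z. dgauss z \<bullet> (axis j 1 :: real ^ 'n))"
  let ?b = "\<lambda>(j::'n) l. knorm (\<lambda>z. ddgauss (axis j 1 :: real ^ 'n) z \<bullet> axis l 1)"
  let ?C = "1 + (\<Sum>j\<in>UNIV. ?a j) + (\<Sum>j\<in>UNIV. \<Sum>l\<in>UNIV. ?b j l)"
  have s0: "0 \<le> (\<Sum>j\<in>UNIV. ?a j)" "0 \<le> (\<Sum>j\<in>UNIV. \<Sum>l\<in>UNIV. ?b j l)"
    by (intro sum_nonneg knorm_nonneg)+
  have a: "?a j \<le> (\<Sum>j\<in>UNIV. ?a j)" for j
    by (rule member_le_sum) (auto simp: knorm_nonneg)
  have b: "?b j l \<le> (\<Sum>j\<in>UNIV. \<Sum>l\<in>UNIV. ?b j l)" for j l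
  proof -
    have "?b j l \<le> (\<Sum>l\<in>UNIV. ?b j l)" by (rule member_le_sum) (auto simp: knorm_nonneg)
    also have "\<dots> \<le> (\<Sum>j\<in>UNIV. \<Sum>l\<in>UNIV. ?b j l)"
      by (rule member_le_sum[where f="\<lambda>j. \<Sum>l\<in>UNIV. ?b j l"]) (auto intro!: sum_nonneg knorm_nonneg)
    finally show ?thesis .
  qed
  have "1 \<le> ?C" using s0 by linarith
  moreover have "?a j \<le> ?C \<and> ?b j l \<le> ?C" for j l
    using a[of j] b[of j l] s0 by linarith
  ultimately show ?thesis by blast
qed

text \<open>Bounds the \<open>L^1\<close> norms of all first and second derivatives of the heat
  kernel at time one. Being at least \<open>1\<close>, the same constant also covers the kernel
  itself, whose mass is one.\<close>

definition heat_const :: "'n::finite itself \<Rightarrow> real"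
  where "heat_const _ = (SOME C. C \<ge> 1 \<and> (\<forall>j l :: 'n. knorm (\<lambda>z. dgauss z \<bullet> (axis j 1 :: real ^ 'n)) \<le> C \<and>
    knorm (\<lambda>z. ddgauss (axis j 1 :: real ^ 'n) z \<bullet> axis l 1) \<le> C))"

lemma heat_const: "1 \<le> heat_const TYPE('n::finite)" "knorm (\<lambda>z. dgauss z \<bullet> (axis j 1 :: real ^ 'n)) \<le> heat_const TYPE('n)"
    "knorm (\<lambda>z. ddgauss (axis j 1 :: real ^ 'n) z \<bullet> axis l 1) \<le> heat_const TYPE('n)"
  using someI_ex[OF kernel_constant[where 'n='n]] unfolding heat_const_def by auto

definition duhamel :: "(real ^ 'n \<Rightarrow> real \<Rightarrow> 'b::euclidean_space) \<Rightarrow> real ^ 'n \<Rightarrow> real \<Rightarrow> 'b"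
  where "duhamel f = tint (heatint gauss f)"

context
  fixes T B :: real and f :: "real ^ 'n \<Rightarrow> real \<Rightarrow> 'b::euclidean_space"
  assumes src: "src T B f" and B0: "0 \<le> B"
begin

lemma src_facts:
  assumes "0 < s" "s \<le> T"
  shows "continuous_on UNIV (\<lambda>y. f y s)" "\<And>y. norm (f y s) \<le> B / sqrt s"
    "continuous_on UNIV (\<lambda>y. pd j f y s)" "\<And>y. norm (pd j f y s) \<le> B / s"
    "((\<lambda>y. f y s) has_derivative (\<lambda>h. \<Sum>j\<in>UNIV. h $ j *\<^sub>R pd j f y s)) (at y)"
  using src assms c1_slice[of T f s] c1_pd_slice[of T f s] c1_has_derivative[of T f s] by (auto simp: src_def)

lemma src_local_bounds:
  assumes "0 < s0"
  shows "\<exists>C. \<forall>s y. s0 \<le> s \<longrightarrow> s \<le> T \<longrightarrow> norm (f y s) \<le> C" "\<exists>C. \<forall>s y. s0 \<le> s \<longrightarrow> s \<le> T \<longrightarrow> norm (pd j f y s) \<le> C"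
proof -
  have "norm (f y s) \<le> B / sqrt s0" "norm (pd j f y s) \<le> B / s0" if "s0 \<le> s" "s \<le> T" for s y
  proof -
    have s: "0 < s" using that assms by simp
    have "B / sqrt s \<le> B / sqrt s0" "B / s \<le> B / s0"
      using that assms B0 by (auto intro!: divide_left_mono mult_pos_pos)
    then show "norm (f y s) \<le> B / sqrt s0" "norm (pd j f y s) \<le> B / s0"
      using src_facts(2,4)[OF s that(2)] order_trans by blast+
  qed
  then show "\<exists>C. \<forall>s y. s0 \<le> s \<longrightarrow> s \<le> T \<longrightarrow> norm (f y s) \<le> C" "\<exists>C. \<forall>s y. s0 \<le> s \<longrightarrow> s \<le> T \<longrightarrow> norm (pd j f y s) \<le> C"
    by blast+
qed

lemma src_heatint_cont:
  assumes "kern k"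
  shows "continuous_on (UNIV \<times> {0<..T} \<times> {0<..<1}) (\<lambda>(x, t, \<theta>). heatint k f x t \<theta>)"
    "continuous_on (UNIV \<times> {0<..T} \<times> {0<..<1}) (\<lambda>(x, t, \<theta>). heatint k (pd j f) x t \<theta>)"
  using src by (auto intro!: heatint_cont[OF assms] src_local_bounds simp: src_def c1_def)

text \<open>One derivative on the source and one on the kernel. The second formula in
  \<open>heatint_derivative2\<close> has both on the kernel; \<open>heatint_bounds\<close>
  interpolates between the two forms.\<close>

definition hess_integrand :: "'n \<Rightarrow> 'n \<Rightarrow> real ^ 'n \<Rightarrow> real \<Rightarrow> real \<Rightarrow> 'b"
  where "hess_integrand j l x t \<theta> = (- (1 / sqrt (t * (1 - \<theta>)))) *\<^sub>R heatint (\<lambda>z. dgauss z \<bullet> axis l 1) (pd j f) x t \<theta>"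

context
  fixes t \<theta> :: real
  assumes t: "0 < t" "t \<le> T" and th: "0 < \<theta>" "\<theta> < 1"
begin

lemma scaled_times: "0 < t * \<theta>" "t * \<theta> \<le> T" "0 < t * (1 - \<theta>)" "0 < sqrt (t * (1 - \<theta>))"
  using t th mult_mono[of t T \<theta> 1] by auto

text \<open>The integrand is differentiated once through the source and once through the kernel;
  uniqueness of partial derivatives identifies the results.\<close>

lemma heatint_derivative:
  shows "((\<lambda>x. heatint gauss f x t \<theta>) has_derivative (\<lambda>h. \<Sum>j\<in>UNIV. h $ j *\<^sub>R heatint gauss (pd j f) x t \<theta>)) (at x)"
    and "heatint gauss (pd j f) x t \<theta> = (- (1 / sqrt (t * (1 - \<theta>)))) *\<^sub>R heatint (\<lambda>z. dgauss z \<bullet> axis j 1) f x t \<theta>"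
proof -
  note F = src_facts[OF scaled_times(1,2)]
  let ?s = "sqrt (t * (1 - \<theta>))"
  have bd: "norm (\<Sum>j\<in>UNIV. h $ j *\<^sub>R pd j f y (t * \<theta>)) \<le> (real CARD('n) * (B / (t * \<theta>))) * norm h" for y h
  proof -
    have "norm (\<Sum>j\<in>UNIV. h $ j *\<^sub>R pd j f y (t * \<theta>)) \<le> (\<Sum>j\<in>(UNIV::'n set). norm h * (B / (t * \<theta>)))"
      by (rule sum_norm_le) (unfold norm_scaleR, intro mult_mono F(4), auto simp: component_le_norm_cart)
    then show ?thesis by (simp add: mult_ac)
  qed
  have d1: "(Tk gauss ?s (\<lambda>y. f y (t * \<theta>)) has_derivative
      (\<lambda>h. Tk gauss ?s (\<lambda>y. \<Sum>j\<in>UNIV. h $ j *\<^sub>R pd j f y (t * \<theta>)) x)) (at x)" for x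
    by (rule Tk_has_derivative_src[OF gauss_kern F(1) F(2) F(5) _ bd]) (intro continuous_intros F(3))
  have d2: "(Tk gauss ?s (\<lambda>y. f y (t * \<theta>)) has_derivative
      (\<lambda>h. (- (1 / ?s)) *\<^sub>R Tk (\<lambda>z. dgauss z \<bullet> h) ?s (\<lambda>y. f y (t * \<theta>)) x)) (at x)" for x
    by (rule Tk_has_derivative[OF gauss_kern_grad F(1) F(2) scaled_times(4)])
  have p1: "partial j (Tk gauss ?s (\<lambda>y. f y (t * \<theta>))) x = heatint gauss (pd j f) x t \<theta>" for j x
    using partial_eqI[OF d1] by (simp add: sum_axis_scaleR heatint_def)
  have p2: "partial j (Tk gauss ?s (\<lambda>y. f y (t * \<theta>))) x = (- (1 / ?s)) *\<^sub>R heatint (\<lambda>z. dgauss z \<bullet> axis j 1) f x t \<theta>" for j x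
    using partial_eqI[OF d2] by (simp add: heatint_def)
  show "heatint gauss (pd j f) x t \<theta> = (- (1 / ?s)) *\<^sub>R heatint (\<lambda>z. dgauss z \<bullet> axis j 1) f x t \<theta>"
    using p1 p2 by metis
  have "Tk gauss ?s (\<lambda>y. f y (t * \<theta>)) differentiable (at x)" using d1 by (rule differentiableI)
  from has_derivative_partial[OF this] show "((\<lambda>x. heatint gauss f x t \<theta>) has_derivative (\<lambda>h. \<Sum>j\<in>UNIV. h $ j *\<^sub>R heatint gauss (pd j f) x t \<theta>)) (at x)"
    unfolding p1 by (simp add: heatint_def)
qed

lemma heatint_derivative2:
  shows "((\<lambda>x. heatint gauss (pd j f) x t \<theta>) has_derivative (\<lambda>h. \<Sum>l\<in>UNIV. h $ l *\<^sub>R hess_integrand j l x t \<theta>)) (at x)"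
    and "hess_integrand j l x t \<theta> = (1 / (t * (1 - \<theta>))) *\<^sub>R heatint (\<lambda>z. ddgauss (axis j 1) z \<bullet> axis l 1) f x t \<theta>"
proof -
  note F = src_facts[OF scaled_times(1,2)]
  let ?s = "sqrt (t * (1 - \<theta>))"
  have d1: "(Tk gauss ?s (\<lambda>y. pd j f y (t * \<theta>)) has_derivative
      (\<lambda>h. (- (1 / ?s)) *\<^sub>R Tk (\<lambda>z. dgauss z \<bullet> h) ?s (\<lambda>y. pd j f y (t * \<theta>)) x)) (at x)" for x
    by (rule Tk_has_derivative[OF gauss_kern_grad F(3) F(4) scaled_times(4)])
  have e: "Tk gauss ?s (\<lambda>y. pd j f y (t * \<theta>)) = (\<lambda>x. (- (1 / ?s)) *\<^sub>R Tk (\<lambda>z. dgauss z \<bullet> axis j 1) ?s (\<lambda>y. f y (t * \<theta>)) x)"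
    using heatint_derivative(2) by (auto simp: heatint_def)
  have d2: "(Tk gauss ?s (\<lambda>y. pd j f y (t * \<theta>)) has_derivative
      (\<lambda>h. (- (1 / ?s)) *\<^sub>R (- (1 / ?s)) *\<^sub>R Tk (\<lambda>z. ddgauss (axis j 1) z \<bullet> h) ?s (\<lambda>y. f y (t * \<theta>)) x)) (at x)" for x
    unfolding e by (rule has_derivative_scaleR_right[OF Tk_has_derivative[OF dgauss_kern_grad F(1) F(2) scaled_times(4)]])
  have p1: "partial l (Tk gauss ?s (\<lambda>y. pd j f y (t * \<theta>))) x = hess_integrand j l x t \<theta>" for l x
    using partial_eqI[OF d1] by (simp add: hess_integrand_def heatint_def)
  have p2: "partial l (Tk gauss ?s (\<lambda>y. pd j f y (t * \<theta>))) x = (1 / (t * (1 - \<theta>))) *\<^sub>R heatint (\<lambda>z. ddgauss (axis j 1) z \<bullet> axis l 1) f x t \<theta>" for l x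
    using partial_eqI[OF d2] scaled_times(3) by (simp add: heatint_def)
  show "hess_integrand j l x t \<theta> = (1 / (t * (1 - \<theta>))) *\<^sub>R heatint (\<lambda>z. ddgauss (axis j 1) z \<bullet> axis l 1) f x t \<theta>"
    using p1 p2 by metis
  have "Tk gauss ?s (\<lambda>y. pd j f y (t * \<theta>)) differentiable (at x)" using d1 by (rule differentiableI)
  from has_derivative_partial[OF this] show "((\<lambda>x. heatint gauss (pd j f) x t \<theta>) has_derivative (\<lambda>h. \<Sum>l\<in>UNIV. h $ l *\<^sub>R hess_integrand j l x t \<theta>)) (at x)"
    unfolding p1 by (simp add: heatint_def)
qed

lemma heatint_bounds:
  shows "norm (heatint gauss f x t \<theta>) \<le> B * t powr (-1/2) * wt \<theta>"
    "norm (heatint gauss (pd j f) x t \<theta>) \<le> (heat_const TYPE('n) * B) * t powr (-1) * wt \<theta>"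
    "norm (hess_integrand j l x t \<theta>) \<le> (heat_const TYPE('n) * B) * t powr (-3/2) * wt \<theta>"
proof -
  note F = src_facts[OF scaled_times(1,2)]
  let ?s = "sqrt (t * (1 - \<theta>))"
  let ?K = "heat_const TYPE('n) * B"
  have K0: "0 \<le> ?K" using heat_const(1)[where 'n='n] B0 by simp
  have "norm (heatint gauss f x t \<theta>) \<le> knorm (gauss :: real^'n \<Rightarrow> real) * (B / sqrt (t * \<theta>))"
    unfolding heatint_def by (rule Tk_norm[OF gauss_kern F(1) F(2)])
  also have "\<dots> = B * (1 / sqrt (t * \<theta>))" by (simp add: knorm_gauss)
  also have "\<dots> \<le> B * (t powr (-1/2) * wt \<theta>)" by (intro mult_left_mono wt_bounds B0 t th)
  finally show "norm (heatint gauss f x t \<theta>) \<le> B * t powr (-1/2) * wt \<theta>" by simp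
  have g: "norm (heatint k f x t \<theta>) \<le> heat_const TYPE('n) * (B / sqrt (t * \<theta>))" "norm (heatint k (pd j f) x t \<theta>) \<le> heat_const TYPE('n) * (B / (t * \<theta>))"
    if "kern k" "knorm k \<le> heat_const TYPE('n)" for k
  proof -
    have "norm (heatint k f x t \<theta>) \<le> knorm k * (B / sqrt (t * \<theta>))"
      unfolding heatint_def by (rule Tk_norm[OF that(1) F(1) F(2)])
    also have "\<dots> \<le> heat_const TYPE('n) * (B / sqrt (t * \<theta>))" using that(2) B0 scaled_times by (intro mult_right_mono) auto
    finally show "norm (heatint k f x t \<theta>) \<le> heat_const TYPE('n) * (B / sqrt (t * \<theta>))" .
    have "norm (heatint k (pd j f) x t \<theta>) \<le> knorm k * (B / (t * \<theta>))"
      unfolding heatint_def by (rule Tk_norm[OF that(1) F(3) F(4)])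
    also have "\<dots> \<le> heat_const TYPE('n) * (B / (t * \<theta>))" using that(2) B0 scaled_times by (intro mult_right_mono divide_nonneg_pos) auto
    finally show "norm (heatint k (pd j f) x t \<theta>) \<le> heat_const TYPE('n) * (B / (t * \<theta>))" .
  qed
  note k1 = kern_grad_component[OF gauss_kern_grad]
  note k2 = kern_grad_component[OF dgauss_kern_grad]
  have "norm (heatint gauss (pd j f) x t \<theta>) = 1 / ?s * norm (heatint (\<lambda>z. dgauss z \<bullet> axis j 1) f x t \<theta>)"
    unfolding heatint_derivative(2) using scaled_times by simp
  also have "\<dots> \<le> 1 / ?s * (heat_const TYPE('n) * (B / sqrt (t * \<theta>)))"
    by (intro mult_left_mono g(1) k1 heat_const) (use scaled_times in auto)
  also have "\<dots> = ?K * (1 / ?s * (1 / sqrt (t * \<theta>)))" by simp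
  also have "\<dots> \<le> ?K * (t powr (-1) * wt \<theta>)" by (intro mult_left_mono wt_bounds K0 t th)
  finally show "norm (heatint gauss (pd j f) x t \<theta>) \<le> ?K * t powr (-1) * wt \<theta>" by simp
  have "norm (hess_integrand j l x t \<theta>) = 1 / ?s * norm (heatint (\<lambda>z. dgauss z \<bullet> axis l 1) (pd j f) x t \<theta>)"
    unfolding hess_integrand_def using scaled_times by simp
  also have "\<dots> \<le> 1 / ?s * (heat_const TYPE('n) * (B / (t * \<theta>)))"
    by (intro mult_left_mono g(2) k1 heat_const) (use scaled_times in auto)
  finally have q1: "norm (hess_integrand j l x t \<theta>) \<le> ?K * (1 / ?s * (1 / (t * \<theta>)))" by simp
  have "norm (hess_integrand j l x t \<theta>) = 1 / (t * (1 - \<theta>)) * norm (heatint (\<lambda>z. ddgauss (axis j 1) z \<bullet> axis l 1) f x t \<theta>)"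
    unfolding heatint_derivative2(2) using scaled_times by simp
  also have "\<dots> \<le> 1 / (t * (1 - \<theta>)) * (heat_const TYPE('n) * (B / sqrt (t * \<theta>)))"
    by (intro mult_left_mono g(1) k2 heat_const) (use scaled_times in auto)
  finally have q2: "norm (hess_integrand j l x t \<theta>) \<le> ?K * (1 / (t * (1 - \<theta>)) * (1 / sqrt (t * \<theta>)))" by simp
  have "norm (hess_integrand j l x t \<theta>) \<le> ?K * ((t * (1 - \<theta>)) * (t * \<theta>)) powr (-3/4)"
    by (rule powr_min_bound[OF scaled_times(3,1) K0 norm_ge_zero q1 q2])
  then show "norm (hess_integrand j l x t \<theta>) \<le> ?K * t powr (-3/2) * wt \<theta>"
    unfolding wt_bounds(3)[OF t(1) th] by (simp only: mult.assoc)
qed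

end

lemma hess_integrand_cont: "continuous_on (UNIV \<times> {0<..T} \<times> {0<..<1}) (\<lambda>(x, t, \<theta>). hess_integrand j l x t \<theta>)"
proof -
  have "continuous_on (UNIV \<times> {0<..T} \<times> {0<..<1}) (\<lambda>p. heatint (\<lambda>z. dgauss z \<bullet> axis l 1) (pd j f) (fst p) (fst (snd p)) (snd (snd p)))"
    using src_heatint_cont(2)[OF kern_grad_component[OF gauss_kern_grad]] by (simp add: case_prod_unfold)
  then show ?thesis
    unfolding hess_integrand_def case_prod_unfold by (intro continuous_intros) auto
qed

lemma duhamel_c1:
  shows "c1 T (duhamel f)" "0 < t \<Longrightarrow> t \<le> T \<Longrightarrow> pd j (duhamel f) x t = tint (heatint gauss (pd j f)) x t"
    "c1 T (tint (heatint gauss (pd j f)))" "0 < t \<Longrightarrow> t \<le> T \<Longrightarrow> pd l (tint (heatint gauss (pd j f))) x t = tint (hess_integrand j l) x t"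
proof -
  let ?K = "heat_const TYPE('n) * B"
  have K: "0 \<le> ?K" "B \<le> ?K" using heat_const(1)[where 'n='n] B0 mult_right_mono[of 1 "heat_const TYPE('n)" B] by auto
  have b1: "norm (heatint gauss f x t \<theta>) \<le> ?K * t powr (- (1/2)) * wt \<theta>" if "0 < t" "t \<le> T" "0 < \<theta>" "\<theta> < 1" for x t \<theta>
  proof -
    have "B * t powr (-1/2) * wt \<theta> \<le> ?K * t powr (-1/2) * wt \<theta>"
      by (intro mult_right_mono K wt_nonneg) auto
    then show ?thesis using heatint_bounds(1)[OF that, of x] by simp
  qed
  note c = src_heatint_cont[OF gauss_kern]
  show "c1 T (duhamel f)" "0 < t \<Longrightarrow> t \<le> T \<Longrightarrow> pd j (duhamel f) x t = tint (heatint gauss (pd j f)) x t"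
    unfolding duhamel_def
    using tint_c1[where \<Phi>="heatint gauss f" and \<Phi>'="\<lambda>j. heatint gauss (pd j f)" and a'=1, OF c(1) b1 c(2) _ _ _ K(1) heatint_derivative(1)]
      heatint_bounds(2) by auto
  show "c1 T (tint (heatint gauss (pd j f)))" "0 < t \<Longrightarrow> t \<le> T \<Longrightarrow> pd l (tint (heatint gauss (pd j f))) x t = tint (hess_integrand j l) x t"
    using tint_c1[where \<Phi>="heatint gauss (pd j f)" and \<Phi>'="hess_integrand j" and a=1 and a'="3/2", OF c(2) _ hess_integrand_cont _ _ _ K(1) heatint_derivative2(1)]
      heatint_bounds(2,3) by auto
qed

text \<open>Each estimate is better by a factor \<open>sqrt t\<close> than \<open>jet\<close> asks
  for. Enlarged to \<open>sqrt T\<close>, this factor makes the map from \<open>src\<close> to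
  \<open>jet\<close> small on short time intervals. The pointwise estimate that keeps
  \<open>sqrt t\<close> later yields continuity at time zero.\<close>

lemma duhamel_jet:
  shows "jet T (heat_const TYPE('n) * Wc * sqrt T * B) (duhamel f)"
    and "0 < t \<Longrightarrow> t \<le> T \<Longrightarrow> norm (duhamel f x t) \<le> Wc * B * sqrt t"
    and "0 < t \<Longrightarrow> t \<le> T \<Longrightarrow> pd l (pd j (duhamel f)) x t = tint (hess_integrand j l) x t"
proof -
  let ?K = "heat_const TYPE('n) * B"
  have K: "0 \<le> ?K" "B \<le> ?K" using heat_const(1)[where 'n='n] B0 mult_right_mono[of 1 "heat_const TYPE('n)" B] by auto
  have e: "tint (heatint gauss (pd j f)) x t = pd j (duhamel f) x t" if "0 < t" "t \<le> T" for j x t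
    using duhamel_c1(2)[OF that] by simp
  note c2 = c1_cong[OF duhamel_c1(3) e]
  show pp: "pd l (pd j (duhamel f)) x t = tint (hess_integrand j l) x t" if "0 < t" "t \<le> T" for j l x t
    using c1_cong(2)[OF duhamel_c1(3) e that] duhamel_c1(4)[OF that] by metis
  have n0: "norm (duhamel f x t) \<le> Wc * B * sqrt t" if t: "0 < t" "t \<le> T" for x t
  proof -
    have "norm (duhamel f x t) \<le> t * ((B * t powr (-1/2)) * Wc)"
      unfolding duhamel_def
      by (rule tint_norm(2)[where \<Phi>="heatint gauss f" and c="B * t powr (-1/2)", OF triple_cont(1)[OF src_heatint_cont(1)[OF gauss_kern] t] heatint_bounds(1)[OF t]]) (use t in auto)
    also have "t * ((B * t powr (-1/2)) * Wc) = Wc * B * (t * t powr (-1/2))" by simp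
    also have "t * t powr (-1/2) = sqrt t" using t by (simp add: powr_minus_divide powr_half_sqrt real_div_sqrt)
    finally show ?thesis .
  qed
  then show "0 < t \<Longrightarrow> t \<le> T \<Longrightarrow> norm (duhamel f x t) \<le> Wc * B * sqrt t" .
  have n1: "norm (pd j (duhamel f) x t) \<le> ?K * Wc" if t: "0 < t" "t \<le> T" for j x t
  proof -
    have "norm (pd j (duhamel f) x t) \<le> t * ((?K * t powr (-1)) * Wc)"
      unfolding duhamel_c1(2)[OF t]
      by (rule tint_norm(2)[where \<Phi>="heatint gauss (pd j f)" and c="?K * t powr (-1)", OF triple_cont(1)[OF src_heatint_cont(2)[OF gauss_kern] t] heatint_bounds(2)[OF t]]) (use t in auto)
    also have "\<dots> = ?K * Wc" using t by (simp add: powr_minus_divide)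
    finally show ?thesis .
  qed
  have n2: "norm (pd l (pd j (duhamel f)) x t) \<le> ?K * Wc / sqrt t" if t: "0 < t" "t \<le> T" for j l x t
  proof -
    have "norm (pd l (pd j (duhamel f)) x t) \<le> t * ((?K * t powr (-3/2)) * Wc)"
      unfolding pp[OF t]
      by (rule tint_norm(2)[where \<Phi>="hess_integrand j l" and c="?K * t powr (-3/2)", OF triple_cont(1)[OF hess_integrand_cont t] heatint_bounds(3)[OF t]]) (use t in auto)
    also have "\<dots> = ?K * Wc * (t powr 1 * t powr (-3/2))" using t by simp
    also have "t powr 1 * t powr (-3/2) = 1 / sqrt t"
      unfolding powr_add[symmetric] using t by (simp add: powr_minus_divide powr_half_sqrt)
    finally show ?thesis by simp
  qed
  let ?A = "heat_const TYPE('n) * Wc * sqrt T * B"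
  have KW: "0 \<le> ?K * Wc" "0 \<le> Wc * B" using K Wc_nonneg B0 by auto
  have "norm (duhamel f x t) \<le> ?A" "norm (pd j (duhamel f) x t) \<le> ?A / sqrt t" "norm (pd l (pd j (duhamel f)) x t) \<le> ?A / t"
    if t: "0 < t" "t \<le> T" for j l x t
  proof -
    have s: "sqrt t \<le> sqrt T" using t by simp
    have "Wc * B * sqrt t \<le> (Wc * ?K) * sqrt T"
      by (intro mult_mono s mult_left_mono K) (use Wc_nonneg K t in auto)
    then show "norm (duhamel f x t) \<le> ?A" using n0[OF t, of x] by (simp add: mult_ac)
    have "?K * Wc * 1 \<le> ?K * Wc * (sqrt T / sqrt t)"
      by (intro mult_left_mono KW) (use t s in \<open>simp add: pos_le_divide_eq\<close>)
    then show "norm (pd j (duhamel f) x t) \<le> ?A / sqrt t" using n1[OF t, of j x] by (simp add: mult_ac)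
    have "1 / sqrt t \<le> sqrt T / t"
      using t divide_right_mono[OF s, of t] by (simp add: sqrt_divide_self_eq inverse_eq_divide)
    then have "?K * Wc * (1 / sqrt t) \<le> ?K * Wc * (sqrt T / t)" by (intro mult_left_mono KW)
    then show "norm (pd l (pd j (duhamel f)) x t) \<le> ?A / t" using n2[OF t, of l j x] by (simp add: mult_ac)
  qed
  then show "jet T ?A (duhamel f)"
    unfolding jet_def using duhamel_c1(1) c2(1) by auto
qed

end

lemma Tk_kernel_sum:
  fixes f :: "'a::euclidean_space \<Rightarrow> 'b::euclidean_space"
  assumes "\<And>j. j \<in> J \<Longrightarrow> kern (k j)" and f: "continuous_on UNIV f" "\<And>y. norm (f y) \<le> B"
  shows "Tk (\<lambda>z. \<Sum>j\<in>J. k j z) \<sigma> f x = (\<Sum>j\<in>J. Tk (k j) \<sigma> f x)"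
  unfolding Tk_def scaleR_sum_left
  by (rule Bochner_Integration.integral_sum) (rule Tk_integrable[OF assms(1) f])

lemma Basis_vec_real: "(Basis :: (real ^ 'n) set) = range (\<lambda>j. axis j 1)"
  by (auto simp: Basis_vec_def)

lemma lgauss_eq_sum_axis: "lgauss (z :: real ^ 'n) = (\<Sum>j\<in>UNIV. ddgauss (axis j 1) z \<bullet> axis j 1)"
  unfolding lgauss_eq_sum Basis_vec_real
  by (subst sum.reindex) (auto simp: inj_on_def axis_eq_axis)

lemma Tk_lgauss:
  fixes f :: "real ^ 'n \<Rightarrow> 'b::euclidean_space"
  assumes f: "continuous_on UNIV f" "\<And>y. norm (f y) \<le> B"
  shows "Tk lgauss \<sigma> f x = (\<Sum>j\<in>UNIV. Tk (\<lambda>z. ddgauss (axis j 1) z \<bullet> axis j 1) \<sigma> f x)"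
proof -
  have "(lgauss :: real ^ 'n \<Rightarrow> real) = (\<lambda>z. \<Sum>j\<in>UNIV. ddgauss (axis j 1) z \<bullet> axis j 1)"
    by (rule ext) (rule lgauss_eq_sum_axis)
  then have "Tk lgauss \<sigma> f x = Tk (\<lambda>z. \<Sum>j\<in>UNIV. ddgauss (axis j 1) z \<bullet> axis j 1) \<sigma> f x" by simp
  also have "\<dots> = (\<Sum>j\<in>UNIV. Tk (\<lambda>z. ddgauss (axis j 1) z \<bullet> axis j 1) \<sigma> f x)"
    by (rule Tk_kernel_sum[OF kern_grad_component[OF dgauss_kern_grad] f])
  finally show ?thesis .
qed

section \<open>The heat flow and the inhomogeneous heat equation\<close>

definition flow :: "(real ^ 'n \<Rightarrow> 'b::euclidean_space) \<Rightarrow> real ^ 'n \<Rightarrow> real \<Rightarrow> 'b"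
  where "flow u0 x t = Tk gauss (sqrt t) u0 x"

definition lap :: "(real ^ 'n \<Rightarrow> real \<Rightarrow> 'b::real_normed_vector) \<Rightarrow> real ^ 'n \<Rightarrow> real \<Rightarrow> 'b"
  where "lap u x t = (\<Sum>j\<in>UNIV. pd j (pd j u) x t)"

context
  fixes u0 :: "real ^ 'n \<Rightarrow> 'b::euclidean_space" and M :: real
  assumes u0: "continuous_on UNIV u0" "\<And>y. norm (u0 y) \<le> M"
begin

lemma flow_zero: "flow u0 x 0 = u0 x"
  using kern_integrable[OF gauss_kern, where 'a="real^'n"] by (simp add: flow_def Tk_def integral_gauss)

lemma flow_norm: "norm (flow u0 x t) \<le> M"
  unfolding flow_def using Tk_norm[OF gauss_kern u0, of "sqrt t" x] by (simp add: knorm_gauss)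

lemma flow_kernel_cont:
  assumes "kern k"
  shows "continuous_on UNIV (\<lambda>p. Tk k (sqrt (snd p)) u0 (fst p))"
proof -
  have "continuous_on (UNIV \<times> UNIV \<times> (UNIV :: real set)) (\<lambda>(x, \<sigma>, s). Tk k \<sigma> (\<lambda>y. u0 y) x)"
    by (rule Tk_continuous[OF assms, where B=M]) (auto simp: case_prod_unfold u0 intro!: continuous_on_compose2[OF u0(1)] continuous_intros)
  then have "continuous_on UNIV (\<lambda>p. case (fst p, sqrt (snd p), 0::real) of (x, \<sigma>, s) \<Rightarrow> Tk k \<sigma> (\<lambda>y. u0 y) x)"
    by (rule continuous_on_compose2) (auto intro!: continuous_intros)
  then show ?thesis by simp
qed

lemma flow_cont: "continuous_on UNIV (\<lambda>(x, t). flow u0 x t)"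
  using flow_kernel_cont[OF gauss_kern] by (simp add: flow_def case_prod_unfold)

lemma flow_jet: "jet T (heat_const TYPE('n) * M) (flow u0)"
  and flow_lap: "0 < t \<Longrightarrow> lap (flow u0) x t = (1 / t) *\<^sub>R Tk lgauss (sqrt t) u0 x"
proof -
  have M0: "0 \<le> M" using u0(2) norm_ge_zero order_trans by blast
  note h = heat_const[where 'n='n]
  define p where "p j x t = (- (1 / sqrt t)) *\<^sub>R Tk (\<lambda>z. dgauss z \<bullet> axis j 1) (sqrt t) u0 x" for j x t
  define q where "q j l x t = (1 / t) *\<^sub>R Tk (\<lambda>z. ddgauss (axis j 1) z \<bullet> axis l 1) (sqrt t) u0 x" for j l x t
  note k1 = kern_grad_component[OF gauss_kern_grad]
  note k2 = kern_grad_component[OF dgauss_kern_grad]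
  have d1: "((\<lambda>y. flow u0 y t) has_derivative (\<lambda>h. \<Sum>j\<in>UNIV. h $ j *\<^sub>R p j x t)) (at x)" if t: "0 < t" for x t
  proof -
    have d: "(Tk gauss (sqrt t) u0 has_derivative (\<lambda>h. (- (1 / sqrt t)) *\<^sub>R Tk (\<lambda>z. dgauss z \<bullet> h) (sqrt t) u0 x)) (at x)"
      by (rule Tk_has_derivative[OF gauss_kern_grad u0]) (use t in simp)
    have "partial j (Tk gauss (sqrt t) u0) x = p j x t" for j unfolding p_def by (rule partial_eqI[OF d])
    then show ?thesis using has_derivative_partial[OF differentiableI[OF d]] by (simp add: flow_def)
  qed
  have d2: "((\<lambda>y. p j y t) has_derivative (\<lambda>h. \<Sum>l\<in>UNIV. h $ l *\<^sub>R q j l x t)) (at x)" if t: "0 < t" for j x t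
  proof -
    have d: "((\<lambda>y. p j y t) has_derivative (\<lambda>h. (- (1 / sqrt t)) *\<^sub>R (- (1 / sqrt t)) *\<^sub>R Tk (\<lambda>z. ddgauss (axis j 1) z \<bullet> h) (sqrt t) u0 x)) (at x)"
      unfolding p_def by (rule has_derivative_scaleR_right[OF Tk_has_derivative[OF dgauss_kern_grad u0]]) (use t in simp)
    have "partial l (\<lambda>y. p j y t) x = q j l x t" for l
      using partial_eqI[OF d, of l] t by (simp add: q_def)
    then show ?thesis using has_derivative_partial[OF differentiableI[OF d]] by simp
  qed
  have cf: "continuous_on (UNIV \<times> {0<..T}) (\<lambda>(x, t). flow u0 x t)" for T by (rule continuous_on_subset[OF flow_cont]) auto
  have cp: "continuous_on (UNIV \<times> {0<..T}) (\<lambda>(x, t). p j x t)" for j T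
    unfolding p_def case_prod_unfold
    by (intro continuous_intros continuous_on_subset[OF flow_kernel_cont[OF k1]]) auto
  have cq: "continuous_on (UNIV \<times> {0<..T}) (\<lambda>(x, t). q j l x t)" for j l T
    unfolding q_def case_prod_unfold
    by (intro continuous_intros continuous_on_subset[OF flow_kernel_cont[OF k2]]) auto
  note c1 = c1I[OF cf cp d1]
  note c2 = c1I[OF cp cq d2]
  have e: "p j x t = pd j (flow u0) x t" if "0 < t" for j x t using c1(2)[OF _ that order_refl] by simp
  have c3: "c1 T (pd j (flow u0))" for j T by (rule c1_cong(1)[OF c2(1)]) (auto simp: e)
  have c4: "pd l (pd j (flow u0)) x t = q j l x t" if "0 < t" for j l x t
  proof -
    have "pd l (pd j (flow u0)) x t = pd l (p j) x t"
      by (rule c1_cong(2)[OF c2(1) _ that order_refl]) (auto simp: e)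
    also have "\<dots> = q j l x t" by (rule c2(2)[OF _ that order_refl]) auto
    finally show ?thesis .
  qed
  have b0: "norm (flow u0 x t) \<le> heat_const TYPE('n) * M" for x t
    using flow_norm[of x t] mult_right_mono[OF h(1) M0] by simp
  have b1: "norm (p j x t) \<le> heat_const TYPE('n) * M / sqrt t" if "0 < t" for j x t
  proof -
    have "norm (Tk (\<lambda>z. dgauss z \<bullet> axis j 1) (sqrt t) u0 x) \<le> heat_const TYPE('n) * M"
      by (rule order_trans[OF Tk_norm[OF k1 u0]]) (intro mult_right_mono h M0)
    then show ?thesis using that by (simp add: p_def divide_right_mono)
  qed
  have b2: "norm (q j l x t) \<le> heat_const TYPE('n) * M / t" if "0 < t" for j l x t
  proof -
    have "norm (Tk (\<lambda>z. ddgauss (axis j 1) z \<bullet> axis l 1) (sqrt t) u0 x) \<le> heat_const TYPE('n) * M"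
      by (rule order_trans[OF Tk_norm[OF k2 u0]]) (intro mult_right_mono h M0)
    then show ?thesis using that by (simp add: q_def divide_right_mono)
  qed
  show "jet T (heat_const TYPE('n) * M) (flow u0)"
    unfolding jet_def using c1(1) c3 b0 b1 b2 by (auto simp: c4 e[symmetric])
  show "0 < t \<Longrightarrow> lap (flow u0) x t = (1 / t) *\<^sub>R Tk lgauss (sqrt t) u0 x"
    unfolding lap_def Tk_lgauss[OF u0] by (simp add: c4 q_def scaleR_sum_right)
qed

lemma flow_time_derivative:
  assumes "0 < t"
  shows "((\<lambda>t. flow u0 x t) has_vector_derivative lap (flow u0) x t) (at t)"
  unfolding flow_lap[OF assms] unfolding flow_def
  by (rule Tk_gauss_time_derivative[OF u0 assms])

end

section \<open>The time derivative of the Duhamel integral\<close>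

lemma set_integrable_inverse_sqrt:
  assumes "0 \<le> T" shows "set_integrable lborel {0<..<T} (\<lambda>s::real. s powr (-1/2))"
proof -
  have "((\<lambda>x::real. x powr (-1/2)) has_integral (T powr (-1/2 + 1) / (-1/2 + 1))) {0..T}"
    by (rule has_integral_powr_from_0) (use assms in auto)
  then have "(\<lambda>x::real. x powr (-1/2)) absolutely_integrable_on {0..T}"
    by (intro nonnegative_absolutely_integrable_1) (auto simp: integrable_on_def)
  then have "(\<lambda>x::real. x powr (-1/2)) absolutely_integrable_on {0<..<T}"
    by (rule set_integrable_subset) auto
  then show ?thesis
    unfolding set_integrable_def by (subst (asm) integrable_completion) auto
qed

context
  fixes T B :: real and f :: "real ^ 'n \<Rightarrow> real \<Rightarrow> 'b::euclidean_space" and x :: "real ^ 'n"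
  assumes src: "src T B f" and B0: "0 \<le> B"
begin

lemma src_Tk_cont:
  assumes k: "kern k"
  shows "continuous_on (UNIV \<times> UNIV \<times> {0<..T}) (\<lambda>(x, \<sigma>, s). Tk k \<sigma> (\<lambda>y. f y s) x)"
proof -
  have "continuous_on {p \<in> UNIV \<times> UNIV \<times> {..T}. 0 < snd (snd p)} (\<lambda>(x, \<sigma>, s). Tk k \<sigma> (\<lambda>y. f y s) x)"
  proof (rule continuous_on_positive_time)
    show "continuous_on UNIV (\<lambda>p::(real^'n) \<times> real \<times> real. snd (snd p))" by (intro continuous_intros)
    fix s0 :: real assume s0: "0 < s0"
    obtain C where C: "\<And>s y. s \<in> {s0..T} \<Longrightarrow> norm (f y s) \<le> C" using src_local_bounds(1)[OF src B0 s0] by auto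
    have fs: "continuous_on (UNIV \<times> {s0..T}) (\<lambda>(y, s). f y s)"
      by (rule continuous_on_subset[of "UNIV \<times> {0<..T}"]) (use s0 src in \<open>auto simp: src_def c1_def\<close>)
    have "{p \<in> UNIV \<times> UNIV \<times> {..T}. s0 \<le> snd (snd p)} = (UNIV :: (real^'n) set) \<times> (UNIV::real set) \<times> {s0..T}" by auto
    then show "continuous_on {p \<in> UNIV \<times> UNIV \<times> {..T}. s0 \<le> snd (snd p)} (\<lambda>(x, \<sigma>, s). Tk k \<sigma> (\<lambda>y. f y s) x)"
      using Tk_continuous[OF k fs C] by simp
  qed
  moreover have "{p \<in> UNIV \<times> UNIV \<times> {..T}. 0 < snd (snd p)} = (UNIV :: (real^'n) set) \<times> (UNIV::real set) \<times> {0<..T}" by auto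
  ultimately show ?thesis by simp
qed

text \<open>For the heat flow started from \<open>f\<close> at time \<open>s\<close>, this is both
  the Laplacian and the time derivative at time \<open>\<tau>\<close>. The double role is what the
  Fubini argument exploits.\<close>

definition lap_integrand :: "real \<Rightarrow> real \<Rightarrow> 'b"
  where "lap_integrand \<tau> s = (1 / (\<tau> - s)) *\<^sub>R Tk lgauss (sqrt (\<tau> - s)) (\<lambda>y. f y s) x"

lemma lap_integrand_scaled:
  assumes t: "0 < t" "t \<le> T" and th: "0 < \<theta>" "\<theta> < 1"
  shows "lap_integrand t (t * \<theta>) = (\<Sum>j\<in>UNIV. hess_integrand f j j x t \<theta>)"
    and "norm (lap_integrand t (t * \<theta>)) \<le> (real CARD('n) * (heat_const TYPE('n) * B)) * t powr (-3/2) * wt \<theta>"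
proof -
  have q: "0 < t * \<theta>" "t * \<theta> \<le> T" using t th mult_mono[of t T \<theta> 1] by auto
  note F = src_facts[OF src B0 q]
  have e: "t - t * \<theta> = t * (1 - \<theta>)" by (simp add: algebra_simps)
  show 1: "lap_integrand t (t * \<theta>) = (\<Sum>j\<in>UNIV. hess_integrand f j j x t \<theta>)"
    unfolding lap_integrand_def e Tk_lgauss[OF F(1,2)] heatint_derivative2(2)[OF src B0 t th] heatint_def by (simp add: scaleR_sum_right)
  have "norm (lap_integrand t (t * \<theta>)) \<le> (\<Sum>j\<in>(UNIV::'n set). (heat_const TYPE('n) * B) * t powr (-3/2) * wt \<theta>)"
    unfolding 1 by (rule sum_norm_le) (rule heatint_bounds(3)[OF src B0 t th])
  then show "norm (lap_integrand t (t * \<theta>)) \<le> (real CARD('n) * (heat_const TYPE('n) * B)) * t powr (-3/2) * wt \<theta>"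
    by (simp add: mult_ac)
qed

text \<open>Undoes the rescaling \<open>s = t * \<theta>\<close>: an exchange of the order of
  integration needs the variable \<open>s\<close> itself.\<close>

lemma I01_scale:
  fixes g :: "real \<Rightarrow> 'c::euclidean_space"
  assumes t: "0 < t"
  shows "t *\<^sub>R (\<integral>\<theta>. g (t * \<theta>) \<partial>I01) = (\<integral>s. indicator {0<..<t} s *\<^sub>R g s \<partial>lborel)"
    and "integrable I01 (\<lambda>\<theta>. g (t * \<theta>)) \<Longrightarrow> integrable lborel (\<lambda>s. indicator {0<..<t} s *\<^sub>R g s)"
proof -
  have i: "indicator {0<..<t} (0 + t * \<theta>) = (indicator {0<..<1} \<theta> :: real)" for \<theta>
    using t by (auto simp: indicator_def zero_less_mult_iff)
  have "(\<integral>s. indicator {0<..<t} s *\<^sub>R g s \<partial>lborel) = \<bar>t\<bar> *\<^sub>R (\<integral>\<theta>. indicator {0<..<t} (0 + t * \<theta>) *\<^sub>R g (0 + t * \<theta>) \<partial>lborel)"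
    by (rule lborel_integral_real_affine) (use t in simp)
  then show "t *\<^sub>R (\<integral>\<theta>. g (t * \<theta>) \<partial>I01) = (\<integral>s. indicator {0<..<t} s *\<^sub>R g s \<partial>lborel)"
    unfolding i using t by (simp add: I01_def integral_restrict_space)
  assume "integrable I01 (\<lambda>\<theta>. g (t * \<theta>))"
  then have "integrable lborel (\<lambda>\<theta>. indicator {0<..<1} \<theta> *\<^sub>R g (t * \<theta>))"
    unfolding I01_def by (subst (asm) integrable_restrict_space) auto
  then have "integrable lborel (\<lambda>\<theta>. indicator {0<..<t} (0 + t * \<theta>) *\<^sub>R g (0 + t * \<theta>))"
    unfolding i by simp
  then show "integrable lborel (\<lambda>s. indicator {0<..<t} s *\<^sub>R g s)"
    using lborel_integrable_real_affine_iff[of t "\<lambda>s. indicator {0<..<t} s *\<^sub>R g s" 0] t by simp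
qed

text \<open>The bound in the last part is integrable in \<open>t\<close> near zero; it provides the
  absolute integrability over a triangle that Fubini requires.\<close>

lemma lap_duhamel_eq:
  assumes t: "0 < t" "t \<le> T"
  shows "lap (duhamel f) x t = (\<integral>s. indicator {0<..<t} s *\<^sub>R lap_integrand t s \<partial>lborel)"
    and "integrable lborel (\<lambda>s. indicator {0<..<t} s *\<^sub>R lap_integrand t s)"
    and "(\<integral>s. norm (indicator {0<..<t} s *\<^sub>R lap_integrand t s) \<partial>lborel) \<le> (real CARD('n) * (heat_const TYPE('n) * B) * Wc) * t powr (-1/2)"
proof -
  let ?K = "real CARD('n) * (heat_const TYPE('n) * B)"
  have iQ: "integrable I01 (hess_integrand f j j x t)" for j
    by (rule tint_norm(1)[where \<Phi>="hess_integrand f j j" and c="heat_const TYPE('n) * B * t powr (-3/2)", OF triple_cont(1)[OF hess_integrand_cont[OF src B0] t] heatint_bounds(3)[OF src B0 t]])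
       (use t in auto)
  have "lap (duhamel f) x t = t *\<^sub>R (\<integral>\<theta>. (\<Sum>j\<in>UNIV. hess_integrand f j j x t \<theta>) \<partial>I01)"
    unfolding lap_def duhamel_jet(3)[OF src B0 t] tint_def using iQ by (simp add: scaleR_sum_right)
  also have "(\<integral>\<theta>. (\<Sum>j\<in>UNIV. hess_integrand f j j x t \<theta>) \<partial>I01) = (\<integral>\<theta>. lap_integrand t (t * \<theta>) \<partial>I01)"
    by (rule Bochner_Integration.integral_cong) (auto simp: lap_integrand_scaled(1)[OF t])
  finally show "lap (duhamel f) x t = (\<integral>s. indicator {0<..<t} s *\<^sub>R lap_integrand t s \<partial>lborel)"
    unfolding I01_scale(1)[OF t(1)] .
  have "integrable I01 (\<lambda>\<theta>. \<Sum>j\<in>UNIV. hess_integrand f j j x t \<theta>)" using iQ by simp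
  then have ip: "integrable I01 (\<lambda>\<theta>. lap_integrand t (t * \<theta>))"
    by (rule iffD1[OF Bochner_Integration.integrable_cong, rotated -1]) (auto simp: lap_integrand_scaled(1)[OF t])
  then show "integrable lborel (\<lambda>s. indicator {0<..<t} s *\<^sub>R lap_integrand t s)" by (rule I01_scale(2)[OF t(1)])
  have "(\<integral>s. norm (indicator {0<..<t} s *\<^sub>R lap_integrand t s) \<partial>lborel) = t * (\<integral>\<theta>. norm (lap_integrand t (t * \<theta>)) \<partial>I01)"
    using I01_scale(1)[OF t(1), of "\<lambda>s. norm (lap_integrand t s)"] by simp
  also have "(\<integral>\<theta>. norm (lap_integrand t (t * \<theta>)) \<partial>I01) \<le> (\<integral>\<theta>. ?K * t powr (-3/2) * wt \<theta> \<partial>I01)"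
    by (rule integral_mono) (use ip integrable_wt lap_integrand_scaled(2)[OF t] in auto)
  also have "(\<integral>\<theta>. ?K * t powr (-3/2) * wt \<theta> \<partial>I01) = ?K * t powr (-3/2) * Wc" by (simp add: Wc_def)
  also have "t * (?K * t powr (-3/2) * Wc) = ?K * Wc * (t powr 1 * t powr (-3/2))" using t by simp
  also have "t powr 1 * t powr (-3/2) = t powr (-1/2)" unfolding powr_add[symmetric] by simp
  finally show "(\<integral>s. norm (indicator {0<..<t} s *\<^sub>R lap_integrand t s) \<partial>lborel) \<le> (?K * Wc) * t powr (-1/2)"
    using t by (simp add: mult_left_mono)
qed

lemma duhamel_eq:
  assumes t: "0 < t" "t \<le> T"
  shows "duhamel f x t = (\<integral>s. indicator {0<..<t} s *\<^sub>R Tk gauss (sqrt (t - s)) (\<lambda>y. f y s) x \<partial>lborel)"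
    and "integrable lborel (\<lambda>s. indicator {0<..<t} s *\<^sub>R Tk gauss (sqrt (t - s)) (\<lambda>y. f y s) x)"
proof -
  have e: "heatint gauss f x t = (\<lambda>\<theta>. Tk gauss (sqrt (t - t * \<theta>)) (\<lambda>y. f y (t * \<theta>)) x)"
    by (auto simp: heatint_def algebra_simps)
  have "integrable I01 (heatint gauss f x t)"
    by (rule tint_norm(1)[where \<Phi>="heatint gauss f" and c="B * t powr (-1/2)", OF triple_cont(1)[OF src_heatint_cont(1)[OF src B0 gauss_kern] t] heatint_bounds(1)[OF src B0 t]])
       (use t in auto)
  then show "integrable lborel (\<lambda>s. indicator {0<..<t} s *\<^sub>R Tk gauss (sqrt (t - s)) (\<lambda>y. f y s) x)"
    unfolding e by (rule I01_scale(2)[OF t(1)])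
  show "duhamel f x t = (\<integral>s. indicator {0<..<t} s *\<^sub>R Tk gauss (sqrt (t - s)) (\<lambda>y. f y s) x \<partial>lborel)"
    unfolding duhamel_def tint_def e by (rule I01_scale(1)[OF t(1)])
qed

lemma src_integrable:
  assumes t: "0 < t" "t \<le> T" shows "integrable lborel (\<lambda>s. indicator {0<..<t} s *\<^sub>R f x s)"
proof (rule Bochner_Integration.integrable_bound)
  show "integrable lborel (\<lambda>s. B * (indicator {0<..<t} s *\<^sub>R s powr (-1/2)))"
    using set_integrable_inverse_sqrt[of t] t by (intro integrable_mult_right) (simp add: set_integrable_def)
  have "continuous_on {0<..<t} (\<lambda>s. case (x, s) of (x, s) \<Rightarrow> f x s)"
    by (rule continuous_on_compose2[of "UNIV \<times> {0<..T}"]) (use src t in \<open>auto simp: src_def c1_def intro!: continuous_intros\<close>)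
  then show "(\<lambda>s. indicator {0<..<t} s *\<^sub>R f x s) \<in> borel_measurable lborel"
    by (simp add: borel_measurable_continuous_on_indicator)
  show "AE s in lborel. norm (indicator {0<..<t} s *\<^sub>R f x s) \<le> norm (B * (indicator {0<..<t} s *\<^sub>R s powr (-1/2)))"
    using src_facts(2)[OF src B0, of _ x] t B0
    by (intro AE_I2) (auto simp: indicator_def powr_minus_divide powr_half_sqrt abs_mult)
qed

text \<open>The heat equation integrated from \<open>s\<close> to \<open>t\<close>. The integrand
  may be singular at \<open>\<tau> = s\<close>, so the fundamental theorem is used in the form that
  wants continuity on the closed interval and a derivative only inside. Integrability is an
  assumption because Fubini supplies it for almost every \<open>s\<close> only.\<close>

lemma lap_integrand_time_integral:
  assumes s: "0 < s" "s < t" and t: "t \<le> T" and int: "integrable lborel (\<lambda>\<tau>. indicator {s<..<t} \<tau> *\<^sub>R lap_integrand \<tau> s)"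
  shows "(\<integral>\<tau>. indicator {s<..<t} \<tau> *\<^sub>R lap_integrand \<tau> s \<partial>lborel) = Tk gauss (sqrt (t - s)) (\<lambda>y. f y s) x - f x s"
proof -
  have sT: "s \<le> T" using s t by simp
  note F = src_facts[OF src B0 s(1) sT]
  let ?\<phi> = "\<lambda>\<tau>. Tk gauss (sqrt (\<tau> - s)) (\<lambda>y. f y s) x"
  have "continuous_on UNIV (\<lambda>p::(real^'n)\<times>real. Tk gauss (sqrt (snd p)) (\<lambda>y. f y s) (fst p))"
    by (rule flow_kernel_cont[OF F(1,2) gauss_kern])
  then have "continuous_on {s..t} (\<lambda>\<tau>. Tk gauss (sqrt (snd (x, \<tau> - s))) (\<lambda>y. f y s) (fst (x, \<tau> - s)))"
    by (rule continuous_on_compose2) (auto intro!: continuous_intros)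
  then have c: "continuous_on {s..t} ?\<phi>" by simp
  have d: "(?\<phi> has_vector_derivative lap_integrand \<tau> s) (at \<tau>)" if "\<tau> \<in> {s<..<t}" for \<tau>
  proof -
    have "((\<lambda>r. Tk gauss (sqrt r) (\<lambda>y. f y s) x) has_vector_derivative lap_integrand \<tau> s) (at (\<tau> - s))"
      unfolding lap_integrand_def by (rule Tk_gauss_time_derivative[OF F(1,2)]) (use that in auto)
    moreover have "((\<lambda>\<tau>. \<tau> - s) has_real_derivative 1) (at \<tau>)" by (auto intro!: derivative_eq_intros)
    ultimately show ?thesis
      using vector_diff_chain_within[of "\<lambda>\<tau>. \<tau> - s" 1 \<tau> UNIV "\<lambda>r. Tk gauss (sqrt r) (\<lambda>y. f y s) x" "lap_integrand \<tau> s"]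
      by (auto simp: comp_def has_real_derivative_iff_has_vector_derivative intro: has_vector_derivative_at_within)
  qed
  have "((\<lambda>\<tau>. lap_integrand \<tau> s) has_integral (?\<phi> t - ?\<phi> s)) {s..t}"
    by (rule fundamental_theorem_of_calculus_interior[OF less_imp_le[OF s(2)] c d])
  then have h: "((\<lambda>\<tau>. lap_integrand \<tau> s) has_integral (?\<phi> t - ?\<phi> s)) {s<..<t}" by (simp add: has_integral_Icc_iff_Ioo)
  have e: "(\<lambda>\<tau>. if \<tau> \<in> {s<..<t} then lap_integrand \<tau> s else 0) = (\<lambda>\<tau>. indicator {s<..<t} \<tau> *\<^sub>R lap_integrand \<tau> s)"
    by (auto simp: indicator_def)
  have "((\<lambda>\<tau>. indicator {s<..<t} \<tau> *\<^sub>R lap_integrand \<tau> s) has_integral (?\<phi> t - ?\<phi> s)) UNIV"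
    using h unfolding has_integral_restrict_UNIV[symmetric, of _ _ "{s<..<t}"] e .
  moreover have "((\<lambda>\<tau>. indicator {s<..<t} \<tau> *\<^sub>R lap_integrand \<tau> s) has_integral (\<integral>\<tau>. indicator {s<..<t} \<tau> *\<^sub>R lap_integrand \<tau> s \<partial>lborel)) UNIV"
    by (rule has_integral_integral_lborel[OF int])
  moreover have "?\<phi> s = f x s" using flow_zero[OF F(1,2)] by (simp add: flow_def)
  ultimately show ?thesis using has_integral_unique by metis
qed

text \<open>
  Differentiating the Duhamel integral in \<open>t\<close> directly would need the kernel at \<open>s = t\<close>. Instead, the heat
  equation of the semigroup is integrated in \<open>\<tau>\<close> over \<open>s < \<tau> < t\<close> and Fubini is applied.
\<close>

lemma duhamel_integral_equation:
  assumes t: "0 < t" "t \<le> T"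
  shows "duhamel f x t = (LBINT \<tau>:{0<..<t}. lap (duhamel f) x \<tau> + f x \<tau>)"
    and "set_integrable lborel {0<..<t} (\<lambda>\<tau>. lap (duhamel f) x \<tau> + f x \<tau>)"
proof -
  \<comment> \<open>The triangle \<open>0 < s < \<tau> < t\<close>, with points written as
    \<open>(\<tau>, s)\<close>; \<open>F1\<close> and \<open>F2\<close> are its two ways of
    slicing.\<close>
  define A where "A = {p::real \<times> real. 0 < snd p \<and> snd p < fst p \<and> fst p < t}"
  have oA: "open A"
    unfolding A_def by (intro open_Collect_conj open_Collect_less continuous_intros)
  define F where "F p = indicator A p *\<^sub>R lap_integrand (fst p) (snd p)" for p
  have "continuous_on A (\<lambda>p. case (x, sqrt (fst p - snd p), snd p) of (x, \<sigma>, s) \<Rightarrow> Tk lgauss \<sigma> (\<lambda>y. f y s) x)"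
    by (rule continuous_on_compose2[OF src_Tk_cont[OF lgauss_kern]]) (use t in \<open>auto simp: A_def intro!: continuous_intros\<close>)
  then have "continuous_on A (\<lambda>p. lap_integrand (fst p) (snd p))"
    unfolding lap_integrand_def by (intro continuous_intros) (auto simp: A_def)
  then have "F \<in> borel_measurable borel"
    unfolding F_def using oA by (intro borel_measurable_continuous_on_indicator) auto
  then have mF: "F \<in> borel_measurable (lborel \<Otimes>\<^sub>M lborel)" by (simp add: lborel_prod)
  have F1: "F (\<tau>, s) = (indicator {0<..<t} \<tau> :: real) *\<^sub>R (indicator {0<..<\<tau>} s :: real) *\<^sub>R lap_integrand \<tau> s" for \<tau> s
    by (auto simp: F_def A_def indicator_def)
  have F2: "F (\<tau>, s) = (indicator {0<..<t} s :: real) *\<^sub>R (indicator {s<..<t} \<tau> :: real) *\<^sub>R lap_integrand \<tau> s" for \<tau> s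
    by (auto simp: F_def A_def indicator_def)
  let ?K = "real CARD('n) * (heat_const TYPE('n) * B) * Wc"
  have iF: "integrable (lborel \<Otimes>\<^sub>M lborel) F"
  proof (rule lborel_pair.Fubini_integrable[OF mF])
    show "integrable lborel (\<lambda>\<tau>. \<integral>s. norm (F (\<tau>, s)) \<partial>lborel)"
    proof (rule Bochner_Integration.integrable_bound)
      show "integrable lborel (\<lambda>s. ?K * (indicator {0<..<t} s *\<^sub>R s powr (-1/2)))"
        using set_integrable_inverse_sqrt[of t] t by (intro integrable_mult_right) (simp add: set_integrable_def)
      show "(\<lambda>\<tau>. \<integral>s. norm (F (\<tau>, s)) \<partial>lborel) \<in> borel_measurable lborel"
        using mF by (intro lborel.borel_measurable_lebesgue_integral) (simp add: case_prod_unfold)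
      show "AE \<tau> in lborel. norm (\<integral>s. norm (F (\<tau>, s)) \<partial>lborel) \<le> norm (?K * (indicator {0<..<t} \<tau> *\<^sub>R \<tau> powr (-1/2)))"
      proof (rule AE_I2)
        fix \<tau> :: real
        show "norm (\<integral>s. norm (F (\<tau>, s)) \<partial>lborel) \<le> norm (?K * (indicator {0<..<t} \<tau> *\<^sub>R \<tau> powr (-1/2)))"
        proof (cases "\<tau> \<in> {0<..<t}")
          case True
          then have "(\<integral>s. norm (F (\<tau>, s)) \<partial>lborel) \<le> ?K * \<tau> powr (-1/2)"
            using lap_duhamel_eq(3)[of \<tau>] t by (simp add: F1)
          moreover have "0 \<le> (\<integral>s. norm (F (\<tau>, s)) \<partial>lborel)" by simp
          ultimately show ?thesis using True by simp
        next
          case False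
          then show ?thesis by (simp add: F1)
        qed
      qed
    qed
    show "AE \<tau> in lborel. integrable lborel (\<lambda>s. F (\<tau>, s))"
    proof (rule AE_I2)
      fix \<tau> :: real
      show "integrable lborel (\<lambda>s. F (\<tau>, s))"
        using lap_duhamel_eq(2)[of \<tau>] t by (cases "\<tau> \<in> {0<..<t}") (simp_all add: F1)
    qed
  qed
  have in1: "(\<integral>s. F (\<tau>, s) \<partial>lborel) = indicator {0<..<t} \<tau> *\<^sub>R lap (duhamel f) x \<tau>" for \<tau>
    using lap_duhamel_eq(1)[of \<tau>] t by (cases "\<tau> \<in> {0<..<t}") (simp_all add: F1)
  have iF': "integrable (lborel \<Otimes>\<^sub>M lborel) (\<lambda>(a, b). F (a, b))" using iF by simp
  have il: "integrable lborel (\<lambda>\<tau>. indicator {0<..<t} \<tau> *\<^sub>R lap (duhamel f) x \<tau>)"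
    using lborel_pair.integrable_fst'[OF iF] by (simp add: in1)
  have ae: "AE s in lborel. integrable lborel (\<lambda>\<tau>. F (\<tau>, s))"
    by (rule lborel_pair.AE_integrable_snd[OF iF'])
  have in2: "AE s in lborel. (\<integral>\<tau>. F (\<tau>, s) \<partial>lborel) = indicator {0<..<t} s *\<^sub>R Tk gauss (sqrt (t - s)) (\<lambda>y. f y s) x - indicator {0<..<t} s *\<^sub>R f x s"
    using ae
  proof (eventually_elim)
    case (elim s)
    show ?case
    proof (cases "s \<in> {0<..<t}")
      case True
      then have "integrable lborel (\<lambda>\<tau>. indicator {s<..<t} \<tau> *\<^sub>R lap_integrand \<tau> s)" using elim by (simp add: F2)
      then show ?thesis using lap_integrand_time_integral[of s t] True t by (simp add: F2)
    qed (simp add: F2)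
  qed
  have m1: "(\<lambda>s. \<integral>\<tau>. F (\<tau>, s) \<partial>lborel) \<in> borel_measurable lborel"
  proof -
    have "integrable (lborel \<Otimes>\<^sub>M lborel) (\<lambda>(b, a). F (a, b))" using lborel_pair.integrable_product_swap[OF iF] by (simp add: case_prod_unfold)
    then have "integrable lborel (\<lambda>b. \<integral>a. F (a, b) \<partial>lborel)" using lborel_pair.integrable_fst by blast
    then show ?thesis by simp
  qed
  note i1 = duhamel_eq(2)[OF t] src_integrable[OF t]
  have "(\<integral>\<tau>. indicator {0<..<t} \<tau> *\<^sub>R lap (duhamel f) x \<tau> \<partial>lborel) = (\<integral>\<tau>. (\<integral>s. F (\<tau>, s) \<partial>lborel) \<partial>lborel)"
    by (simp add: in1)
  also have "\<dots> = (\<integral>s. (\<integral>\<tau>. F (\<tau>, s) \<partial>lborel) \<partial>lborel)"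
    using lborel_pair.Fubini_integral[OF iF'] by simp
  also have "\<dots> = (\<integral>s. indicator {0<..<t} s *\<^sub>R Tk gauss (sqrt (t - s)) (\<lambda>y. f y s) x - indicator {0<..<t} s *\<^sub>R f x s \<partial>lborel)"
    by (rule integral_cong_AE[OF m1 _ in2]) (use i1 in auto)
  also have "\<dots> = duhamel f x t - (\<integral>s. indicator {0<..<t} s *\<^sub>R f x s \<partial>lborel)"
    using i1 by (simp add: duhamel_eq(1)[OF t])
  finally have "duhamel f x t = (\<integral>\<tau>. indicator {0<..<t} \<tau> *\<^sub>R lap (duhamel f) x \<tau> \<partial>lborel) + (\<integral>s. indicator {0<..<t} s *\<^sub>R f x s \<partial>lborel)"
    by simp
  then show "duhamel f x t = (LBINT \<tau>:{0<..<t}. lap (duhamel f) x \<tau> + f x \<tau>)"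
    using il i1(2) by (simp add: set_lebesgue_integral_def scaleR_right_distrib)
  show "set_integrable lborel {0<..<t} (\<lambda>\<tau>. lap (duhamel f) x \<tau> + f x \<tau>)"
    using il i1(2) by (simp add: set_integrable_def scaleR_right_distrib)
qed

lemma duhamel_time_derivative:
  assumes t: "0 < t" "t < T"
  shows "((\<lambda>t. duhamel f x t) has_vector_derivative (lap (duhamel f) x t + f x t)) (at t)"
proof -
  let ?G = "\<lambda>\<tau>. lap (duhamel f) x \<tau> + f x \<tau>"
  have slice: "continuous_on {0<..T} (g x)" if "continuous_on (UNIV \<times> {0<..T}) (\<lambda>(y, t). g y t)" for g :: "real^'n \<Rightarrow> real \<Rightarrow> 'b"
  proof -
    have "continuous_on {0<..T} (\<lambda>s. case (x, s) of (y, s) \<Rightarrow> g y s)"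
      by (rule continuous_on_compose2[OF that]) (auto intro!: continuous_intros)
    then show ?thesis by simp
  qed
  have cG: "continuous_on {0<..T} ?G"
    unfolding lap_def
    using src duhamel_jet(1)[OF src B0] by (intro continuous_intros slice) (auto simp: src_def c1_def jet_def)
  \<comment> \<open>The integrand is continuous for positive times but may blow up at time zero, so
    the integral up to \<open>t / 2\<close> is put into the constant \<open>c\<close>.\<close>
  define t0 where "t0 = t / 2"
  have t0: "0 < t0" "t0 < t" using t by (auto simp: t0_def)
  define c where "c = (LBINT \<tau>:{0<..t0}. ?G \<tau>)"
  have c0: "continuous_on {t0..T} ?G" by (rule continuous_on_subset[OF cG]) (use t0 in auto)
  have eq: "duhamel f x r = c + integral {t0..r} ?G" if "t0 < r" "r \<le> T" for r
  proof -
    have r: "0 < r" using that t0 by simp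
    note si = duhamel_integral_equation(2)[OF r that(2)]
    have u: "{0<..<r} = {0<..t0} \<union> {t0<..<r}" using that t0 by auto
    have s1: "set_integrable lborel {0<..t0} ?G" "set_integrable lborel {t0<..<r} ?G"
      by (rule set_integrable_subset[OF si]; use that t0 in auto)+
    have "duhamel f x r = c + (LBINT \<tau>:{t0<..<r}. ?G \<tau>)"
      unfolding duhamel_integral_equation(1)[OF r that(2)] u c_def
      by (rule set_integral_Un[OF _ s1]) auto
    also have "(LBINT \<tau>:{t0<..<r}. ?G \<tau>) = integral {t0<..<r} ?G"
      by (rule set_borel_integral_eq_integral(2)[OF s1(2)])
    also have "\<dots> = integral {t0..r} ?G" by (rule integral_open_interval_real[symmetric])
    finally show ?thesis .
  qed
  have "((\<lambda>u. integral {t0..u} ?G) has_vector_derivative ?G t) (at t within {t0..T})"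
    by (rule integral_has_vector_derivative[OF c0]) (use t t0 in auto)
  then have "((\<lambda>u. integral {t0..u} ?G) has_vector_derivative ?G t) (at t)"
    using t t0 by (simp add: at_within_Icc_at)
  then have d: "((\<lambda>u. c + integral {t0..u} ?G) has_vector_derivative ?G t) (at t)"
    by (auto intro!: derivative_eq_intros)
  show ?thesis
    by (rule has_vector_derivative_transform_within_open[OF d, of "{t0<..<T}"]) (use eq t t0 in auto)
qed

end

section \<open>Rotation equivariance\<close>

lemma nn_integral_lborel_translate:
  fixes h :: "'a::euclidean_space \<Rightarrow> ennreal"
  assumes "h \<in> borel_measurable borel"
  shows "(\<integral>\<^sup>+z. h (c + z) \<partial>lborel) = (\<integral>\<^sup>+z. h z \<partial>lborel)"
proof -
  have "(\<integral>\<^sup>+z. h z \<partial>lborel) = (\<integral>\<^sup>+z. h z \<partial>distr lborel borel ((+) c))" by (simp add: lborel_distr_plus)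
  also have "\<dots> = (\<integral>\<^sup>+z. h (c + z) \<partial>lborel)" by (rule nn_integral_distr) (use assms in auto)
  finally show ?thesis by simp
qed

text \<open>
  As in the uniqueness proof for Haar measure, Fubini and translation invariance show that the image
  measure is a multiple of Lebesgue measure; a rotation invariant density of mass one makes the factor one.
\<close>

lemma lborel_distr_orthogonal:
  fixes R :: "'a::euclidean_space \<Rightarrow> 'a"
  assumes R: "orthogonal_transformation R"
  shows "distr lborel borel R = lborel"
proof (rule measure_eqI)
  show "sets (distr lborel borel R) = sets lborel" by simp
  fix A assume "A \<in> sets (distr lborel borel R)"
  then have A[measurable]: "A \<in> sets borel" by simp
  have lin: "linear R" and nR: "\<And>x. norm (R x) = norm x"
    using R by (auto simp: orthogonal_transformation)
  have "continuous_on UNIV R" using lin by (simp add: linear_continuous_on linear_conv_bounded_linear)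
  then have [measurable]: "R \<in> borel_measurable borel" by (rule borel_measurable_continuous_onI)
  obtain Q where Q: "\<And>x. R (Q x) = x"
    using orthogonal_transformation_surj[OF R] by (metis surjD)
  let ?g = "\<lambda>z::'a. ennreal (gauss z)"
  have [measurable]: "gauss \<in> borel_measurable (borel :: 'a measure)"
    by (intro borel_measurable_continuous_onI continuous_intros)
  have g1: "(\<integral>\<^sup>+z. ?g z \<partial>lborel) = 1"
    using nn_integral_eq_integral[OF kern_integrable[OF gauss_kern]] by (simp add: gauss_nonneg integral_gauss)
  have gR: "gauss (y - R x) = gauss (- Q y + x)" for x y
  proof -
    have "R (- Q y + x) = - (y - R x)" by (simp add: linear_add[OF lin] linear_diff[OF lin] linear_neg[OF lin] Q)
    then have "norm (- Q y + x) = norm (y - R x)" by (metis nR norm_minus_cancel)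
    then show ?thesis by (simp add: gauss_def)
  qed
  have "emeasure (distr lborel borel R) A = (\<integral>\<^sup>+x. indicator A (R x) \<partial>lborel)"
    by (simp add: nn_integral_indicator[symmetric] nn_integral_distr del: nn_integral_indicator)
  also have "\<dots> = (\<integral>\<^sup>+y. ?g y * (\<integral>\<^sup>+x. indicator A (R x) \<partial>lborel) \<partial>lborel)"
    by (subst nn_integral_multc) (auto simp: g1)
  also have "\<dots> = (\<integral>\<^sup>+y. (\<integral>\<^sup>+x. ?g y * indicator A (R x + y) \<partial>lborel) \<partial>lborel)"
  proof (rule nn_integral_cong)
    fix y
    have "(\<integral>\<^sup>+x. indicator A (R x) \<partial>lborel) = (\<integral>\<^sup>+x. indicator A (R (Q y + x)) \<partial>lborel :: ennreal)"
      by (rule nn_integral_lborel_translate[symmetric]) measurable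
    also have "\<dots> = (\<integral>\<^sup>+x. indicator A (R x + y) \<partial>lborel)"
      by (simp add: linear_add[OF lin] Q add.commute)
    finally show "?g y * (\<integral>\<^sup>+x. indicator A (R x) \<partial>lborel) = (\<integral>\<^sup>+x. ?g y * indicator A (R x + y) \<partial>lborel)"
      by (simp add: nn_integral_cmult)
  qed
  also have "\<dots> = (\<integral>\<^sup>+x. (\<integral>\<^sup>+y. ?g y * indicator A (R x + y) \<partial>lborel) \<partial>lborel)"
    by (rule lborel_pair.Fubini'[symmetric]) measurable
  also have "\<dots> = (\<integral>\<^sup>+x. (\<integral>\<^sup>+y. ?g (y - R x) * indicator A y \<partial>lborel) \<partial>lborel)"
  proof (rule nn_integral_cong)
    fix x
    show "(\<integral>\<^sup>+y. ?g y * indicator A (R x + y) \<partial>lborel) = (\<integral>\<^sup>+y. ?g (y - R x) * indicator A y \<partial>lborel)"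
      using nn_integral_lborel_translate[of "\<lambda>y. ?g (y - R x) * indicator A y" "R x"] by simp
  qed
  also have "\<dots> = (\<integral>\<^sup>+y. (\<integral>\<^sup>+x. ?g (y - R x) * indicator A y \<partial>lborel) \<partial>lborel)"
    by (rule lborel_pair.Fubini') measurable
  also have "\<dots> = (\<integral>\<^sup>+y. indicator A y \<partial>lborel)"
  proof (rule nn_integral_cong)
    fix y
    have "(\<integral>\<^sup>+x. ?g (y - R x) \<partial>lborel) = 1"
      unfolding gR using nn_integral_lborel_translate[of ?g "- Q y"] g1 by simp
    then show "(\<integral>\<^sup>+x. ?g (y - R x) * indicator A y \<partial>lborel) = indicator A y"
      by (subst nn_integral_multc) auto
  qed
  also have "\<dots> = emeasure lborel A" by simp
  finally show "emeasure (distr lborel borel R) A = emeasure lborel A" .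
qed

text \<open>Both the Gaussian kernel and Lebesgue measure are invariant under
  \<open>R\<close>.\<close>

lemma Tk_gauss_equivariant:
  fixes f :: "'a::euclidean_space \<Rightarrow> 'a"
  assumes R: "orthogonal_transformation R" and f: "continuous_on UNIV f" "\<And>y. norm (f y) \<le> B"
    and eq: "\<And>y. f (R y) = R (f y)"
  shows "Tk gauss \<sigma> f (R x) = R (Tk gauss \<sigma> f x)"
proof -
  have lin: "linear R" and nR: "\<And>x. norm (R x) = norm x"
    using R by (auto simp: orthogonal_transformation)
  have bl: "bounded_linear R" using lin by (simp add: linear_conv_bounded_linear)
  have "continuous_on UNIV R" using bl by (simp add: linear_continuous_on)
  then have mR: "R \<in> borel_measurable borel" by (rule borel_measurable_continuous_onI)
  have mf: "(\<lambda>z. gauss z *\<^sub>R f (R x + \<sigma> *\<^sub>R z)) \<in> borel_measurable borel"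
    by (intro borel_measurable_continuous_onI continuous_intros continuous_on_compose2[OF f(1)]) auto
  have "Tk gauss \<sigma> f (R x) = (\<integral>z. gauss z *\<^sub>R f (R x + \<sigma> *\<^sub>R z) \<partial>distr lborel borel R)"
    by (simp add: Tk_def lborel_distr_orthogonal[OF R])
  also have "\<dots> = (\<integral>z. gauss (R z) *\<^sub>R f (R x + \<sigma> *\<^sub>R R z) \<partial>lborel)"
    by (rule integral_distr) (use mR mf in auto)
  also have "\<dots> = (\<integral>z. R (gauss z *\<^sub>R f (x + \<sigma> *\<^sub>R z)) \<partial>lborel)"
  proof (rule Bochner_Integration.integral_cong[OF refl])
    fix z
    have "R x + \<sigma> *\<^sub>R R z = R (x + \<sigma> *\<^sub>R z)" by (simp add: linear_add[OF lin] linear_cmul[OF lin])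
    then show "gauss (R z) *\<^sub>R f (R x + \<sigma> *\<^sub>R R z) = R (gauss z *\<^sub>R f (x + \<sigma> *\<^sub>R z))"
      by (simp add: gauss_def nR eq linear_cmul[OF lin])
  qed
  also have "\<dots> = R (Tk gauss \<sigma> f x)"
    unfolding Tk_def by (rule integral_bounded_linear[OF bl Tk_integrable[OF gauss_kern f]])
  finally show ?thesis .
qed

section \<open>Local existence\<close>

lemma geometric_limit:
  fixes s :: "nat \<Rightarrow> 'b::banach"
  assumes s: "\<And>k. norm (s (Suc k) - s k) \<le> a * (1/2) ^ Suc k"
  shows "\<exists>l. s \<longlonglongrightarrow> l \<and> (\<forall>m. norm (l - s m) \<le> a * (1/2) ^ m)"
proof -
  have a0: "0 \<le> a" using order_trans[OF norm_ge_zero s[of 0]] by simp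
  have d: "norm (s (m + k) - s m) \<le> a * ((1/2) ^ m - (1/2) ^ (m + k))" for m k
  proof (induction k)
    case (Suc k)
    have "norm (s (m + Suc k) - s m) \<le> norm (s (Suc (m + k)) - s (m + k)) + norm (s (m + k) - s m)"
      using norm_triangle_ineq[of "s (Suc (m + k)) - s (m + k)" "s (m + k) - s m"] by simp
    also have "\<dots> \<le> a * (1/2) ^ Suc (m + k) + a * ((1/2) ^ m - (1/2) ^ (m + k))"
      by (intro add_mono s Suc)
    also have "\<dots> = a * ((1/2) ^ m - (1/2) ^ (m + Suc k))" by (simp add: algebra_simps)
    finally show ?case .
  qed simp
  have d': "norm (s n - s m) \<le> a * (1/2) ^ m" if "m \<le> n" for m n
  proof -
    have "norm (s n - s m) \<le> a * ((1/2) ^ m - (1/2) ^ n)" using d[of m "n - m"] that by simp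
    also have "\<dots> \<le> a * (1/2) ^ m" using a0 by (intro mult_left_mono) auto
    finally show ?thesis .
  qed
  have "Cauchy s"
  proof (rule metric_CauchyI)
    fix e :: real assume e: "0 < e"
    have "(\<lambda>m. a * (1/2) ^ m) \<longlonglongrightarrow> a * 0" by (intro tendsto_mult tendsto_const LIMSEQ_realpow_zero) auto
    then obtain N where N': "\<And>m. m \<ge> N \<Longrightarrow> norm (a * (1/2) ^ m) < e / 2"
      using e LIMSEQ_D[of "\<lambda>m. a * (1/2) ^ m" 0 "e/2"] by auto
    have N: "a * (1/2) ^ N < e / 2" using N'[OF order_refl] by (metis abs_ge_self le_less_trans real_norm_def)
    show "\<exists>M. \<forall>m\<ge>M. \<forall>n\<ge>M. dist (s m) (s n) < e"
    proof (intro exI allI impI)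
      fix m n assume "m \<ge> N" "n \<ge> N"
      then have "dist (s m) (s N) < e / 2" "dist (s n) (s N) < e / 2"
        using d'[of N m] d'[of N n] N by (auto simp: dist_norm)
      then show "dist (s m) (s n) < e" by (rule dist_triangle_half_l)
    qed
  qed
  then obtain l where l: "s \<longlonglongrightarrow> l" using Cauchy_convergent convergent_def by blast
  have "norm (l - s m) \<le> a * (1/2) ^ m" for m
  proof (rule LIMSEQ_le_const2)
    show "(\<lambda>n. norm (s n - s m)) \<longlonglongrightarrow> norm (l - s m)" by (intro tendsto_intros l)
    show "\<exists>N. \<forall>n\<ge>N. norm (s n - s m) \<le> a * (1/2) ^ m" using d' by blast
  qed
  then show ?thesis using l by blast
qed

text \<open>The bound \<open>a t\<close> may blow up as \<open>t\<close> tends to zero; being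
  decreasing it is uniform for \<open>t \<ge> s\<close>, and that is enough for continuity at
  positive times. At each fixed \<open>t\<close> the gradients converge uniformly in space, so the
  limit may be differentiated.\<close>

lemma c1_limit:
  fixes W :: "nat \<Rightarrow> real ^ 'n \<Rightarrow> real \<Rightarrow> 'b::euclidean_space"
  assumes W: "\<And>m. c1 T (W m)"
    and w: "\<And>m x t. 0 < t \<Longrightarrow> t \<le> T \<Longrightarrow> norm (W (Suc m) x t - W m x t) \<le> a t * (1/2) ^ Suc m"
    and pw: "\<And>m j x t. 0 < t \<Longrightarrow> t \<le> T \<Longrightarrow> norm (pd j (W (Suc m)) x t - pd j (W m) x t) \<le> a t * (1/2) ^ Suc m"
    and a: "\<And>s t. 0 < s \<Longrightarrow> s \<le> t \<Longrightarrow> a t \<le> a s"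
  shows "\<exists>u. c1 T u \<and> (\<forall>x t. 0 < t \<longrightarrow> t \<le> T \<longrightarrow> (\<lambda>m. W m x t) \<longlonglongrightarrow> u x t \<and> (\<forall>j. (\<lambda>m. pd j (W m) x t) \<longlonglongrightarrow> pd j u x t))"
proof -
  define u where "u x t = lim (\<lambda>m. W m x t)" for x t
  define p where "p j x t = lim (\<lambda>m. pd j (W m) x t)" for j x t
  have u: "(\<lambda>m. W m x t) \<longlonglongrightarrow> u x t" "\<And>m. norm (u x t - W m x t) \<le> a t * (1/2) ^ m" if "0 < t" "t \<le> T" for x t
    using geometric_limit[of "\<lambda>m. W m x t", OF w[OF that]] limI unfolding u_def by metis+
  have p: "(\<lambda>m. pd j (W m) x t) \<longlonglongrightarrow> p j x t" "\<And>m. norm (p j x t - pd j (W m) x t) \<le> a t * (1/2) ^ m" if "0 < t" "t \<le> T" for j x t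
    using geometric_limit[of "\<lambda>m. pd j (W m) x t", OF pw[OF that]] limI unfolding p_def by metis+
  have geo: "(\<lambda>m. c * (1/2) ^ m) \<longlonglongrightarrow> 0" for c :: real
    using tendsto_mult[OF tendsto_const[of c] LIMSEQ_realpow_zero[of "1/2"]] by simp
  have cont: "continuous_on (UNIV \<times> {0<..T}) (\<lambda>(x, t). g x t)"
    if V: "\<And>m. continuous_on (UNIV \<times> {0<..T}) (\<lambda>(x, t). V m x t)"
      and g: "\<And>x t m. 0 < t \<Longrightarrow> t \<le> T \<Longrightarrow> norm (g x t - V m x t) \<le> a t * (1/2) ^ m"
    for V and g :: "real ^ 'n \<Rightarrow> real \<Rightarrow> 'b"
  proof -
    have "continuous_on {p \<in> UNIV \<times> {..T}. 0 < snd p} (\<lambda>(x, t). g x t)"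
    proof (rule continuous_on_positive_time)
      show "continuous_on UNIV (snd :: (real^'n) \<times> real \<Rightarrow> real)" by (intro continuous_intros)
      fix s :: real assume s: "0 < s"
      let ?P = "{p \<in> (UNIV :: (real^'n) set) \<times> {..T}. s \<le> snd p}"
      have "uniform_limit ?P (\<lambda>m (x, t). V m x t) (\<lambda>(x, t). g x t) sequentially"
      proof (rule uniform_limitI)
        fix e :: real assume e: "0 < e"
        have "\<forall>\<^sub>F m in sequentially. a s * (1/2) ^ m < e" using order_tendstoD(2)[OF geo e] .
        then show "\<forall>\<^sub>F m in sequentially. \<forall>q\<in>?P. dist (case q of (x, t) \<Rightarrow> V m x t) (case q of (x, t) \<Rightarrow> g x t) < e"
        proof eventually_elim
          case (elim m)
          have "norm (g x t - V m x t) < e" if "s \<le> t" "t \<le> T" for x t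
          proof -
            have "norm (g x t - V m x t) \<le> a t * (1/2) ^ m" using g that s by auto
            also have "\<dots> \<le> a s * (1/2) ^ m" using a[OF s that(1)] by (intro mult_right_mono) auto
            finally show ?thesis using elim by simp
          qed
          then show ?case by (auto simp: dist_norm norm_minus_commute)
        qed
      qed
      then show "continuous_on ?P (\<lambda>(x, t). g x t)"
        by (rule uniform_limit_theorem[rotated])
           (auto intro!: always_eventually continuous_on_subset[OF V] simp: s intro: less_le_trans[OF s])
    qed
    moreover have "{p \<in> UNIV \<times> {..T}. 0 < snd p} = (UNIV :: (real^'n) set) \<times> {0<..T}" by auto
    ultimately show ?thesis by simp
  qed
  have cu: "continuous_on (UNIV \<times> {0<..T}) (\<lambda>(x, t). u x t)"
    by (rule cont[of W, OF _ u(2)]) (use W in \<open>auto simp: c1_def\<close>)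
  have cp: "continuous_on (UNIV \<times> {0<..T}) (\<lambda>(x, t). p j x t)" for j
    by (rule cont[of "\<lambda>m. pd j (W m)", OF _ p(2)]) (use W in \<open>auto simp: c1_def\<close>)
  have der: "((\<lambda>y. u y t) has_derivative (\<lambda>h. \<Sum>j\<in>UNIV. h $ j *\<^sub>R p j x t)) (at x)" if t: "0 < t" "t \<le> T" for x t
  proof -
    have "\<exists>g. \<forall>x\<in>UNIV. (\<lambda>m. W m x t) \<longlonglongrightarrow> g x \<and> (g has_derivative (\<lambda>h. \<Sum>j\<in>UNIV. h $ j *\<^sub>R p j x t)) (at x)"
    proof (rule has_derivative_sequence[where f'="\<lambda>m x h. \<Sum>j\<in>UNIV. h $ j *\<^sub>R pd j (W m) x t" and ?x0.0=0])
      show "((\<lambda>y. W m y t) has_derivative (\<lambda>h. \<Sum>j\<in>UNIV. h $ j *\<^sub>R pd j (W m) x t)) (at x)" for m x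
        by (rule c1_has_derivative[OF W t])
      show "(\<lambda>m. W m 0 t) \<longlonglongrightarrow> u 0 t" by (rule u(1)[OF t])
      fix e :: real assume e: "0 < e"
      have "\<forall>\<^sub>F m in sequentially. real CARD('n) * a t * (1/2) ^ m < e" using order_tendstoD(2)[OF geo e] .
      then show "\<forall>\<^sub>F m in sequentially. \<forall>x\<in>UNIV. \<forall>h. norm ((\<Sum>j\<in>UNIV. h $ j *\<^sub>R pd j (W m) x t) - (\<Sum>j\<in>UNIV. h $ j *\<^sub>R p j x t)) \<le> e * norm h"
      proof eventually_elim
        case (elim m)
        have "norm ((\<Sum>j\<in>UNIV. h $ j *\<^sub>R pd j (W m) x t) - (\<Sum>j\<in>UNIV. h $ j *\<^sub>R p j x t)) \<le> e * norm h" for x h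
        proof -
          have "norm ((\<Sum>j\<in>UNIV. h $ j *\<^sub>R pd j (W m) x t) - (\<Sum>j\<in>UNIV. h $ j *\<^sub>R p j x t)) =
            norm (\<Sum>j\<in>UNIV. h $ j *\<^sub>R (pd j (W m) x t - p j x t))"
            by (simp add: scaleR_right_diff_distrib sum_subtractf)
          also have "\<dots> \<le> (\<Sum>j\<in>(UNIV::'n set). norm h * (a t * (1/2) ^ m))"
            using p(2)[OF t, of _ x m]
            by (intro sum_norm_le, unfold norm_scaleR, intro mult_mono)
               (auto simp: component_le_norm_cart norm_minus_commute)
          also have "\<dots> = (real CARD('n) * a t * (1/2) ^ m) * norm h" by simp
          also have "\<dots> \<le> e * norm h" using elim by (intro mult_right_mono) auto
          finally show ?thesis .
        qed
        then show ?case by blast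
      qed
    qed auto
    then obtain g where g: "\<And>x. (\<lambda>m. W m x t) \<longlonglongrightarrow> g x" "\<And>x. (g has_derivative (\<lambda>h. \<Sum>j\<in>UNIV. h $ j *\<^sub>R p j x t)) (at x)"
      by auto
    have "g = (\<lambda>y. u y t)" using LIMSEQ_unique[OF g(1) u(1)[OF t]] by auto
    then show ?thesis using g(2) by simp
  qed
  note c = c1I[where T=T and u=u and p=p, OF cu cp der]
  show ?thesis
    by (rule exI[of _ u]) (use c u(1) p(1) in auto)
qed

lemma jet_cong:
  assumes u: "jet T A u" and eq: "\<And>x t. 0 < t \<Longrightarrow> t \<le> T \<Longrightarrow> u x t = v x t"
  shows "jet T A v" and "\<And>j l x t. 0 < t \<Longrightarrow> t \<le> T \<Longrightarrow> pd l (pd j v) x t = pd l (pd j u) x t"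
proof -
  have u1: "c1 T u" "\<And>j. c1 T (pd j u)" using u by (auto simp: jet_def)
  note a = c1_cong[OF u1(1) eq]
  have e: "pd j u x t = pd j v x t" if "0 < t" "t \<le> T" for j x t using a(2)[OF _ _ that] by simp
  note b = c1_cong[OF u1(2) e]
  show 1: "\<And>j l x t. 0 < t \<Longrightarrow> t \<le> T \<Longrightarrow> pd l (pd j v) x t = pd l (pd j u) x t"
    using c1_cong(2)[OF u1(2) e] by metis
  show "jet T A v"
    unfolding jet_def using u a(1) b(1) 1 by (auto simp: jet_def eq[symmetric] e[symmetric])
qed

text \<open>\<open>c1_limit\<close> is used twice: for the fields, and for their partial derivatives
  as sequences of their own. Uniqueness of limits identifies the second family of limits with the
  partial derivatives of the first.\<close>

lemma jet_limit:
  fixes U :: "nat \<Rightarrow> real ^ 'n \<Rightarrow> real \<Rightarrow> 'b::euclidean_space"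
  assumes U: "\<And>m. jet T C (U m)" and d: "\<And>m. jet T (A * (1/2) ^ Suc m) (\<lambda>x t. U (Suc m) x t - U m x t)" and A: "0 \<le> A"
  shows "\<exists>u. jet T C u \<and> (\<forall>m. jet T (A * (1/2) ^ m) (\<lambda>x t. u x t - U m x t)) \<and> (\<forall>x t. 0 < t \<longrightarrow> t \<le> T \<longrightarrow> (\<lambda>m. U m x t) \<longlonglongrightarrow> u x t)"
proof -
  have U1: "c1 T (U m)" "c1 T (pd j (U m))" for m j using U[of m] by (auto simp: jet_def)
  define a where "a t = A + A / sqrt t + A / t" for t
  have a0: "A * c \<le> a t * c" "A * c / sqrt t \<le> a t * c" "A * c / t \<le> a t * c" if "0 < t" "0 \<le> c" for t c
  proof -
    have "0 \<le> A / sqrt t" "0 \<le> A / t" using that A by auto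
    then have "A \<le> a t" "A / sqrt t \<le> a t" "A / t \<le> a t" using A by (auto simp: a_def)
    then show "A * c \<le> a t * c" "A * c / sqrt t \<le> a t * c" "A * c / t \<le> a t * c"
      using mult_right_mono[OF _ that(2)] by fastforce+
  qed
  have am: "a t \<le> a s" if "0 < s" "s \<le> t" for s t
    unfolding a_def using that A by (intro add_mono divide_left_mono order_refl) auto
  have df: "norm (U (Suc m) x t - U m x t) \<le> A * (1/2) ^ Suc m"
    "norm (pd j (U (Suc m)) x t - pd j (U m) x t) \<le> A * (1/2) ^ Suc m / sqrt t"
    "norm (pd l (pd j (U (Suc m))) x t - pd l (pd j (U m)) x t) \<le> A * (1/2) ^ Suc m / t"
    if t: "0 < t" "t \<le> T" for m j l x t
  proof -
    note s1 = c1_sum_op(3,4)[OF U1(1)[of "Suc m"] U1(1)[of m]]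
    note s2 = c1_sum_op(3,4)[OF U1(2)[of j "Suc m"] U1(2)[of j m]]
    have e: "pd j (U (Suc m)) x t - pd j (U m) x t = pd j (\<lambda>x t. U (Suc m) x t - U m x t) x t" if "0 < t" "t \<le> T" for x t
      using s1(2)[OF that] by simp
    have e2: "pd l (pd j (\<lambda>x t. U (Suc m) x t - U m x t)) x t = pd l (pd j (U (Suc m))) x t - pd l (pd j (U m)) x t"
      using c1_cong(2)[OF s2(1) e t, of l] s2(2)[OF t, of l] by simp
    have "t \<in> {0<..T}" using t by simp
    then show "norm (U (Suc m) x t - U m x t) \<le> A * (1/2) ^ Suc m"
      "norm (pd j (U (Suc m)) x t - pd j (U m) x t) \<le> A * (1/2) ^ Suc m / sqrt t"
      "norm (pd l (pd j (U (Suc m))) x t - pd l (pd j (U m)) x t) \<le> A * (1/2) ^ Suc m / t"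
      using d[of m] unfolding jet_def e[OF t] e2[symmetric] by blast+
  qed
  have c0: "0 \<le> (1/2 :: real) ^ Suc m" for m by simp
  have dfa: "norm (U (Suc m) x t - U m x t) \<le> a t * (1/2) ^ Suc m"
    "norm (pd j (U (Suc m)) x t - pd j (U m) x t) \<le> a t * (1/2) ^ Suc m"
    "norm (pd l (pd j (U (Suc m))) x t - pd l (pd j (U m)) x t) \<le> a t * (1/2) ^ Suc m"
    if t: "0 < t" "t \<le> T" for m j l x t
    by (rule order_trans[OF df(1)[OF t] a0(1)[OF t(1) c0]], rule order_trans[OF df(2)[OF t] a0(2)[OF t(1) c0]],
        rule order_trans[OF df(3)[OF t] a0(3)[OF t(1) c0]])
  have "\<exists>u. c1 T u \<and> (\<forall>x t. 0 < t \<longrightarrow> t \<le> T \<longrightarrow> (\<lambda>m. U m x t) \<longlonglongrightarrow> u x t \<and> (\<forall>j. (\<lambda>m. pd j (U m) x t) \<longlonglongrightarrow> pd j u x t))"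
    by (rule c1_limit[of T U a, OF U1(1) dfa(1) dfa(2) am])
  then obtain u where u: "c1 T u" "\<And>x t. 0 < t \<Longrightarrow> t \<le> T \<Longrightarrow> (\<lambda>m. U m x t) \<longlonglongrightarrow> u x t"
    "\<And>x t j. 0 < t \<Longrightarrow> t \<le> T \<Longrightarrow> (\<lambda>m. pd j (U m) x t) \<longlonglongrightarrow> pd j u x t" by blast
  have "\<forall>j. \<exists>v. c1 T v \<and> (\<forall>x t. 0 < t \<longrightarrow> t \<le> T \<longrightarrow> (\<lambda>m. pd j (U m) x t) \<longlonglongrightarrow> v x t \<and> (\<forall>l. (\<lambda>m. pd l (pd j (U m)) x t) \<longlonglongrightarrow> pd l v x t))"
    by (rule allI, rule c1_limit[of T "\<lambda>m. pd _ (U m)" a, OF U1(2) dfa(2) dfa(3) am])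
  then obtain v where v: "\<And>j. c1 T (v j)" "\<And>j x t. 0 < t \<Longrightarrow> t \<le> T \<Longrightarrow> (\<lambda>m. pd j (U m) x t) \<longlonglongrightarrow> v j x t"
    "\<And>j l x t. 0 < t \<Longrightarrow> t \<le> T \<Longrightarrow> (\<lambda>m. pd l (pd j (U m)) x t) \<longlonglongrightarrow> pd l (v j) x t"
    by (rule exE[OF choice]) blast
  have vu: "v j x t = pd j u x t" if "0 < t" "t \<le> T" for j x t
    using LIMSEQ_unique[OF v(2)[OF that] u(3)[OF that]] .
  have u2: "c1 T (pd j u)" for j by (rule c1_cong(1)[OF v(1) vu])
  have u3: "(\<lambda>m. pd l (pd j (U m)) x t) \<longlonglongrightarrow> pd l (pd j u) x t" if "0 < t" "t \<le> T" for j l x t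
    using v(3)[OF that] c1_cong(2)[OF v(1) vu that] by simp
  \<comment> \<open>Pointwise limits preserve the bounds in \<open>jet\<close>. The claim is used
    with \<open>V = 0\<close> for the bound \<open>C\<close> and with \<open>V = U m\<close> for the
    distance to the limit.\<close>
  have closed: "jet T K (\<lambda>x t. u x t - V x t)"
    if V: "c1 T V" "\<And>j. c1 T (pd j V)" and K: "\<And>k. k \<ge> N \<Longrightarrow> jet T K (\<lambda>x t. U k x t - V x t)" for V K N
  proof -
    note su = c1_sum_op(3,4)[OF u(1) V(1)]
    note su2 = c1_sum_op(3,4)[OF u2 V(2)]
    note sk = c1_sum_op(3,4)[OF U1(1) V(1)]
    note sk2 = c1_sum_op(3,4)[OF U1(2) V(2)]
    have e: "pd j u x t - pd j V x t = pd j (\<lambda>x t. u x t - V x t) x t" if "0 < t" "t \<le> T" for j x t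
      using su(2)[OF that] by simp
    have ek: "pd j (U k) x t - pd j V x t = pd j (\<lambda>x t. U k x t - V x t) x t" if "0 < t" "t \<le> T" for j x t k
      using sk(2)[OF that] by simp
    have pp: "pd l (pd j (\<lambda>x t. u x t - V x t)) x t = pd l (pd j u) x t - pd l (pd j V) x t" if "0 < t" "t \<le> T" for j l x t
      using c1_cong(2)[OF su2(1) e that] su2(2)[OF that] by simp
    have ppk: "pd l (pd j (\<lambda>x t. U k x t - V x t)) x t = pd l (pd j (U k)) x t - pd l (pd j V) x t" if "0 < t" "t \<le> T" for j l x t k
      using c1_cong(2)[OF sk2(1) ek that] sk2(2)[OF that] by simp
    have "norm (u x t - V x t) \<le> K" "norm (pd j u x t - pd j V x t) \<le> K / sqrt t" "norm (pd l (pd j u) x t - pd l (pd j V) x t) \<le> K / t"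
      if t: "0 < t" "t \<le> T" for j l x t
    proof -
      have b: "norm (U k x t - V x t) \<le> K" "norm (pd j (U k) x t - pd j V x t) \<le> K / sqrt t"
        "norm (pd l (pd j (U k)) x t - pd l (pd j V) x t) \<le> K / t" if "k \<ge> N" for k
        using K[OF that] t unfolding jet_def ek[OF t] ppk[OF t, symmetric] by auto
      show "norm (u x t - V x t) \<le> K"
        by (rule LIMSEQ_le_const2[OF tendsto_norm[OF tendsto_diff[OF u(2)[OF t] tendsto_const]]]) (use b in blast)
      show "norm (pd j u x t - pd j V x t) \<le> K / sqrt t"
        by (rule LIMSEQ_le_const2[OF tendsto_norm[OF tendsto_diff[OF u(3)[OF t] tendsto_const]]]) (use b in blast)
      show "norm (pd l (pd j u) x t - pd l (pd j V) x t) \<le> K / t"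
        by (rule LIMSEQ_le_const2[OF tendsto_norm[OF tendsto_diff[OF u3[OF t] tendsto_const]]]) (use b in blast)
    qed
    then show ?thesis
      unfolding jet_def using su(1) c1_cong(1)[OF su2(1) e] pp su(2) by auto
  qed
  have z0: "((\<lambda>y::real^'n. 0 :: 'b) has_derivative (\<lambda>h. \<Sum>j\<in>UNIV. h $ j *\<^sub>R 0)) (at x)" for x by simp
  have z2: "pd j (\<lambda>x t. 0 :: 'b) = (\<lambda>(x::real^'n) t. 0)" for j :: 'n
    by (rule ext, rule ext, rule pd_eqI[where u="\<lambda>x t. 0" and p="\<lambda>_. 0", OF z0])
  have z1: "c1 T (\<lambda>(x::real^'n) t. 0 :: 'b)" by (auto simp: c1_def z2 case_prod_unfold)
  note z = z1 z2
  have "jet T C (\<lambda>x t. u x t - 0)"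
    by (rule closed[of "\<lambda>x t. 0" 0]) (use U z in auto)
  moreover have "jet T (A * (1/2) ^ m) (\<lambda>x t. u x t - U m x t)" for m
  proof (rule closed[OF U1])
    \<comment> \<open>Telescoping from \<open>m\<close> to \<open>k\<close>: the increments sum to
      \<open>A * ((1/2) ^ m - (1/2) ^ k)\<close>.\<close>
    fix k assume "m \<le> k"
    then have "jet T (A * ((1/2) ^ m - (1/2) ^ k)) (\<lambda>x t. U k x t - U m x t)"
    proof (induction k rule: dec_induct)
      case base
      show ?case using z by (auto simp: jet_def)
    next
      case (step k)
      have "jet T (A * (1/2) ^ Suc k + A * ((1/2) ^ m - (1/2) ^ k)) (\<lambda>x t. (U (Suc k) x t - U k x t) + (U k x t - U m x t))"
        by (rule jet_add[OF d step.IH])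
      also have "A * (1/2) ^ Suc k + A * ((1/2) ^ m - (1/2) ^ k) = A * ((1/2) ^ m - (1/2) ^ Suc k)"
        by (simp add: algebra_simps)
      finally show ?case by simp
    qed
    then show "jet T (A * (1/2) ^ m) (\<lambda>x t. U k x t - U m x t)"
      by (rule jet_mono) (use A in \<open>auto intro!: mult_left_mono\<close>)
  qed
  ultimately show ?thesis using u(2) by auto
qed

lemma jet_norm: "jet T A u \<Longrightarrow> 0 < t \<Longrightarrow> t \<le> T \<Longrightarrow> norm (u x t) \<le> A"
  by (simp add: jet_def)

lemma src_cong:
  assumes f: "src T B f" and eq: "\<And>x t. 0 < t \<Longrightarrow> t \<le> T \<Longrightarrow> f x t = g x t"
  shows "src T B g"
proof -
  have f1: "c1 T f" using f by (simp add: src_def)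
  show ?thesis
    unfolding src_def using f c1_cong[OF f1 eq] by (auto simp: src_def eq[symmetric])
qed

lemma duhamel_cong:
  assumes t: "0 < t" "t \<le> T" and eq: "\<And>y s. 0 < s \<Longrightarrow> s \<le> T \<Longrightarrow> f y s = g y s"
  shows "duhamel f x t = duhamel g x t"
proof -
  have "heatint gauss f x t \<theta> = heatint gauss g x t \<theta>" if "\<theta> \<in> {0<..<1}" for \<theta>
    using that t mult_mono[of t T \<theta> 1] by (simp add: heatint_def eq)
  then show ?thesis
    unfolding duhamel_def tint_def by (metis (mono_tags, lifting) Bochner_Integration.integral_cong space_I01)
qed

lemma duhamel_diff:
  fixes f g :: "real ^ 'n \<Rightarrow> real \<Rightarrow> 'b::euclidean_space"
  assumes f: "src T B f" "0 \<le> B" and g: "src T B' g" "0 \<le> B'" and t: "0 < t" "t \<le> T"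
  shows "duhamel (\<lambda>x t. f x t - g x t) x t = duhamel f x t - duhamel g x t"
proof -
  have i: "integrable I01 (heatint gauss h x t)" if "src T C h" "0 \<le> C" for h :: "real ^ 'n \<Rightarrow> real \<Rightarrow> 'b" and C
    by (rule tint_norm(1)[where \<Phi>="heatint gauss h" and c="C * t powr (-1/2)", OF triple_cont(1)[OF src_heatint_cont(1)[OF that gauss_kern] t] heatint_bounds(1)[OF that t]])
       (use t in auto)
  have "heatint gauss (\<lambda>x t. f x t - g x t) x t \<theta> = heatint gauss f x t \<theta> - heatint gauss g x t \<theta>" if "\<theta> \<in> space I01" for \<theta>
  proof -
    have q: "0 < t * \<theta>" "t * \<theta> \<le> T" using that t mult_mono[of t T \<theta> 1] by auto
    show ?thesis
      unfolding heatint_def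
      by (rule Tk_diff[OF gauss_kern src_facts(1,2)[OF f q] src_facts(1,2)[OF g q]])
  qed
  then have "(\<integral>\<theta>. heatint gauss (\<lambda>x t. f x t - g x t) x t \<theta> \<partial>I01) = (\<integral>\<theta>. heatint gauss f x t \<theta> - heatint gauss g x t \<theta> \<partial>I01)"
    by (rule Bochner_Integration.integral_cong[OF refl])
  then show ?thesis
    using i[OF f] i[OF g] by (simp add: duhamel_def tint_def scaleR_right_diff_distrib)
qed

definition equivariant :: "real \<Rightarrow> (real ^ 'n \<Rightarrow> real ^ 'n) \<Rightarrow> (real ^ 'n \<Rightarrow> real \<Rightarrow> real ^ 'n) \<Rightarrow> bool"
  where "equivariant T R u \<longleftrightarrow> (\<forall>x t. 0 < t \<longrightarrow> t \<le> T \<longrightarrow> u (R x) t = R (u x t))"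

lemma duhamel_equivariant:
  assumes f: "src T B f" "0 \<le> B" and R: "orthogonal_transformation R" and eq: "equivariant T R f"
  shows "equivariant T R (duhamel f)"
  unfolding equivariant_def
proof (intro allI impI)
  fix x t assume t: "0 < t" "t \<le> T"
  have bl: "bounded_linear R" using R by (simp add: orthogonal_transformation linear_conv_bounded_linear)
  have i: "integrable I01 (heatint gauss f x t)"
    by (rule tint_norm(1)[where \<Phi>="heatint gauss f" and c="B * t powr (-1/2)", OF triple_cont(1)[OF src_heatint_cont(1)[OF f gauss_kern] t] heatint_bounds(1)[OF f t]])
       (use t in auto)
  have "heatint gauss f (R x) t \<theta> = R (heatint gauss f x t \<theta>)" if "\<theta> \<in> space I01" for \<theta>
  proof -
    have q: "0 < t * \<theta>" "t * \<theta> \<le> T" using that t mult_mono[of t T \<theta> 1] by auto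
    show ?thesis
      unfolding heatint_def
      by (rule Tk_gauss_equivariant[OF R src_facts(1,2)[OF f q]]) (use eq q in \<open>auto simp: equivariant_def\<close>)
  qed
  then have "(\<integral>\<theta>. heatint gauss f (R x) t \<theta> \<partial>I01) = (\<integral>\<theta>. R (heatint gauss f x t \<theta>) \<partial>I01)"
    by (rule Bochner_Integration.integral_cong[OF refl])
  also have "\<dots> = R (\<integral>\<theta>. heatint gauss f x t \<theta> \<partial>I01)" by (rule integral_bounded_linear[OF bl i])
  finally show "duhamel f (R x) t = R (duhamel f x t)"
    by (simp add: duhamel_def tint_def linear_cmul[OF bounded_linear.linear[OF bl]])
qed

text \<open>The equation is demanded for \<open>t < T\<close>, where the two-sided time derivative
  lies inside the interval; continuity is demanded on the closed interval, so that the initial value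
  is attained.\<close>

definition classical_on :: "('n \<Rightarrow> real ^ 'n \<Rightarrow> real ^ 'n \<Rightarrow> real ^ 'n) \<Rightarrow> real \<Rightarrow> real \<Rightarrow> (real ^ 'n \<Rightarrow> real \<Rightarrow> real ^ 'n) \<Rightarrow> bool"
  where "classical_on \<beta> T A u \<longleftrightarrow> jet T A u \<and> continuous_on (UNIV \<times> {0..T}) (\<lambda>(x, t). u x t) \<and>
    (\<forall>x t. 0 < t \<longrightarrow> t < T \<longrightarrow> ((\<lambda>t. u x t) has_vector_derivative (lap u x t + nonlin \<beta> u u x t)) (at t))"

context
  fixes \<beta> :: "'n::finite \<Rightarrow> real ^ 'n \<Rightarrow> real ^ 'n \<Rightarrow> real ^ 'n"
  assumes bl: "\<And>j. bounded_bilinear (\<beta> j)" and nb: "\<And>j a b. norm (\<beta> j a b) \<le> 2 * norm a * norm b"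
begin

primrec picard :: "(real ^ 'n \<Rightarrow> real ^ 'n) \<Rightarrow> nat \<Rightarrow> real ^ 'n \<Rightarrow> real \<Rightarrow> real ^ 'n"
  where
    "picard u0 0 = flow u0"
  | "picard u0 (Suc m) = (\<lambda>x t. flow u0 x t + duhamel (nonlin \<beta> (picard u0 m) (picard u0 m)) x t)"

text \<open>A contraction in the ball of radius \<open>2 A\<close> of \<open>jet\<close>, where
  \<open>A\<close> bounds the heat flow of the data. For two fields in this ball at distance
  \<open>c\<close>, bilinearity bounds the difference of the quadratic terms by
  \<open>16 n A c\<close> (\<open>dbound\<close>), and the Duhamel integral multiplies this by
  \<open>e\<close>. The condition on \<open>T\<close> reads \<open>32 n A e \<le> 1\<close>, so
  distances are halved.\<close>

lemma mild_solution:
  fixes M A T :: real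
  assumes u0: "continuous_on UNIV u0" "\<And>y. norm (u0 y) \<le> M"
    and A: "A = heat_const TYPE('n) * M" and T: "0 < T" "heat_const TYPE('n) * Wc * sqrt T * (32 * real CARD('n) * A) \<le> 1"
    and eqN: "\<And>R u. orthogonal_transformation R \<Longrightarrow> c1 T u \<Longrightarrow> equivariant T R u \<Longrightarrow> equivariant T R (nonlin \<beta> u u)"
  shows "\<exists>u. jet T (2 * A) u \<and> (\<forall>x t. 0 < t \<longrightarrow> t \<le> T \<longrightarrow> u x t = flow u0 x t + duhamel (nonlin \<beta> u u) x t) \<and>
    (\<forall>R. orthogonal_transformation R \<longrightarrow> (\<forall>x. u0 (R x) = R (u0 x)) \<longrightarrow> equivariant T R u)"
proof -
  let ?n = "real CARD('n)"
  define e where "e = heat_const TYPE('n) * Wc * sqrt T"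
  have M0: "0 \<le> M" using u0(2) norm_ge_zero order_trans by blast
  have A0: "0 \<le> A" using heat_const(1)[where 'n='n] M0 by (simp add: A)
  have eA: "e * (32 * ?n * A) \<le> 1" using T by (simp add: e_def)
  let ?U = "picard u0"
  let ?N = "\<lambda>m. nonlin \<beta> (?U m) (?U m)"
  have V: "jet T A (flow u0)" unfolding A by (rule flow_jet[OF u0])
  have duh': "jet T (e * B) (duhamel f)" if "src T B f" "0 \<le> B" for B and f :: "real ^ 'n \<Rightarrow> real \<Rightarrow> real ^ 'n"
    using duhamel_jet(1)[OF that] by (simp add: e_def)
  have bil: "src T (4 * ?n * a * b) (nonlin \<beta> u v)" if "jet T a u" "jet T b v" "0 \<le> a" "0 \<le> b" for a b u v
    by (rule src_nonlin[OF bl nb that])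
  \<comment> \<open>The first \<open>m\<close> increments add up to
    \<open>A * (1 - (1/2) ^ m)\<close>; together with the bound \<open>A\<close> for the heat flow
    this keeps every iterate below \<open>2 * A\<close>.\<close>
  define r where "r m = A * (2 - (1/2) ^ m)" for m
  have r0: "0 \<le> r m" "r m \<le> 2 * A" for m
    using A0 power_le_one[of "1/2::real" m] mult_nonneg_nonneg[OF A0, of "(1/2) ^ m"]
    by (auto simp: r_def right_diff_distrib intro: order_trans[OF mult_left_le])
  have dbound: "src T (16 * ?n * A * c) (\<lambda>x t. nonlin \<beta> u u x t - nonlin \<beta> v v x t)"
    if u: "jet T (2 * A) u" and v: "jet T (2 * A) v" and d: "jet T c (\<lambda>x t. u x t - v x t)" and c: "0 \<le> c" for u v c
  proof -
    have "src T (4 * ?n * c * (2 * A) + 4 * ?n * (2 * A) * c)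
       (\<lambda>x t. nonlin \<beta> (\<lambda>x t. u x t - v x t) u x t + nonlin \<beta> v (\<lambda>x t. u x t - v x t) x t)"
      by (intro src_add bil u v d) (use c A0 in auto)
    then have s: "src T (16 * ?n * A * c) (\<lambda>x t. nonlin \<beta> (\<lambda>x t. u x t - v x t) u x t + nonlin \<beta> v (\<lambda>x t. u x t - v x t) x t)"
      by (rule src_mono) simp
    have "nonlin \<beta> (\<lambda>x t. u x t - v x t) u x t + nonlin \<beta> v (\<lambda>x t. u x t - v x t) x t = nonlin \<beta> u u x t - nonlin \<beta> v v x t"
      if "0 < t" "t \<le> T" for x t
      by (rule nonlin_diff[OF bl _ _ that, symmetric]) (use u v in \<open>auto simp: jet_def\<close>)
    then show ?thesis by (rule src_cong[OF s])
  qed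
  have step: "jet T (r m) (?U m) \<and> jet T (A * (1/2) ^ Suc m) (\<lambda>x t. ?U (Suc m) x t - ?U m x t)" for m
  proof (induction m)
    case 0
    have "jet T (e * (4 * ?n * A * A)) (duhamel (?N 0))" using V A0 by (intro duh' bil) auto
    moreover have "e * (4 * ?n * A * A) \<le> A * (1/2)"
    proof -
      have "e * (4 * ?n * A * A) = (e * (32 * ?n * A)) * (A / 8)" by simp
      also have "\<dots> \<le> 1 * (A / 8)" using A0 by (intro mult_right_mono eA) auto
      finally show ?thesis using A0 by simp
    qed
    ultimately have "jet T (A * (1/2)) (duhamel (?N 0))" by (rule jet_mono)
    then show ?case using V by (simp add: r_def)
  next
    case (Suc m)
    then have IH: "jet T (r m) (?U m)" and D: "jet T (A * (1/2) ^ Suc m) (\<lambda>x t. ?U (Suc m) x t - ?U m x t)" by auto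
    have "jet T (A * (1/2) ^ Suc m + r m) (\<lambda>x t. (?U (Suc m) x t - ?U m x t) + ?U m x t)" by (rule jet_add[OF D IH])
    moreover have "A * (1/2) ^ Suc m + r m = r (Suc m)" by (simp add: r_def algebra_simps)
    ultimately have S: "jet T (r (Suc m)) (?U (Suc m))" by simp
    note U1 = jet_mono[OF IH r0(2)] jet_mono[OF S r0(2)]
    let ?c = "A * (1/2) ^ Suc m"
    have c0: "0 \<le> ?c" using A0 by simp
    have s: "src T (16 * ?n * A * ?c) (\<lambda>x t. ?N (Suc m) x t - ?N m x t)" by (rule dbound[OF U1(2,1) D c0])
    have j: "jet T (e * (16 * ?n * A * ?c)) (duhamel (\<lambda>x t. ?N (Suc m) x t - ?N m x t))"
      by (rule duh'[OF s]) (use A0 c0 in auto)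
    have "e * (16 * ?n * A * ?c) \<le> A * (1/2) ^ Suc (Suc m)"
    proof -
      have "e * (16 * ?n * A * ?c) = (e * (32 * ?n * A)) * (?c / 2)" by simp
      also have "\<dots> \<le> 1 * (?c / 2)" using c0 by (intro mult_right_mono eA) auto
      finally show ?thesis by simp
    qed
    then have j': "jet T (A * (1/2) ^ Suc (Suc m)) (duhamel (\<lambda>x t. ?N (Suc m) x t - ?N m x t))" by (rule jet_mono[OF j])
    have "duhamel (\<lambda>x t. ?N (Suc m) x t - ?N m x t) x t = ?U (Suc (Suc m)) x t - ?U (Suc m) x t" if t: "0 < t" "t \<le> T" for x t
      using duhamel_diff[OF bil[OF U1(2) U1(2)] _ bil[OF U1(1) U1(1)] _ t] A0 by simp
    then have "jet T (A * (1/2) ^ Suc (Suc m)) (\<lambda>x t. ?U (Suc (Suc m)) x t - ?U (Suc m) x t)"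
      by (rule jet_cong(1)[OF j'])
    then show ?case using S by simp
  qed
  then have J: "jet T (2 * A) (?U m)" for m using jet_mono r0(2) by blast
  obtain u where u: "jet T (2 * A) u" "\<And>m. jet T (A * (1/2) ^ m) (\<lambda>x t. u x t - ?U m x t)"
    "\<And>x t. 0 < t \<Longrightarrow> t \<le> T \<Longrightarrow> (\<lambda>m. ?U m x t) \<longlonglongrightarrow> u x t"
    using jet_limit[of T "2 * A" ?U A, OF J conjunct2[OF step] A0] by blast
  have fp: "u x t = flow u0 x t + duhamel (nonlin \<beta> u u) x t" if t: "0 < t" "t \<le> T" for x t
  proof -
    have b: "norm (duhamel (nonlin \<beta> u u) x t - duhamel (?N m) x t) \<le> e * (16 * ?n * A * A) * (1/2) ^ m" for m
    proof -
      let ?c = "A * (1/2) ^ m"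
      have c0: "0 \<le> ?c" using A0 by simp
      have s: "src T (16 * ?n * A * ?c) (\<lambda>x t. nonlin \<beta> u u x t - ?N m x t)" by (rule dbound[OF u(1) J u(2) c0])
      have a: "jet T (e * (16 * ?n * A * ?c)) (duhamel (\<lambda>x t. nonlin \<beta> u u x t - ?N m x t))"
        by (rule duh'[OF s]) (use A0 c0 in auto)
      have b: "duhamel (\<lambda>x t. nonlin \<beta> u u x t - ?N m x t) x t = duhamel (nonlin \<beta> u u) x t - duhamel (?N m) x t"
        by (rule duhamel_diff[OF bil[OF u(1) u(1)] _ bil[OF J J] _ t]) (use A0 in auto)
      show ?thesis using jet_norm[OF a t, of x] unfolding b by (simp only: mult.assoc)
    qed
    have "(\<lambda>m. e * (16 * ?n * A * A) * (1/2) ^ m) \<longlonglongrightarrow> 0"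
      using tendsto_mult[OF tendsto_const LIMSEQ_realpow_zero[of "1/2"]] by simp
    then have "(\<lambda>m. duhamel (nonlin \<beta> u u) x t - duhamel (?N m) x t) \<longlonglongrightarrow> 0"
      by (rule Lim_null_comparison[rotated]) (use b in auto)
    then have "(\<lambda>m. flow u0 x t + (duhamel (nonlin \<beta> u u) x t - (duhamel (nonlin \<beta> u u) x t - duhamel (?N m) x t))) \<longlonglongrightarrow>
        flow u0 x t + (duhamel (nonlin \<beta> u u) x t - 0)"
      by (intro tendsto_intros)
    then have "(\<lambda>m. ?U (Suc m) x t) \<longlonglongrightarrow> flow u0 x t + duhamel (nonlin \<beta> u u) x t" by simp
    moreover have "(\<lambda>m. ?U (Suc m) x t) \<longlonglongrightarrow> u x t" using u(3)[OF t] by (rule LIMSEQ_Suc)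
    ultimately show ?thesis using LIMSEQ_unique by blast
  qed
  have "equivariant T R u" if R: "orthogonal_transformation R" and eq: "\<And>x. u0 (R x) = R (u0 x)" for R
  proof -
    have lin: "linear R" using R by (simp add: orthogonal_transformation)
    have cR: "continuous_on UNIV R" using lin by (simp add: linear_continuous_on linear_conv_bounded_linear)
    have fl: "equivariant T R (flow u0)"
      unfolding equivariant_def flow_def using Tk_gauss_equivariant[OF R u0 eq] by blast
    have Um: "equivariant T R (?U m)" for m
    proof (induction m)
      case (Suc m)
      have eN: "equivariant T R (?N m)" by (rule eqN[OF R _ Suc]) (use J[of m] in \<open>auto simp: jet_def\<close>)
      have "equivariant T R (duhamel (?N m))"
        by (rule duhamel_equivariant[OF bil[OF J J] _ R eN]) (use A0 in auto)
      then show ?case using fl by (simp add: equivariant_def linear_add[OF lin])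
    qed (simp add: fl)
    show ?thesis
      unfolding equivariant_def
    proof (intro allI impI)
      fix x t assume t: "0 < t" "t \<le> T"
      have "(\<lambda>m. R (?U m x t)) \<longlonglongrightarrow> R (u x t)"
        using continuous_on_tendsto_compose[OF cR u(3)[OF t]] by simp
      then have "(\<lambda>m. ?U m (R x) t) \<longlonglongrightarrow> R (u x t)" using Um t by (simp add: equivariant_def)
      then show "u (R x) t = R (u x t)" using u(3)[OF t] LIMSEQ_unique by blast
    qed
  qed
  then show ?thesis using u(1) fp by blast
qed

text \<open>The mild solution is classical because its two summands satisfy the homogeneous and the
  inhomogeneous heat equation; what remains is the behaviour at time zero.\<close>

lemma local_existence:
  fixes M A T :: real
  assumes u0: "continuous_on UNIV u0" "\<And>y. norm (u0 y) \<le> M"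
    and A: "A = heat_const TYPE('n) * M" and T: "0 < T" "heat_const TYPE('n) * Wc * sqrt T * (32 * real CARD('n) * A) \<le> 1"
    and eqN: "\<And>R u. orthogonal_transformation R \<Longrightarrow> c1 T u \<Longrightarrow> equivariant T R u \<Longrightarrow> equivariant T R (nonlin \<beta> u u)"
  shows "\<exists>u. classical_on \<beta> T (2 * A) u \<and> (\<forall>x. u x 0 = u0 x) \<and>
    (\<forall>R. orthogonal_transformation R \<longrightarrow> (\<forall>x. u0 (R x) = R (u0 x)) \<longrightarrow> equivariant T R u)"
proof -
  have M0: "0 \<le> M" using u0(2) norm_ge_zero order_trans by blast
  have A0: "0 \<le> A" using heat_const(1)[where 'n='n] M0 by (simp add: A)
  obtain w where w: "jet T (2 * A) w" and fp: "\<And>x t. 0 < t \<Longrightarrow> t \<le> T \<Longrightarrow> w x t = flow u0 x t + duhamel (nonlin \<beta> w w) x t"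
    and eqv: "\<And>R. orthogonal_transformation R \<Longrightarrow> (\<forall>x. u0 (R x) = R (u0 x)) \<Longrightarrow> equivariant T R w"
    using mild_solution[OF u0 A T eqN] by blast
  \<comment> \<open>The Picard limit is determined for positive times only, so its values at
    \<open>t \<le> 0\<close> are set to the data by hand.\<close>
  define u where "u x t = (if t \<le> 0 then u0 x else w x t)" for x t
  have uw: "w x t = u x t" if "0 < t" "t \<le> T" for x t using that by (simp add: u_def)
  have J: "jet T (2 * A) u" by (rule jet_cong(1)[OF w uw])
  define B where "B = 4 * real CARD('n) * (2 * A) * (2 * A)"
  have B0: "0 \<le> B" using A0 by (simp add: B_def)
  have S: "src T B (nonlin \<beta> u u)" unfolding B_def by (rule src_nonlin[OF bl nb J J]) (use A0 in auto)
  have W1: "c1 T w" using w by (auto simp: jet_def)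
  have Nuw: "nonlin \<beta> w w x t = nonlin \<beta> u u x t" if "0 < t" "t \<le> T" for x t
    unfolding nonlin_def using c1_cong(2)[OF W1 uw that] uw[OF that] by simp
  have fpu: "u x t = flow u0 x t + duhamel (nonlin \<beta> u u) x t" if t: "0 < t" "t \<le> T" for x t
    using fp[OF t] uw[OF t] duhamel_cong[OF t Nuw] by simp
  have V: "jet T (heat_const TYPE('n) * M) (flow u0)" by (rule flow_jet[OF u0])
  note D = duhamel_jet(1)[OF S B0]
  have lapu: "lap u x t = lap (flow u0) x t + lap (duhamel (nonlin \<beta> u u)) x t" if t: "0 < t" "t \<le> T" for x t
  proof -
    have V1: "c1 T (flow u0)" "\<And>j. c1 T (pd j (flow u0))" using V by (auto simp: jet_def)
    have D1: "c1 T (duhamel (nonlin \<beta> u u))" "\<And>j. c1 T (pd j (duhamel (nonlin \<beta> u u)))" using D by (auto simp: jet_def)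
    note s = c1_sum_op(1,2)[OF V1(1) D1(1)]
    note s2 = c1_sum_op(1,2)[OF V1(2) D1(2)]
    have e1: "pd j (flow u0) x t + pd j (duhamel (nonlin \<beta> u u)) x t = pd j u x t" if "0 < t" "t \<le> T" for j x t
      using c1_cong(2)[OF s(1) fpu[symmetric] that] s(2)[OF that] by simp
    have "pd j (pd j u) x t = pd j (pd j (flow u0)) x t + pd j (pd j (duhamel (nonlin \<beta> u u))) x t" for j
      using c1_cong(2)[OF s2(1) e1 t] s2(2)[OF t] by simp
    then show ?thesis by (simp add: lap_def sum.distrib)
  qed
  have td: "((\<lambda>t. u x t) has_vector_derivative (lap u x t + nonlin \<beta> u u x t)) (at t)" if t: "0 < t" "t < T" for x t
  proof -
    have "((\<lambda>t. flow u0 x t + duhamel (nonlin \<beta> u u) x t) has_vector_derivative (lap (flow u0) x t + (lap (duhamel (nonlin \<beta> u u)) x t + nonlin \<beta> u u x t))) (at t)"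
      by (intro has_vector_derivative_add flow_time_derivative[OF u0 t(1)] duhamel_time_derivative[OF S B0 t])
    then have "((\<lambda>t. flow u0 x t + duhamel (nonlin \<beta> u u) x t) has_vector_derivative (lap u x t + nonlin \<beta> u u x t)) (at t)"
      using t by (simp add: lapu add.assoc)
    then show ?thesis
      by (rule has_vector_derivative_transform_within_open[of _ _ _ "{0<..<T}"]) (use t fpu in auto)
  qed
  have cont: "continuous_on (UNIV \<times> {0..T}) (\<lambda>(x, t). u x t)"
  proof -
    \<comment> \<open>The heat flow is continuous up to time zero, so only the difference matters;
      for positive times it is a Duhamel integral, of order \<open>sqrt t\<close>.\<close>
    define d where "d p = u (fst p) (snd p) - flow u0 (fst p) (snd p)" for p
    have d0: "norm (d p) \<le> Wc * B * sqrt (snd p)" if "snd p \<in> {0..T}" for p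
    proof (cases "snd p = 0")
      case True
      then show ?thesis by (simp add: d_def u_def flow_zero[OF u0])
    next
      case False
      then have "0 < snd p" "snd p \<le> T" using that by auto
      then show ?thesis using duhamel_jet(2)[OF S B0, of "snd p" "fst p"] fpu[of "snd p" "fst p"] by (simp add: d_def)
    qed
    have cf: "continuous_on UNIV (\<lambda>p. flow u0 (fst p) (snd p))" using flow_cont[OF u0] by (simp add: case_prod_unfold)
    have "continuous_on (UNIV \<times> {0..T}) d"
      unfolding continuous_on_eq_continuous_within
    proof
      fix p :: "(real^'n) \<times> real" assume p: "p \<in> UNIV \<times> {0..T}"
      show "continuous (at p within UNIV \<times> {0..T}) d"
      proof (cases "snd p = 0")
        case True
        have "(d \<longlongrightarrow> 0) (at p within UNIV \<times> {0..T})"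
        proof (rule Lim_null_comparison)
          show "\<forall>\<^sub>F q in at p within UNIV \<times> {0..T}. norm (d q) \<le> Wc * B * sqrt (snd q)"
            unfolding eventually_at_filter by (rule always_eventually) (use d0 in auto)
          have "((\<lambda>q. Wc * B * sqrt (snd q)) \<longlongrightarrow> Wc * B * sqrt (snd p)) (at p within UNIV \<times> {0..T})"
            by (intro tendsto_intros)
          then show "((\<lambda>q. Wc * B * sqrt (snd q)) \<longlongrightarrow> 0) (at p within UNIV \<times> {0..T})" using True by simp
        qed
        moreover have "d p = 0" using d0[of p] p True by auto
        ultimately show ?thesis by (simp add: continuous_within)
      next
        case False
        then have sp: "0 < snd p" using p by auto
        have "continuous_on (UNIV \<times> {0<..T}) d"
          unfolding d_def using J cf by (auto simp: jet_def c1_def case_prod_unfold intro!: continuous_on_diff elim: continuous_on_subset)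
        then have "continuous (at p within UNIV \<times> {0<..T}) d" using p sp by (auto simp: continuous_on_eq_continuous_within)
        moreover have "at p within UNIV \<times> {0<..T} = at p within UNIV \<times> {0..T}"
          by (rule at_within_nhd[of p "UNIV \<times> {0<..}"]) (use sp p in \<open>auto simp: open_Times mem_Times_iff\<close>)
        ultimately show ?thesis by simp
      qed
    qed
    then have "continuous_on (UNIV \<times> {0..T}) (\<lambda>p. d p + flow u0 (fst p) (snd p))"
      by (intro continuous_on_add continuous_on_subset[OF cf]) auto
    then show ?thesis by (simp add: d_def case_prod_unfold)
  qed
  have "equivariant T R u" if "orthogonal_transformation R" "\<forall>x. u0 (R x) = R (u0 x)" for R
    using eqv[OF that] uw by (simp add: equivariant_def)
  then show ?thesis
    using J cont td by (intro exI[of _ u]) (auto simp: classical_on_def u_def)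
qed

end

section \<open>Radial solutions\<close>

text \<open>
  \<open>nonlin (quad_form a) u u\<close> collects the quadratic terms of the equation, moved to the right-hand side.
\<close>

definition quad_form :: "real \<Rightarrow> 'n::finite \<Rightarrow> real ^ 'n \<Rightarrow> real ^ 'n \<Rightarrow> real ^ 'n"
  where "quad_form a j p q = - ((a * p $ j) *\<^sub>R q + ((1 - a) * (p \<bullet> q)) *\<^sub>R axis j 1 + (1/2 * q $ j) *\<^sub>R p)"

lemma quad_form_norm:
  assumes "0 \<le> a" "a \<le> 1" shows "norm (quad_form a j p q) \<le> 2 * norm p * norm q"
proof -
  have 1: "norm ((a * p $ j) *\<^sub>R q) \<le> a * (norm p * norm q)"
    using assms component_le_norm_cart[of p j] by (simp add: abs_mult mult.assoc mult_left_mono mult_right_mono)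
  have 2: "norm (((1 - a) * (p \<bullet> q)) *\<^sub>R (axis j 1 :: real ^ 'a)) \<le> (1 - a) * (norm p * norm q)"
    using assms Cauchy_Schwarz_ineq2[of p q] by (simp add: abs_mult mult_left_mono)
  have 3: "norm ((1/2 * q $ j) *\<^sub>R p) \<le> 1/2 * (norm p * norm q)"
    using mult_right_mono[OF component_le_norm_cart[of q j], of "norm p"] by (simp add: abs_mult mult.commute)
  have "norm (quad_form a j p q) \<le> a * (norm p * norm q) + (1 - a) * (norm p * norm q) + 1/2 * (norm p * norm q)"
    unfolding quad_form_def norm_minus_cancel by (intro norm_triangle_le add_mono 1 2 3)
  also have "\<dots> = 3/2 * (norm p * norm q)" by (simp add: algebra_simps)
  also have "\<dots> \<le> 2 * (norm p * norm q)" by (intro mult_right_mono) auto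
  finally show ?thesis by simp
qed

lemma quad_form_bilinear:
  assumes "0 \<le> a" "a \<le> 1" shows "bounded_bilinear (quad_form a j)"
proof
  show "\<exists>K. \<forall>p q. norm (quad_form a j p q) \<le> norm p * norm q * K"
    using quad_form_norm[OF assms, of j] by (auto intro!: exI[of _ 2] simp: mult_ac)
qed (simp_all add: quad_form_def algebra_simps inner_simps)

lemma nonlin_quad_form:
  "nonlin (quad_form a) u v x t = - (a *\<^sub>R (\<Sum>j\<in>UNIV. u x t $ j *\<^sub>R pd j v x t)
     + (1 - a) *\<^sub>R (\<Sum>j\<in>UNIV. (u x t \<bullet> pd j v x t) *\<^sub>R axis j 1)
     + (1/2 * (\<Sum>j\<in>UNIV. pd j v x t $ j)) *\<^sub>R u x t)"
  unfolding nonlin_def quad_form_def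
  by (simp add: sum_negf sum_subtractf sum.distrib scaleR_sum_right sum_distrib_left scaleR_sum_left)

lemma sum_axis_inner: "(\<Sum>j\<in>UNIV. c j *\<^sub>R (axis j 1 :: real ^ 'n)) \<bullet> h = (\<Sum>j\<in>UNIV. h $ j * c j)"
  by (simp add: inner_sum_left inner_axis' mult.commute)

text \<open>Differentiating \<open>u (R y) t = R (u y t)\<close> gives
  \<open>D (R y) \<circ> R = R \<circ> D y\<close> for the Jacobian. The quadratic terms are built
  from \<open>D\<close> applied to \<open>u\<close>, the transpose of \<open>D\<close> applied to
  \<open>u\<close> (called \<open>G\<close>), and the trace of \<open>D\<close> times
  \<open>u\<close>. By this relation each of them is equivariant.\<close>

lemma nonlin_equivariant:
  fixes u :: "real ^ 'n \<Rightarrow> real \<Rightarrow> real ^ 'n"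
  assumes R: "orthogonal_transformation R" and u: "c1 T u" and eq: "equivariant T R u"
  shows "equivariant T R (nonlin (quad_form a) u u)"
  unfolding equivariant_def
proof (intro allI impI)
  fix x t assume t: "0 < t" "t \<le> T"
  have lin: "linear R" and iR: "\<And>v w. R v \<bullet> R w = v \<bullet> w"
    using R by (auto simp: orthogonal_transformation_def)
  have bl: "bounded_linear R" using lin by (simp add: linear_conv_bounded_linear)
  have E: "u (R y) t = R (u y t)" for y using eq t by (simp add: equivariant_def)
  define D where "D y h = (\<Sum>j\<in>UNIV. h $ j *\<^sub>R pd j u y t)" for y h
  have dD: "((\<lambda>y. u y t) has_derivative D y) (at y)" for y
    unfolding D_def by (rule c1_has_derivative[OF u t])
  have linD: "linear (D y)" for y using dD by (rule has_derivative_linear)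
  have DR: "D (R y) (R h) = R (D y h)" for y h
  proof -
    have 1: "((\<lambda>y. u (R y) t) has_derivative (\<lambda>h. D (R y) (R h))) (at y)"
      by (rule has_derivative_compose[OF bounded_linear_imp_has_derivative[OF bl] dD])
    have 2: "((\<lambda>y. R (u y t)) has_derivative (\<lambda>h. R (D y h))) (at y)"
      by (rule bounded_linear.has_derivative[OF bl dD])
    have "(\<lambda>h. D (R y) (R h)) = (\<lambda>h. R (D y h))"
      using has_derivative_unique[OF 1] 2 by (simp add: E)
    then show ?thesis by meson
  qed
  have Daxis: "D y (axis j 1) = pd j u y t" for y j by (simp add: D_def sum_axis_scaleR)
  define G where "G y = (\<Sum>j\<in>UNIV. (u y t \<bullet> pd j u y t) *\<^sub>R (axis j 1 :: real ^ 'n))" for y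
  have Gi: "G y \<bullet> h = u y t \<bullet> D y h" for y h
    unfolding G_def sum_axis_inner D_def by (simp add: inner_sum_right)
  have GR: "G (R x) = R (G x)"
  proof (rule vector_eq_rdot[THEN iffD1], rule allI)
    fix k
    obtain h where k: "k = R h" using orthogonal_transformation_surj[OF R] by (metis surjD)
    show "G (R x) \<bullet> k = R (G x) \<bullet> k"
      unfolding k Gi iR E DR by (simp add: Gi)
  qed
  have tr: "(\<Sum>j\<in>UNIV. pd j u y t $ j) = trace (matrix (D y))" for y
    by (simp add: trace_def matrix_def Daxis)
  have tR: "trace (matrix (D (R x))) = trace (matrix (D x))"
  proof -
    let ?R = "matrix R"
    have "D (R x) \<circ> R = R \<circ> D x" using DR by auto
    then have "matrix (D (R x)) ** ?R = ?R ** matrix (D x)"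
      using matrix_compose[OF lin linD[of "R x"]] matrix_compose[OF linD[of x] lin] by simp
    moreover have o: "transpose ?R ** ?R = mat 1" "?R ** transpose ?R = mat 1"
      using R orthogonal_transformation_matrix[of R] by (auto simp: orthogonal_matrix_def)
    ultimately have "matrix (D (R x)) = ?R ** matrix (D x) ** transpose ?R"
      by (metis matrix_mul_assoc matrix_mul_rid)
    then have "trace (matrix (D (R x))) = trace (transpose ?R ** (?R ** matrix (D x)))"
      by (metis trace_mul_sym)
    then show ?thesis by (simp add: matrix_mul_assoc o)
  qed
  have "nonlin (quad_form a) u u y t = - (a *\<^sub>R D y (u y t) + (1 - a) *\<^sub>R G y + (1/2 * trace (matrix (D y))) *\<^sub>R u y t)" for y
    unfolding nonlin_quad_form tr D_def G_def ..
  then show "nonlin (quad_form a) u u (R x) t = R (nonlin (quad_form a) u u x t)"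
    by (simp add: E DR GR tR linear_neg[OF lin] linear_diff[OF lin] linear_add[OF lin] linear_cmul[OF lin])
qed

text \<open>Equivariance under the whole orthogonal group, reflections included, is the form that
  passes through the iteration; \<open>radial_parallel\<close> recovers the geometric
  meaning.\<close>

definition radial :: "(real ^ 'n \<Rightarrow> real ^ 'n) \<Rightarrow> bool"
  where "radial f \<longleftrightarrow> (\<forall>R x. orthogonal_transformation R \<longrightarrow> f (R x) = R (f x))"

text \<open>\<open>R\<close> fixes \<open>x\<close> and changes the sign on its orthogonal
  complement. Equivariance makes \<open>f x\<close> a fixed point of \<open>R\<close>, hence a
  multiple of \<open>x\<close>. At the origin the map \<open>- id\<close> takes over.\<close>

lemma radial_parallel:
  assumes "radial f"
  shows "f x = ((f x \<bullet> x) / (x \<bullet> x)) *\<^sub>R x"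
proof (cases "x = 0")
  case True
  have "orthogonal_transformation (\<lambda>y::real^'a. - y)"
    by (simp add: orthogonal_transformation_def linear_iff)
  then have "f (- 0) = - f 0" using assms unfolding radial_def by blast
  then have "f 0 + f 0 = 0" by (metis add.right_inverse minus_zero)
  then have "2 *\<^sub>R f 0 = 0" by (simp add: scaleR_2)
  then show ?thesis using True by simp
next
  case False
  define R where "R y = (2 * (y \<bullet> x) / (x \<bullet> x)) *\<^sub>R x - y" for y
  have lin: "linear R"
    by (rule linearI) (simp_all add: R_def inner_simps algebra_simps add_divide_distrib)
  have "R v \<bullet> R w = v \<bullet> w" for v w
    using False by (simp add: R_def inner_simps field_simps inner_commute)
  then have "orthogonal_transformation R" using lin by (simp add: orthogonal_transformation_def)
  then have "f (R x) = R (f x)" using assms by (simp add: radial_def)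
  moreover have "R x = x" using False by (simp add: R_def scaleR_2)
  ultimately have "2 *\<^sub>R f x = (2 * (f x \<bullet> x) / (x \<bullet> x)) *\<^sub>R x"
    by (simp add: R_def scaleR_2 algebra_simps)
  then have "(1/2) *\<^sub>R (2 *\<^sub>R f x) = (1/2) *\<^sub>R ((2 * (f x \<bullet> x) / (x \<bullet> x)) *\<^sub>R x)" by simp
  then show ?thesis by simp
qed

text \<open>Obtained by differentiating the identity \<open>par\<close>, whose right-hand side
  involves \<open>f\<close> only through \<open>f y \<bullet> y\<close>. It removes the divergence
  from the equation for \<open>u \<bullet> x\<close>, leaving that scalar and its radial
  derivative.\<close>

lemma divergence_radial:
  fixes f :: "real ^ 'n \<Rightarrow> real ^ 'n"
  assumes der: "(f has_derivative (\<lambda>h. \<Sum>j\<in>UNIV. h $ j *\<^sub>R p j)) (at x)" and x: "x \<noteq> 0"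
    and par: "\<And>y. f y = ((f y \<bullet> y) / (y \<bullet> y)) *\<^sub>R y"
  shows "(\<Sum>j\<in>UNIV. p j $ j) = ((\<Sum>j\<in>UNIV. x $ j * (p j \<bullet> x)) + (real CARD('n) - 1) * (f x \<bullet> x)) / (x \<bullet> x)"
proof -
  define D where "D h = (\<Sum>j\<in>UNIV. h $ j *\<^sub>R p j)" for h
  define m where "m = f x \<bullet> x"
  define s where "s = x \<bullet> x"
  have s0: "s \<noteq> 0" using x by (simp add: s_def)
  have dD: "(f has_derivative D) (at x)" using der by (simp add: D_def[abs_def])
  have d: "((\<lambda>y. ((f y \<bullet> y) / (y \<bullet> y)) *\<^sub>R y) has_derivative
      (\<lambda>h. (m / s) *\<^sub>R h + ((((f x \<bullet> h + D h \<bullet> x) * s - m * (2 * (x \<bullet> h))) / (s * s))) *\<^sub>R x)) (at x)"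
    by (rule has_derivative_eq_rhs,
        rule has_derivative_scaleR[OF has_derivative_divide'[OF has_derivative_inner[OF dD has_derivative_ident] has_derivative_inner[OF has_derivative_ident has_derivative_ident]] has_derivative_ident])
       (use s0 in \<open>auto simp: s_def m_def inner_commute fun_eq_iff\<close>)
  have "D = (\<lambda>h. (m / s) *\<^sub>R h + ((((f x \<bullet> h + D h \<bullet> x) * s - m * (2 * (x \<bullet> h))) / (s * s))) *\<^sub>R x)"
    by (rule has_derivative_unique[OF dD]) (use d in \<open>simp add: par[symmetric]\<close>)
  then have Dh: "D h = (m / s) *\<^sub>R h + ((((f x \<bullet> h + D h \<bullet> x) * s - m * (2 * (x \<bullet> h))) / (s * s))) *\<^sub>R x" for h
    by meson
  have pj: "p j = D (axis j 1)" for j by (simp add: D_def sum_axis_scaleR)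
  have e: "p j $ j = m / s + ((f x $ j + p j \<bullet> x) * s - m * (2 * x $ j)) / (s * s) * x $ j" for j
    using arg_cong[OF Dh[of "axis j 1"], of "\<lambda>v. v $ j"] by (simp add: pj[symmetric] inner_axis)
  have "(\<Sum>j\<in>UNIV. p j $ j) = (\<Sum>j\<in>UNIV. m / s + (f x $ j * x $ j + x $ j * (p j \<bullet> x)) / s - 2 * m * (x $ j * x $ j) / (s * s))"
    by (rule sum.cong[OF refl], unfold e) (use s0 in \<open>simp add: field_simps\<close>)
  also have "\<dots> = real CARD('n) * (m / s) + ((\<Sum>j\<in>UNIV. f x $ j * x $ j) + (\<Sum>j\<in>UNIV. x $ j * (p j \<bullet> x))) / s
      - 2 * m * (\<Sum>j\<in>UNIV. x $ j * x $ j) / (s * s)"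
    by (simp add: sum.distrib sum_subtractf sum_divide_distrib[symmetric] sum_distrib_left[symmetric])
  also have "(\<Sum>j\<in>UNIV. f x $ j * x $ j) = m" by (simp add: m_def inner_vec_def)
  also have "(\<Sum>j\<in>UNIV. x $ j * x $ j) = s" by (simp add: s_def inner_vec_def)
  also have "real CARD('n) * (m / s) + (m + (\<Sum>j\<in>UNIV. x $ j * (p j \<bullet> x))) / s - 2 * m * s / (s * s)
      = ((\<Sum>j\<in>UNIV. x $ j * (p j \<bullet> x)) + (real CARD('n) - 1) * m) / s"
    using s0 by (simp add: field_simps)
  finally show ?thesis by (simp only: m_def s_def)
qed

section \<open>The comparison principle\<close>

text \<open>At a maximum only derivatives along the coordinate axes are needed, so one-variable
  calculus suffices. The relational form treats solutions and barriers alike.\<close>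

definition line_deriv :: "(real ^ 'n \<Rightarrow> real) \<Rightarrow> 'n \<Rightarrow> real ^ 'n \<Rightarrow> real \<Rightarrow> bool"
  where "line_deriv f j x d \<longleftrightarrow> ((\<lambda>s. f (x + s *\<^sub>R axis j 1)) has_real_derivative d) (at 0)"

lemma line_deriv_shift:
  assumes "line_deriv f j (x + s *\<^sub>R axis j 1) d"
  shows "((\<lambda>s. f (x + s *\<^sub>R axis j 1)) has_real_derivative d) (at s)"
proof -
  have "((\<lambda>r. f (x + (r + s) *\<^sub>R axis j 1)) has_real_derivative d) (at 0)"
    using assms by (simp add: line_deriv_def algebra_simps)
  then show ?thesis using DERIV_shift[of "\<lambda>s. f (x + s *\<^sub>R axis j 1)" d 0 s] by simp
qed

lemma second_derivative_at_max:
  fixes f :: "real \<Rightarrow> real"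
  assumes d: "0 < d" and f: "\<And>s. \<bar>s\<bar> < d \<Longrightarrow> (f has_real_derivative f' s) (at s)"
    and f2: "(f' has_real_derivative l) (at 0)" and mx: "\<And>s. \<bar>s\<bar> < d \<Longrightarrow> f s \<le> f 0"
  shows "f' 0 = 0" "l \<le> 0"
proof -
  show z: "f' 0 = 0"
    by (rule DERIV_local_max[OF f d]) (use d mx in auto)
  show "l \<le> 0"
  proof (rule ccontr)
    assume "\<not> l \<le> 0"
    then obtain e where e: "0 < e" "\<And>h. 0 < h \<Longrightarrow> h < e \<Longrightarrow> f' 0 < f' (0 + h)"
      using DERIV_pos_inc_right[OF f2] by auto
    define h where "h = min d e / 2"
    have h: "0 < h" "h < d" "h < e" using d e(1) by (auto simp: h_def min_def)
    obtain z where z': "0 < z" "z < h" "f h - f 0 = (h - 0) * f' z"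
      using MVT2[of 0 h f f'] f h by auto
    have "0 < f' z" using e(2)[of z] z' h z by auto
    then have "0 < f h - f 0" using z'(3) h by simp
    then show False using mx[of h] h by simp
  qed
qed

section \<open>The scalar \<open>u \<bullet> x\<close> and its equation\<close>

definition mom :: "(real ^ 'n \<Rightarrow> real \<Rightarrow> real ^ 'n) \<Rightarrow> real ^ 'n \<Rightarrow> real \<Rightarrow> real"
  where "mom u x t = u x t \<bullet> x"

definition mom_grad :: "(real ^ 'n \<Rightarrow> real \<Rightarrow> real ^ 'n) \<Rightarrow> 'n \<Rightarrow> real ^ 'n \<Rightarrow> real \<Rightarrow> real"
  where "mom_grad u j x t = pd j u x t \<bullet> x + u x t $ j"

text \<open>The product rule applied twice. Summed over \<open>j\<close> it gives the Laplacian of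
  \<open>u\<close> against \<open>x\<close> plus twice the divergence; the latter is the source of
  the singular drift term in \<open>mom_equation\<close>.\<close>

definition mom_hess :: "(real ^ 'n \<Rightarrow> real \<Rightarrow> real ^ 'n) \<Rightarrow> 'n \<Rightarrow> real ^ 'n \<Rightarrow> real \<Rightarrow> real"
  where "mom_hess u j x t = pd j (pd j u) x t \<bullet> x + 2 * pd j u x t $ j"

context
  fixes a T A :: real and u :: "real ^ 'n \<Rightarrow> real \<Rightarrow> real ^ 'n"
  assumes sol: "classical_on (quad_form a) T A u" and rad: "\<And>t. 0 \<le> t \<Longrightarrow> t \<le> T \<Longrightarrow> radial (\<lambda>x. u x t)"
begin

lemma mom_derivs:
  assumes t: "0 < t" "t \<le> T"
  shows "line_deriv (\<lambda>y. mom u y t) j x (mom_grad u j x t)" "line_deriv (\<lambda>y. mom_grad u j y t) j x (mom_hess u j x t)"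
proof -
  have c: "c1 T u" "c1 T (pd j u)" using sol by (auto simp: classical_on_def jet_def)
  have l: "((\<lambda>s. x + s *\<^sub>R axis j 1) has_derivative (\<lambda>s. s *\<^sub>R axis j 1)) (at 0)"
    by (auto intro!: derivative_eq_intros)
  have d: "((\<lambda>s. g (x + s *\<^sub>R axis j 1)) has_derivative (\<lambda>s. s *\<^sub>R p j)) (at 0)"
    if "(g has_derivative (\<lambda>h. \<Sum>j\<in>UNIV. h $ j *\<^sub>R p j)) (at x)" for g :: "real^'n \<Rightarrow> real^'n" and p
  proof -
    have "((\<lambda>s. g (x + s *\<^sub>R axis j 1)) has_derivative (\<lambda>s. \<Sum>i\<in>UNIV. (s *\<^sub>R (axis j 1 :: real^'n)) $ i *\<^sub>R p i)) (at 0)"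
      by (rule has_derivative_compose[OF l]) (use that in simp)
    moreover have "(\<Sum>i\<in>UNIV. (s *\<^sub>R (axis j 1 :: real^'n)) $ i *\<^sub>R p i) = s *\<^sub>R p j" for s
      using sum_axis_scaleR[of j p] by (simp add: scaleR_sum_right[symmetric] flip: scaleR_scaleR)
    ultimately show ?thesis by simp
  qed
  note d1 = d[OF c1_has_derivative[OF c(1) t]] and d2 = d[OF c1_has_derivative[OF c(2) t]]
  show "line_deriv (\<lambda>y. mom u y t) j x (mom_grad u j x t)"
    unfolding line_deriv_def mom_def has_field_derivative_def
    by (rule has_derivative_eq_rhs, rule has_derivative_inner[OF d1 l])
       (auto simp: mom_grad_def inner_axis fun_eq_iff algebra_simps inner_simps)
  have "((\<lambda>s. u (x + s *\<^sub>R axis j 1) t $ j) has_derivative (\<lambda>s. (s *\<^sub>R pd j u x t) $ j)) (at 0)"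
    by (rule bounded_linear.has_derivative[OF bounded_linear_vec_nth d1])
  from has_derivative_add[OF has_derivative_inner[OF d2 l] this]
  show "line_deriv (\<lambda>y. mom_grad u j y t) j x (mom_hess u j x t)"
    unfolding line_deriv_def mom_grad_def has_field_derivative_def
    by (rule has_derivative_eq_rhs)
       (auto simp: mom_hess_def inner_axis fun_eq_iff algebra_simps inner_simps)
qed

text \<open>
  For radial \<open>u\<close> the quadratic terms only enter through \<open>m = u \<bullet> x\<close> and its radial derivative \<open>G\<close>, and
  \<open>a\<close> cancels.
\<close>

lemma mom_equation:
  assumes t: "0 < t" "t < T" and x: "x \<noteq> 0"
  defines "G \<equiv> \<Sum>j\<in>UNIV. x $ j * mom_grad u j x t"
  shows "((\<lambda>t. mom u x t) has_real_derivative
    ((\<Sum>j\<in>UNIV. mom_hess u j x t) - 2 / (x \<bullet> x) * (G + (real CARD('n) - 2) * mom u x t)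
      - (3/2 * (mom u x t * G) + (real CARD('n) - 4) / 2 * (mom u x t)\<^sup>2) / (x \<bullet> x))) (at t)"
proof -
  have c: "c1 T u" using sol by (auto simp: classical_on_def jet_def)
  have tT: "t \<le> T" using t by simp
  define m where "m = mom u x t"
  define s where "s = x \<bullet> x"
  have s0: "s \<noteq> 0" using x by (simp add: s_def)
  define dv where "dv = (\<Sum>j\<in>UNIV. pd j u x t $ j)"
  define X where "X = (\<Sum>j\<in>UNIV. x $ j * (pd j u x t \<bullet> x))"
  have par: "u y t = ((u y t \<bullet> y) / (y \<bullet> y)) *\<^sub>R y" for y
    by (rule radial_parallel[OF rad]) (use t in auto)
  have ux: "u x t = (m / s) *\<^sub>R x" using par[of x] by (simp add: m_def mom_def s_def)
  have G: "G = X + m"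
    by (simp add: G_def X_def mom_grad_def distrib_left sum.distrib m_def mom_def inner_vec_def mult.commute)
  have div: "dv = (X + (real CARD('n) - 1) * m) / s"
    unfolding dv_def X_def m_def s_def mom_def
    by (rule divergence_radial[OF c1_has_derivative[OF c t(1) tT] x par])
  have hess: "(\<Sum>j\<in>UNIV. mom_hess u j x t) = lap u x t \<bullet> x + 2 * dv"
    by (simp add: mom_hess_def sum.distrib lap_def inner_sum_left dv_def sum_distrib_left)
  have N: "nonlin (quad_form a) u u x t \<bullet> x = - ((m / s) * X + 1/2 * dv * m)"
  proof -
    have "(\<Sum>j\<in>UNIV. u x t $ j *\<^sub>R pd j u x t) \<bullet> x = (m / s) * X"
      by (simp add: inner_sum_left ux X_def sum_distrib_left mult_ac)
    moreover have "(\<Sum>j\<in>UNIV. (u x t \<bullet> pd j u x t) *\<^sub>R axis j 1) \<bullet> x = (m / s) * X"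
      unfolding sum_axis_inner by (simp add: ux X_def sum_distrib_left mult_ac inner_commute)
    moreover have "u x t \<bullet> x = m" by (simp add: m_def mom_def)
    ultimately show ?thesis
      unfolding nonlin_quad_form dv_def[symmetric] by (simp add: inner_simps algebra_simps)
  qed
  have "((\<lambda>t. u x t) has_vector_derivative (lap u x t + nonlin (quad_form a) u u x t)) (at t)"
    using sol t by (simp add: classical_on_def)
  then have "((\<lambda>t. u x t \<bullet> x) has_vector_derivative ((lap u x t + nonlin (quad_form a) u u x t) \<bullet> x)) (at t)"
    by (rule bounded_linear.has_vector_derivative[OF bounded_linear_inner_left])
  then have "((\<lambda>t. mom u x t) has_real_derivative ((lap u x t + nonlin (quad_form a) u u x t) \<bullet> x)) (at t)"
    by (simp add: mom_def has_real_derivative_iff_has_vector_derivative)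
  moreover have "(lap u x t + nonlin (quad_form a) u u x t) \<bullet> x = (\<Sum>j\<in>UNIV. mom_hess u j x t) - 2 / s * (G + (real CARD('n) - 2) * m)
      - (3/2 * (m * G) + (real CARD('n) - 4) / 2 * m\<^sup>2) / s"
    unfolding inner_add_left N hess div G using s0 by (simp add: field_simps power2_eq_square)
  ultimately show ?thesis by (simp add: m_def s_def)
qed

end

lemma radial_line_deriv:
  fixes x :: "real ^ 'n"
  assumes h: "(h has_real_derivative h' (x \<bullet> x)) (at (x \<bullet> x))" and h': "(h' has_real_derivative h2) (at (x \<bullet> x))"
  shows "line_deriv (\<lambda>y. h (y \<bullet> y)) j x (2 * x $ j * h' (x \<bullet> x))"
    and "line_deriv (\<lambda>y. 2 * y $ j * h' (y \<bullet> y)) j x (2 * h' (x \<bullet> x) + 4 * (x $ j)\<^sup>2 * h2)"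
proof -
  have e: "(x + s *\<^sub>R axis j 1) \<bullet> (x + s *\<^sub>R axis j 1) = x \<bullet> x + 2 * x $ j * s + s\<^sup>2" for s
    by (simp add: inner_simps inner_axis inner_axis' inner_commute algebra_simps power2_eq_square inner_axis_axis)
  have d: "((\<lambda>s. x \<bullet> x + 2 * x $ j * s + s\<^sup>2) has_real_derivative 2 * x $ j) (at 0)"
    by (auto intro!: derivative_eq_intros)
  have "((\<lambda>s. h (x \<bullet> x + 2 * x $ j * s + s\<^sup>2)) has_real_derivative h' (x \<bullet> x) * (2 * x $ j)) (at 0)"
    by (rule DERIV_chain2[OF _ d]) (use h in simp)
  then show "line_deriv (\<lambda>y. h (y \<bullet> y)) j x (2 * x $ j * h' (x \<bullet> x))"
    unfolding line_deriv_def e by (simp add: mult_ac)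
  have d': "((\<lambda>s. h' (x \<bullet> x + 2 * x $ j * s + s\<^sup>2)) has_real_derivative h2 * (2 * x $ j)) (at 0)"
    by (rule DERIV_chain2[OF _ d]) (use h' in simp)
  have "((\<lambda>s. 2 * (x $ j + s) * h' (x \<bullet> x + 2 * x $ j * s + s\<^sup>2)) has_real_derivative
      2 * h' (x \<bullet> x) + 4 * (x $ j)\<^sup>2 * h2) (at 0)"
    by (rule derivative_eq_intros d' refl)+ (simp add: power2_eq_square algebra_simps)
  then show "line_deriv (\<lambda>y. 2 * y $ j * h' (y \<bullet> y)) j x (2 * h' (x \<bullet> x) + 4 * (x $ j)\<^sup>2 * h2)"
    unfolding line_deriv_def e by (simp add: axis_def)
qed

text \<open>
  The contradiction at a touching point in the proof of the comparison principle. The test function is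
  \<open>\<Psi> = r (F + E (1 + r\<^sup>2))\<close>: the linear part keeps the touching point away from the origin, the cubic part
  from infinity. The term \<open>(n - 1) \<psi> K / 2\<close> is not small, but the damping \<open>- (n - 1) \<psi> / r\<close> absorbs it up to a
  multiple of \<open>r \<psi>\<close>.
\<close>

lemma comparison_arith:
  fixes n r E F H K C B lam \<Psi> S G GP mm v J Dt :: real
  assumes n: "1 \<le> n" and r: "0 < r" and E: "0 < E" and F: "0 < F" and H: "H = F + E"
    and K: "K = C + B" "0 \<le> C" "0 \<le> B"
    and P: "\<Psi> = H * r + E * r ^ 3" and GP: "GP = H * r + 3 * E * r ^ 3"
    and mm: "\<bar>mm\<bar> \<le> C * r" and S: "\<bar>S\<bar> \<le> B * r" and v: "\<bar>G - S\<bar> \<le> B * r\<^sup>2"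
    and J: "J = 3/2 * (mm * GP + \<Psi> * G) + (n - 4) / 2 * (\<Psi> * (mm + S))"
    and lamdef: "lam = 1 + 2 * n + (n - 1) * K\<^sup>2 / 16 + 3 * C + 3/2 * B"
    and low: "lam * \<Psi> \<le> Dt"
    and up: "Dt \<le> ((n - 1) * H / r + 3 * (n + 1) * E * r) - 2 / r\<^sup>2 * (GP + (n - 2) * \<Psi>) + \<bar>J\<bar> / r\<^sup>2"
  shows False
proof -
  define \<psi> where "\<psi> = H + E * r\<^sup>2"
  have P': "\<Psi> = r * \<psi>" by (simp add: P \<psi>_def power2_eq_square power3_eq_cube algebra_simps)
  have GP': "GP = \<Psi> + 2 * E * r ^ 3" by (simp add: P GP)
  have psi0: "0 < \<psi>" using E F H r by (simp add: \<psi>_def add_pos_pos)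
  have P0: "0 < \<Psi>" using psi0 r by (simp add: P')
  have lin: "((n - 1) * H / r + 3 * (n + 1) * E * r) - 2 / r\<^sup>2 * (GP + (n - 2) * \<Psi>) = - (n - 1) * \<psi> / r + 2 * n * E * r"
    unfolding GP P \<psi>_def using r by (simp add: field_simps power2_eq_square power3_eq_cube)
  have J': "J = (n - 1) / 2 * \<Psi> * (mm + S) + 3 * E * r ^ 3 * mm + 3/2 * \<Psi> * (G - S)"
    unfolding J GP' by (simp add: algebra_simps add_divide_distrib diff_divide_distrib)
  have "\<bar>J\<bar> \<le> (n - 1) / 2 * \<Psi> * (K * r) + 3 * E * r ^ 3 * (C * r) + 3/2 * \<Psi> * (B * r\<^sup>2)"
  proof -
    have "\<bar>mm + S\<bar> \<le> K * r" using mm S K by (simp add: distrib_right)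
    then have 1: "\<bar>(n - 1) / 2 * \<Psi> * (mm + S)\<bar> \<le> (n - 1) / 2 * \<Psi> * (K * r)"
      using n P0 by (simp add: abs_mult mult_left_mono)
    have 2: "\<bar>3 * E * r ^ 3 * mm\<bar> \<le> 3 * E * r ^ 3 * (C * r)"
      using E r mm by (simp add: abs_mult mult_left_mono)
    have 3: "\<bar>3/2 * \<Psi> * (G - S)\<bar> \<le> 3/2 * \<Psi> * (B * r\<^sup>2)"
      using P0 v by (simp add: abs_mult mult_left_mono)
    show ?thesis unfolding J' using 1 2 3 by linarith
  qed
  then have "\<bar>J\<bar> / r\<^sup>2 \<le> ((n - 1) / 2 * \<Psi> * (K * r) + 3 * E * r ^ 3 * (C * r) + 3/2 * \<Psi> * (B * r\<^sup>2)) / r\<^sup>2"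
    by (rule divide_right_mono) simp
  also have "\<dots> = (n - 1) / 2 * \<psi> * K + 3 * C * (E * r\<^sup>2) + 3/2 * B * (r * \<psi>)"
    unfolding P' using r by (simp add: field_simps power2_eq_square power3_eq_cube)
  finally have Jb: "\<bar>J\<bar> / r\<^sup>2 \<le> (n - 1) / 2 * \<psi> * K + 3 * C * (E * r\<^sup>2) + 3/2 * B * (r * \<psi>)" .
  have Er: "E * r\<^sup>2 \<le> r * \<psi>"
  proof -
    have "0 \<le> (r - 1)\<^sup>2" by simp
    then have "r \<le> 1 + r\<^sup>2" using r by (simp add: power2_diff; linarith)
    then have "E * r \<le> E * (1 + r\<^sup>2)" using E by (intro mult_left_mono) auto
    also have "\<dots> \<le> \<psi>" using F by (simp add: \<psi>_def H distrib_left)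
    finally have "r * (E * r) \<le> r * \<psi>" using r by (intro mult_left_mono) auto
    then show ?thesis by (simp add: power2_eq_square mult_ac)
  qed
  have E1: "E * r \<le> r * \<psi>"
  proof -
    have "E \<le> \<psi>" using F E by (simp add: \<psi>_def H)
    then show ?thesis using r by (simp add: mult.commute mult_left_mono)
  qed
  \<comment> \<open>A completed square plays the term with \<open>K / 2\<close> off against the
    damping \<open>1 / r\<close>; the remainder \<open>r * K\<^sup>2 / 16\<close> is paid for by the
    corresponding summand of \<open>lam\<close>.\<close>
  have am: "K / 2 - 1 / r \<le> r * K\<^sup>2 / 16"
  proof -
    have "0 \<le> (K * r / 4 - 1)\<^sup>2 / r" using r by simp
    also have "\<dots> = r * K\<^sup>2 / 16 - K / 2 + 1 / r"
      using r by (simp add: field_simps power2_eq_square)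
    finally show ?thesis by simp
  qed
  have "(n - 1) * \<psi> * (K / 2 - 1 / r) \<le> (n - 1) * \<psi> * (r * K\<^sup>2 / 16)"
    using n psi0 by (intro mult_left_mono am) auto
  moreover have "3 * C * (E * r\<^sup>2) \<le> 3 * C * (r * \<psi>)" using K Er by (intro mult_left_mono) auto
  moreover have "2 * n * (E * r) \<le> 2 * n * (r * \<psi>)" using n E1 by (intro mult_left_mono) auto
  moreover have "lam * (r * \<psi>) \<le> - (n - 1) * \<psi> / r + 2 * n * (E * r) + ((n - 1) / 2 * \<psi> * K + 3 * C * (E * r\<^sup>2) + 3/2 * B * (r * \<psi>))"
  proof -
    have "lam * (r * \<psi>) \<le> Dt" using low by (simp add: P')
    moreover have "2 * n * E * r = 2 * n * (E * r)" by simp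
    ultimately show ?thesis using up Jb unfolding lin by linarith
  qed
  moreover have "(n - 1) * \<psi> * (K / 2 - 1 / r) = - (n - 1) * \<psi> / r + (n - 1) / 2 * \<psi> * K"
    by (simp add: algebra_simps diff_divide_distrib)
  moreover have "lam * (r * \<psi>) = r * \<psi> + 2 * n * (r * \<psi>) + (n - 1) * \<psi> * (r * K\<^sup>2 / 16) + 3 * C * (r * \<psi>) + 3/2 * B * (r * \<psi>)"
    unfolding lamdef by (simp add: algebra_simps)
  \<comment> \<open>All other summands of \<open>lam\<close> are used up by now; the summand
    \<open>1\<close> leaves \<open>r * \<psi>\<close>.\<close>
  ultimately have "r * \<psi> \<le> 0" by linarith
  then show False using r psi0 by (simp add: mult_le_0_iff)
qed

text \<open>If the inequality failed, then \<open>q\<close>, the difference divided by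
  \<open>|x|\<close> with an exponential weight in time and an \<open>\<epsilon>\<close>-penalty in
  space, would have a positive maximum. Infinity is excluded by the penalty, the origin by
  \<open>near\<close>, time zero by \<open>init\<close>. At the maximum the difference touches a
  test function \<open>h (|y|^2)\<close> from below, which \<open>mom_equation\<close> and
  \<open>super\<close> forbid. The sign \<open>\<sigma>\<close> covers bounds from both sides, since
  \<open>\<sigma> * mom u\<close> satisfies the same equation with the quadratic part multiplied by
  \<open>\<sigma>\<close>.\<close>

lemma comparison:
  fixes u :: "real ^ 'n \<Rightarrow> real \<Rightarrow> real ^ 'n" and S :: "real ^ 'n \<Rightarrow> real \<Rightarrow> real"
  assumes sol: "classical_on (quad_form a) T A u" and rad: "\<And>t. 0 \<le> t \<Longrightarrow> t \<le> T \<Longrightarrow> radial (\<lambda>x. u x t)"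
    and T': "T' \<le> T" and sg: "\<sigma> = 1 \<or> \<sigma> = -1"
    and C: "\<And>x t. 0 \<le> t \<Longrightarrow> t < T' \<Longrightarrow> norm (u x t) \<le> C"
    and Scont: "continuous_on (UNIV \<times> {0..<T'}) (\<lambda>(x, t). S x t)"
    and S1: "\<And>j x t. x \<noteq> 0 \<Longrightarrow> 0 < t \<Longrightarrow> t < T' \<Longrightarrow> line_deriv (\<lambda>y. S y t) j x (Sg j x t)"
    and S2: "\<And>j x t. x \<noteq> 0 \<Longrightarrow> 0 < t \<Longrightarrow> t < T' \<Longrightarrow> line_deriv (\<lambda>y. Sg j y t) j x (Sh j x t)"
    and St: "\<And>x t. x \<noteq> 0 \<Longrightarrow> 0 < t \<Longrightarrow> t < T' \<Longrightarrow> ((\<lambda>t. S x t) has_real_derivative St x t) (at t)"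
    and B: "\<And>x t. 0 \<le> t \<Longrightarrow> t < T' \<Longrightarrow> \<bar>S x t\<bar> \<le> B * norm x" "0 \<le> B"
    and B2: "\<And>x t. x \<noteq> 0 \<Longrightarrow> 0 < t \<Longrightarrow> t < T' \<Longrightarrow> \<bar>(\<Sum>j\<in>UNIV. x $ j * Sg j x t) - S x t\<bar> \<le> B * (norm x)\<^sup>2"
    and super: "\<And>x t. x \<noteq> 0 \<Longrightarrow> 0 < t \<Longrightarrow> t < T' \<Longrightarrow>
      (\<Sum>j\<in>UNIV. Sh j x t) - 2 / (x \<bullet> x) * ((\<Sum>j\<in>UNIV. x $ j * Sg j x t) + (real CARD('n) - 2) * S x t)
      - \<sigma> * (3/2 * (S x t * (\<Sum>j\<in>UNIV. x $ j * Sg j x t)) + (real CARD('n) - 4) / 2 * (S x t)\<^sup>2) / (x \<bullet> x) \<le> St x t"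
    and near: "\<And>t0 e. 0 < t0 \<Longrightarrow> t0 < T' \<Longrightarrow> 0 < e \<Longrightarrow>
      \<exists>d>0. \<forall>t x. 0 \<le> t \<longrightarrow> t \<le> t0 \<longrightarrow> norm x < d \<longrightarrow> \<sigma> * mom u x t - S x t \<le> e * norm x"
    and init: "\<And>x. \<sigma> * mom u x 0 \<le> S x 0"
    and t: "0 \<le> t" "t < T'"
  shows "\<sigma> * mom u x t \<le> S x t"
proof (rule ccontr)
  let ?n = "real CARD('n)"
  assume "\<not> \<sigma> * mom u x t \<le> S x t"
  define D where "D x t = \<sigma> * mom u x t - S x t" for x t
  from \<open>\<not> _\<close> have D0: "0 < D x t" by (simp add: D_def)
  have C0: "0 \<le> C" using C[OF t, of 0] norm_ge_zero order_trans by blast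
  define K where "K = C + B"
  have K0: "0 \<le> K" using C0 B by (simp add: K_def)
  define lam where "lam = 1 + 2 * ?n + (?n - 1) * K\<^sup>2 / 16 + 3 * C + 3/2 * B"
  have n1: "1 \<le> ?n" using zero_less_card_finite[where 'a='n] by linarith
  have lam0: "0 < lam" using n1 C0 B by (auto simp: lam_def intro!: add_pos_nonneg)
  have mb: "\<bar>\<sigma> * mom u y s\<bar> \<le> C * norm y" if "0 \<le> s" "s < T'" for y s
  proof -
    have "\<bar>mom u y s\<bar> \<le> norm (u y s) * norm y" unfolding mom_def by (rule Cauchy_Schwarz_ineq2)
    also have "\<dots> \<le> C * norm y" by (intro mult_right_mono C that) auto
    finally show ?thesis using sg by (auto simp: abs_mult)
  qed
  have DK: "D y s \<le> K * norm y" if "0 \<le> s" "s < T'" for y s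
    using mb[OF that, of y] B(1)[OF that, of y] unfolding D_def K_def distrib_right by linarith
  have x0: "x \<noteq> 0" using DK[OF t, of x] D0 by auto
  have t0: "0 < t" using t D0 init[of x] by (cases "t = 0") (auto simp: D_def)
  \<comment> \<open>With this \<open>\<epsilon>\<close> the penalty takes away exactly half of the
    weighted quotient at the chosen point, so \<open>q x t\<close> stays positive.\<close>
  define \<epsilon> where "\<epsilon> = exp (- lam * t) * (D x t / norm x) / (2 * (1 + (norm x)\<^sup>2))"
  have px: "0 < 1 + (norm y)\<^sup>2" for y :: "real^'n" by (simp add: add_pos_nonneg)
  have e0: "0 < \<epsilon>" using D0 x0 px[of x] by (simp add: \<epsilon>_def)
  define q where "q y s = exp (- lam * s) * (D y s / norm y) - \<epsilon> * (1 + (norm y)\<^sup>2)" for y s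
  define c where "c = q x t"
  have c0: "0 < c"
  proof -
    have "\<epsilon> * (1 + (norm x)\<^sup>2) = exp (- lam * t) * (D x t / norm x) / 2"
    proof -
      have "A / (2 * W) * W = A / 2" if "0 < W" for A W :: real using that by simp
      from this[OF px[of x]] show ?thesis unfolding \<epsilon>_def .
    qed
    then show ?thesis using D0 x0 by (simp add: c_def q_def)
  qed
  have ex1: "exp (- lam * s) \<le> 1" if "0 \<le> s" for s using that lam0 by simp
  have qR: "norm y \<le> K / \<epsilon>" if "y \<noteq> 0" "0 \<le> s" "s \<le> t" "c \<le> q y s" for y s
  proof -
    have "D y s / norm y \<le> K" using DK[of s y] that t by (simp add: pos_divide_le_eq)
    then have "exp (- lam * s) * (D y s / norm y) \<le> exp (- lam * s) * K" by (intro mult_left_mono) auto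
    also have "\<dots> \<le> 1 * K" using K0 ex1[OF that(2)] by (intro mult_right_mono) auto
    finally have "\<epsilon> * (1 + (norm y)\<^sup>2) \<le> K" using that c0 by (simp add: q_def)
    then have "1 + (norm y)\<^sup>2 \<le> K / \<epsilon>" using e0 by (simp add: pos_le_divide_eq mult.commute)
    then show ?thesis using norm_le_one_plus_square[of "norm y"] by linarith
  qed
  obtain d where d: "0 < d" "\<And>s y. 0 \<le> s \<Longrightarrow> s \<le> t \<Longrightarrow> norm y < d \<Longrightarrow> D y s \<le> c * norm y"
    using near[OF t0 t(2) c0] by (auto simp: D_def)
  have qd: "d \<le> norm y" if "y \<noteq> 0" "0 \<le> s" "s \<le> t" "c \<le> q y s" for y s
  proof (rule ccontr)
    assume "\<not> d \<le> norm y"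
    then have "D y s / norm y \<le> c" using d(2)[of s y] that by (simp add: pos_divide_le_eq)
    then have "exp (- lam * s) * (D y s / norm y) \<le> exp (- lam * s) * c" by (intro mult_left_mono) auto
    also have "\<dots> \<le> 1 * c" using c0 ex1[OF that(2)] by (intro mult_right_mono) auto
    finally have "q y s \<le> c - \<epsilon> * (1 + (norm y)\<^sup>2)" by (simp add: q_def)
    then show False using that(4) e0 px[of y] mult_pos_pos[OF e0 px[of y]] by linarith
  qed
  \<comment> \<open>By \<open>qR\<close> and \<open>qd\<close>, \<open>q\<close> is below
    \<open>c\<close> at every point other than the origin that lies outside this compact shell; so
    the maximum over \<open>X\<close> is global.\<close>
  define X where "X = (cball 0 (K / \<epsilon>) - ball (0 :: real ^ 'n) d) \<times> {0..t}"
  have "compact X" unfolding X_def by (intro compact_Times compact_diff compact_cball compact_Icc open_ball)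
  moreover have xX: "(x, t) \<in> X"
    using qR[OF x0 t(1) order_refl] qd[OF x0 t(1) order_refl] t by (simp add: X_def c_def)
  moreover have "continuous_on X (\<lambda>(y, s). q y s)"
  proof -
    have sub: "X \<subseteq> UNIV \<times> {0..<T'}" "X \<subseteq> UNIV \<times> {0..T}" using t T' by (auto simp: X_def)
    have cu: "continuous_on X (\<lambda>p. u (fst p) (snd p))"
      using sol continuous_on_subset[OF _ sub(2)] by (auto simp: classical_on_def case_prod_unfold)
    have cS: "continuous_on X (\<lambda>p. S (fst p) (snd p))"
      using continuous_on_subset[OF Scont sub(1)] by (simp add: case_prod_unfold)
    have "continuous_on X (\<lambda>p. D (fst p) (snd p))"
      unfolding D_def mom_def by (intro continuous_intros cu cS)
    then show ?thesis
      unfolding q_def case_prod_unfold using d(1) by (intro continuous_intros) (auto simp: X_def)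
  qed
  ultimately obtain p where p: "p \<in> X" "\<And>p'. p' \<in> X \<Longrightarrow> (case p' of (y, s) \<Rightarrow> q y s) \<le> (case p of (y, s) \<Rightarrow> q y s)"
    using continuous_attains_sup[of X "\<lambda>(y, s). q y s"] by blast
  obtain y s where ys: "p = (y, s)" by (cases p)
  define q1 where "q1 = q y s"
  have s: "0 \<le> s" "s \<le> t" and y: "d \<le> norm y" "norm y \<le> K / \<epsilon>" using p(1) by (auto simp: ys X_def)
  have y0: "y \<noteq> 0" using y d by auto
  have q1c: "c \<le> q1" using p(2)[OF xX] by (simp add: ys c_def q1_def)
  have qmax: "q z r \<le> q1" if "z \<noteq> 0" "0 \<le> r" "r \<le> t" for z r
  proof (cases "c \<le> q z r")
    case True
    then have "(z, r) \<in> X" using qR[OF that] qd[OF that] that by (simp add: X_def)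
    then show ?thesis using p(2) by (fastforce simp: ys q1_def)
  next
    case False
    then show ?thesis using q1c by simp
  qed
  have q10: "0 < q1" using c0 q1c by simp
  have s0: "0 < s"
  proof (rule ccontr)
    assume "\<not> 0 < s"
    then have "s = 0" using s by simp
    then have "D y s \<le> 0" using init[of y] by (simp add: D_def)
    then have "D y s / norm y \<le> 0" by (simp add: divide_nonpos_nonneg)
    then have "exp (- lam * s) * (D y s / norm y) \<le> 0" by (intro mult_nonneg_nonpos) auto
    then have "q y s \<le> - (\<epsilon> * (1 + (norm y)\<^sup>2))" unfolding q_def by linarith
    then show False using q10 mult_pos_pos[OF e0 px[of y]] by (simp add: q1_def)
  qed
  have sT: "s < T'" "s < T" using s t T' by auto
  \<comment> \<open>Multiplied by \<open>exp (lam * s)\<close> and by \<open>norm z\<close>, the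
    inequality \<open>q z s \<le> q1\<close> becomes \<open>D z s \<le> h (z \<bullet> z)\<close>,
    with equality at \<open>y\<close>. Here \<open>h\<close> is the test function
    \<open>\<Psi>\<close> of \<open>comparison_arith\<close>, expressed in the squared
    radius.\<close>
  define E where "E = exp (lam * s) * \<epsilon>"
  define F where "F = exp (lam * s) * q1"
  define H where "H = F + E"
  have EF: "0 < E" "0 < F" using e0 q10 by (auto simp: E_def F_def)
  define h where "h w = H * sqrt w + E * (w * sqrt w)" for w
  define h' where "h' w = H / (2 * sqrt w) + 3/2 * E * sqrt w" for w
  define h2 where "h2 w = - H / (4 * (w * sqrt w)) + 3/4 * E / sqrt w" for w
  have dh: "(h has_real_derivative h' w) (at w)" "(h' has_real_derivative h2 w) (at w)" if "0 < w" for w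
  proof -
    have sw: "sqrt w * sqrt w = w" "sqrt w \<noteq> 0" using that by auto
    have ds: "(sqrt has_real_derivative (inverse (sqrt w) / 2)) (at w)" by (rule DERIV_real_sqrt[OF that])
    show "(h has_real_derivative h' w) (at w)"
      unfolding h_def h'_def
      by (rule derivative_eq_intros ds refl | (use sw that in \<open>simp add: field_simps; fail\<close>))+
    have "sqrt w * (sqrt w * 2) = 2 * w" using sw by simp
    show "(h' has_real_derivative h2 w) (at w)"
      unfolding h'_def h2_def
      by (rule derivative_eq_intros ds refl | (use sw that in \<open>simp add: field_simps; fail\<close>))+
  qed
  have hn: "h (z \<bullet> z) = norm z * (F + E * (1 + (norm z)\<^sup>2))" for z :: "real^'n"
    by (simp add: h_def H_def norm_eq_sqrt_inner[symmetric] power2_norm_eq_inner algebra_simps)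
  have FE: "exp (lam * s) * (q1 + \<epsilon> * W) = F + E * W" for W by (simp add: F_def E_def algebra_simps)
  have cancel: "exp (lam * s) * (exp (- lam * s) * W) = W" for W by (simp add: exp_minus)
  have Dh: "D z s \<le> h (z \<bullet> z)" if "z \<noteq> 0" for z
  proof -
    have "exp (- lam * s) * (D z s / norm z) \<le> q1 + \<epsilon> * (1 + (norm z)\<^sup>2)"
      using qmax[OF that s] by (simp add: q_def)
    then have "exp (lam * s) * (exp (- lam * s) * (D z s / norm z)) \<le> exp (lam * s) * (q1 + \<epsilon> * (1 + (norm z)\<^sup>2))"
      by (intro mult_left_mono) auto
    then have "D z s / norm z \<le> F + E * (1 + (norm z)\<^sup>2)" unfolding FE cancel .
    then show ?thesis unfolding hn using that by (simp add: pos_divide_le_eq mult.commute)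
  qed
  have Deq: "D y s = h (y \<bullet> y)"
  proof -
    have "exp (- lam * s) * (D y s / norm y) = q1 + \<epsilon> * (1 + (norm y)\<^sup>2)" by (simp add: q_def q1_def)
    then have "exp (lam * s) * (exp (- lam * s) * (D y s / norm y)) = exp (lam * s) * (q1 + \<epsilon> * (1 + (norm y)\<^sup>2))" by simp
    then have "D y s / norm y = F + E * (1 + (norm y)\<^sup>2)" unfolding FE cancel .
    then show ?thesis unfolding hn using y0 by (simp add: divide_eq_eq mult.commute)
  qed
  let ?w = "y \<bullet> y"
  define r where "r = norm y"
  have r0: "0 < r" using y0 by (simp add: r_def)
  have w: "?w = r\<^sup>2" "sqrt ?w = r" "0 < ?w" using y0 by (auto simp: r_def power2_norm_eq_inner norm_eq_sqrt_inner)
  \<comment> \<open>First- and second-order conditions along the line through \<open>y\<close> in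
    direction \<open>j\<close>. For parameters smaller than \<open>norm y\<close> this line avoids
    the origin, where nothing is assumed about derivatives of \<open>S\<close>.\<close>
  have space: "\<sigma> * mom_grad u j y s - Sg j y s - 2 * y $ j * h' ?w = 0"
    "\<sigma> * mom_hess u j y s - Sh j y s - (2 * h' ?w + 4 * (y $ j)\<^sup>2 * h2 ?w) \<le> 0" for j
  proof -
    let ?l = "\<lambda>r. y + r *\<^sub>R axis j 1"
    define f where "f r = D (?l r) s - h (?l r \<bullet> ?l r)" for r
    define f' where "f' r = \<sigma> * mom_grad u j (?l r) s - Sg j (?l r) s - 2 * ?l r $ j * h' (?l r \<bullet> ?l r)" for r
    have nz: "?l r \<noteq> 0" if "\<bar>r\<bar> < norm y" for r
    proof
      assume "?l r = 0"
      then have "y = - (r *\<^sub>R axis j 1)" by (simp add: eq_neg_iff_add_eq_0)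
      then have "norm y = \<bar>r\<bar>" by (metis norm_axis_1 norm_minus_cancel norm_scaleR mult.right_neutral)
      then show False using that by simp
    qed
    have sT1: "s \<le> T" using sT by simp
    have d1: "(f has_real_derivative f' r) (at r)" if "\<bar>r\<bar> < norm y" for r
    proof -
      have w0: "0 < ?l r \<bullet> ?l r" using nz[OF that] by simp
      note a = line_deriv_shift[OF mom_derivs(1)[OF sol rad s0 sT1, of j "?l r"]]
      note b = line_deriv_shift[OF S1[OF nz[OF that] s0 sT(1)]]
      note e = line_deriv_shift[OF radial_line_deriv(1)[OF dh(1)[OF w0] dh(2)[OF w0]]]
      show ?thesis unfolding f_def f'_def D_def by (intro DERIV_diff DERIV_cmult a b e)
    qed
    have d2: "(f' has_real_derivative (\<sigma> * mom_hess u j y s - Sh j y s - (2 * h' ?w + 4 * (y $ j)\<^sup>2 * h2 ?w))) (at 0)"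
      using mom_derivs(2)[OF sol rad s0 sT1, of j y] S2[OF y0 s0 sT(1), of j] radial_line_deriv(2)[OF dh(1)[OF w(3)] dh(2)[OF w(3)], of j]
      unfolding line_deriv_def f'_def by (intro DERIV_diff DERIV_cmult)
    have mx: "f r \<le> f 0" if "\<bar>r\<bar> < norm y" for r
      using Dh[OF nz[OF that]] Deq by (simp add: f_def)
    have ny: "0 < norm y" using y0 by simp
    show "\<sigma> * mom_grad u j y s - Sg j y s - 2 * y $ j * h' ?w = 0"
      "\<sigma> * mom_hess u j y s - Sh j y s - (2 * h' ?w + 4 * (y $ j)\<^sup>2 * h2 ?w) \<le> 0"
      using second_derivative_at_max[OF ny d1 d2 mx] by (auto simp: f'_def)
  qed
  define Gs where "Gs = (\<Sum>j\<in>UNIV. y $ j * Sg j y s)"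
  define Gm where "Gm = (\<Sum>j\<in>UNIV. y $ j * mom_grad u j y s)"
  define mt where "mt = (\<Sum>j\<in>UNIV. mom_hess u j y s) - 2 / ?w * (Gm + (?n - 2) * mom u y s)
      - (3/2 * (mom u y s * Gm) + (?n - 4) / 2 * (mom u y s)\<^sup>2) / ?w"
  have dm: "((\<lambda>t. mom u y t) has_real_derivative mt) (at s)"
    unfolding mt_def Gm_def by (rule mom_equation[OF sol rad s0 sT(2) y0])
  \<comment> \<open>Only earlier times are compared, because \<open>s\<close> may be the final time
    \<open>t\<close>; this already gives the one-sided inequality that is wanted.\<close>
  have time: "lam * D y s \<le> \<sigma> * mt - St y s"
  proof (rule ccontr)
    assume neg: "\<not> lam * D y s \<le> \<sigma> * mt - St y s"
    define g where "g r = exp (- lam * r) * D y r" for r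
    have "((\<lambda>r. D y r) has_real_derivative (\<sigma> * mt - St y s)) (at s)"
      unfolding D_def by (intro DERIV_diff DERIV_cmult dm St[OF y0 s0 sT(1)])
    then have dg: "(g has_real_derivative exp (- lam * s) * ((\<sigma> * mt - St y s) - lam * D y s)) (at s)"
      unfolding g_def by (auto intro!: derivative_eq_intros simp: algebra_simps)
    have "exp (- lam * s) * ((\<sigma> * mt - St y s) - lam * D y s) < 0" using neg by (simp add: mult_pos_neg)
    from DERIV_neg_dec_left[OF dg this] obtain e where e: "0 < e" "\<And>k. 0 < k \<Longrightarrow> k < e \<Longrightarrow> g s < g (s - k)" by auto
    define k where "k = min e s / 2"
    have k: "0 < k" "k < e" "k < s" using e(1) s0 by (auto simp: k_def min_def)
    have "q y (s - k) \<le> q y s" using qmax[OF y0, of "s - k"] k s by (simp add: q1_def)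
    then have "g (s - k) / norm y \<le> g s / norm y" by (simp add: q_def g_def)
    then have "g (s - k) \<le> g s" using y0 by (simp add: divide_le_cancel)
    then show False using e(2)[OF k(1,2)] by simp
  qed
  have GG: "\<sigma> * Gm = Gs + 2 * ?w * h' ?w"
  proof -
    have "\<sigma> * Gm = (\<Sum>j\<in>UNIV. y $ j * Sg j y s + 2 * h' ?w * (y $ j * y $ j))"
      unfolding Gm_def sum_distrib_left
    proof (rule sum.cong[OF refl])
      fix j
      have "\<sigma> * mom_grad u j y s = Sg j y s + 2 * y $ j * h' ?w" using space(1)[of j] by simp
      then have "y $ j * (\<sigma> * mom_grad u j y s) = y $ j * (Sg j y s + 2 * y $ j * h' ?w)" by simp
      then show "\<sigma> * (y $ j * mom_grad u j y s) = y $ j * Sg j y s + 2 * h' ?w * (y $ j * y $ j)" by (simp add: algebra_simps)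
    qed
    also have "\<dots> = Gs + 2 * h' ?w * ?w"
      by (simp add: sum.distrib Gs_def sum_distrib_left inner_vec_def)
    finally show ?thesis by (simp add: mult_ac)
  qed
  have HH: "\<sigma> * (\<Sum>j\<in>UNIV. mom_hess u j y s) \<le> (\<Sum>j\<in>UNIV. Sh j y s) + (2 * ?n * h' ?w + 4 * ?w * h2 ?w)"
  proof -
    have "\<sigma> * (\<Sum>j\<in>UNIV. mom_hess u j y s) \<le> (\<Sum>j\<in>UNIV. Sh j y s + (2 * h' ?w + 4 * h2 ?w * (y $ j * y $ j)))"
      unfolding sum_distrib_left
    proof (rule sum_mono)
      fix j show "\<sigma> * mom_hess u j y s \<le> Sh j y s + (2 * h' ?w + 4 * h2 ?w * (y $ j * y $ j))"
        using space(2)[of j] by (simp add: power2_eq_square algebra_simps)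
    qed
    also have "\<dots> = (\<Sum>j\<in>UNIV. Sh j y s) + (2 * ?n * h' ?w + 4 * ?w * h2 ?w)"
      by (simp add: sum.distrib sum_distrib_left[symmetric] inner_vec_def)
    finally show ?thesis .
  qed
  define \<Psi> where "\<Psi> = h ?w"
  define GP where "GP = 2 * ?w * h' ?w"
  define mm where "mm = \<sigma> * mom u y s"
  have mmS: "mm = S y s + \<Psi>" using Deq by (simp add: D_def mm_def \<Psi>_def)
  \<comment> \<open>The change of the quadratic part when \<open>S\<close> is replaced by
    \<open>mm = S + \<Psi>\<close> and \<open>Gs\<close> by \<open>Gs + GP\<close>.\<close>
  define J where "J = 3/2 * (mm * GP + \<Psi> * Gs) + (?n - 4) / 2 * (\<Psi> * (mm + S y s))"
  have ss: "\<sigma> * \<sigma> = 1" using sg by auto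
  have sup: "(\<Sum>j\<in>UNIV. Sh j y s) - 2 / ?w * (Gs + (?n - 2) * S y s)
      - \<sigma> * (3/2 * (S y s * Gs) + (?n - 4) / 2 * (S y s)\<^sup>2) / ?w \<le> St y s"
    unfolding Gs_def by (rule super[OF y0 s0 sT(1)])
  have prods: "mom u y s * Gm = mm * (Gs + GP)" "(mom u y s)\<^sup>2 = mm\<^sup>2"
  proof -
    have "mm * (Gs + GP) = (\<sigma> * \<sigma>) * (mom u y s * Gm)" unfolding mm_def GP_def GG[symmetric] by simp
    then show "mom u y s * Gm = mm * (Gs + GP)" using ss by simp
    have "mm\<^sup>2 = (\<sigma> * \<sigma>) * (mom u y s)\<^sup>2" by (simp add: mm_def power2_eq_square)
    then show "(mom u y s)\<^sup>2 = mm\<^sup>2" using ss by simp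
  qed
  have "\<sigma> * mt = \<sigma> * (\<Sum>j\<in>UNIV. mom_hess u j y s) - 2 / ?w * (Gs + GP + (?n - 2) * mm) - \<sigma> * (3/2 * (mm * (Gs + GP)) + (?n - 4) / 2 * mm\<^sup>2) / ?w"
  proof -
    have "\<sigma> * (2 / ?w * (Gm + (?n - 2) * mom u y s)) = 2 / ?w * (\<sigma> * Gm + (?n - 2) * (\<sigma> * mom u y s))" by (simp add: algebra_simps)
    then show ?thesis
      unfolding mt_def prods right_diff_distrib GG mm_def[symmetric] GP_def[symmetric] by simp
  qed
  also have "\<dots> \<le> (\<Sum>j\<in>UNIV. Sh j y s) + (2 * ?n * h' ?w + 4 * ?w * h2 ?w) - 2 / ?w * (Gs + GP + (?n - 2) * mm) - \<sigma> * (3/2 * (mm * (Gs + GP)) + (?n - 4) / 2 * mm\<^sup>2) / ?w"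
    using HH by simp
  finally have "\<sigma> * mt - St y s \<le> (2 * ?n * h' ?w + 4 * ?w * h2 ?w)
      - (2 / ?w * (Gs + GP + (?n - 2) * mm) - 2 / ?w * (Gs + (?n - 2) * S y s))
      - (\<sigma> * (3/2 * (mm * (Gs + GP)) + (?n - 4) / 2 * mm\<^sup>2) / ?w - \<sigma> * (3/2 * (S y s * Gs) + (?n - 4) / 2 * (S y s)\<^sup>2) / ?w)"
    using sup by linarith
  moreover have "2 / ?w * (Gs + GP + (?n - 2) * mm) - 2 / ?w * (Gs + (?n - 2) * S y s) = 2 / ?w * (GP + (?n - 2) * \<Psi>)"
    unfolding mmS by (simp add: algebra_simps add_divide_distrib diff_divide_distrib)
  moreover have "\<sigma> * (3/2 * (mm * (Gs + GP)) + (?n - 4) / 2 * mm\<^sup>2) / ?w - \<sigma> * (3/2 * (S y s * Gs) + (?n - 4) / 2 * (S y s)\<^sup>2) / ?w = \<sigma> * J / ?w"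
  proof -
    have "J = (3/2 * (mm * (Gs + GP)) + (?n - 4) / 2 * mm\<^sup>2) - (3/2 * (S y s * Gs) + (?n - 4) / 2 * (S y s)\<^sup>2)"
      unfolding J_def mmS by (simp add: algebra_simps power2_eq_square)
    then show ?thesis by (simp add: diff_divide_distrib right_diff_distrib)
  qed
  moreover have "- (\<sigma> * J / ?w) \<le> \<bar>J\<bar> / ?w"
  proof -
    have "- (\<sigma> * J) \<le> \<bar>J\<bar>" using sg by auto
    from divide_right_mono[OF this, of ?w] w(3) show ?thesis by simp
  qed
  ultimately have up: "\<sigma> * mt - St y s \<le> (2 * ?n * h' ?w + 4 * ?w * h2 ?w) - 2 / ?w * (GP + (?n - 2) * \<Psi>) + \<bar>J\<bar> / ?w"
    by linarith
  have lap: "2 * ?n * h' ?w + 4 * ?w * h2 ?w = (?n - 1) * H / r + 3 * (?n + 1) * E * r"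
    unfolding h'_def h2_def w(2) unfolding w(1) using r0 by (simp add: field_simps power2_eq_square)
  show False
  proof (rule comparison_arith[OF n1 r0 EF H_def K_def C0 B(2) _ _ _ _ _ J_def lam_def])
    show "\<Psi> = H * r + E * r ^ 3" unfolding \<Psi>_def h_def w(2) unfolding w(1) by (simp add: power2_eq_square power3_eq_cube)
    show "GP = H * r + 3 * E * r ^ 3"
      unfolding GP_def h'_def w(2) unfolding w(1) using r0 by (simp add: field_simps power2_eq_square power3_eq_cube)
    show "\<bar>mm\<bar> \<le> C * r" unfolding mm_def r_def by (rule mb) (use s0 sT in auto)
    show "\<bar>S y s\<bar> \<le> B * r" unfolding r_def by (rule B(1)) (use s0 sT in auto)
    show "\<bar>Gs - S y s\<bar> \<le> B * r\<^sup>2" unfolding Gs_def r_def by (rule B2[OF y0 s0 sT(1)])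
    show "lam * \<Psi> \<le> \<sigma> * mt - St y s" using time Deq by (simp add: \<Psi>_def)
    show "\<sigma> * mt - St y s \<le> (?n - 1) * H / r + 3 * (?n + 1) * E * r - 2 / r\<^sup>2 * (GP + (?n - 2) * \<Psi>) + \<bar>J\<bar> / r\<^sup>2"
      using up[unfolded lap, unfolded w(1)] .
  qed
qed

lemma radial_zero: assumes "radial f" shows "f 0 = 0"
  using radial_parallel[OF assms, of 0] by simp

text \<open>A radial field vanishes at the origin, so by uniform continuity on a compact set
  \<open>u\<close> is small near it, uniformly in time. Hence \<open>u \<bullet> x\<close> is small
  even relative to \<open>|x|\<close>.\<close>

lemma near_origin:
  fixes u :: "real ^ 'n \<Rightarrow> real \<Rightarrow> real ^ 'n"
  assumes c: "continuous_on (UNIV \<times> {0..T}) (\<lambda>(x, t). u x t)" and rad: "\<And>t. 0 \<le> t \<Longrightarrow> t \<le> T \<Longrightarrow> radial (\<lambda>x. u x t)"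
    and e: "0 < e"
  shows "\<exists>d>0. \<forall>t x. 0 \<le> t \<longrightarrow> t \<le> T \<longrightarrow> norm x < d \<longrightarrow> \<bar>mom u x t\<bar> \<le> e * norm x"
proof -
  have "uniformly_continuous_on (cball 0 1 \<times> {0..T}) (\<lambda>(x, t). u x t)"
    by (intro compact_uniformly_continuous continuous_on_subset[OF c] compact_Times compact_cball compact_Icc) auto
  then obtain d where d: "0 < d" "\<And>p q. p \<in> cball 0 1 \<times> {0..T} \<Longrightarrow> q \<in> cball 0 1 \<times> {0..T} \<Longrightarrow> dist q p < d \<Longrightarrow>
      dist (case q of (x, t) \<Rightarrow> u x t) (case p of (x, t) \<Rightarrow> u x t) < e"
    using e unfolding uniformly_continuous_on_def by metis
  have "\<bar>mom u x t\<bar> \<le> e * norm x" if t: "0 \<le> t" "t \<le> T" and x: "norm x < min d 1" for x t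
  proof -
    have "dist (case (x, t) of (x, t) \<Rightarrow> u x t) (case (0, t) of (x, t) \<Rightarrow> u x t) < e"
      by (rule d(2)) (use t x in \<open>auto simp: dist_Pair_Pair dist_norm\<close>)
    then have "norm (u x t) \<le> e" using radial_zero[OF rad[OF t]] by simp
    moreover have "\<bar>mom u x t\<bar> \<le> norm (u x t) * norm x" unfolding mom_def by (rule Cauchy_Schwarz_ineq2)
    ultimately show ?thesis using mult_right_mono[of "norm (u x t)" e "norm x"] by simp
  qed
  then show ?thesis using d(1) by (intro exI[of _ "min d 1"]) auto
qed

section \<open>Barriers\<close>

text \<open>
  In terms of \<open>s = |x|\<^sup>2\<close>: \<open>h (|x|\<^sup>2)\<close> is a stationary supersolution of the equation for
  \<open>\<sigma> * (u \<bullet> x)\<close>, with \<open>\<sigma> = 1\<close> or \<open>\<sigma> = -1\<close>. The bound by \<open>B * sqrt s\<close> corresponds to \<open>|u| \<le> B\<close>.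
\<close>

definition barrier :: "real \<Rightarrow> real \<Rightarrow> real \<Rightarrow> (real \<Rightarrow> real) \<Rightarrow> bool"
  where "barrier n \<sigma> B h \<longleftrightarrow> 0 \<le> B \<and> continuous_on {0..} h \<and> (\<forall>s\<ge>0. 0 \<le> h s \<and> h s \<le> B * sqrt s) \<and>
    (\<exists>h' h''. \<forall>s>0. (h has_real_derivative h' s) (at s) \<and> (h' has_real_derivative h'' s) (at s) \<and>
      \<bar>2 * s * h' s - h s\<bar> \<le> B * s \<and>
      4 * s * h'' s + (2 * n - 4) * h' s - 2 * (n - 2) * h s / s - \<sigma> * (3 * h s * h' s + (n - 4) / 2 * (h s)\<^sup>2 / s) \<le> 0)"

text \<open>Comparison with the stationary function \<open>h (|x|^2)\<close>. Near the origin it is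
  enough that \<open>h\<close> is nonnegative, because \<open>near_origin\<close> controls the
  solution.\<close>

lemma barrier_bound:
  fixes u :: "real ^ 'n \<Rightarrow> real \<Rightarrow> real ^ 'n"
  assumes sol: "classical_on (quad_form a) T A u" and rad: "\<And>t. 0 \<le> t \<Longrightarrow> t \<le> T \<Longrightarrow> radial (\<lambda>x. u x t)"
    and sg: "\<sigma> = 1 \<or> \<sigma> = -1" and A: "\<And>x. norm (u x 0) \<le> A"
    and bar: "barrier (real CARD('n)) \<sigma> B h"
    and init: "\<And>x. \<sigma> * mom u x 0 \<le> h (x \<bullet> x)" and t: "0 \<le> t" "t < T"
  shows "\<sigma> * mom u x t \<le> h (x \<bullet> x)"
proof -
  let ?n = "real CARD('n)"
  from bar obtain h' h'' where B0: "0 \<le> B" and hc: "continuous_on {0..} h" and hb: "\<And>s. 0 \<le> s \<Longrightarrow> 0 \<le> h s \<and> h s \<le> B * sqrt s"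
    and h: "\<And>s. 0 < s \<Longrightarrow> (h has_real_derivative h' s) (at s)" "\<And>s. 0 < s \<Longrightarrow> (h' has_real_derivative h'' s) (at s)"
      "\<And>s. 0 < s \<Longrightarrow> \<bar>2 * s * h' s - h s\<bar> \<le> B * s"
      "\<And>s. 0 < s \<Longrightarrow> 4 * s * h'' s + (2 * ?n - 4) * h' s - 2 * (?n - 2) * h s / s - \<sigma> * (3 * h s * h' s + (?n - 4) / 2 * (h s)\<^sup>2 / s) \<le> 0"
    unfolding barrier_def by blast
  have G: "(\<Sum>j\<in>UNIV. y $ j * (2 * y $ j * h' (y \<bullet> y))) = 2 * (y \<bullet> y) * h' (y \<bullet> y)" for y :: "real^'n"
    by (simp add: inner_vec_def sum_distrib_left sum_distrib_right mult_ac)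
  have L: "(\<Sum>j\<in>UNIV. 2 * h' (y \<bullet> y) + 4 * (y $ j)\<^sup>2 * h'' (y \<bullet> y)) = 2 * ?n * h' (y \<bullet> y) + 4 * (y \<bullet> y) * h'' (y \<bullet> y)" for y :: "real^'n"
    by (simp add: inner_vec_def sum.distrib sum_distrib_left sum_distrib_right power2_eq_square mult_ac)
  have nu: "norm (u x t) \<le> A" if "0 \<le> t" "t < T" for x t
    using sol A that by (cases "t = 0") (auto simp: classical_on_def jet_def)
  show ?thesis
  proof (rule comparison[where S="\<lambda>x t. h (x \<bullet> x)" and Sg="\<lambda>j x t. 2 * x $ j * h' (x \<bullet> x)"
        and Sh="\<lambda>j x t. 2 * h' (x \<bullet> x) + 4 * (x $ j)\<^sup>2 * h'' (x \<bullet> x)" and St="\<lambda>x t. 0" and C=A and B=B, OF sol rad order_refl sg nu _ _ _ _ _ B0 _ _ _ init t])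
    show "continuous_on (UNIV \<times> {0..<T}) (\<lambda>(x::real^'n, t). h (x \<bullet> x))"
      unfolding case_prod_unfold by (rule continuous_on_compose2[OF hc]) (auto intro!: continuous_intros)
    show "line_deriv (\<lambda>y. h (y \<bullet> y)) j x (2 * x $ j * h' (x \<bullet> x))" if "x \<noteq> 0" for j and x :: "real^'n"
      using radial_line_deriv(1)[OF h(1) h(2)] that by simp
    show "line_deriv (\<lambda>y. 2 * y $ j * h' (y \<bullet> y)) j x (2 * h' (x \<bullet> x) + 4 * (x $ j)\<^sup>2 * h'' (x \<bullet> x))" if "x \<noteq> 0" for j and x :: "real^'n"
      using radial_line_deriv(2)[OF h(1) h(2)] that by simp
    show "\<bar>h (x \<bullet> x)\<bar> \<le> B * norm x" for x :: "real^'n"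
      using hb[of "x \<bullet> x"] by (simp add: norm_eq_sqrt_inner)
    show "\<bar>(\<Sum>j\<in>UNIV. x $ j * (2 * x $ j * h' (x \<bullet> x))) - h (x \<bullet> x)\<bar> \<le> B * (norm x)\<^sup>2" if "x \<noteq> 0" for x :: "real^'n"
      unfolding G power2_norm_eq_inner using h(3)[of "x \<bullet> x"] that by simp
    show "(\<Sum>j\<in>UNIV. 2 * h' (x \<bullet> x) + 4 * (x $ j)\<^sup>2 * h'' (x \<bullet> x)) - 2 / (x \<bullet> x) * ((\<Sum>j\<in>UNIV. x $ j * (2 * x $ j * h' (x \<bullet> x))) + (?n - 2) * h (x \<bullet> x))
        - \<sigma> * (3/2 * (h (x \<bullet> x) * (\<Sum>j\<in>UNIV. x $ j * (2 * x $ j * h' (x \<bullet> x)))) + (?n - 4) / 2 * (h (x \<bullet> x))\<^sup>2) / (x \<bullet> x) \<le> 0"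
      if "x \<noteq> 0" for x :: "real^'n"
    proof -
      define s where "s = x \<bullet> x"
      have s: "0 < s" using that by (simp add: s_def)
      have "2 * ?n * h' s + 4 * s * h'' s - 2 / s * (2 * s * h' s + (?n - 2) * h s)
        - \<sigma> * (3/2 * (h s * (2 * s * h' s)) + (?n - 4) / 2 * (h s)\<^sup>2) / s
        = 4 * s * h'' s + (2 * ?n - 4) * h' s - 2 * (?n - 2) * h s / s - \<sigma> * (3 * h s * h' s + (?n - 4) / 2 * (h s)\<^sup>2 / s)"
        using s by (simp add: field_simps)
      then show ?thesis using h(4)[OF s] unfolding G L unfolding s_def[symmetric] by linarith
    qed
    fix t0 e :: real assume t0: "0 < t0" "t0 < T" and e: "0 < e"
    have "continuous_on (UNIV \<times> {0..T}) (\<lambda>(x, t). u x t)" using sol by (simp add: classical_on_def)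
    from near_origin[OF this rad e] obtain d where d: "0 < d" "\<And>t x. 0 \<le> t \<Longrightarrow> t \<le> T \<Longrightarrow> norm x < d \<Longrightarrow> \<bar>mom u x t\<bar> \<le> e * norm x"
      by blast
    have "\<sigma> * mom u x t - h (x \<bullet> x) \<le> e * norm x" if "0 \<le> t" "t \<le> t0" "norm x < d" for x t
    proof -
      have "\<bar>mom u x t\<bar> \<le> e * norm x" using d(2)[of t x] that t0 by auto
      then show ?thesis using hb[of "x \<bullet> x"] sg by (auto simp: abs_le_iff)
    qed
    then show "\<exists>d>0. \<forall>t x. 0 \<le> t \<longrightarrow> t \<le> t0 \<longrightarrow> norm x < d \<longrightarrow> \<sigma> * mom u x t - h (x \<bullet> x) \<le> e * norm x"
      using d(1) by blast
  qed (auto intro!: derivative_eq_intros)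
qed

text \<open>Comparison of \<open>u\<close> with the shifted \<open>w\<close>, once for each sign; a
  solution is a supersolution with equality. The positive shift \<open>h\<close> is essential: it
  bounds the partial derivatives of \<open>w\<close> by \<open>A / sqrt h\<close>, which yields the
  hypothesis on the radial derivative of \<open>S\<close> minus \<open>S\<close> that could fail
  near time zero.\<close>

lemma uniqueness:
  fixes u w :: "real ^ 'n \<Rightarrow> real \<Rightarrow> real ^ 'n"
  assumes u: "classical_on (quad_form a) T A u" and radu: "\<And>t. 0 \<le> t \<Longrightarrow> t \<le> T \<Longrightarrow> radial (\<lambda>x. u x t)"
    and w: "classical_on (quad_form a) T A w" and radw: "\<And>t. 0 \<le> t \<Longrightarrow> t \<le> T \<Longrightarrow> radial (\<lambda>x. w x t)"
    and A: "\<And>x. norm (u x 0) \<le> A" "0 \<le> A" and h: "0 < h"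
    and init: "\<And>x. u x 0 = w x h" and t: "0 \<le> t" "t < T - h"
  shows "u x t = w x (t + h)"
proof -
  let ?n = "real CARD('n)"
  let ?B = "A + ?n * (A / sqrt h)"
  have jw: "jet T A w" using w by (simp add: classical_on_def)
  have B: "0 \<le> ?n * (A / sqrt h)" using A h by simp
  have nu: "norm (u x t) \<le> A" if "0 \<le> t" "t < T - h" for x t
    using u A that h by (cases "t = 0") (auto simp: classical_on_def jet_def)
  have cw': "continuous_on (UNIV \<times> {0..T}) (\<lambda>(x, t). w x t)" using w by (simp add: classical_on_def)
  have cw: "continuous_on (UNIV \<times> {0..T}) (\<lambda>p. w (fst p) (snd p))" and cu: "continuous_on (UNIV \<times> {0..T}) (\<lambda>(x, t). u x t)"
    using w u by (auto simp: classical_on_def case_prod_unfold)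
  have comp: "\<sigma> * mom u x t \<le> \<sigma> * mom w x (t + h)" if sg: "\<sigma> = 1 \<or> \<sigma> = -1" for \<sigma>
  proof (rule comparison[where S="\<lambda>x t. \<sigma> * mom w x (t + h)" and Sg="\<lambda>j x t. \<sigma> * mom_grad w j x (t + h)"
        and Sh="\<lambda>j x t. \<sigma> * mom_hess w j x (t + h)" and T'="T - h" and C=A and B="?B" and \<sigma>=\<sigma>
        and St="\<lambda>x t. \<sigma> * ((\<Sum>j\<in>UNIV. mom_hess w j x (t + h)) - 2 / (x \<bullet> x) * ((\<Sum>j\<in>UNIV. x $ j * mom_grad w j x (t + h)) + (?n - 2) * mom w x (t + h))
          - (3/2 * (mom w x (t + h) * (\<Sum>j\<in>UNIV. x $ j * mom_grad w j x (t + h))) + (?n - 4) / 2 * (mom w x (t + h))\<^sup>2) / (x \<bullet> x))",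
        OF u radu _ sg nu _ _ _ _ _ _ _ _ _ _ t])
    have "continuous_on (UNIV \<times> {0..<T - h}) (\<lambda>p. w (fst p) (snd p + h))"
      using h by (intro continuous_on_compose2[OF cw, of _ "\<lambda>p. (fst p, snd p + h)", simplified] continuous_intros) auto
    then show "continuous_on (UNIV \<times> {0..<T - h}) (\<lambda>(x, t). \<sigma> * mom w x (t + h))"
      unfolding mom_def case_prod_unfold by (intro continuous_intros)
    fix j and x :: "real ^ 'n" and t :: real
    assume x: "x \<noteq> 0" and t: "0 < t" "t < T - h"
    have th: "0 < t + h" "t + h \<le> T" "t + h < T" using t h by auto
    show "line_deriv (\<lambda>y. \<sigma> * mom w y (t + h)) j x (\<sigma> * mom_grad w j x (t + h))"
      using mom_derivs(1)[OF w radw th(1,2)] unfolding line_deriv_def by (intro DERIV_cmult)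
    show "line_deriv (\<lambda>y. \<sigma> * mom_grad w j y (t + h)) j x (\<sigma> * mom_hess w j x (t + h))"
      using mom_derivs(2)[OF w radw th(1,2)] unfolding line_deriv_def by (intro DERIV_cmult)
    show "((\<lambda>t. \<sigma> * mom w x (t + h)) has_real_derivative \<sigma> * ((\<Sum>j\<in>UNIV. mom_hess w j x (t + h)) - 2 / (x \<bullet> x) * ((\<Sum>j\<in>UNIV. x $ j * mom_grad w j x (t + h)) + (?n - 2) * mom w x (t + h))
          - (3/2 * (mom w x (t + h) * (\<Sum>j\<in>UNIV. x $ j * mom_grad w j x (t + h))) + (?n - 4) / 2 * (mom w x (t + h))\<^sup>2) / (x \<bullet> x))) (at t)"
      by (rule DERIV_cmult) (rule DERIV_shift[THEN iffD1], rule mom_equation[OF w radw th(1,3) x])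
    show "\<bar>(\<Sum>j\<in>UNIV. x $ j * (\<sigma> * mom_grad w j x (t + h))) - \<sigma> * mom w x (t + h)\<bar> \<le> ?B * (norm x)\<^sup>2"
    proof -
      have "(\<Sum>j\<in>UNIV. x $ j * (\<sigma> * mom_grad w j x (t + h))) - \<sigma> * mom w x (t + h) = \<sigma> * (\<Sum>j\<in>UNIV. x $ j * (pd j w x (t + h) \<bullet> x))"
        by (simp add: mom_grad_def mom_def inner_vec_def[of "w x (t + h)"] distrib_left sum.distrib sum_distrib_left mult_ac)
      moreover have "\<bar>\<Sum>j\<in>UNIV. x $ j * (pd j w x (t + h) \<bullet> x)\<bar> \<le> (\<Sum>j\<in>(UNIV::'n set). norm x * (A / sqrt h * norm x))"
      proof (rule order_trans[OF sum_abs], rule sum_mono)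
        fix j
        have "norm (pd j w x (t + h)) \<le> A / sqrt (t + h)" using jw th by (simp add: jet_def)
        also have "\<dots> \<le> A / sqrt h" using A h t by (intro divide_left_mono) auto
        finally have "\<bar>pd j w x (t + h) \<bullet> x\<bar> \<le> A / sqrt h * norm x"
          by (intro order_trans[OF Cauchy_Schwarz_ineq2] mult_right_mono) auto
        then show "\<bar>x $ j * (pd j w x (t + h) \<bullet> x)\<bar> \<le> norm x * (A / sqrt h * norm x)"
          unfolding abs_mult by (intro mult_mono component_le_norm_cart) auto
      qed
      moreover have "(\<Sum>j\<in>(UNIV::'n set). norm x * (A / sqrt h * norm x)) = ?n * (A / sqrt h) * (norm x)\<^sup>2"
        by (simp add: power2_eq_square)
      moreover have "\<bar>\<sigma> * c\<bar> = \<bar>c\<bar>" for c using sg by auto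
      ultimately have "\<bar>(\<Sum>j\<in>UNIV. x $ j * (\<sigma> * mom_grad w j x (t + h))) - \<sigma> * mom w x (t + h)\<bar> \<le> ?n * (A / sqrt h) * (norm x)\<^sup>2"
        by (simp only:)
      also have "\<dots> \<le> ?B * (norm x)\<^sup>2" using A by (intro mult_right_mono) auto
      finally show ?thesis .
    qed
    show "(\<Sum>j\<in>UNIV. \<sigma> * mom_hess w j x (t + h)) - 2 / (x \<bullet> x) * ((\<Sum>j\<in>UNIV. x $ j * (\<sigma> * mom_grad w j x (t + h))) + (?n - 2) * (\<sigma> * mom w x (t + h)))
      - \<sigma> * (3/2 * ((\<sigma> * mom w x (t + h)) * (\<Sum>j\<in>UNIV. x $ j * (\<sigma> * mom_grad w j x (t + h)))) + (?n - 4) / 2 * (\<sigma> * mom w x (t + h))\<^sup>2) / (x \<bullet> x)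
      \<le> \<sigma> * ((\<Sum>j\<in>UNIV. mom_hess w j x (t + h)) - 2 / (x \<bullet> x) * ((\<Sum>j\<in>UNIV. x $ j * mom_grad w j x (t + h)) + (?n - 2) * mom w x (t + h))
          - (3/2 * (mom w x (t + h) * (\<Sum>j\<in>UNIV. x $ j * mom_grad w j x (t + h))) + (?n - 4) / 2 * (mom w x (t + h))\<^sup>2) / (x \<bullet> x))"
    proof -
      have e: "(\<Sum>j\<in>UNIV. x $ j * (\<sigma> * mom_grad w j x (t + h))) = \<sigma> * (\<Sum>j\<in>UNIV. x $ j * mom_grad w j x (t + h))"
        "(\<Sum>j\<in>UNIV. \<sigma> * mom_hess w j x (t + h)) = \<sigma> * (\<Sum>j\<in>UNIV. mom_hess w j x (t + h))"
        by (simp_all add: sum_distrib_left mult_ac)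
      have p: "(\<sigma> * m) * (\<sigma> * g) = m * g" "(\<sigma> * m)\<^sup>2 = m\<^sup>2" for m g
        using sg by auto
      show ?thesis unfolding e p by (simp add: algebra_simps)
    qed
  next
    show "\<bar>\<sigma> * mom w x (t + h)\<bar> \<le> ?B * norm x" if "0 \<le> t" "t < T - h" for x t
    proof -
      have "norm (w x (t + h)) \<le> A" using jw that h by (simp add: jet_def)
      then have "norm (w x (t + h)) * norm x \<le> ?B * norm x" using B by (intro mult_right_mono) auto
      then show ?thesis using Cauchy_Schwarz_ineq2[of "w x (t + h)" x] sg by (auto simp: mom_def abs_mult)
    qed
    fix t0 e :: real assume t0: "0 < t0" "t0 < T - h" and e: "0 < e"
    have e2: "0 < e / 2" using e by simp
    obtain d1 where d1: "0 < d1" "\<And>t x. 0 \<le> t \<Longrightarrow> t \<le> T \<Longrightarrow> norm x < d1 \<Longrightarrow> \<bar>mom u x t\<bar> \<le> e / 2 * norm x"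
      using near_origin[OF cu radu e2] by blast
    obtain d2 where d2: "0 < d2" "\<And>t x. 0 \<le> t \<Longrightarrow> t \<le> T \<Longrightarrow> norm x < d2 \<Longrightarrow> \<bar>mom w x t\<bar> \<le> e / 2 * norm x"
      using near_origin[OF cw' radw e2] by blast
    have "\<sigma> * mom u x t - \<sigma> * mom w x (t + h) \<le> e * norm x" if "0 \<le> t" "t \<le> t0" "norm x < min d1 d2" for x t
    proof -
      have "\<bar>mom u x t\<bar> \<le> e / 2 * norm x" "\<bar>mom w x (t + h)\<bar> \<le> e / 2 * norm x"
        using d1(2)[of t x] d2(2)[of "t + h" x] that t0 h by auto
      then show ?thesis using sg by (auto simp: abs_le_iff)
    qed
    then show "\<exists>d>0. \<forall>t x. 0 \<le> t \<longrightarrow> t \<le> t0 \<longrightarrow> norm x < d \<longrightarrow> \<sigma> * mom u x t - \<sigma> * mom w x (t + h) \<le> e * norm x"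
      using d1(1) d2(1) by (intro exI[of _ "min d1 d2"]) auto
  next
    show "\<sigma> * mom u x 0 \<le> \<sigma> * mom w x (0 + h)" for x using init[of x] by (simp add: mom_def)
  qed (use h A B in auto)
  have "mom u x t = mom w x (t + h)" using comp[of 1] comp[of "-1"] by simp
  moreover have "u x t = ((u x t \<bullet> x) / (x \<bullet> x)) *\<^sub>R x" by (rule radial_parallel[OF radu]) (use t h in auto)
  moreover have "w x (t + h) = ((w x (t + h) \<bullet> x) / (x \<bullet> x)) *\<^sub>R x" by (rule radial_parallel[OF radw]) (use t h in auto)
  ultimately show ?thesis by (simp add: mom_def)
qed

section \<open>Global existence\<close>

lemma norm_le_mom:
  fixes f :: "real ^ 'n \<Rightarrow> real ^ 'n"
  assumes f: "radial f" and m: "\<bar>f x \<bullet> x\<bar> \<le> M * norm x" and M: "0 \<le> M"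
  shows "norm (f x) \<le> M"
proof (cases "x = 0")
  case True
  then show ?thesis using radial_zero[OF f] M by simp
next
  case False
  have "norm (f x) = norm (((f x \<bullet> x) / (x \<bullet> x)) *\<^sub>R x)" using radial_parallel[OF f, of x] by simp
  also have "\<dots> = \<bar>f x \<bullet> x\<bar> / norm x"
    using False by (simp add: power2_norm_eq_inner[symmetric] power2_eq_square)
  also have "\<dots> \<le> M" using False m by (simp add: pos_divide_le_eq)
  finally show ?thesis .
qed

lemma existence_time:
  fixes c :: real assumes "0 \<le> c" shows "\<exists>T>0. sqrt T * c \<le> 1"
proof -
  have "c / (1 + c) \<le> 1" using assms by simp
  then have "sqrt ((1 / (1 + c))\<^sup>2) * c \<le> 1" using assms by simp
  moreover have "0 < (1 / (1 + c))\<^sup>2" using assms by simp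
  ultimately show ?thesis by blast
qed

text \<open>Lying between the two barriers (\<open>good\<close>) is preserved by the local solutions
  and bounds the norm by \<open>M\<close>, so every restart lives for the same time
  \<open>\<tau>\<close>. Restarts are made after \<open>d\<close>, half of that time. Each positive
  time then lies in the interior of a window on which \<open>u\<close> is a single local solution,
  and no regularity has to be checked at seams.\<close>

lemma global_existence:
  fixes u0 :: "real ^ 'n \<Rightarrow> real ^ 'n"
  assumes a: "0 \<le> a" "a \<le> 1" and u0: "continuous_on UNIV u0" "radial u0"
    and b1: "barrier (real CARD('n)) 1 B1 h1" and b2: "barrier (real CARD('n)) (-1) B2 h2"
    and i1: "\<And>x. u0 x \<bullet> x \<le> h1 (x \<bullet> x)" and i2: "\<And>x. - (u0 x \<bullet> x) \<le> h2 (x \<bullet> x)"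
  shows "\<exists>u d A w. 0 < d \<and> (\<forall>x t. 0 \<le> t \<longrightarrow> norm (u x t) \<le> B1 + B2) \<and> (\<forall>x. u x 0 = u0 x) \<and>
    (\<forall>k. classical_on (quad_form a) (2 * d) A (w k)) \<and>
    (\<forall>k x t. real k * d \<le> t \<longrightarrow> t < (real k + 2) * d \<longrightarrow> u x t = w k x (t - real k * d))"
proof -
  let ?n = "real CARD('n)"
  let ?\<beta> = "quad_form a :: 'n \<Rightarrow> real ^ 'n \<Rightarrow> real ^ 'n \<Rightarrow> real ^ 'n"
  define M where "M = B1 + B2"
  have B: "0 \<le> B1" "0 \<le> B2" using b1 b2 by (auto simp: barrier_def)
  then have M0: "0 \<le> M" by (simp add: M_def)
  define A0 where "A0 = heat_const TYPE('n) * M"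
  have MA: "M \<le> A0" using mult_right_mono[OF heat_const(1)[where 'n='n] M0] by (simp add: A0_def)
  have "0 \<le> heat_const TYPE('n) * Wc * (32 * ?n * A0)" using heat_const(1)[where 'n='n] Wc_nonneg M0 MA by simp
  then obtain \<tau> where \<tau>: "0 < \<tau>" "sqrt \<tau> * (heat_const TYPE('n) * Wc * (32 * ?n * A0)) \<le> 1" using existence_time by blast
  have \<tau>2: "heat_const TYPE('n) * Wc * sqrt \<tau> * (32 * ?n * A0) \<le> 1" using \<tau>(2) by (simp add: mult_ac)
  define A where "A = 2 * A0"
  have A: "M \<le> A" "0 \<le> A" using M0 MA by (auto simp: A_def)
  define good where "good f \<longleftrightarrow> continuous_on UNIV f \<and> radial f \<and> (\<forall>x. f x \<bullet> x \<le> h1 (x \<bullet> x)) \<and> (\<forall>x. - (f x \<bullet> x) \<le> h2 (x \<bullet> x))"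
    for f :: "real ^ 'n \<Rightarrow> real ^ 'n"
  have hb: "h1 (x \<bullet> x) \<le> B1 * norm x" "h2 (x \<bullet> x) \<le> B2 * norm x" for x :: "real ^ 'n"
    using b1 b2 by (auto simp: barrier_def norm_eq_sqrt_inner)
  have good_norm: "norm (f x) \<le> M" if "good f" for f x
  proof (rule norm_le_mom[of f x M])
    show "radial f" using that by (simp add: good_def)
    have "f x \<bullet> x \<le> B1 * norm x" "- (f x \<bullet> x) \<le> B2 * norm x"
      using that hb[of x] unfolding good_def by (meson order_trans)+
    moreover have "0 \<le> B1 * norm x" "0 \<le> B2 * norm x" using B by auto
    ultimately show "\<bar>f x \<bullet> x\<bar> \<le> M * norm x" unfolding M_def distrib_right by linarith
  qed (rule M0)
  define P where "P w \<longleftrightarrow> classical_on ?\<beta> \<tau> A w \<and> (\<forall>t. 0 \<le> t \<longrightarrow> t \<le> \<tau> \<longrightarrow> radial (\<lambda>x. w x t)) \<and> good (\<lambda>x. w x 0)" for w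
  have ex: "\<exists>w. P w \<and> (\<forall>x. w x 0 = f x)" if f: "good f" for f
  proof -
    have f': "continuous_on UNIV f" "radial f" using f by (auto simp: good_def)
    obtain w where w: "classical_on ?\<beta> \<tau> (2 * A0) w" "\<And>x. w x 0 = f x"
      "\<And>R. orthogonal_transformation R \<Longrightarrow> \<forall>x. f (R x) = R (f x) \<Longrightarrow> equivariant \<tau> R w"
      using local_existence[OF quad_form_bilinear[OF a] quad_form_norm[OF a] f'(1) good_norm[OF f] A0_def \<tau>(1) \<tau>2 nonlin_equivariant] by blast
    have "radial (\<lambda>x. w x t)" if "0 \<le> t" "t \<le> \<tau>" for t
    proof (cases "t = 0")
      case True
      then show ?thesis using f'(2) w(2) by (simp add: radial_def)
    next
      case False
      then show ?thesis using w(3) f'(2) that unfolding radial_def equivariant_def by force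
    qed
    moreover have "good (\<lambda>x. w x 0)" using f w(2) by simp
    ultimately show ?thesis using w(1,2) unfolding P_def A_def by blast
  qed
  have bound: "good (\<lambda>x. w x t)" if w: "P w" and t: "0 \<le> t" "t < \<tau>" for w t
  proof -
    have c: "classical_on ?\<beta> \<tau> A w" and r: "\<And>t. 0 \<le> t \<Longrightarrow> t \<le> \<tau> \<Longrightarrow> radial (\<lambda>x. w x t)" and g: "good (\<lambda>x. w x 0)"
      using w by (auto simp: P_def)
    have n0: "norm (w x 0) \<le> A" for x using good_norm[OF g] A(1) order_trans by blast
    have m1: "mom w x t \<le> h1 (x \<bullet> x)" for x
      using barrier_bound[OF c r _ n0 b1 _ t, of x] g by (simp add: good_def mom_def)
    have m2: "- mom w x t \<le> h2 (x \<bullet> x)" for x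
      using barrier_bound[OF c r _ n0 b2 _ t, of x] g by (simp add: good_def mom_def)
    have "continuous_on UNIV (\<lambda>x. case (x, t) of (x, t) \<Rightarrow> w x t)"
      by (rule continuous_on_compose2[of "UNIV \<times> {0..\<tau>}"]) (use c t in \<open>auto simp: classical_on_def intro!: continuous_intros\<close>)
    then show ?thesis using m1 m2 r[of t] t by (simp add: good_def mom_def)
  qed
  define d where "d = \<tau> / 2"
  have d: "0 < d" "d < \<tau>" "2 * d = \<tau>" using \<tau>(1) by (auto simp: d_def)
  have g0: "good u0" using u0 i1 i2 by (simp add: good_def)
  have "\<exists>w. \<forall>k. (P (w k) \<and> (k = 0 \<longrightarrow> (\<forall>x. w k x 0 = u0 x))) \<and> (\<forall>x. w (Suc k) x 0 = w k x d)"
  proof (rule dependent_nat_choice)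
    show "\<exists>w. P w \<and> (0 = (0::nat) \<longrightarrow> (\<forall>x. w x 0 = u0 x))" using ex[OF g0] by blast
    fix w and k :: nat assume "P w \<and> (k = 0 \<longrightarrow> (\<forall>x. w x 0 = u0 x))"
    then have "good (\<lambda>x. w x d)" using bound d by simp
    from ex[OF this] show "\<exists>w'. (P w' \<and> (Suc k = 0 \<longrightarrow> (\<forall>x. w' x 0 = u0 x))) \<and> (\<forall>x. w' x 0 = w x d)" by blast
  qed
  then obtain w where w: "\<And>k. P (w k)" "\<And>x. w 0 x 0 = u0 x" "\<And>k x. w (Suc k) x 0 = w k x d" by blast
  \<comment> \<open>On the first half of its lifespan the restarted solution repeats the second half
    of its predecessor.\<close>
  have cons: "w (Suc k) x t = w k x (t + d)" if "0 \<le> t" "t < d" for k x t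
  proof (rule uniqueness[where a=a and T=\<tau> and A=A and u="w (Suc k)" and w="w k" and h=d])
    show "norm (w (Suc k) x 0) \<le> A" for x
      using good_norm[of "\<lambda>x. w (Suc k) x 0"] w(1)[of "Suc k"] A(1) order_trans unfolding P_def by blast
  qed (use w d that A in \<open>auto simp: P_def\<close>)
  define u where "u x t = w (nat \<lfloor>t / d\<rfloor>) x (t - real (nat \<lfloor>t / d\<rfloor>) * d)" for x t
  have rep: "u x t = w k x (t - real k * d)" if t: "real k * d \<le> t" "t < (real k + 2) * d" for k x t
  \<comment> \<open>On the second half of window \<open>k\<close> the definition of \<open>u\<close>
    has already switched to the solution \<open>Suc k\<close>; \<open>cons\<close> translates
    back.\<close>
  proof (cases "t < (real k + 1) * d")
    case True
    then have "\<lfloor>t / d\<rfloor> = int k" using t d by (intro floor_unique) (auto simp: pos_le_divide_eq pos_divide_less_eq)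
    then show ?thesis by (simp add: u_def)
  next
    case False
    then have "\<lfloor>t / d\<rfloor> = int (Suc k)" using t d by (intro floor_unique) (auto simp: pos_le_divide_eq pos_divide_less_eq algebra_simps)
    then have n: "nat \<lfloor>t / d\<rfloor> = Suc k" by (simp only: nat_int)
    have "u x t = w (Suc k) x (t - real (Suc k) * d)" by (simp only: u_def n)
    also have "\<dots> = w k x (t - real (Suc k) * d + d)" by (rule cons) (use False t in \<open>auto simp: algebra_simps\<close>)
    finally show ?thesis by (simp add: algebra_simps)
  qed
  have "norm (u x t) \<le> B1 + B2" if "0 \<le> t" for x t
  proof -
    define k where "k = nat \<lfloor>t / d\<rfloor>"
    have k: "real k * d \<le> t" "t < (real k + 1) * d"
    proof -
      have "0 \<le> \<lfloor>t / d\<rfloor>" using that d by simp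
      then have "real k = of_int \<lfloor>t / d\<rfloor>" by (simp add: k_def)
      then have "real k \<le> t / d" "t / d < real k + 1" by linarith+
      then show "real k * d \<le> t" "t < (real k + 1) * d" using d by (auto simp: pos_le_divide_eq pos_divide_less_eq)
    qed
    have "good (\<lambda>x. w k x (t - real k * d))" by (rule bound[OF w(1)]) (use k d in \<open>auto simp: algebra_simps\<close>)
    from good_norm[OF this, of x] show ?thesis by (simp add: u_def k_def M_def)
  qed
  moreover have "u x 0 = u0 x" for x using w(2) by (simp add: u_def)
  moreover have "classical_on ?\<beta> (2 * d) A (w k)" for k using w(1)[of k] by (simp add: P_def d)
  ultimately show ?thesis using d(1) rep by blast
qed

section \<open>Explicit barriers\<close>

lemma barrierI:
  fixes h h' h'' :: "real \<Rightarrow> real"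
  assumes "0 \<le> B" "continuous_on {0..} h" "\<And>s. 0 \<le> s \<Longrightarrow> 0 \<le> h s" "\<And>s. 0 \<le> s \<Longrightarrow> h s \<le> B * sqrt s"
    "\<And>s. 0 < s \<Longrightarrow> (h has_real_derivative h' s) (at s)" "\<And>s. 0 < s \<Longrightarrow> (h' has_real_derivative h'' s) (at s)"
    "\<And>s. 0 < s \<Longrightarrow> \<bar>2 * s * h' s - h s\<bar> \<le> B * s"
    "\<And>s. 0 < s \<Longrightarrow> 4 * s * h'' s + (2 * n - 4) * h' s - 2 * (n - 2) * h s / s - \<sigma> * (3 * h s * h' s + (n - 4) / 2 * (h s)\<^sup>2 / s) \<le> 0"
  shows "barrier n \<sigma> B h"
  unfolding barrier_def by (intro conjI exI[of _ h'] exI[of _ h''] allI impI assms)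

text \<open>The scalar of outward motion at constant speed \<open>C\<close>. With
  \<open>r = sqrt s\<close> the operator equals \<open>- (n - 1) C / r - (n - 1) C^2 / 2\<close>:
  the linear and the quadratic part have the same favourable sign, so outward motion needs no decay
  at infinity.\<close>

lemma barrier_const:
  assumes n: "2 \<le> n" and C: "0 \<le> C"
  shows "barrier n 1 C (\<lambda>s. C * sqrt s)"
proof (rule barrierI[where h'="\<lambda>s. C / (2 * sqrt s)" and h''="\<lambda>s. - C / (4 * (s * sqrt s))"])
  fix s :: real assume s: "0 < s"
  have sw: "sqrt s * sqrt s = s" "sqrt s \<noteq> 0" using s by auto
  have ds: "(sqrt has_real_derivative (inverse (sqrt s) / 2)) (at s)" by (rule DERIV_real_sqrt[OF s])
  show "((\<lambda>s. C * sqrt s) has_real_derivative C / (2 * sqrt s)) (at s)"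
    by (rule derivative_eq_intros ds refl | (use sw s in \<open>simp add: field_simps; fail\<close>))+
  show "((\<lambda>s. C / (2 * sqrt s)) has_real_derivative - C / (4 * (s * sqrt s))) (at s)"
    by (rule derivative_eq_intros ds refl | (use sw s in \<open>simp add: field_simps; fail\<close>))+
  define r where "r = sqrt s"
  have r: "0 < r" "s = r * r" using s sw by (auto simp: r_def)
  show "\<bar>2 * s * (C / (2 * sqrt s)) - C * sqrt s\<bar> \<le> C * s"
    unfolding r_def[symmetric] unfolding r(2) using r(1) C by (simp add: field_simps)
  have "4 * (r * r) * (- C / (4 * ((r * r) * r))) + (2 * n - 4) * (C / (2 * r)) - 2 * (n - 2) * (C * r) / (r * r)
      - 1 * (3 * (C * r) * (C / (2 * r)) + (n - 4) / 2 * (C * r)\<^sup>2 / (r * r)) = - (n - 1) * C / r - (n - 1) / 2 * C\<^sup>2"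
    using r(1) by (simp add: field_simps power2_eq_square)
  also have "\<dots> \<le> 0"
  proof -
    have "0 \<le> (n - 1) * C / r" "0 \<le> (n - 1) / 2 * C\<^sup>2" using n C r(1) by auto
    moreover have "- (n - 1) * C / r = - ((n - 1) * C / r)" by (simp add: algebra_simps diff_divide_distrib)
    ultimately show ?thesis by linarith
  qed
  finally show "4 * s * (- C / (4 * (s * sqrt s))) + (2 * n - 4) * (C / (2 * sqrt s)) - 2 * (n - 2) * (C * sqrt s) / s
      - 1 * (3 * (C * sqrt s) * (C / (2 * sqrt s)) + (n - 4) / 2 * (C * sqrt s)\<^sup>2 / s) \<le> 0"
    unfolding r_def[symmetric] unfolding r(2) .
qed (use C in \<open>auto intro!: continuous_intros\<close>)

text \<open>Parabolic scaling. Under dilations \<open>u\<close> and \<open>x\<close> scale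
  inversely, so \<open>u \<bullet> x\<close> is only reparametrised, and the operator is multiplied
  by \<open>k\<close>.\<close>

lemma barrier_scale:
  assumes b: "barrier n \<sigma> B h" and k: "1 \<le> k"
  shows "barrier n \<sigma> (B * k) (\<lambda>s. h (k * s))"
proof -
  from b obtain h' h'' where B0: "0 \<le> B" and hc: "continuous_on {0..} h" and hb: "\<And>s. 0 \<le> s \<Longrightarrow> 0 \<le> h s \<and> h s \<le> B * sqrt s"
    and h: "\<And>s. 0 < s \<Longrightarrow> (h has_real_derivative h' s) (at s)" "\<And>s. 0 < s \<Longrightarrow> (h' has_real_derivative h'' s) (at s)"
      "\<And>s. 0 < s \<Longrightarrow> \<bar>2 * s * h' s - h s\<bar> \<le> B * s"
      "\<And>s. 0 < s \<Longrightarrow> 4 * s * h'' s + (2 * n - 4) * h' s - 2 * (n - 2) * h s / s - \<sigma> * (3 * h s * h' s + (n - 4) / 2 * (h s)\<^sup>2 / s) \<le> 0"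
    unfolding barrier_def by blast
  have k0: "0 < k" using k by simp
  show ?thesis
  proof (rule barrierI[where h'="\<lambda>s. k * h' (k * s)" and h''="\<lambda>s. k\<^sup>2 * h'' (k * s)"])
    show "continuous_on {0..} (\<lambda>s. h (k * s))"
      by (rule continuous_on_compose2[OF hc]) (use k0 in \<open>auto intro!: continuous_intros\<close>)
    show "0 \<le> h (k * s)" if "0 \<le> s" for s using hb[of "k * s"] that k0 by simp
    show "h (k * s) \<le> B * k * sqrt s" if "0 \<le> s" for s
    proof -
      have "sqrt k \<le> k" using k real_sqrt_le_mono[of k "k * k"] by (simp add: mult_left_mono)
      then have "B * (sqrt k * sqrt s) \<le> B * (k * sqrt s)" using that B0 by (intro mult_left_mono mult_right_mono) auto
      then show ?thesis using hb[of "k * s"] that k0 by (simp add: real_sqrt_mult mult.assoc)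
    qed
    fix s :: real assume s: "0 < s"
    have ks: "0 < k * s" using s k0 by simp
    have d: "((\<lambda>s. k * s) has_real_derivative k) (at s)" by (auto intro!: derivative_eq_intros)
    show "((\<lambda>s. h (k * s)) has_real_derivative k * h' (k * s)) (at s)"
      using DERIV_chain2[OF h(1)[OF ks] d] by (simp add: mult.commute)
    show "((\<lambda>s. k * h' (k * s)) has_real_derivative k\<^sup>2 * h'' (k * s)) (at s)"
      using DERIV_cmult[OF DERIV_chain2[OF h(2)[OF ks] d], of k] by (simp add: power2_eq_square mult_ac)
    show "\<bar>2 * s * (k * h' (k * s)) - h (k * s)\<bar> \<le> B * k * s"
      using h(3)[OF ks] by (simp add: mult_ac)
    define w where "w = k * s"
    have "4 * s * (k\<^sup>2 * h'' w) + (2 * n - 4) * (k * h' w) - 2 * (n - 2) * h w / s - \<sigma> * (3 * h w * (k * h' w) + (n - 4) / 2 * (h w)\<^sup>2 / s)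
      = k * (4 * w * h'' w + (2 * n - 4) * h' w - 2 * (n - 2) * h w / w - \<sigma> * (3 * h w * h' w + (n - 4) / 2 * (h w)\<^sup>2 / w))"
      using s k0 by (simp add: w_def field_simps power2_eq_square)
    also have "\<dots> \<le> 0" using h(4)[OF ks] k0 unfolding w_def[symmetric] by (simp add: mult_le_0_iff)
    finally show "4 * s * (k\<^sup>2 * h'' (k * s)) + (2 * n - 4) * (k * h' (k * s)) - 2 * (n - 2) * h (k * s) / s
      - \<sigma> * (3 * h (k * s) * (k * h' (k * s)) + (n - 4) / 2 * (h (k * s))\<^sup>2 / s) \<le> 0" unfolding w_def .
  qed (use B0 k0 in auto)
qed

text \<open>
  The growth at infinity is dictated by the hypotheses on \<open>r * v r\<close>: for \<open>n \<ge> 5\<close> the limit must be at least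
  \<open>2 (n - 2) / (n - 4)\<close>, which is \<open>6\<close> for \<open>n = 5\<close> and at most \<open>4\<close> for \<open>n \<ge> 6\<close>; for \<open>n = 4\<close> the growth is
  logarithmic, for \<open>n < 4\<close> a power of \<open>s\<close>.
\<close>

lemma inverse_square_derivative:
  fixes s c :: real
  assumes s: "0 < 1 + s"
  shows "((\<lambda>s. c / (1 + s)\<^sup>2) has_real_derivative - (2 * c) / (1 + s) ^ 3) (at s)"
proof -
  have d: "((\<lambda>s. (1 + s)\<^sup>2) has_real_derivative 2 * (1 + s)) (at s)" by (auto intro!: derivative_eq_intros)
  have nz: "(1 + s)\<^sup>2 \<noteq> 0" using s by simp
  have e: "(0 * D\<^sup>2 - c * (2 * D)) / (D\<^sup>2 * D\<^sup>2) = - (2 * c) / D ^ 3" if "0 < D" for D :: real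
    using that by (simp add: field_simps power2_eq_square power3_eq_cube)
  show ?thesis by (rule DERIV_cong[OF DERIV_divide[OF DERIV_const d nz] e[OF s]])
qed

text \<open>This function solves \<open>2 h' - 2 h / s + h^2 / (2 s) = 0\<close>. The left-hand side
  is the coefficient of \<open>n\<close> in the operator, so \<open>n\<close> drops out and
  \<open>- 16 s^2 / (1 + s)^3\<close> remains in every dimension.\<close>

lemma barrier_rational:
  fixes n :: real
  assumes n: "4 \<le> n"
  shows "barrier n (-1) 4 (\<lambda>s. 4 * s / (1 + s))"
proof (rule barrierI[where h'="\<lambda>s. 4 / (1 + s)\<^sup>2" and h''="\<lambda>s. - 8 / (1 + s) ^ 3"])
  show "continuous_on {0..} (\<lambda>s::real. 4 * s / (1 + s))" by (intro continuous_intros) auto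
  show "4 * s / (1 + s) \<le> 4 * sqrt s" if "0 \<le> s" for s :: real
  proof -
    define r where "r = sqrt s"
    have r: "0 \<le> r" "s = r * r" using that by (auto simp: r_def)
    have "r \<le> 1 + r * r" using norm_le_one_plus_square[of r] by (simp add: power2_eq_square)
    then have "r * r \<le> r * (1 + r * r)" using r by (intro mult_left_mono) auto
    then show ?thesis unfolding r_def[symmetric] unfolding r(2) by (simp add: pos_divide_le_eq add_pos_nonneg)
  qed
  fix s :: real assume s: "0 < s"
  have p: "0 < 1 + s" using s by simp
  show "((\<lambda>s. 4 * s / (1 + s)) has_real_derivative 4 / (1 + s)\<^sup>2) (at s)"
    using p by (auto intro!: derivative_eq_intros simp: field_simps power2_eq_square)
  show "((\<lambda>s. 4 / (1 + s)\<^sup>2) has_real_derivative - 8 / (1 + s) ^ 3) (at s)"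
    using inverse_square_derivative[OF p, of 4] by simp
  show "\<bar>2 * s * (4 / (1 + s)\<^sup>2) - 4 * s / (1 + s)\<bar> \<le> 4 * s"
  proof -
    have eq: "2 * s * (4 / (1 + s)\<^sup>2) - 4 * s / (1 + s) = 4 * s * ((1 - s) / (1 + s)\<^sup>2)"
    proof -
      have "2 * s * (4 / D\<^sup>2) - 4 * s / D = 4 * s * ((2 - D) / D\<^sup>2)" if "0 < D" for D
        using that by (simp add: field_simps power2_eq_square)
      from this[OF p] show ?thesis by simp
    qed
    have bd: "\<bar>(1 - s) / (1 + s)\<^sup>2\<bar> \<le> 1"
    proof -
      have "\<bar>1 - s\<bar> \<le> (1 + s)\<^sup>2" using s by (auto simp: power2_eq_square abs_le_iff algebra_simps)
      then show ?thesis using p by (simp add: abs_divide)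
    qed
    have "\<bar>4 * s * X\<bar> \<le> 4 * s" if "\<bar>X\<bar> \<le> 1" for X using s that by (simp add: abs_mult mult_left_le)
    from this[OF bd] show ?thesis unfolding eq .
  qed
  have "4 * s * (- 8 / (1 + s) ^ 3) + (2 * n - 4) * (4 / (1 + s)\<^sup>2) - 2 * (n - 2) * (4 * s / (1 + s)) / s
      - (-1) * (3 * (4 * s / (1 + s)) * (4 / (1 + s)\<^sup>2) + (n - 4) / 2 * (4 * s / (1 + s))\<^sup>2 / s)
    = - 16 * s * s / (1 + s) ^ 3"
  proof -
    define D where "D = 1 + s"
    have D: "0 < D" "s = D - 1" using p by (auto simp: D_def)
    have e: "2 * (n - 2) * (4 * s / D) / s = 8 * (n - 2) / D" "(n - 4) / 2 * (4 * s / D)\<^sup>2 / s = 8 * (n - 4) * s / D\<^sup>2"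
      using s D(1) by (simp_all add: field_simps power2_eq_square)
    have "4 * s * (- 8 / D ^ 3) + (2 * n - 4) * (4 / D\<^sup>2) - 8 * (n - 2) / D - (-1) * (3 * (4 * s / D) * (4 / D\<^sup>2) + 8 * (n - 4) * s / D\<^sup>2) = - 16 * s * s / D ^ 3"
      unfolding D(2) using D(1) by (simp add: field_simps power2_eq_square power3_eq_cube)
    then show ?thesis unfolding D_def[symmetric] e .
  qed
  also have "\<dots> \<le> 0" using s p by (simp add: divide_nonpos_pos)
  finally show "4 * s * (- 8 / (1 + s) ^ 3) + (2 * n - 4) * (4 / (1 + s)\<^sup>2) - 2 * (n - 2) * (4 * s / (1 + s)) / s
      - (-1) * (3 * (4 * s / (1 + s)) * (4 / (1 + s)\<^sup>2) + (n - 4) / 2 * (4 * s / (1 + s))\<^sup>2 / s) \<le> 0" .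
qed auto

text \<open>\<open>barrier_rational\<close> has limit \<open>4\<close> and stays below the threshold
  \<open>6\<close> of this dimension. In \<open>D = sqrt (1 + s)\<close> and
  \<open>P = D - 1\<close> everything becomes rational, and the operator collapses to
  \<open>- 18 P^3 / D^5\<close>.\<close>

lemma barrier_five: "barrier 5 (-1) 6 (\<lambda>s. 6 * (1 - 1 / sqrt (1 + s)))"
proof (rule barrierI[where h'="\<lambda>s. 3 / ((1 + s) * sqrt (1 + s))" and h''="\<lambda>s. - 9/2 / ((1 + s)\<^sup>2 * sqrt (1 + s))"])
  show "continuous_on {0..} (\<lambda>s::real. 6 * (1 - 1 / sqrt (1 + s)))" by (intro continuous_intros) auto
  have up: "1 - 1 / sqrt (1 + s) \<le> s" if "0 \<le> s" for s :: real
  proof -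
    have D: "1 \<le> sqrt (1 + s)" "sqrt (1 + s) * sqrt (1 + s) = 1 + s" using that by auto
    define D where "D = sqrt (1 + s)"
    have DD: "1 \<le> D" "s = D * D - 1" using D by (auto simp: D_def)
    have "1 - 1 / D \<le> D - 1" using DD(1) mult_mono[of 1 D 1 D] sum_squares_bound[of D 1] by (simp add: field_simps power2_eq_square)
    also have "\<dots> \<le> (D - 1) * (D + 1)" using DD(1) by (intro mult_left_mono[of 1 "D + 1" "D - 1", simplified]) auto
    also have "\<dots> = s" unfolding DD(2) by (simp add: algebra_simps)
    finally show ?thesis by (simp add: D_def)
  qed
  show "0 \<le> 6 * (1 - 1 / sqrt (1 + s))" if "0 \<le> s" for s :: real
  proof -
    have "1 / sqrt (1 + s) \<le> 1" using that by (simp add: divide_le_eq_1)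
    then show ?thesis by simp
  qed
  show "6 * (1 - 1 / sqrt (1 + s)) \<le> 6 * sqrt s" if "0 \<le> s" for s :: real
  proof (cases "s \<le> 1")
    case True
    then have "s \<le> sqrt s" using that real_sqrt_le_mono[of "s * s" s] by (simp add: mult_left_le)
    then show ?thesis using up[OF that] by simp
  next
    case False
    then have "1 \<le> sqrt s" by simp
    moreover have "0 \<le> 1 / sqrt (1 + s)" using that by simp
    moreover have "6 * (1 - X) \<le> 6 * Y" if "1 \<le> Y" "0 \<le> X" for X Y :: real using that by simp
    ultimately show ?thesis by blast
  qed
  fix s :: real assume s: "0 < s"
  define D where "D = sqrt (1 + s)"
  have D: "1 < D" "s = D * D - 1" "1 + s = D * D" using s by (auto simp: D_def)
  have ds: "(sqrt has_real_derivative (inverse D / 2)) (at (1 + s))" unfolding D_def by (rule DERIV_real_sqrt) (use s in simp)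
  have one: "((\<lambda>s. 1 + s) has_real_derivative 1) (at s)" by (auto intro!: derivative_eq_intros)
  have dD: "((\<lambda>s. sqrt (1 + s)) has_real_derivative (inverse D / 2)) (at s)"
    using DERIV_chain2[where f=sqrt and g="\<lambda>s. 1 + s" and x=s and Db=1, OF ds one] by simp
  have nz: "sqrt (1 + s) \<noteq> 0" "(1 + s) * sqrt (1 + s) \<noteq> 0" using s by auto
  have e1: "6 * (0 - (0 * sqrt (1 + s) - 1 * (inverse D / 2)) / (sqrt (1 + s) * sqrt (1 + s))) = 3 / ((1 + s) * sqrt (1 + s))"
    unfolding D_def[symmetric] D(3) using D(1) by (simp add: field_simps)
  show "((\<lambda>s. 6 * (1 - 1 / sqrt (1 + s))) has_real_derivative 3 / ((1 + s) * sqrt (1 + s))) (at s)"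
    by (rule DERIV_cong[OF DERIV_cmult[OF DERIV_diff[OF DERIV_const DERIV_divide[OF DERIV_const dD nz(1)]]] e1])
  have e2: "(0 * ((1 + s) * sqrt (1 + s)) - 3 * (1 * sqrt (1 + s) + (inverse D / 2) * (1 + s))) / (((1 + s) * sqrt (1 + s)) * ((1 + s) * sqrt (1 + s))) = - 9/2 / ((1 + s)\<^sup>2 * sqrt (1 + s))"
    unfolding D_def[symmetric] D(3) using D(1) by (simp add: field_simps power2_eq_square)
  show "((\<lambda>s. 3 / ((1 + s) * sqrt (1 + s))) has_real_derivative - 9/2 / ((1 + s)\<^sup>2 * sqrt (1 + s))) (at s)"
    by (rule DERIV_cong[OF DERIV_divide[OF DERIV_const DERIV_mult[OF one dD] nz(2)] e2])
  show "\<bar>2 * s * (3 / ((1 + s) * sqrt (1 + s))) - 6 * (1 - 1 / sqrt (1 + s))\<bar> \<le> 6 * s"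
  proof -
    have "1 \<le> (1 + s) * sqrt (1 + s)" using s by (intro mult_ge1_I[of "1 + s", THEN order_trans[rotated]] order_refl) auto
    then have "2 * s * (3 / ((1 + s) * sqrt (1 + s))) \<le> 6 * s" using s by (simp add: pos_divide_le_eq mult_left_mono[of 1])
    moreover have "0 \<le> 2 * s * (3 / ((1 + s) * sqrt (1 + s)))" using s by simp
    moreover have "0 \<le> 6 * (1 - 1 / sqrt (1 + s))"
    proof -
      have "1 / sqrt (1 + s) \<le> 1" using s by (simp add: divide_le_eq_1)
      then show ?thesis by simp
    qed
    moreover have "6 * (1 - 1 / sqrt (1 + s)) \<le> 6 * s" using up[of s] s by simp
    ultimately show ?thesis by (intro abs_leI) linarith+
  qed
  show "4 * s * (- 9/2 / ((1 + s)\<^sup>2 * sqrt (1 + s))) + (2 * 5 - 4) * (3 / ((1 + s) * sqrt (1 + s))) - 2 * (5 - 2) * (6 * (1 - 1 / sqrt (1 + s))) / s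
     - (-1) * (3 * (6 * (1 - 1 / sqrt (1 + s))) * (3 / ((1 + s) * sqrt (1 + s))) + (5 - 4) / 2 * (6 * (1 - 1 / sqrt (1 + s)))\<^sup>2 / s) \<le> 0"
  proof -
    define P where "P = D - 1"
    have P: "0 < P" "D = P + 1" "s = P * (P + 2)" "0 < P + 2" using D(1,2) by (auto simp: P_def algebra_simps)
    have D0: "0 < D" using D(1) by simp
    have e0: "1 - 1 / D = P / D" using D0 by (simp add: P_def field_simps)
    have e1: "2 * (5 - 2) * (6 * (1 - 1 / D)) / s = 36 / (D * (P + 2))"
    proof -
      have "2 * (5 - 2) * (6 * (1 - 1 / D)) / s = 36 * P / (D * (P * (P + 2)))" unfolding e0 P(3) by simp
      also have "\<dots> = 36 / (D * (P + 2))" by (subst frac_eq_eq) (use P(1,4) D0 in auto)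
      finally show ?thesis .
    qed
    have e2: "(5 - 4) / 2 * (6 * (1 - 1 / D))\<^sup>2 / s = 18 * P / (D\<^sup>2 * (P + 2))"
    proof -
      have "(5 - 4) / 2 * (6 * (1 - 1 / D))\<^sup>2 / s = 18 * P * P / (D\<^sup>2 * (P * (P + 2)))"
        unfolding e0 P(3) by (simp add: power2_eq_square)
      also have "\<dots> = 18 * P / (D\<^sup>2 * (P + 2))" by (subst frac_eq_eq) (use P(1,4) D0 in auto)
      finally show ?thesis .
    qed
    have "4 * s * (- 9/2 / ((D * D)\<^sup>2 * D)) + (2 * 5 - 4) * (3 / ((D * D) * D)) - 36 / (D * (P + 2))
      - (-1) * (3 * (6 * (P / D)) * (3 / ((D * D) * D)) + 18 * P / (D\<^sup>2 * (P + 2))) = - 18 * P ^ 3 / D ^ 5"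
    proof -
      have q1: "4 * s * (- 9/2 / ((D * D)\<^sup>2 * D)) = - 18 * s / D ^ 5" using D0 by (simp add: power2_eq_square numeral_eq_Suc)
      have q2: "(2 * 5 - 4) * (3 / ((D * D) * D)) = 18 * D\<^sup>2 / D ^ 5" using D0 by (simp add: power2_eq_square numeral_eq_Suc)
      have q3: "36 / (D * (P + 2)) = 36 * D ^ 4 / (P + 2) / D ^ 5" using D0 by (simp add: numeral_eq_Suc)
      have q4: "3 * (6 * (P / D)) * (3 / ((D * D) * D)) = 54 * P * D / D ^ 5" using D0 by (simp add: numeral_eq_Suc)
      have q5: "18 * P / (D\<^sup>2 * (P + 2)) = 18 * P * D ^ 3 / (P + 2) / D ^ 5" using D0 by (simp add: numeral_eq_Suc)
      have q6: "- 18 * s + 18 * D\<^sup>2 - 36 * D ^ 4 / (P + 2) + 54 * P * D + 18 * P * D ^ 3 / (P + 2) = - 18 * P ^ 3"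
      proof -
        have "18 * P * D ^ 3 / (P + 2) - 36 * D ^ 4 / (P + 2) = (- 18 * D ^ 3) * (P + 2) / (P + 2)"
          unfolding diff_divide_distrib[symmetric] P(2) by (rule arg_cong[where f="\<lambda>x. x / _"]) algebra
        then have "18 * P * D ^ 3 / (P + 2) - 36 * D ^ 4 / (P + 2) = - 18 * D ^ 3" using P(4) by simp
        moreover have "- 18 * s + 18 * D\<^sup>2 - 18 * D ^ 3 + 54 * P * D = - 18 * P ^ 3" unfolding P(2,3) by algebra
        ultimately show ?thesis by linarith
      qed
      have q7: "- 18 * s / D ^ 5 + 18 * D\<^sup>2 / D ^ 5 - 36 * D ^ 4 / (P + 2) / D ^ 5 - (-1) * (54 * P * D / D ^ 5 + 18 * P * D ^ 3 / (P + 2) / D ^ 5)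
         = (- 18 * s + 18 * D\<^sup>2 - 36 * D ^ 4 / (P + 2) + 54 * P * D + 18 * P * D ^ 3 / (P + 2)) / D ^ 5"
        by (simp add: add_divide_distrib diff_divide_distrib)
      show ?thesis unfolding q1 q2 q3 q4 q5 q7 q6 ..
    qed
    also have "\<dots> \<le> 0" using P(1) D0 by (simp add: divide_nonpos_pos)
    finally show ?thesis unfolding D_def[symmetric] unfolding e1 e2 unfolding D(3) e0 .
  qed
qed simp

text \<open>With \<open>s = r^2\<close> the term \<open>2/3 ln (1 + s)\<close> grows like
  \<open>4/3 ln r\<close>. For \<open>D = 1 + s\<close> and \<open>H = 2/3 ln D + 1\<close> the
  operator is \<open>s / D^3\<close> times \<open>- 2 D H - 10 H + 8 + 3 H^2\<close>. From
  \<open>ln D \<le> D - 1\<close> follows \<open>3 H \<le> 2 D + 1\<close>, so the bracket is at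
  most \<open>8 - 9 H\<close>, which is negative because \<open>H \<ge> 1\<close>.\<close>

lemma barrier_log: "barrier 4 (-1) 4 (\<lambda>s. (2/3 * ln (1 + s) + 1) * (s / (1 + s)))"
proof (rule barrierI[where h'="\<lambda>s. 2/3 * (1 / (1 + s) - 1 / (1 + s)\<^sup>2) + (2/3 * ln (1 + s) + 1) / (1 + s)\<^sup>2"
      and h''="\<lambda>s. 2/3 * (- 1 / (1 + s)\<^sup>2 + 3 / (1 + s) ^ 3) - 2 * (2/3 * ln (1 + s) + 1) / (1 + s) ^ 3"])
  have lb: "ln (1 + s) \<le> s" "0 \<le> ln (1 + s)" if "0 \<le> s" for s :: real
    using that ln_add_one_self_le_self by auto
  have sr: "s / (1 + s) \<le> sqrt s" if "0 \<le> s" for s :: real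
  proof -
    define r where "r = sqrt s"
    have r: "0 \<le> r" "s = r * r" using that by (auto simp: r_def)
    have "r \<le> 1 + r * r" using norm_le_one_plus_square[of r] by (simp add: power2_eq_square)
    then have "r * r \<le> r * (1 + r * r)" using r by (intro mult_left_mono) auto
    then show ?thesis unfolding r_def[symmetric] unfolding r(2) by (simp add: pos_divide_le_eq add_pos_nonneg)
  qed
  show "continuous_on {0..} (\<lambda>s::real. (2/3 * ln (1 + s) + 1) * (s / (1 + s)))" by (intro continuous_intros) auto
  show "0 \<le> (2/3 * ln (1 + s) + 1) * (s / (1 + s))" if "0 \<le> s" for s :: real using lb[OF that] that by simp
  show "(2/3 * ln (1 + s) + 1) * (s / (1 + s)) \<le> 4 * sqrt s" if s: "0 \<le> s" for s :: real
  proof -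
    have "1 + s \<le> (1 + sqrt s)\<^sup>2" using s by (simp add: power2_sum)
    then have "ln (1 + s) \<le> ln ((1 + sqrt s)\<^sup>2)" using s by (intro ln_mono) (auto simp: add_pos_nonneg)
    also have "\<dots> = 2 * ln (1 + sqrt s)" using s by (simp add: ln_realpow add_pos_nonneg)
    also have "\<dots> \<le> 2 * sqrt s" using ln_add_one_self_le_self[of "sqrt s"] s by simp
    finally have "(2/3 * ln (1 + s) + 1) * (s / (1 + s)) \<le> (4/3 * sqrt s + 1) * (s / (1 + s))"
      using s by (intro mult_right_mono) auto
    also have "\<dots> = 4/3 * sqrt s * (s / (1 + s)) + s / (1 + s)" by (simp only: distrib_right mult_1)
    also have "\<dots> \<le> 4/3 * sqrt s * 1 + sqrt s"
      using s sr[OF s] by (intro add_mono mult_left_mono) (auto simp: pos_divide_le_eq)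
    also have "\<dots> \<le> 4 * sqrt s" using s by simp
    finally show ?thesis .
  qed
  fix s :: real assume s: "0 < s"
  define D where "D = 1 + s"
  define H where "H = 2/3 * ln D + 1"
  have D: "1 < D" "s = D - 1" "0 < D" using s by (auto simp: D_def)
  have H: "1 \<le> H" "3 * H \<le> 2 * D + 1" using lb[of s] s by (auto simp: H_def D_def)
  have dH: "((\<lambda>s. 2/3 * ln (1 + s) + 1) has_real_derivative 2/3 * (1 / D)) (at s)"
    using s by (auto intro!: derivative_eq_intros simp: D_def field_simps)
  have dq: "((\<lambda>s. s / (1 + s)) has_real_derivative 1 / D\<^sup>2) (at s)"
    using s by (auto intro!: derivative_eq_intros simp: D_def field_simps power2_eq_square)
  have di: "((\<lambda>s. 1 / (1 + s)) has_real_derivative - 1 / D\<^sup>2) (at s)"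
    using s by (auto intro!: derivative_eq_intros simp: D_def field_simps power2_eq_square)
  have di2: "((\<lambda>s. 1 / (1 + s)\<^sup>2) has_real_derivative - 2 / D ^ 3) (at s)"
    using inverse_square_derivative[of s 1] s by (simp add: D_def)
  have p1: "(2/3 * (1 / D)) * (s / D) = 2/3 * (1 / D - 1 / D\<^sup>2)" unfolding D(2) using D(3) by (simp add: field_simps power2_eq_square)
  have e1: "(2/3 * (1 / D)) * (s / (1 + s)) + 1 / D\<^sup>2 * (2/3 * ln (1 + s) + 1)
      = 2/3 * (1 / (1 + s) - 1 / (1 + s)\<^sup>2) + (2/3 * ln (1 + s) + 1) / (1 + s)\<^sup>2"
    unfolding D_def[symmetric] p1 by simp
  show "((\<lambda>s. (2/3 * ln (1 + s) + 1) * (s / (1 + s))) has_real_derivative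
      2/3 * (1 / (1 + s) - 1 / (1 + s)\<^sup>2) + (2/3 * ln (1 + s) + 1) / (1 + s)\<^sup>2) (at s)"
    by (rule DERIV_cong[OF DERIV_mult[OF dH dq] e1])
  have "((\<lambda>s. 2/3 * (1 / (1 + s) - 1 / (1 + s)\<^sup>2) + (2/3 * ln (1 + s) + 1) * (1 / (1 + s)\<^sup>2)) has_real_derivative
      2/3 * (- 1 / D\<^sup>2 - (- 2 / D ^ 3)) + ((2/3 * (1 / D)) * (1 / (1 + s)\<^sup>2) + (- 2 / D ^ 3) * (2/3 * ln (1 + s) + 1))) (at s)"
    by (intro DERIV_add DERIV_cmult DERIV_diff DERIV_mult di di2 dH)
  moreover have "2/3 * (- 1 / D\<^sup>2 - (- 2 / D ^ 3)) + ((2/3 * (1 / D)) * (1 / (1 + s)\<^sup>2) + (- 2 / D ^ 3) * (2/3 * ln (1 + s) + 1))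
      = 2/3 * (- 1 / (1 + s)\<^sup>2 + 3 / (1 + s) ^ 3) - 2 * (2/3 * ln (1 + s) + 1) / (1 + s) ^ 3"
    unfolding D_def[symmetric] H_def[symmetric] using D(3) by (simp add: field_simps power2_eq_square power3_eq_cube)
  ultimately show "((\<lambda>s. 2/3 * (1 / (1 + s) - 1 / (1 + s)\<^sup>2) + (2/3 * ln (1 + s) + 1) / (1 + s)\<^sup>2) has_real_derivative
      2/3 * (- 1 / (1 + s)\<^sup>2 + 3 / (1 + s) ^ 3) - 2 * (2/3 * ln (1 + s) + 1) / (1 + s) ^ 3) (at s)"
    by simp
  show "\<bar>2 * s * (2/3 * (1 / (1 + s) - 1 / (1 + s)\<^sup>2) + (2/3 * ln (1 + s) + 1) / (1 + s)\<^sup>2) - (2/3 * ln (1 + s) + 1) * (s / (1 + s))\<bar> \<le> 4 * s"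
  proof -
    have HD: "H \<le> D" using H(2) D(1) by linarith
    have "2/3 * (1 / D - 1 / D\<^sup>2) + H / D\<^sup>2 = (2/3 * (D - 1) + H) / D\<^sup>2" using D(3) by (simp add: field_simps power2_eq_square)
    moreover have "(2/3 * (D - 1) + H) / D\<^sup>2 \<le> 2"
    proof -
      have "2/3 * (D - 1) + H \<le> 2 * D"
      proof -
        have "2/3 * (D - 1) = 2/3 * D - 2/3" by (simp add: right_diff_distrib)
        then show ?thesis using HD D(1) by linarith
      qed
      also have "\<dots> \<le> 2 * D\<^sup>2" using D by (simp add: power2_eq_square)
      finally show ?thesis using D(3) by (simp add: pos_divide_le_eq)
    qed
    moreover have "0 \<le> (2/3 * (D - 1) + H) / D\<^sup>2" using D H by simp
    ultimately have a: "0 \<le> 2/3 * (1 / D - 1 / D\<^sup>2) + H / D\<^sup>2" "2/3 * (1 / D - 1 / D\<^sup>2) + H / D\<^sup>2 \<le> 2" by auto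
    have b: "H * (s / D) \<le> s" "0 \<le> H * (s / D)" using HD D(3) H s by (auto simp: pos_divide_le_eq mult.commute)
    have "2 * s * (2/3 * (1 / D - 1 / D\<^sup>2) + H / D\<^sup>2) \<le> 2 * s * 2" using a(2) s by (intro mult_left_mono) auto
    moreover have "0 \<le> 2 * s * (2/3 * (1 / D - 1 / D\<^sup>2) + H / D\<^sup>2)" using a(1) s by simp
    ultimately show ?thesis unfolding D_def[symmetric] H_def[symmetric] using b by (intro abs_leI) linarith+
  qed
  have "4 * s * (2/3 * (- 1 / D\<^sup>2 + 3 / D ^ 3) - 2 * H / D ^ 3) + (2 * 4 - 4) * (2/3 * (1 / D - 1 / D\<^sup>2) + H / D\<^sup>2) - 2 * (4 - 2) * (H * (s / D)) / s
      - (-1) * (3 * (H * (s / D)) * (2/3 * (1 / D - 1 / D\<^sup>2) + H / D\<^sup>2) + (4 - 4) / 2 * (H * (s / D))\<^sup>2 / s)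
      = s / D ^ 3 * (- 2 * D * H - 10 * H + 8 + 3 * H\<^sup>2)"
  proof -
    have *: "2 * (4 - 2) * (H * (s / D)) / s = 4 * H / D" using s D(3) by (simp add: field_simps)
    show ?thesis unfolding * unfolding D(2) using D(3) by (simp add: field_simps power2_eq_square power3_eq_cube)
  qed
  also have "\<dots> \<le> 0"
  proof -
    have "3 * H * H \<le> (2 * D + 1) * H" using H by (intro mult_right_mono) auto
    then have "- 2 * D * H - 10 * H + 8 + 3 * H\<^sup>2 \<le> 0" using H(1) by (simp add: power2_eq_square distrib_right)
    then show ?thesis by (rule mult_nonneg_nonpos[rotated]) (use s D(3) in simp)
  qed
  finally show "4 * s * (2/3 * (- 1 / (1 + s)\<^sup>2 + 3 / (1 + s) ^ 3) - 2 * (2/3 * ln (1 + s) + 1) / (1 + s) ^ 3)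
      + (2 * 4 - 4) * (2/3 * (1 / (1 + s) - 1 / (1 + s)\<^sup>2) + (2/3 * ln (1 + s) + 1) / (1 + s)\<^sup>2) - 2 * (4 - 2) * ((2/3 * ln (1 + s) + 1) * (s / (1 + s))) / s
      - (-1) * (3 * ((2/3 * ln (1 + s) + 1) * (s / (1 + s))) * (2/3 * (1 / (1 + s) - 1 / (1 + s)\<^sup>2) + (2/3 * ln (1 + s) + 1) / (1 + s)\<^sup>2)
        + (4 - 4) / 2 * ((2/3 * ln (1 + s) + 1) * (s / (1 + s)))\<^sup>2 / s) \<le> 0"
    unfolding D_def[symmetric] H_def[symmetric] .
qed simp

text \<open>For a pure power with exponent \<open>1 - p\<close> the quadratic terms add up to a
  multiple of \<open>3 (1 - p) + (n - 4) / 2\<close>, and \<open>p\<close> is chosen to make this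
  zero. The amplitude \<open>4/9\<close> is the largest for which the last estimate reaches down to
  \<open>p = 2/3\<close>, that is \<open>n = 2\<close>: the estimate needs
  \<open>4 - 8 p + 3 * 4/9 \<le> 0\<close>. Dilation later makes up for the small amplitude.\<close>

lemma barrier_power:
  fixes n p :: real
  assumes n: "2 \<le> n" "n < 4" and p: "p = (n + 2) / 6"
  shows "barrier n (-1) 2 (\<lambda>s. 4/9 * (s * (1 + s) powr (- p)))"
proof (rule barrierI[where h'="\<lambda>s. 4/9 * ((1 + s) powr (- p) - p * (s * (1 + s) powr (- p - 1)))"
      and h''="\<lambda>s. 4/9 * (- 2 * p * (1 + s) powr (- p - 1) + p * (p + 1) * (s * (1 + s) powr (- p - 2)))"])
  have pb: "2/3 \<le> p" "p < 1" using n by (auto simp: p)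
  show "continuous_on {0..} (\<lambda>s::real. 4/9 * (s * (1 + s) powr (- p)))" by (intro continuous_intros) auto
  have le1: "(1 + s) powr (- q) \<le> 1" if "0 \<le> s" "0 \<le> q" for s q :: real
    using that powr_mono[of "- q" 0 "1 + s"] by simp
  show "4/9 * (s * (1 + s) powr (- p)) \<le> 2 * sqrt s" if s: "0 \<le> s" for s :: real
  proof -
    have "(1 + s) powr (- p) \<le> (1 + s) powr (- (1/2))" using s pb by (intro powr_mono) auto
    also have "\<dots> = 1 / sqrt (1 + s)" using s by (simp add: powr_minus_divide powr_half_sqrt)
    finally have "s * (1 + s) powr (- p) \<le> s * (1 / sqrt (1 + s))" using s by (intro mult_left_mono) auto
    also have "\<dots> = sqrt s * (sqrt s / sqrt (1 + s))" using s by simp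
    also have "\<dots> \<le> sqrt s * 1" using s by (intro mult_left_mono) (auto simp: divide_le_eq_1)
    finally have "4/9 * (s * (1 + s) powr (- p)) \<le> 4/9 * sqrt s" by (intro mult_left_mono) auto
    also have "\<dots> \<le> 2 * sqrt s" using s by (intro mult_right_mono) auto
    finally show ?thesis .
  qed
  fix s :: real assume s: "0 < s"
  define D where "D = 1 + s"
  have D: "1 < D" "s = D - 1" "0 < D" using s by (auto simp: D_def)
  have dp: "((\<lambda>s. (1 + s) powr q) has_real_derivative q * (1 + s) powr (q - 1)) (at s)" for q
    using s by (auto intro!: derivative_eq_intros DERIV_fun_powr[where g="\<lambda>s. 1 + s", THEN DERIV_cong])
  have di: "((\<lambda>s::real. s) has_real_derivative 1) (at s)" by simp
  have "((\<lambda>s. 4/9 * (s * (1 + s) powr (- p))) has_real_derivative 4/9 * (1 * (1 + s) powr (- p) + (- p * (1 + s) powr (- p - 1)) * s)) (at s)"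
    by (intro DERIV_cmult DERIV_mult di dp)
  then show "((\<lambda>s. 4/9 * (s * (1 + s) powr (- p))) has_real_derivative 4/9 * ((1 + s) powr (- p) - p * (s * (1 + s) powr (- p - 1)))) (at s)"
    by (simp add: mult_ac)
  have dd: "((\<lambda>s. 4/9 * ((1 + s) powr (- p) - p * (s * (1 + s) powr (- p - 1)))) has_real_derivative
      4/9 * (- p * (1 + s) powr (- p - 1) - p * (1 * (1 + s) powr (- p - 1) + ((- p - 1) * (1 + s) powr (- p - 1 - 1)) * s))) (at s)"
    by (intro DERIV_cmult DERIV_diff DERIV_mult di dp)
  have de: "4/9 * (- p * (1 + s) powr (- p - 1) - p * (1 * (1 + s) powr (- p - 1) + ((- p - 1) * (1 + s) powr (- p - 1 - 1)) * s))
    = 4/9 * (- 2 * p * (1 + s) powr (- p - 1) + p * (p + 1) * (s * (1 + s) powr (- p - 2)))"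
  proof -
    have e: "- p - 1 - 1 = - p - 2" by simp
    have "4/9 * (- p * a - p * (1 * a + ((- p - 1) * b) * s)) = 4/9 * (- 2 * p * a + p * (p + 1) * (s * b))" for a b
      by (simp add: algebra_simps)
    then show ?thesis unfolding e .
  qed
  show "((\<lambda>s. 4/9 * ((1 + s) powr (- p) - p * (s * (1 + s) powr (- p - 1)))) has_real_derivative
      4/9 * (- 2 * p * (1 + s) powr (- p - 1) + p * (p + 1) * (s * (1 + s) powr (- p - 2)))) (at s)"
    by (rule DERIV_cong[OF dd de])
  define g where "g = D powr (- p)"
  have g: "0 < g" "g \<le> 1" using D(3) le1[of s p] s pb by (simp_all add: g_def D_def)
  have g1: "D powr (- p - 1) = g / D" "D powr (- p - 2) = g / D\<^sup>2"
  proof -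
    have "D powr 1 = D" "D powr 2 = D\<^sup>2" using D(3) by simp_all
    then show "D powr (- p - 1) = g / D" "D powr (- p - 2) = g / D\<^sup>2" by (simp_all only: g_def powr_diff)
  qed
  have sD: "s / D \<le> 1" "0 \<le> s / D" using D s by auto
  show "\<bar>2 * s * (4/9 * ((1 + s) powr (- p) - p * (s * (1 + s) powr (- p - 1)))) - 4/9 * (s * (1 + s) powr (- p))\<bar> \<le> 2 * s"
  proof -
    have "2 * s * (4/9 * (g - p * (g * q))) - 4/9 * (s * g) = s * (4/9 * (g * (1 - 2 * p * q)))" for q
      by (simp add: algebra_simps add_divide_distrib diff_divide_distrib)
    from this[of "s / D"] have eq: "2 * s * (4/9 * (g - p * (s * (g / D)))) - 4/9 * (s * g) = s * (4/9 * (g * (1 - 2 * p * (s / D))))"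
      by (simp add: mult.commute)
    have bd: "\<bar>4/9 * (g * (1 - 2 * p * (s / D)))\<bar> \<le> 2"
    proof -
      have "2 * p * (s / D) \<le> 2 * 1 * 1" using pb sD by (intro mult_mono) auto
      moreover have "0 \<le> 2 * p * (s / D)" using pb sD by (intro mult_nonneg_nonneg) auto
      ultimately have "\<bar>1 - 2 * p * (s / D)\<bar> \<le> 1" by simp
      then have "g * \<bar>1 - 2 * p * (s / D)\<bar> \<le> 1 * 1" using g by (intro mult_mono) auto
      then show ?thesis using g by (simp add: abs_mult)
    qed
    have "\<bar>s * X\<bar> \<le> 2 * s" if "\<bar>X\<bar> \<le> 2" for X using s that by (simp add: abs_mult mult.commute)
    from this[OF bd] show ?thesis unfolding D_def[symmetric] g1 g_def[symmetric] eq .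
  qed
  have Dg: "D * g \<le> D" using g D by simp
  have n': "n = 6 * p - 2" by (simp add: p add_divide_distrib)
  have "4 * s * (4/9 * (- 2 * p * (g / D) + p * (p + 1) * (s * (g / D\<^sup>2)))) + (2 * n - 4) * (4/9 * (g - p * (s * (g / D)))) - 2 * (n - 2) * (4/9 * (s * g)) / s
      - (-1) * (3 * (4/9 * (s * g)) * (4/9 * (g - p * (s * (g / D)))) + (n - 4) / 2 * (4/9 * (s * g))\<^sup>2 / s)
      = 4/9 * p * g / D\<^sup>2 * s * (- 12 * p + s * (4 - 8 * p) + 4/3 * (D * g))"
  proof -
    have *: "2 * (n - 2) * (4/9 * (s * g)) / s = 2 * (n - 2) * (4/9 * g)" "(n - 4) / 2 * (4/9 * (s * g))\<^sup>2 / s = (n - 4) / 2 * (16/81 * (s * g\<^sup>2))"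
      using s by (simp_all add: power2_eq_square)
    show ?thesis unfolding * unfolding n' D(2) using D(3) by (simp add: field_simps power2_eq_square)
  qed
  also have "\<dots> \<le> 0"
  proof -
    have "- 12 * p + s * (4 - 8 * p) + 4/3 * (D * g) \<le> - 12 * p + s * (4 - 8 * p) + 4/3 * D" using Dg by simp
    also have "\<dots> = (4/3 - 12 * p) + s * (16/3 - 8 * p)" by (simp add: D_def algebra_simps add_divide_distrib)
    also have "\<dots> \<le> 0" using pb s mult_nonneg_nonpos[of s "16/3 - 8 * p"] by simp
    finally have "- 12 * p + s * (4 - 8 * p) + 4/3 * (D * g) \<le> 0" .
    moreover have "0 \<le> 4/9 * p * g / D\<^sup>2 * s" using pb g s by simp
    ultimately show ?thesis by (rule mult_nonneg_nonpos[rotated])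
  qed
  finally show "4 * s * (4/9 * (- 2 * p * (1 + s) powr (- p - 1) + p * (p + 1) * (s * (1 + s) powr (- p - 2)))) + (2 * n - 4) * (4/9 * ((1 + s) powr (- p) - p * (s * (1 + s) powr (- p - 1))))
      - 2 * (n - 2) * (4/9 * (s * (1 + s) powr (- p))) / s
      - (-1) * (3 * (4/9 * (s * (1 + s) powr (- p))) * (4/9 * ((1 + s) powr (- p) - p * (s * (1 + s) powr (- p - 1)))) + (n - 4) / 2 * (4/9 * (s * (1 + s) powr (- p)))\<^sup>2 / s) \<le> 0"
    unfolding D_def[symmetric] g1 g_def[symmetric] .
qed auto

section \<open>Barriers above the initial data\<close>

text \<open>
  A barrier can be dilated, so the smoothness of the data at the origin (\<open>v r \<le> K * r\<close>) and the assumed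
  decay at infinity are met by one large factor \<open>k\<close>.
\<close>

lemma barrier_above_power:
  fixes v :: "real \<Rightarrow> real"
  assumes n: "2 \<le> n" "n < 4" and K: "0 \<le> K" "\<And>r. 0 < r \<Longrightarrow> r \<le> 1 \<Longrightarrow> v r \<le> K * r"
    and C: "0 < C" "\<And>r. 0 < r \<Longrightarrow> v r \<le> C * (1 + r) powr (- ((n - 1) / 3))"
  shows "\<exists>B h. barrier n (-1) B h \<and> (\<forall>r>0. r * v r \<le> h (r\<^sup>2))"
proof -
  define p where "p = (n + 2) / 6"
  have pb: "2/3 \<le> p" "p < 1" using n by (auto simp: p_def)
  have np: "(n - 1) / 3 = 2 * p - 1" by (simp add: p_def field_simps)
  \<comment> \<open>The entry \<open>1\<close> is what \<open>barrier_scale\<close> asks for,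
    \<open>9 * K / 2\<close> serves the region \<open>k * r\<^sup>2 \<le> 1\<close>, and the power
    of \<open>C\<close> the region beyond. Since \<open>p < 1\<close>, dilation raises the barrier
    at infinity too.\<close>
  define k where "k = Max {1, 9 * K / 2, (9 * C / 2) powr (1 / (1 - p))}"
  have k: "1 \<le> k" "9 * K / 2 \<le> k" "(9 * C / 2) powr (1 / (1 - p)) \<le> k" by (auto simp: k_def)
  have kC: "9 * C / 2 \<le> k powr (1 - p)"
  proof -
    have "((9 * C / 2) powr (1 / (1 - p))) powr (1 - p) \<le> k powr (1 - p)" using k(3) pb by (intro powr_mono2) auto
    then show ?thesis using pb C(1) by (simp add: powr_powr)
  qed
  have "r * v r \<le> 4/9 * ((k * r\<^sup>2) * (1 + k * r\<^sup>2) powr (- p))" if r: "0 < r" for r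
  proof -
    define w where "w = k * r\<^sup>2"
    have w: "0 < w" using r k by (simp add: w_def)
    have half: "1/2 \<le> 2 powr (- p)" using powr_mono[of "-1" "- p" "2::real"] pb by (simp add: powr_minus_divide)
    show ?thesis
    proof (cases "w \<le> 1")
      case True
      have "r\<^sup>2 \<le> w" using k by (simp add: w_def mult_left_mono[of 1 k, simplified] mult_le_cancel_right1)
      then have "r\<^sup>2 \<le> 1\<^sup>2" using True by simp
      then have r1: "r \<le> 1" by (rule power2_le_imp_le) simp
      have "r * v r \<le> r * (K * r)" using K(2)[OF r r1] r by (intro mult_left_mono) auto
      also have "\<dots> = K * r\<^sup>2" by (simp add: power2_eq_square)
      also have "\<dots> \<le> (2/9 * k) * r\<^sup>2" using k(2) by (intro mult_right_mono) auto
      also have "\<dots> = 4/9 * (w * (1/2))" by (simp add: w_def)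
      also have "\<dots> \<le> 4/9 * (w * (1 + w) powr (- p))"
      proof -
        have "2 powr (- p) \<le> (1 + w) powr (- p)" using True w pb by (intro powr_mono2') auto
        then show ?thesis using half w by (intro mult_left_mono) auto
      qed
      finally show ?thesis by (simp add: w_def)
    next
      case False
      have "r * v r \<le> r * (C * (1 + r) powr (- (2 * p - 1)))" using C(2)[OF r] r unfolding np by (intro mult_left_mono) auto
      also have "\<dots> \<le> r * (C * r powr (- (2 * p - 1)))"
        using r C pb by (intro mult_left_mono powr_mono2') auto
      also have "\<dots> = C * (r powr 1 * r powr (- (2 * p - 1)))" using r by simp
      also have "r powr 1 * r powr (- (2 * p - 1)) = r powr (2 * (1 - p))" unfolding powr_add[symmetric] by (simp add: algebra_simps)
      also have "\<dots> = (r\<^sup>2) powr (1 - p)"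
        using r powr_powr[of r 2 "1 - p"] by simp
      also have "C * (r\<^sup>2) powr (1 - p) \<le> (2/9 * k powr (1 - p)) * (r\<^sup>2) powr (1 - p)"
        using kC by (intro mult_right_mono) auto
      also have "\<dots> = 2/9 * w powr (1 - p)" using k r by (simp add: w_def powr_mult)
      also have "\<dots> = 4/9 * (w * (1/2 * w powr (- p)))"
        using w by (simp add: powr_diff powr_minus_divide)
      also have "\<dots> \<le> 4/9 * (w * (1 + w) powr (- p))"
      proof -
        have "1/2 * w powr (- p) \<le> 2 powr (- p) * w powr (- p)" by (intro mult_right_mono half) auto
        also have "\<dots> = (2 * w) powr (- p)" using w by (simp add: powr_mult)
        also have "\<dots> \<le> (1 + w) powr (- p)" using False w pb by (intro powr_mono2') auto
        finally show ?thesis using w by (intro mult_left_mono) auto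
      qed
      finally show ?thesis by (simp add: w_def)
    qed
  qed
  then show ?thesis using barrier_scale[OF barrier_power[OF n p_def] k(1)] by blast
qed

text \<open>For \<open>r > 1\<close> dilation adds \<open>2/3 ln (k / 4)\<close> to the logarithm,
  which pays for \<open>C\<close>. For \<open>r \<le> 1\<close> the values \<open>w = k r^2\<close>
  are split at \<open>sqrt k\<close>: below, the quotient \<open>k / (1 + w)\<close> is at least
  \<open>sqrt k / 2\<close>; above, the logarithm is large while the quotient is still at least
  \<open>1/2\<close>.\<close>

lemma barrier_above_log:
  fixes v :: "real \<Rightarrow> real"
  assumes K: "0 \<le> K" "\<And>r. 0 < r \<Longrightarrow> r \<le> 1 \<Longrightarrow> v r \<le> K * r"
    and C: "0 < C" "\<And>r. 0 < r \<Longrightarrow> v r \<le> (4 / 3 * ln (1 + r) + C) / (1 + r)"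
  shows "\<exists>B h. barrier 4 (-1) B h \<and> (\<forall>r>0. r * v r \<le> h (r\<^sup>2))"
proof -
  \<comment> \<open>In this order: the requirement of \<open>barrier_scale\<close>, the ranges
    \<open>w \<le> sqrt k\<close> and \<open>w > sqrt k\<close> inside the unit ball, and the
    exterior.\<close>
  define k where "k = Max {1, (2 * K)\<^sup>2, exp (6 * K), 4 * exp (3/2 * C)}"
  have k: "1 \<le> k" "(2 * K)\<^sup>2 \<le> k" "exp (6 * K) \<le> k" "4 * exp (3/2 * C) \<le> k" by (auto simp: k_def)
  have k0: "0 < k" using k by simp
  have kK: "2 * K \<le> sqrt k" by (rule real_le_rsqrt[OF k(2)])
  have kl: "6 * K \<le> ln k" using k(3) k0 by (simp add: ln_ge_iff)
  have kC: "C \<le> 2/3 * ln (k / 4)"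
  proof -
    have "exp (3/2 * C) \<le> k / 4" using k(4) by simp
    then have "3/2 * C \<le> ln (k / 4)" using k0 ln_ge_iff[of "k / 4" "3/2 * C"] by simp
    then show ?thesis by simp
  qed
  have sk: "1 \<le> sqrt k" "sqrt k * sqrt k = k" using k k0 by auto
  have "r * v r \<le> (2/3 * ln (1 + k * r\<^sup>2) + 1) * ((k * r\<^sup>2) / (1 + k * r\<^sup>2))" if r: "0 < r" for r
  proof -
    define w where "w = k * r\<^sup>2"
    have w: "0 < w" using r k0 by (simp add: w_def)
    define H where "H = 2/3 * ln (1 + w) + 1"
    have H: "1 \<le> H" using w by (simp add: H_def)
    show ?thesis
    proof (cases "r \<le> 1")
      case True
      have s1: "r\<^sup>2 \<le> 1" using True r by (simp add: power_le_one)
      have "K \<le> H * (k / (1 + w))"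
      proof (cases "w \<le> sqrt k")
        case True
        have "1 + w \<le> 2 * sqrt k" using True sk(1) by linarith
        then have "k / (2 * sqrt k) \<le> k / (1 + w)" using k0 w by (intro divide_left_mono) auto
        moreover have "k / (2 * sqrt k) = sqrt k / 2" using sk k0 by (simp add: real_div_sqrt)
        ultimately have "K \<le> k / (1 + w)" using kK by linarith
        also have "\<dots> = 1 * (k / (1 + w))" by simp
        also have "\<dots> \<le> H * (k / (1 + w))" using H k0 w by (intro mult_right_mono) auto
        finally show ?thesis .
      next
        case False
        have "ln (sqrt k) \<le> ln (1 + w)" using False sk k0 by (intro ln_mono) auto
        then have "1/2 * ln k \<le> ln (1 + w)" using k0 by (simp add: ln_sqrt)
        then have H2: "2 * K \<le> H" using kl K(1) by (simp add: H_def)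
        have "w \<le> k" using mult_left_mono[OF s1, of k] k0 by (simp add: w_def)
        then have "1/2 \<le> k / (1 + w)" using w k(1) by (simp add: pos_le_divide_eq)
        then have "(2 * K) * (1/2) \<le> H * (k / (1 + w))" using H2 K(1) H by (intro mult_mono) auto
        then show ?thesis by simp
      qed
      then have "K * r\<^sup>2 \<le> H * (k / (1 + w)) * r\<^sup>2" by (intro mult_right_mono) auto
      moreover have "r * v r \<le> r * (K * r)" using K(2)[OF r True] r by (intro mult_left_mono) auto
      moreover have "r * (K * r) = K * r\<^sup>2" by (simp add: power2_eq_square)
      ultimately have "r * v r \<le> H * (k / (1 + w)) * r\<^sup>2" by linarith
      then show ?thesis by (simp add: H_def w_def)
    next
      case False
      then have r1: "1 < r" by simp
      have "(1 + r)\<^sup>2 \<le> (2 * r)\<^sup>2" using r1 by (intro power_mono) auto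
      then have "(k / 4) * (1 + r)\<^sup>2 \<le> (k / 4) * (4 * r\<^sup>2)" using k0 by (intro mult_left_mono) auto
      also have "\<dots> \<le> 1 + w" by (simp add: w_def)
      finally have "ln ((k / 4) * (1 + r)\<^sup>2) \<le> ln (1 + w)" using k0 r by (intro ln_mono) auto
      moreover have "ln ((k / 4) * (1 + r)\<^sup>2) = ln (k / 4) + 2 * ln (1 + r)"
        using k0 r ln_mult[of "k / 4" "(1 + r)\<^sup>2"] ln_realpow[of "1 + r" 2] by simp
      ultimately have HH: "4/3 * ln (1 + r) + C \<le> H" using kC by (simp add: H_def)
      have "r \<le> w"
      proof -
        have "1 * r \<le> k * r\<^sup>2" using k(1) r1 k0 by (intro mult_mono) (auto simp: power2_eq_square)
        then show ?thesis by (simp add: w_def)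
      qed
      then have q: "r / (1 + r) \<le> w / (1 + w)" using r w by (simp add: field_simps)
      have "r * v r \<le> r * ((4 / 3 * ln (1 + r) + C) / (1 + r))" using C(2)[OF r] r by (intro mult_left_mono) auto
      also have "\<dots> = (4/3 * ln (1 + r) + C) * (r / (1 + r))" by simp
      also have "\<dots> \<le> H * (w / (1 + w))" using HH q H r C(1) by (intro mult_mono) auto
      finally show ?thesis by (simp add: H_def w_def)
    qed
  qed
  then show ?thesis using barrier_scale[OF barrier_log k(1)] by blast
qed

text \<open>For barriers that are at least linear up to \<open>w1\<close> and at least
  \<open>L\<close> afterwards. Dilation by \<open>k \<ge> w1\<close> brings the region before
  \<open>w1\<close> into the unit ball, where the data obey \<open>v r \<le> K * r\<close>.\<close>

lemma barrier_above_saturating: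
  fixes v :: "real \<Rightarrow> real"
  assumes b: "barrier n \<sigma> B h" and K: "0 \<le> K" "\<And>r. 0 < r \<Longrightarrow> r \<le> 1 \<Longrightarrow> v r \<le> K * r"
    and kap: "0 < \<kappa>" "\<And>w. 0 < w \<Longrightarrow> w \<le> w1 \<Longrightarrow> \<kappa> * w \<le> h w" and L: "\<And>w. w1 \<le> w \<Longrightarrow> 0 < w \<Longrightarrow> L \<le> h w"
    and v: "\<And>r. 0 < r \<Longrightarrow> r * v r \<le> L"
  shows "\<exists>B h. barrier n \<sigma> B h \<and> (\<forall>r>0. r * v r \<le> h (r\<^sup>2))"
proof -
  define k where "k = Max {1, w1, K / \<kappa>}"
  have k: "1 \<le> k" "w1 \<le> k" "K / \<kappa> \<le> k" by (auto simp: k_def)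
  have "r * v r \<le> h (k * r\<^sup>2)" if r: "0 < r" for r
  proof (cases "w1 \<le> k * r\<^sup>2")
    case True
    then show ?thesis using L[OF True] v[OF r] r k by (auto intro: order_trans)
  next
    case False
    then have "k * r\<^sup>2 \<le> k * 1\<^sup>2" using k(2) by simp
    then have "r\<^sup>2 \<le> 1\<^sup>2" using k(1) by simp
    then have r1: "r \<le> 1" by (rule power2_le_imp_le) simp
    have "r * v r \<le> r * (K * r)" using K(2)[OF r r1] r by (intro mult_left_mono) auto
    also have "\<dots> = K * r\<^sup>2" by (simp add: power2_eq_square)
    also have "\<dots> \<le> (\<kappa> * k) * r\<^sup>2" using k(3) kap(1) by (intro mult_right_mono) (auto simp: pos_divide_le_eq mult.commute)
    also have "\<dots> \<le> h (k * r\<^sup>2)" using kap(2)[of "k * r\<^sup>2"] False k r by (simp add: mult.assoc)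
    finally show ?thesis .
  qed
  then show ?thesis using barrier_scale[OF b k(1)] by blast
qed

text \<open>Because \<open>\<gamma> < 1\<close>, the bound on \<open>r * v r\<close> lies strictly
  below the limit of the barrier, so the barrier exceeds it from some finite \<open>w1\<close>
  on.\<close>

lemma barrier_above_inverse:
  fixes v :: "real \<Rightarrow> real"
  assumes n: "n = 5 \<or> 6 \<le> n" and K: "0 \<le> K" "\<And>r. 0 < r \<Longrightarrow> r \<le> 1 \<Longrightarrow> v r \<le> K * r"
    and g: "\<gamma> < 1" and v: "\<And>r. 0 < r \<Longrightarrow> v r \<le> \<gamma> * ((n - 2) / (n - 4)) * (2 / r)"
  shows "\<exists>B h. barrier n (-1) B h \<and> (\<forall>r>0. r * v r \<le> h (r\<^sup>2))"
proof -
  \<comment> \<open>\<open>\<gamma>\<close> may be zero or negative; a replacement in the open unit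
    interval keeps the thresholds below positive and finite.\<close>
  define g' where "g' = max \<gamma> (1/2)"
  have g': "\<gamma> \<le> g'" "0 < g'" "g' < 1" using g by (auto simp: g'_def)
  define L where "L = 2 * ((n - 2) / (n - 4))"
  have L0: "0 \<le> L" using n by (auto simp: L_def)
  have vL: "r * v r \<le> g' * L" if r: "0 < r" for r
  proof -
    have "r * v r \<le> r * (\<gamma> * ((n - 2) / (n - 4)) * (2 / r))" using v[OF r] r by (intro mult_left_mono) auto
    also have "\<dots> = \<gamma> * L" using r by (simp add: L_def)
    also have "\<dots> \<le> g' * L" using g' L0 by (intro mult_right_mono) auto
    finally show ?thesis .
  qed
  from n show ?thesis
  proof
    assume n5: "n = 5"
    have L6: "L = 6" by (simp add: L_def n5)
    define D1 where "D1 = 1 / (1 - g')"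
    have D1: "1 < D1" using g' by (simp add: D1_def)
    define w1 where "w1 = D1\<^sup>2"
    have dec: "1 - 1 / sqrt (1 + w) = w / (sqrt (1 + w) * (sqrt (1 + w) + 1))" if "0 < w" for w :: real
    proof -
      have "w = (D - 1) * (D + 1)" "1 < D" if "D = sqrt (1 + w)" for D using that \<open>0 < w\<close> by (auto simp: algebra_simps)
      then have *: "w = (sqrt (1 + w) - 1) * (sqrt (1 + w) + 1)" "1 < sqrt (1 + w)" by blast+
      have "(D - 1) * (D + 1) / (D * (D + 1)) = 1 - 1 / D" if "1 < D" for D :: real
      proof -
        have "(D - 1) * (D + 1) / (D * (D + 1)) = (D - 1) / D" using that by simp
        also have "\<dots> = 1 - 1 / D" using that by (simp add: diff_divide_distrib)
        finally show ?thesis .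
      qed
      from this[OF *(2)] show ?thesis using *(1) by simp
    qed
    define D2 where "D2 = sqrt (1 + w1)"
    have D2: "0 < D2" by (simp add: D2_def w1_def add_pos_nonneg)
    show ?thesis
      unfolding n5
    proof (rule barrier_above_saturating[OF barrier_five K, where \<kappa>="6 / (D2 * (D2 + 1))" and ?w1.0=w1 and L="g' * L"])
      show "0 < 6 / (D2 * (D2 + 1))" using D2 by simp
      fix w :: real assume w: "0 < w"
      show "6 / (D2 * (D2 + 1)) * w \<le> 6 * (1 - 1 / sqrt (1 + w))" if "w \<le> w1"
      proof -
        have "sqrt (1 + w) \<le> D2" using that by (simp add: D2_def)
        then have "sqrt (1 + w) * (sqrt (1 + w) + 1) \<le> D2 * (D2 + 1)" using w D2 by (intro mult_mono) auto
        then have "w / (D2 * (D2 + 1)) \<le> w / (sqrt (1 + w) * (sqrt (1 + w) + 1))" using w D2 by (intro divide_left_mono mult_pos_pos add_pos_pos) auto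
        then show ?thesis unfolding dec[OF w] by simp
      qed
      show "g' * L \<le> 6 * (1 - 1 / sqrt (1 + w))" if "w1 \<le> w"
      proof -
        have "D1 \<le> sqrt (1 + w)" using that D1 by (intro real_le_rsqrt) (simp add: w1_def)
        then have "1 / sqrt (1 + w) \<le> 1 / D1" using D1 w by (intro divide_left_mono mult_pos_pos) auto
        also have "\<dots> = 1 - g'" by (simp add: D1_def)
        finally show ?thesis by (simp add: L6)
      qed
    qed (use vL in auto)
  next
    assume n6: "6 \<le> n"
    have L4: "L \<le> 4" using n6 by (simp add: L_def field_simps)
    define w1 where "w1 = g' / (1 - g')"
    have w1: "0 < w1" using g' by (simp add: w1_def)
    show ?thesis
    proof (rule barrier_above_saturating[OF barrier_rational K, where \<kappa>="4 / (1 + w1)" and ?w1.0=w1 and L="g' * L"])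
      show "0 < 4 / (1 + w1)" using w1 by simp
      fix w :: real assume w: "0 < w"
      show "4 / (1 + w1) * w \<le> 4 * w / (1 + w)" if "w \<le> w1"
      proof -
        have "4 * w / (1 + w1) \<le> 4 * w / (1 + w)" using that w w1 by (intro divide_left_mono) auto
        then show ?thesis by simp
      qed
      show "g' * L \<le> 4 * w / (1 + w)" if "w1 \<le> w"
      proof -
        have "g' \<le> w * (1 - g')" using that g' by (simp add: w1_def pos_divide_le_eq)
        then have "g' * (1 + w) \<le> w" by (simp add: algebra_simps)
        then have "g' \<le> w / (1 + w)" using w by (simp add: pos_le_divide_eq)
        then have "g' * L \<le> (w / (1 + w)) * 4" using L4 L0 g' w by (intro mult_mono) auto
        then show ?thesis by (simp only: times_divide_eq_left mult.commute[of 4])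
      qed
    qed (use n6 vL in auto)
  qed
qed

section \<open>The theorem\<close>

text \<open>The barriers against inward motion vanish like \<open>|x|^2\<close> at the origin; this
  bound makes \<open>u0 x \<bullet> x\<close> vanish at the same order, so that a dilated barrier
  lies above it.\<close>

lemma smooth_lipschitz_at_zero:
  fixes f :: "real ^ 'n \<Rightarrow> real ^ 'n"
  assumes f: "smooth f" and z: "f 0 = 0"
  shows "\<exists>K\<ge>0. \<forall>x. norm x \<le> 1 \<longrightarrow> norm (f x) \<le> K * norm x"
proof -
  have "C_k (Suc 0) f" using f by (simp add: smooth_def)
  then have d: "\<And>x. f differentiable (at x)" and c: "\<And>j. continuous_on UNIV (partial j f)" by auto
  have "\<exists>b. \<forall>x\<in>cball 0 1. norm (partial j f x) \<le> b" for j
  proof -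
    have "compact (partial j f ` cball 0 1)"
      by (intro compact_continuous_image continuous_on_subset[OF c]) auto
    then show ?thesis using compact_imp_bounded bounded_iff by (metis imageI)
  qed
  then obtain b where b: "\<And>j x. x \<in> cball 0 1 \<Longrightarrow> norm (partial j f x) \<le> b j" by metis
  define K where "K = (\<Sum>j\<in>UNIV. b j)"
  have b0: "0 \<le> b j" for j using order_trans[OF norm_ge_zero b[of 0 j]] by simp
  have K0: "0 \<le> K" unfolding K_def by (intro sum_nonneg b0)
  have "norm (f x) \<le> K * norm x" if x: "norm x \<le> 1" for x
  proof -
    have "norm (f x - f 0) \<le> K * norm (x - 0)"
    proof (rule differentiable_bound[of "cball 0 1" f "\<lambda>x h. \<Sum>j\<in>UNIV. h $ j *\<^sub>R partial j f x"])
      show "(f has_derivative (\<lambda>h. \<Sum>j\<in>UNIV. h $ j *\<^sub>R partial j f y)) (at y within cball 0 1)" for y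
        using has_derivative_partial[OF d] by (rule has_derivative_at_withinI)
      show "onorm (\<lambda>h. \<Sum>j\<in>UNIV. h $ j *\<^sub>R partial j f y) \<le> K" if y: "y \<in> cball 0 1" for y
      proof (rule onorm_le)
        fix h :: "real ^ 'n"
        have "norm (\<Sum>j\<in>UNIV. h $ j *\<^sub>R partial j f y) \<le> (\<Sum>j\<in>UNIV. norm h * b j)"
          by (rule sum_norm_le) (unfold norm_scaleR, intro mult_mono b y, auto simp: component_le_norm_cart)
        then show "norm (\<Sum>j\<in>UNIV. h $ j *\<^sub>R partial j f y) \<le> K * norm h"
          by (simp only: K_def sum_distrib_left mult.commute)
      qed
    qed (use x in auto)
    then show ?thesis by (simp add: z)
  qed
  then show ?thesis using K0 by blast
qed

text \<open>The formula leaves the value at the origin open. Elsewhere it makes \<open>f\<close>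
  odd, so approaching the origin along \<open>X m\<close> and \<open>- X m\<close> gives
  \<open>f 0 = - f 0\<close>.\<close>

lemma radial_form_zero:
  fixes f :: "real ^ 'n \<Rightarrow> real ^ 'n"
  assumes c: "continuous_on UNIV f" and f: "\<And>x. x \<noteq> 0 \<Longrightarrow> f x = - (v (norm x) *\<^sub>R (x /\<^sub>R norm x))"
  shows "f 0 = 0"
proof -
  fix i :: 'n
  define e where "e = (axis i 1 :: real ^ 'n)"
  define X where "X m = (1 / real (Suc m)) *\<^sub>R e" for m
  have e0: "e \<noteq> 0" by (simp add: e_def axis_eq_0_iff)
  have X0: "X m \<noteq> 0" for m using e0 by (simp add: X_def)
  have "(\<lambda>m. 1 / real (Suc m)) \<longlonglongrightarrow> 0" using LIMSEQ_inverse_real_of_nat by (simp add: inverse_eq_divide)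
  then have X: "X \<longlonglongrightarrow> 0" using tendsto_scaleR[OF _ tendsto_const, of _ 0 _ e] by (simp add: X_def[abs_def])
  then have nX: "(\<lambda>m. - X m) \<longlonglongrightarrow> 0" using tendsto_minus by force
  have l: "(\<lambda>m. f (Y m)) \<longlonglongrightarrow> f 0" if "Y \<longlonglongrightarrow> 0" for Y
    using continuous_on_tendsto_compose[OF c that] by simp
  have "f (- X m) = - f (X m)" for m using f[OF X0[of m]] f[of "- X m"] X0[of m] by simp
  then have "(\<lambda>m. - f (X m)) \<longlonglongrightarrow> f 0" using l[OF nX] by simp
  moreover have "(\<lambda>m. - f (X m)) \<longlonglongrightarrow> - f 0" by (intro tendsto_minus l X)
  ultimately have "f 0 = - f 0" by (rule LIMSEQ_unique)
  then have "f 0 + f 0 = 0" by (metis add.right_inverse)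
  then have "2 *\<^sub>R f 0 = 0" by (simp add: scaleR_2)
  then show ?thesis by simp
qed

section \<open>Gluing the local solutions\<close>

lemma time_window:
  fixes t d :: real
  assumes "0 < d" "0 < t"
  shows "\<exists>k::nat. real k * d < t \<and> t < (real k + 2) * d"
proof (cases "t < 2 * d")
  case True
  then show ?thesis using assms by (intro exI[of _ 0]) simp
next
  case False
  \<comment> \<open>One is subtracted so that a multiple of \<open>d\<close> falls inside an open
    window and not on its left end.\<close>
  define k where "k = nat (\<lfloor>t / d\<rfloor> - 1)"
  have "2 \<le> t / d" using False assms by (simp add: pos_le_divide_eq)
  then have k: "real k = of_int \<lfloor>t / d\<rfloor> - 1" by (simp add: k_def le_floor_iff)
  have "real k < t / d" "t / d < real k + 2" unfolding k by linarith+
  then show ?thesis using assms by (intro exI[of _ k]) (simp add: pos_less_divide_eq pos_divide_less_eq)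
qed

lemma glued_continuous:
  fixes F :: "real ^ 'n \<Rightarrow> real \<Rightarrow> 'b::topological_space"
  assumes d: "0 < d" and G: "\<And>k::nat. continuous_on (UNIV \<times> {0<..2 * d}) (\<lambda>(x, t). G k x t)"
    and eq: "\<And>k x t. real k * d < t \<Longrightarrow> t < (real k + 2) * d \<Longrightarrow> F x t = G k x (t - real k * d)"
  shows "continuous_on (UNIV \<times> {0<..}) (\<lambda>(x, t). F x t)"
proof -
  define I where "I k = {real k * d<..<(real k + 2) * d}" for k :: nat
  have "t \<in> (\<Union>k. I k) \<longleftrightarrow> 0 < t" for t
  proof
    assume "t \<in> (\<Union>k. I k)"
    then obtain k where "real k * d < t" by (auto simp: I_def)
    moreover have "0 \<le> real k * d" using d by simp
    ultimately show "0 < t" by linarith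
  next
    assume "0 < t"
    then show "t \<in> (\<Union>k. I k)" using time_window[OF d] by (auto simp: I_def)
  qed
  then have "{0<..} = (\<Union>k. I k)" by blast
  then have U: "(UNIV :: (real^'n) set) \<times> {0<..} = (\<Union>k\<in>UNIV. UNIV \<times> I k)" by auto
  show ?thesis
    unfolding U
  proof (rule continuous_on_open_UN)
    show "open ((UNIV :: (real^'n) set) \<times> I k)" for k by (auto simp: I_def intro: open_Times)
    fix k
    have "continuous_on (UNIV \<times> I k) (\<lambda>p. case (fst p, snd p - real k * d) of (x, t) \<Rightarrow> G k x t)"
      by (rule continuous_on_compose2[OF G]) (auto simp: I_def algebra_simps intro!: continuous_intros)
    then show "continuous_on (UNIV \<times> I k) (\<lambda>(x, t). F x t)"
      by (rule continuous_on_eq) (auto simp: I_def eq)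
  qed
qed

text \<open>Translates the componentwise operators of the equation into sums of \<open>pd\<close>.
  The factor \<open>2\<close> from the gradient of the squared norm cancels the factor
  \<open>1/2\<close> in the equation.\<close>

lemma equation_terms:
  fixes u :: "real ^ 'n \<Rightarrow> real \<Rightarrow> real ^ 'n"
  assumes d: "\<And>x. (\<lambda>y. u y t) differentiable (at x)" and d2: "\<And>j x. partial j (\<lambda>y. u y t) differentiable (at x)"
  shows "a *\<^sub>R advection (\<lambda>y. u y t) (\<lambda>y. u y t) x + (1/2 * (1 - a)) *\<^sub>R gradient (\<lambda>y. (norm (u y t))\<^sup>2) x
      + (1/2 * divergence (\<lambda>y. u y t) x) *\<^sub>R u x t = - nonlin (quad_form a) u u x t"
    and "vector_laplacian (\<lambda>y. u y t) x = lap u x t"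
proof -
  have comp: "partial j (\<lambda>y. f y $ i) x = partial j f x $ i" if "f differentiable (at x)" for f :: "real^'n \<Rightarrow> real^'n" and i j x
    using partial_eqI[OF bounded_linear.has_derivative[OF bounded_linear_vec_nth has_derivative_partial[OF that]], of j i]
    by (simp add: sum_axis_scaleR)
  have p: "partial j (\<lambda>y. u y t) x = pd j u x t" for j x by (simp add: pd_def)
  have adv: "advection (\<lambda>y. u y t) (\<lambda>y. u y t) x = (\<Sum>j\<in>UNIV. u x t $ j *\<^sub>R pd j u x t)"
    by (simp add: advection_def vec_eq_iff comp[OF d] p)
  have dv: "divergence (\<lambda>y. u y t) x = (\<Sum>j\<in>UNIV. pd j u x t $ j)"
    by (simp add: divergence_def comp[OF d] p)
  have gr: "gradient (\<lambda>y. (norm (u y t))\<^sup>2) x = 2 *\<^sub>R (\<Sum>j\<in>UNIV. (u x t \<bullet> pd j u x t) *\<^sub>R axis j 1)"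
  proof -
    have "partial i (\<lambda>y. u y t \<bullet> u y t) x = 2 * (u x t \<bullet> pd i u x t)" for i
      using partial_eqI[OF has_derivative_inner[OF has_derivative_partial[OF d[of x]] has_derivative_partial[OF d[of x]]], of i]
      by (simp add: sum_axis_scaleR p inner_commute)
    moreover have "(\<Sum>j\<in>UNIV. (u x t \<bullet> pd j u x t) *\<^sub>R (axis j 1 :: real^'n)) $ i = u x t \<bullet> pd i u x t" for i
    proof -
      have "(\<Sum>j\<in>UNIV. (u x t \<bullet> pd j u x t) *\<^sub>R (axis j 1 :: real^'n)) $ i = (\<Sum>j\<in>UNIV. (axis i 1 :: real^'n) $ j *\<^sub>R (u x t \<bullet> pd j u x t))"
        by (simp add: axis_def eq_commute mult.commute)
      then show ?thesis unfolding sum_axis_scaleR .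
    qed
    ultimately show ?thesis by (simp add: gradient_def power2_norm_eq_inner vec_eq_iff)
  qed
  show "a *\<^sub>R advection (\<lambda>y. u y t) (\<lambda>y. u y t) x + (1/2 * (1 - a)) *\<^sub>R gradient (\<lambda>y. (norm (u y t))\<^sup>2) x
      + (1/2 * divergence (\<lambda>y. u y t) x) *\<^sub>R u x t = - nonlin (quad_form a) u u x t"
    unfolding nonlin_quad_form adv dv gr by simp
  have "partial j (partial j (\<lambda>y. u y t $ i)) x = pd j (pd j u) x t $ i" for i j
  proof -
    have "partial j (\<lambda>y. u y t $ i) = (\<lambda>y. partial j (\<lambda>y. u y t) y $ i)" using comp[OF d] by auto
    then show ?thesis using comp[OF d2[of j x], of j i] by (simp add: pd_def)
  qed
  then show "vector_laplacian (\<lambda>y. u y t) x = lap u x t"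
    by (simp add: vector_laplacian_def laplacian_def lap_def vec_eq_iff)
qed

lemma glued_solution:
  fixes u u0 w and d A M a :: real
  assumes d: "0 < d" and bd: "\<And>x t. 0 \<le> t \<Longrightarrow> norm (u x t) \<le> M" and init: "\<And>x. u x 0 = u0 x"
    and w: "\<And>k. classical_on (quad_form a) (2 * d) A (w k)"
    and rep: "\<And>k x t. real k * d \<le> t \<Longrightarrow> t < (real k + 2) * d \<Longrightarrow> u x t = w k x (t - real k * d)"
  shows "global_bounded_solution a u0 (u :: real ^ 'n \<Rightarrow> real \<Rightarrow> real ^ 'n)"
proof -
  have jw: "c1 (2 * d) (w k)" "c1 (2 * d) (pd j (w k))" for k j
    using w[of k] by (auto simp: classical_on_def jet_def)
  note cw = jw[unfolded c1_def]
  have sl: "(\<lambda>y. u y t) = (\<lambda>y. w k y (t - real k * d))" if "real k * d < t" "t < (real k + 2) * d" for k t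
    using rep[of k t] that by auto
  have p1: "pd j u x t = pd j (w k) x (t - real k * d)" if "real k * d < t" "t < (real k + 2) * d" for j k x t
    unfolding pd_def sl[OF that] ..
  have p2: "pd l (pd j u) x t = pd l (pd j (w k)) x (t - real k * d)" if "real k * d < t" "t < (real k + 2) * d" for l j k x t
  proof -
    have "(\<lambda>y. pd j u y t) = (\<lambda>y. pd j (w k) y (t - real k * d))" using p1[OF that] by auto
    then show ?thesis unfolding pd_def[of l] by simp
  qed
  have st: "0 < t - real k * d" "t - real k * d < 2 * d" "t - real k * d \<le> 2 * d" "t - real k * d \<in> {0<..2 * d}"
    if "real k * d < t" "t < (real k + 2) * d" for k t using that by (auto simp: algebra_simps)
  define rhs where "rhs v x t = lap v x t + nonlin (quad_form a) v v x t" for v :: "real ^ 'n \<Rightarrow> real \<Rightarrow> real ^ 'n" and x t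
  have td: "((\<lambda>t. u x t) has_vector_derivative rhs u x t) (at t)" if t: "0 < t" for x t
  proof -
    obtain k :: nat where k: "real k * d < t" "t < (real k + 2) * d" using time_window[OF d t] by blast
    have "((\<lambda>t. w k x t) has_vector_derivative rhs (w k) x (t - real k * d)) (at (t - real k * d))"
      using w[of k] st[OF k] by (simp add: classical_on_def rhs_def)
    moreover have "((\<lambda>t. t - real k * d) has_vector_derivative 1) (at t)"
      by (auto intro!: derivative_eq_intros)
    ultimately have "((\<lambda>t. w k x (t - real k * d)) has_vector_derivative rhs (w k) x (t - real k * d)) (at t)"
      using vector_diff_chain_at[of "\<lambda>t. t - real k * d" 1 t "\<lambda>t. w k x t" "rhs (w k) x (t - real k * d)"]
      by (simp add: comp_def)
    then have "((\<lambda>t. u x t) has_vector_derivative rhs (w k) x (t - real k * d)) (at t)"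
      by (rule has_vector_derivative_transform_within_open[of _ _ _ "{real k * d<..<(real k + 2) * d}"]) (use k rep[of k _ x] in auto)
    moreover have "rhs (w k) x (t - real k * d) = rhs u x t"
      unfolding rhs_def lap_def nonlin_def using p1[OF k] p2[OF k] rep[of k t x] k by simp
    ultimately show ?thesis by simp
  qed
  have tde: "time_derivative u x t = rhs u x t" if "0 < t" for x t
    unfolding time_derivative_def by (rule vector_derivative_at[OF td[OF that]])
  have dif: "(\<lambda>y. u y t) differentiable (at x)" "partial j (\<lambda>y. u y t) differentiable (at x)" if t: "0 < t" for j x t
  proof -
    obtain k :: nat where k: "real k * d < t" "t < (real k + 2) * d" using time_window[OF d t] by blast
    show "(\<lambda>y. u y t) differentiable (at x)" unfolding sl[OF k] using cw(1)[of k] st(4)[OF k] by blast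
    have "(\<lambda>y. pd j (w k) y (t - real k * d)) differentiable (at x)" using cw(2)[of j k] st(4)[OF k] by blast
    then show "partial j (\<lambda>y. u y t) differentiable (at x)" unfolding sl[OF k] pd_def .
  qed
  have cpos: "continuous_on (UNIV \<times> {0<..}) (\<lambda>(x, t). u x t)"
    by (rule glued_continuous[OF d, of w]) (use cw(1) rep in auto)
  have cp1: "continuous_on (UNIV \<times> {0<..}) (\<lambda>(x, t). pd j u x t)" for j
    by (rule glued_continuous[OF d, of "\<lambda>k. pd j (w k)"]) (use cw(1) p1 in auto)
  have cp2: "continuous_on (UNIV \<times> {0<..}) (\<lambda>(x, t). pd l (pd j u) x t)" for j l
    by (rule glued_continuous[OF d, of "\<lambda>k. pd l (pd j (w k))"]) (use cw(2) p2 in auto)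
  have slice: "continuous_on UNIV (\<lambda>y. g y t)" if "continuous_on (UNIV \<times> {0<..}) (\<lambda>(x, t). g x t)" "0 < t" for g :: "real^'n \<Rightarrow> real \<Rightarrow> real^'n" and t
  proof -
    have "continuous_on UNIV (\<lambda>y. case (y, t) of (x, t) \<Rightarrow> g x t)"
      by (rule continuous_on_compose2[OF that(1)]) (use that(2) in \<open>auto intro!: continuous_intros\<close>)
    then show ?thesis by simp
  qed
  have c0: "continuous_on (UNIV \<times> {0..}) (\<lambda>(x, t). u x t)"
    unfolding continuous_on_eq_continuous_within
  proof
    fix p :: "(real^'n) \<times> real" assume p: "p \<in> UNIV \<times> {0..}"
    show "continuous (at p within UNIV \<times> {0..}) (\<lambda>(x, t). u x t)"
    proof (cases "snd p = 0")
      case True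
      \<comment> \<open>Only the window \<open>k = 0\<close> reaches time zero, and there its
        solution is continuous up to the initial time.\<close>
      have "continuous_on (UNIV \<times> {0..<2 * d}) (\<lambda>(x, t). w 0 x t)"
        using w[of 0] by (auto simp: classical_on_def elim!: continuous_on_subset)
      then have "continuous_on (UNIV \<times> {0..<2 * d}) (\<lambda>(x, t). u x t)"
        by (rule continuous_on_eq) (use rep[of 0] in auto)
      then have "continuous (at p within UNIV \<times> {0..<2 * d}) (\<lambda>(x, t). u x t)"
        unfolding continuous_on_eq_continuous_within using True d p by (cases p) auto
      moreover have "at p within UNIV \<times> {0..<2 * d} = at p within UNIV \<times> {0..}"
        by (rule at_within_nhd[of p "UNIV \<times> {..<2 * d}"]) (use True d in \<open>auto simp: open_Times mem_Times_iff\<close>)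
      ultimately show ?thesis by simp
    next
      case False
      then have "p \<in> UNIV \<times> {0<..}" using p by (cases p) auto
      moreover have "open ((UNIV :: (real^'n) set) \<times> {0::real<..})" by (intro open_Times) auto
      ultimately have "continuous (at p) (\<lambda>(x, t). u x t)" using cpos continuous_on_eq_continuous_at by blast
      then show ?thesis by (rule continuous_at_imp_continuous_at_within)
    qed
  qed
  \<comment> \<open>\<open>classical_on\<close> gives the existence of the time derivative; its
    continuity is read off from the right-hand side of the equation.\<close>
  have crhs: "continuous_on (UNIV \<times> {0<..}) (\<lambda>(x, t). time_derivative u x t)"
  proof -
    note c = cpos[unfolded case_prod_unfold] cp1[unfolded case_prod_unfold] cp2[unfolded case_prod_unfold]
    have "continuous_on (UNIV \<times> {0<..}) (\<lambda>(x, t). rhs u x t)"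
      unfolding rhs_def lap_def nonlin_def quad_form_def case_prod_unfold by (intro continuous_intros c)
    then show ?thesis by (rule continuous_on_eq) (auto simp: tde)
  qed
  have "classical_regularity u"
    unfolding classical_regularity_def
  proof (intro conjI allI impI)
    fix x and t :: real assume t: "0 < t"
    show "(\<lambda>s. u x s) differentiable at t"
      using td[OF t] by (rule differentiableI_vector)
  next
    fix t :: real assume t: "0 < t"
    have "continuous_on UNIV (\<lambda>y. pd l (pd j u) y t)" for l j by (rule slice[OF cp2 t])
    then have "continuous_on UNIV (partial l (partial j (\<lambda>y. u y t)))" for l j by (simp add: pd_def)
    then show "C_k 2 (\<lambda>x. u x t)" using dif[OF t] by (simp add: numeral_2_eq_2)
  qed (use c0 crhs cp1 cp2 in \<open>auto simp: pd_def\<close>)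
  moreover have "solves_equation a u"
    unfolding solves_equation_def
  proof (intro allI impI)
    fix x and t :: real assume t: "0 < t"
    note e = equation_terms[of u t, OF dif(1)[OF t] dif(2)[OF t]]
    show "time_derivative u x t + a *\<^sub>R advection (\<lambda>y. u y t) (\<lambda>y. u y t) x
      + (1/2 * (1 - a)) *\<^sub>R gradient (\<lambda>y. (norm (u y t))\<^sup>2) x
      + (1/2 * divergence (\<lambda>y. u y t) x) *\<^sub>R u x t = vector_laplacian (\<lambda>y. u y t) x"
      using e(1)[of a x] e(2)[of x] tde[OF t, of x] by (simp add: rhs_def add.assoc)
  qed
  moreover have "bounded ((\<lambda>(x, t). u x t) ` (UNIV \<times> {0..}))"
    unfolding bounded_iff using bd by auto
  ultimately show ?thesis unfolding global_bounded_solution_def using init by blast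
qed

theorem theorem2p1:
  fixes a :: real
    and v0 :: "real \<Rightarrow> real"
    and u0 :: "real ^ 'n \<Rightarrow> real ^ 'n"
  assumes "0 < a" and "a < 1"
    and "smooth u0"
    and "\<And>x. x \<noteq> 0 \<Longrightarrow> u0 x = - (v0 (norm x) *\<^sub>R (x /\<^sub>R norm x))"
    and "(CARD('n) \<in> {2, 3} \<and>
          (\<exists>C>0. \<forall>x :: real ^ 'n. - C \<le> v0 (norm x) \<and>
             v0 (norm x) \<le> C * (1 + norm x) powr (- ((real CARD('n) - 1) / 3))))
       \<or> (CARD('n) = 4 \<and>
          (\<exists>C>0. \<forall>x :: real ^ 'n. - C \<le> v0 (norm x) \<and>
             v0 (norm x) \<le> (4 / 3 * ln (1 + norm x) + C) / (1 + norm x)))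
       \<or> (CARD('n) \<ge> 5 \<and>
          (\<exists>\<gamma><1. \<exists>C>0. \<forall>x :: real ^ 'n. x \<noteq> 0 \<longrightarrow> - C \<le> v0 (norm x) \<and>
             v0 (norm x) \<le> \<gamma> * ((real CARD('n) - 2) / (real CARD('n) - 4)) * (2 / norm x)))"
  shows "\<exists>u :: real ^ 'n \<Rightarrow> real \<Rightarrow> real ^ 'n. global_bounded_solution a u0 u"
proof -
  let ?n = "real CARD('n)"
  have "C_k 0 u0" using assms(3) unfolding smooth_def by blast
  then have cu: "continuous_on UNIV u0" by simp
  have u00: "u0 0 = 0" by (rule radial_form_zero[OF cu assms(4)])
  obtain K where K: "0 \<le> K" "\<And>x. norm x \<le> 1 \<Longrightarrow> norm (u0 x) \<le> K * norm x"
    using smooth_lipschitz_at_zero[OF assms(3) u00] by blast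
  \<comment> \<open>The hypotheses speak of \<open>v0 (norm x)\<close>; a vector of length
    \<open>r\<close> turns them into statements about \<open>v0 r\<close>.\<close>
  have ex: "\<exists>x :: real ^ 'n. norm x = r" if "0 < r" for r
    using vector_choose_size[of r] that by auto
  have dot: "u0 x \<bullet> x = - (norm x * v0 (norm x))" if "x \<noteq> 0" for x
    using that by (simp add: assms(4) power2_norm_eq_inner[symmetric] power2_eq_square)
  have vK: "v0 r \<le> K * r" if r: "0 < r" "r \<le> 1" for r
  proof -
    obtain x :: "real ^ 'n" where x: "norm x = r" using ex[OF r(1)] by blast
    then have x0: "x \<noteq> 0" using r by auto
    have "norm (u0 x) = \<bar>v0 r\<bar>" using x x0 r by (simp add: assms(4) abs_mult)
    then show ?thesis using K(2)[of x] x r by simp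
  qed
  have rad: "radial u0"
    unfolding radial_def
  proof (intro allI impI)
    fix R :: "real ^ 'n \<Rightarrow> real ^ 'n" and x assume R: "orthogonal_transformation R"
    then have lin: "linear R" and nR: "norm (R x) = norm x" by (auto simp: orthogonal_transformation)
    show "u0 (R x) = R (u0 x)"
    proof (cases "x = 0")
      case True
      then show ?thesis by (simp add: u00 linear_0[OF lin])
    next
      case False
      then have "R x \<noteq> 0" using nR by auto
      then show ?thesis using False by (simp add: assms(4) nR linear_neg[OF lin] linear_cmul[OF lin])
    qed
  qed
  have n2: "2 \<le> ?n" using assms(5) by auto
  \<comment> \<open>The lower bound on \<open>v0\<close> is common to the three cases and limits
    outward motion, for which \<open>barrier_const\<close> serves in every dimension.\<close>
  obtain C where C: "0 < C" "\<And>x :: real ^ 'n. x \<noteq> 0 \<Longrightarrow> - C \<le> v0 (norm x)"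
    using assms(5) by blast
  have i1: "u0 x \<bullet> x \<le> C * sqrt (x \<bullet> x)" for x
  proof (cases "x = 0")
    case False
    have "norm x * (- v0 (norm x)) \<le> norm x * C" using C(2)[OF False] by (intro mult_left_mono) auto
    then show ?thesis by (simp add: dot[OF False] norm_eq_sqrt_inner[symmetric] mult.commute)
  qed simp
  have "\<exists>B h. barrier ?n (-1) B h \<and> (\<forall>r>0. r * v0 r \<le> h (r\<^sup>2))"
    using assms(5)
  proof (elim disjE conjE)
    assume n: "CARD('n) \<in> {2, 3}" and "\<exists>C>0. \<forall>x :: real ^ 'n. - C \<le> v0 (norm x) \<and>
             v0 (norm x) \<le> C * (1 + norm x) powr (- ((?n - 1) / 3))"
    then obtain D where D: "0 < D" "\<And>x :: real ^ 'n. v0 (norm x) \<le> D * (1 + norm x) powr (- ((?n - 1) / 3))" by blast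
    have "v0 r \<le> D * (1 + r) powr (- ((?n - 1) / 3))" if "0 < r" for r using D(2) ex[OF that] by metis
    then show ?thesis using n by (intro barrier_above_power[OF _ _ K(1) vK D(1)]) auto
  next
    assume n: "CARD('n) = 4" and "\<exists>C>0. \<forall>x :: real ^ 'n. - C \<le> v0 (norm x) \<and>
             v0 (norm x) \<le> (4 / 3 * ln (1 + norm x) + C) / (1 + norm x)"
    then obtain D where D: "0 < D" "\<And>x :: real ^ 'n. v0 (norm x) \<le> (4 / 3 * ln (1 + norm x) + D) / (1 + norm x)" by blast
    have "v0 r \<le> (4 / 3 * ln (1 + r) + D) / (1 + r)" if "0 < r" for r using D(2) ex[OF that] by metis
    from barrier_above_log[OF K(1) vK D(1) this] show ?thesis by (simp add: n)
  next
    assume n: "CARD('n) \<ge> 5" and "\<exists>\<gamma><1. \<exists>C>0. \<forall>x :: real ^ 'n. x \<noteq> 0 \<longrightarrow> - C \<le> v0 (norm x) \<and>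
             v0 (norm x) \<le> \<gamma> * ((?n - 2) / (?n - 4)) * (2 / norm x)"
    then obtain \<gamma> where g: "\<gamma> < 1" "\<And>x :: real ^ 'n. x \<noteq> 0 \<Longrightarrow> v0 (norm x) \<le> \<gamma> * ((?n - 2) / (?n - 4)) * (2 / norm x)" by blast
    have "v0 r \<le> \<gamma> * ((?n - 2) / (?n - 4)) * (2 / r)" if r: "0 < r" for r
    proof -
      obtain x :: "real ^ 'n" where x: "norm x = r" using ex[OF r] by blast
      then have "x \<noteq> 0" using r by auto
      then show ?thesis using g(2) x by blast
    qed
    moreover have "?n = 5 \<or> 6 \<le> ?n" using n by (cases "CARD('n) = 5") auto
    ultimately show ?thesis by (intro barrier_above_inverse[OF _ K(1) vK g(1)]) auto
  qed
  then obtain B h where B: "barrier ?n (-1) B h" and h: "\<And>r. 0 < r \<Longrightarrow> r * v0 r \<le> h (r\<^sup>2)" by blast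
  have i2: "- (u0 x \<bullet> x) \<le> h (x \<bullet> x)" for x
  proof (cases "x = 0")
    case True
    then show ?thesis using B by (simp add: barrier_def)
  next
    case False
    then show ?thesis using h[of "norm x"] by (simp add: dot power2_norm_eq_inner)
  qed
  have a: "0 \<le> a" "a \<le> 1" using assms(1,2) by auto
  have "barrier ?n 1 C (\<lambda>s. C * sqrt s)" using barrier_const[OF n2] C(1) by simp
  from global_existence[OF a cu rad this B i1 i2] obtain u d A w where
    "0 < d" "\<And>x t. 0 \<le> t \<Longrightarrow> norm (u x t) \<le> C + B" "\<And>x. u x 0 = u0 x"
    "\<And>k. classical_on (quad_form a) (2 * d) A (w k)"
    "\<And>k x t. real k * d \<le> t \<Longrightarrow> t < (real k + 2) * d \<Longrightarrow> u x t = w k x (t - real k * d)" by blast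
  then have "global_bounded_solution a u0 u" by (rule glued_solution)
  then show ?thesis by blast
qed

end
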